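(* The GIT quotient of the space of full flag (symplectic) quivers $\bigoplus_{i=1}^{n-1}\operatorname{Hom}(\mathbb C^i,\mathbb C^{i+1})$ by $SL=\prod_{i=2}^{n-1}SL(i,\mathbb C)$ is the universal symplectic implosion for $SU(n)$, i.e. it is isomorphic as an affine variety to $SL(n,\mathbb C)/\!/N=\operatorname{Spec}(\mathcal O(SL(n,\mathbb C))^N)$. The stratification of the GIT quotient by quiver diagrams corresponds to the stratification of the implosion as the disjoint union, over the standard parabolic subgroups $P$ of $SL(n,\mathbb C)$, of the varieties $SL(n,\mathbb C)/[P,P]$.
   Context: $N$ is a maximal unipotent subgroup of $SL(n,\mathbb C)$ (acting on $SL(n,\mathbb C)$ by right translation). The universal symplectic implosion $(T^*K)_{\rm impl}$ for a compact group $K$ (Guillemin–Jeffrey–Sjamaar) is identified with the affine variety $K_{\mathbb C}/\!/N=\operatorname{Spec}(\mathcal O(K_{\mathbb C})^N)$, which is stratified by the subvarieties $K_{\mathbb C}/[P,P]$, $P$ ranging over standard parabolic subgroups. A full flag symplectic quiver is a tuple $\alpha=(\alpha_1,\dots,\alpha_{n-1})$ with $\alpha_i\in\operatorname{Hom}(\mathbb C^i,\mathbb C^{i+1})$; $g=(g_i)\in SL$ acts by $\alpha_i\mapsto g_{i+1}\alpha_ig_i^{-1}$ for $i\leqslant n-2$ and $\alpha_{n-1}\mapsto\alpha_{n-1}g_{n-1}^{-1}$. Points of the GIT quotient correspond to closed $SL$-orbits; quivers in closed orbits are called polystable. For a polystable quiver, at each stage either $\alpha_i$ is injective or $\mathbb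 C^i=\operatorname{im}\alpha_{i-1}\oplus\ker\alpha_i$ (with $\alpha_0=0$). Stratification by quiver diagrams: put $m_i=\operatorname{rank}\alpha_i$ for $i<n$ and $m_n=n$; then $m_i=i$ if $\alpha_i$ is injective and $m_i=m_{i-1}$ otherwise (with $m_0=0$), and the stratum of $\alpha$ is determined by the strictly increasing sequence of the distinct positive values among $m_1,\dots,m_n$ (equivalently, by the set of $i$ for which $\alpha_i$ is injective). A strictly increasing sequence of positive integers $n_1<\dots<n_r=n$ corresponds to the standard parabolic subgroup $P$ of $SL(n,\mathbb C)$ associated to the flag of dimensions $(n_1,\dots,n_r)$ in $\mathbb C^n$. *)

theory Defs
  imports
    "HOL-Analysis.Abstract_Topology"
    "HOL-Algebra.Generated_Groups"
    "HOL-Algebra.QuotRing"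
    "Jordan_Normal_Form.Determinant"
    "Jordan_Normal_Form.DL_Rank"
    "HOL-Library.Disjoint_Sets"
begin

section \<open>Complex varieties as spaces with functions\<close>

text \<open>
  A classical complex variety is its set of closed points with the Zariski topology and, for each
  open set, the functions regular on it. \<open>regular X U h\<close> is only used for open \<open>U\<close> and depends
  only on the values of \<open>h\<close> on \<open>U\<close>.
\<close>

record 'p variety =
  zariski :: "'p topology"
  regular :: "'p set \<Rightarrow> ('p \<Rightarrow> complex) \<Rightarrow> bool"

abbreviation points :: "'p variety \<Rightarrow> 'p set" where
  "points X \<equiv> topspace (zariski X)"

text \<open>
  The variety with points \<open>Y\<close> and global functions \<open>F\<close>, where \<open>F\<close> is an algebra of functions on
  \<open>Y\<close>: the non-vanishing loci of members of \<open>F\<close> form a basis of the topology, and a function is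
  regular if it is locally a fraction of members of \<open>F\<close>.
\<close>

definition affine_variety :: "'p set \<Rightarrow> ('p \<Rightarrow> complex) set \<Rightarrow> 'p variety" where
  "affine_variety Y F = (let T = topology_generated_by ((\<lambda>f. {y \<in> Y. f y \<noteq> 0}) ` F) in
     \<lparr> zariski = T,
       regular = (\<lambda>U h. \<forall>y\<in>U. \<exists>W a b. openin T W \<and> y \<in> W \<and> W \<subseteq> U \<and> a \<in> F \<and> b \<in> F \<and>
                    (\<forall>z\<in>W. b z \<noteq> 0 \<and> h z = a z / b z)) \<rparr>)"

definition locally_closed_in :: "'p topology \<Rightarrow> 'p set \<Rightarrow> bool" where
  "locally_closed_in T Z \<longleftrightarrow> (\<exists>U C. openin T U \<and> closedin T C \<and> Z = U \<inter> C)"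

text \<open>The induced (reduced) structure on a locally closed subset \<open>Z\<close>.\<close>

definition subvariety :: "'p variety \<Rightarrow> 'p set \<Rightarrow> 'p variety" where
  "subvariety X Z =
     \<lparr> zariski = subtopology (zariski X) Z,
       regular = (\<lambda>U h. \<forall>z\<in>U. \<exists>W k. openin (zariski X) W \<and> z \<in> W \<and> W \<inter> Z \<subseteq> U \<and>
                    regular X W k \<and> (\<forall>y \<in> W \<inter> Z. h y = k y)) \<rparr>"

definition variety_iso :: "'p variety \<Rightarrow> 'q variety \<Rightarrow> ('p \<Rightarrow> 'q) \<Rightarrow> bool" where
  "variety_iso X Y \<Phi> \<longleftrightarrow>
     homeomorphic_map (zariski X) (zariski Y) \<Phi> \<and>
     (\<forall>V h. openin (zariski Y) V \<longrightarrow>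
        (regular Y V h \<longleftrightarrow> regular X {x \<in> points X. \<Phi> x \<in> V} (h \<circ> \<Phi>)))"

section \<open>Algebras of functions and their spectra\<close>

text \<open>
  Functions on \<open>X\<close> are represented by HOL functions that are \<open>undefined\<close> outside \<open>X\<close>, so that two
  of them are equal exactly when they agree on \<open>X\<close>.
\<close>

inductive_set poly_functions :: "'x set \<Rightarrow> ('x \<Rightarrow> complex) set \<Rightarrow> ('x \<Rightarrow> complex) set"
  for X :: "'x set" and coords :: "('x \<Rightarrow> complex) set" where
  const: "(\<lambda>x\<in>X. c) \<in> poly_functions X coords"
| coord: "f \<in> coords \<Longrightarrow> restrict f X \<in> poly_functions X coords"
| add: "f \<in> poly_functions X coords \<Longrightarrow> h \<in> poly_functions X coords \<Longrightarrow>
    (\<lambda>x\<in>X. f x + h x) \<in> poly_functions X coords"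
| mult: "f \<in> poly_functions X coords \<Longrightarrow> h \<in> poly_functions X coords \<Longrightarrow>
    (\<lambda>x\<in>X. f x * h x) \<in> poly_functions X coords"

definition fun_ring :: "'x set \<Rightarrow> ('x \<Rightarrow> complex) set \<Rightarrow> ('x \<Rightarrow> complex) ring" where
  "fun_ring X A =
     \<lparr> carrier = A, mult = (\<lambda>f h. \<lambda>x\<in>X. f x * h x), one = (\<lambda>x\<in>X. 1),
       zero = (\<lambda>x\<in>X. 0), add = (\<lambda>f h. \<lambda>x\<in>X. f x + h x) \<rparr>"

text \<open>Isomorphisms of \<open>\<complex>\<close>-algebras: ring isomorphisms that fix the constants.\<close>

definition calg_iso ::
  "'x set \<Rightarrow> ('x \<Rightarrow> complex) set \<Rightarrow> 'y set \<Rightarrow> ('y \<Rightarrow> complex) set \<Rightarrow>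
   (('x \<Rightarrow> complex) \<Rightarrow> ('y \<Rightarrow> complex)) \<Rightarrow> bool" where
  "calg_iso X A Y B \<phi> \<longleftrightarrow>
     \<phi> \<in> ring_iso (fun_ring X A) (fun_ring Y B) \<and> (\<forall>c. \<phi> (\<lambda>x\<in>X. c) = (\<lambda>y\<in>Y. c))"

text \<open>
  Closed points of \<open>Spec A\<close> are the \<open>\<complex>\<close>-algebra homomorphisms \<open>A \<rightarrow> \<complex>\<close>; an element \<open>f\<close> of \<open>A\<close> is the
  function \<open>\<chi> \<mapsto> \<chi> f\<close> on them.
\<close>

definition characters :: "'x set \<Rightarrow> ('x \<Rightarrow> complex) set \<Rightarrow> (('x \<Rightarrow> complex) \<Rightarrow> complex) set" where
  "characters X A =
     {\<chi> \<in> extensional A. \<chi> \<in> Ring.ring_hom (fun_ring X A) class_ring \<and> (\<forall>c. \<chi> (\<lambda>x\<in>X. c) = c)}"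

definition Spec :: "'x set \<Rightarrow> ('x \<Rightarrow> complex) set \<Rightarrow> (('x \<Rightarrow> complex) \<Rightarrow> complex) variety" where
  "Spec X A = affine_variety (characters X A) ((\<lambda>f \<chi>. \<chi> f) ` A)"

text \<open>The map \<open>Spec B \<rightarrow> Spec A\<close> induced by \<open>\<phi> : A \<rightarrow> B\<close>.\<close>

definition Spec_map ::
  "('x \<Rightarrow> complex) set \<Rightarrow> (('x \<Rightarrow> complex) \<Rightarrow> ('y \<Rightarrow> complex)) \<Rightarrow>
   (('y \<Rightarrow> complex) \<Rightarrow> complex) \<Rightarrow> (('x \<Rightarrow> complex) \<Rightarrow> complex)" where
  "Spec_map A \<phi> \<chi> = (\<lambda>f\<in>A. \<chi> (\<phi> f))"

text \<open>The point of \<open>Spec A\<close> given by a point of \<open>X\<close>.\<close>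

definition eval_point :: "('x \<Rightarrow> complex) set \<Rightarrow> 'x \<Rightarrow> (('x \<Rightarrow> complex) \<Rightarrow> complex)" where
  "eval_point A x = (\<lambda>f\<in>A. f x)"

section \<open>The group \<open>SL(n,\<complex>)\<close>, its unipotent and parabolic subgroups\<close>

definition SL :: "nat \<Rightarrow> complex mat monoid" where
  "SL n = \<lparr> carrier = {g \<in> carrier_mat n n. det g = 1}, mult = (*), one = 1\<^sub>m n \<rparr>"

definition SL_functions :: "nat \<Rightarrow> (complex mat \<Rightarrow> complex) set" where
  "SL_functions n = poly_functions (carrier (SL n)) {(\<lambda>g. g $$ (r, c)) | r c. r < n \<and> c < n}"

definition SL_variety :: "nat \<Rightarrow> complex mat variety" where
  "SL_variety n = affine_variety (carrier (SL n)) (SL_functions n)"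

definition unipotent_subgroup :: "nat \<Rightarrow> complex mat set \<Rightarrow> bool" where
  "unipotent_subgroup n N \<longleftrightarrow>
     subgroup N (SL n) \<and> (\<forall>u\<in>N. \<exists>k. (u - 1\<^sub>m n) ^\<^sub>m k = 0\<^sub>m n n)"

definition maximal_unipotent :: "nat \<Rightarrow> complex mat set \<Rightarrow> bool" where
  "maximal_unipotent n N \<longleftrightarrow>
     unipotent_subgroup n N \<and> (\<forall>M. unipotent_subgroup n M \<and> N \<subseteq> M \<longrightarrow> M = N)"

text \<open>
  A strictly increasing sequence \<open>n\<^sub>1 < \<dots> < n\<^sub>r = n\<close> of positive integers is represented by the set of
  its members.
\<close>

definition flag_types :: "nat \<Rightarrow> nat set set" where
  "flag_types n = {D. D \<subseteq> {1..n} \<and> n \<in> D}"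

definition linear_subspace :: "nat \<Rightarrow> complex vec set \<Rightarrow> bool" where
  "linear_subspace n W \<longleftrightarrow> VectorSpace.subspace class_ring W (module_vec TYPE(complex) n)"

definition linear_dim :: "nat \<Rightarrow> complex vec set \<Rightarrow> nat" where
  "linear_dim n W = vectorspace.dim class_ring ((module_vec TYPE(complex) n)\<lparr>carrier := W\<rparr>)"

text \<open>
  If \<open>N\<close> is maximal unipotent, it stabilises exactly one subspace of each dimension, and these form a
  full flag whose stabiliser is the Borel subgroup containing \<open>N\<close>. The parabolic subgroups containing
  this Borel subgroup (the standard ones) are the stabilisers of partial flags of this full flag.
  When \<open>N\<close> is the group of upper unitriangular matrices, \<open>parabolic n N D\<close> consists of the
  block upper triangular matrices preserving the span of the first \<open>d\<close> basis vectors for \<open>d \<in> D\<close>.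
\<close>

definition parabolic :: "nat \<Rightarrow> complex mat set \<Rightarrow> nat set \<Rightarrow> complex mat set" where
  "parabolic n N D = {g \<in> carrier (SL n).
     \<forall>W. linear_subspace n W \<and> (\<forall>u\<in>N. \<forall>w\<in>W. u *\<^sub>v w \<in> W) \<and> linear_dim n W \<in> D \<longrightarrow>
         (\<forall>w\<in>W. g *\<^sub>v w \<in> W)}"

text \<open>
  The quotient variety \<open>SL(n,\<complex>)/H\<close> of left cosets: it has the quotient topology, and its regular
  functions are the right \<open>H\<close>-invariant regular functions on preimages.
\<close>

definition SL_quotient :: "nat \<Rightarrow> complex mat set \<Rightarrow> complex mat set variety" where
  "SL_quotient n H =
     \<lparr> zariski = topology (\<lambda>U. U \<subseteq> (\<lambda>g. g <#\<^bsub>SL n\<^esub> H) ` carrier (SL n) \<and>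
                    openin (zariski (SL_variety n)) {g \<in> carrier (SL n). g <#\<^bsub>SL n\<^esub> H \<in> U}),
       regular = (\<lambda>U h. regular (SL_variety n) {g \<in> carrier (SL n). g <#\<^bsub>SL n\<^esub> H \<in> U}
                    (\<lambda>g. h (g <#\<^bsub>SL n\<^esub> H))) \<rparr>"

lemma istopology_quotient:
  "istopology (\<lambda>U. U \<subseteq> \<pi> ` X \<and> openin T {x \<in> X. \<pi> x \<in> U})"
  unfolding istopology_def
proof (intro conjI allI impI)
  fix S U
  assume "S \<subseteq> \<pi> ` X \<and> openin T {x \<in> X. \<pi> x \<in> S}" and "U \<subseteq> \<pi> ` X \<and> openin T {x \<in> X. \<pi> x \<in> U}"
  moreover have "{x \<in> X. \<pi> x \<in> S \<inter> U} = {x \<in> X. \<pi> x \<in> S} \<inter> {x \<in> X. \<pi> x \<in> U}"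
    by blast
  ultimately show "S \<inter> U \<subseteq> \<pi> ` X" and "openin T {x \<in> X. \<pi> x \<in> S \<inter> U}"
    by auto
next
  fix \<K>
  assume K: "\<forall>U\<in>\<K>. U \<subseteq> \<pi> ` X \<and> openin T {x \<in> X. \<pi> x \<in> U}"
  then show "\<Union>\<K> \<subseteq> \<pi> ` X"
    by blast
  have "{x \<in> X. \<pi> x \<in> \<Union>\<K>} = \<Union>((\<lambda>U. {x \<in> X. \<pi> x \<in> U}) ` \<K>)"
    by blast
  then show "openin T {x \<in> X. \<pi> x \<in> \<Union>\<K>}"
    using K by auto
qed

section \<open>The universal symplectic implosion\<close>

definition implosion_functions :: "nat \<Rightarrow> complex mat set \<Rightarrow> (complex mat \<Rightarrow> complex) set" where
  "implosion_functions n N =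
     {f \<in> SL_functions n. \<forall>g \<in> carrier (SL n). \<forall>u\<in>N. f (g * u) = f g}"

definition implosion ::
  "nat \<Rightarrow> complex mat set \<Rightarrow> ((complex mat \<Rightarrow> complex) \<Rightarrow> complex) variety" where
  "implosion n N = Spec (carrier (SL n)) (implosion_functions n N)"

text \<open>
  The action of \<open>SL(n,\<complex>)\<close> on \<open>Spec(O(SL(n,\<complex>))\<^sup>N)\<close> induced by left translation: it sends the point
  of \<open>g\<close> to that of \<open>h * g\<close>.
\<close>

definition implosion_act ::
  "nat \<Rightarrow> complex mat set \<Rightarrow> complex mat \<Rightarrow> ((complex mat \<Rightarrow> complex) \<Rightarrow> complex) \<Rightarrow>
   ((complex mat \<Rightarrow> complex) \<Rightarrow> complex)" where
  "implosion_act n N h \<chi> =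
     (\<lambda>f \<in> implosion_functions n N. \<chi> (\<lambda>g \<in> carrier (SL n). f (h * g)))"

definition SL_equivariant_iso ::
  "nat \<Rightarrow> complex mat set \<Rightarrow> complex mat set \<Rightarrow> ((complex mat \<Rightarrow> complex) \<Rightarrow> complex) set \<Rightarrow>
   (complex mat set \<Rightarrow> ((complex mat \<Rightarrow> complex) \<Rightarrow> complex)) \<Rightarrow> bool" where
  "SL_equivariant_iso n N H Z \<iota> \<longleftrightarrow>
     variety_iso (SL_quotient n H) (subvariety (implosion n N) Z) \<iota> \<and>
     (\<forall>h \<in> carrier (SL n). \<forall>C \<in> points (SL_quotient n H).
        \<iota> (h <#\<^bsub>SL n\<^esub> C) = implosion_act n N h (\<iota> C))"

text \<open>
  The strata of \<open>SL(n,\<complex>)//N\<close> are its \<open>SL(n,\<complex>)\<close>-orbits. The one labelled \<open>SL(n,\<complex>)/[P,P]\<close> is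
  singled out by its type as an \<open>SL(n,\<complex>)\<close>-variety; this is unambiguous since the groups \<open>[P,P]\<close> for
  distinct standard \<open>P\<close> are not conjugate. That there is just one such orbit for each \<open>P\<close>, and that
  every orbit is of this form, is not part of the definition.
\<close>

definition implosion_stratum ::
  "nat \<Rightarrow> complex mat set \<Rightarrow> nat set \<Rightarrow> ((complex mat \<Rightarrow> complex) \<Rightarrow> complex) set" where
  "implosion_stratum n N D = {\<chi> \<in> points (implosion n N).
     \<exists>\<iota>. SL_equivariant_iso n N (derived (SL n) (parabolic n N D))
           ((\<lambda>h. implosion_act n N h \<chi>) ` carrier (SL n)) \<iota>}"

section \<open>Full flag quivers and their GIT quotient\<close>

definition quivers :: "nat \<Rightarrow> (nat \<Rightarrow> complex mat) set" where
  "quivers n = (\<Pi>\<^sub>E i\<in>{1..<n}. carrier_mat (i + 1) i)"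

definition quiver_functions :: "nat \<Rightarrow> ((nat \<Rightarrow> complex mat) \<Rightarrow> complex) set" where
  "quiver_functions n = poly_functions (quivers n)
     {(\<lambda>\<alpha>. \<alpha> i $$ (r, c)) | i r c. 1 \<le> i \<and> i < n \<and> r < i + 1 \<and> c < i}"

definition quiver_group :: "nat \<Rightarrow> (nat \<Rightarrow> complex mat) set" where
  "quiver_group n = (\<Pi>\<^sub>E i\<in>{2..<n}. carrier (SL i))"

text \<open>The component at vertex \<open>i\<close>; no group acts at the vertices \<open>1\<close> and \<open>n\<close>.\<close>

definition component :: "nat \<Rightarrow> (nat \<Rightarrow> complex mat) \<Rightarrow> nat \<Rightarrow> complex mat" where
  "component n g i = (if 2 \<le> i \<and> i < n then g i else 1\<^sub>m i)"

definition quiver_act ::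
  "nat \<Rightarrow> (nat \<Rightarrow> complex mat) \<Rightarrow> (nat \<Rightarrow> complex mat) \<Rightarrow> (nat \<Rightarrow> complex mat)" where
  "quiver_act n g \<alpha> =
     (\<lambda>i\<in>{1..<n}. component n g (i + 1) * \<alpha> i * inv\<^bsub>SL i\<^esub> (component n g i))"

definition quiver_invariants :: "nat \<Rightarrow> ((nat \<Rightarrow> complex mat) \<Rightarrow> complex) set" where
  "quiver_invariants n =
     {f \<in> quiver_functions n. \<forall>g \<in> quiver_group n. \<forall>\<alpha> \<in> quivers n. f (quiver_act n g \<alpha>) = f \<alpha>}"

definition quiver_GIT :: "nat \<Rightarrow> (((nat \<Rightarrow> complex mat) \<Rightarrow> complex) \<Rightarrow> complex) variety" where
  "quiver_GIT n = Spec (quivers n) (quiver_invariants n)"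

definition polystable :: "nat \<Rightarrow> (nat \<Rightarrow> complex mat) \<Rightarrow> bool" where
  "polystable n \<alpha> \<longleftrightarrow> \<alpha> \<in> quivers n \<and>
     closedin (zariski (affine_variety (quivers n) (quiver_functions n)))
       ((\<lambda>g. quiver_act n g \<alpha>) ` quiver_group n)"

text \<open>The matrix \<open>\<alpha> i\<close> has \<open>i + 1\<close> rows, the dimension argument of \<open>vec_space.rank\<close>.\<close>

definition quiver_rank :: "nat \<Rightarrow> (nat \<Rightarrow> complex mat) \<Rightarrow> nat \<Rightarrow> nat" where
  "quiver_rank n \<alpha> i = (if i < n then vec_space.rank (i + 1) (\<alpha> i) else n)"

definition quiver_type :: "nat \<Rightarrow> (nat \<Rightarrow> complex mat) \<Rightarrow> nat set" where
  "quiver_type n \<alpha> = quiver_rank n \<alpha> ` {1..n} - {0}"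

definition quiver_stratum ::
  "nat \<Rightarrow> nat set \<Rightarrow> (((nat \<Rightarrow> complex mat) \<Rightarrow> complex) \<Rightarrow> complex) set" where
  "quiver_stratum n D =
     {eval_point (quiver_invariants n) \<alpha> | \<alpha>. polystable n \<alpha> \<and> quiver_type n \<alpha> = D}"

end

theory Submission
  imports Defs "Jordan_Normal_Form.Schur_Decomposition" "Jordan_Normal_Form.Column_Operations"
begin

text \<open>
  A unitriangular group may be taken for \<open>N\<close> by conjugation (Kolchin). The invariants of right translation
  by it are the polynomials in the minors on the first columns, by an averaging argument with reproducing
  kernels. For \<open>g\<close> in \<open>SL(n,\<complex>)\<close> and a flag type \<open>D\<close> the characters \<open>pnt D g\<close> take the value of the minor
  of size \<open>d\<close> if \<open>d\<close> belongs to \<open>D\<close> and 0 otherwise; they exhaust the spectrum, and \<open>pnt D\<close> identifies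
  its orbits with \<open>SL(n,\<complex>)/[P,P]\<close>. On the quiver side, a quiver with closed orbit is equivalent under
  the gauge group to \<open>pt n D g\<close>, built from coordinate projections and, at the last vertex, \<open>g\<close>; the quivers
  all of whose maps are injective are dense and their orbits are parametrised by \<open>SL(n,\<complex>)/N\<close>. Hence
  invariants of quivers restrict isomorphically to invariants of \<open>SL(n,\<complex>)\<close>, which matches both strata.
\<close>

text \<open>Two classical inputs are replaced by elementary arguments. Instead of complete
  reducibility, coefficient vectors of polynomials carry the standard hermitian product, for which
  left translation by the conjugate transpose of h is adjoint to left translation by h; orthogonal
  projection to a translation-stable space does what an integral over SU(n) would do. Instead of the
  Hilbert-Mumford criterion, a point of the orbit closure with least total rank of its arrows
  satisfies the direct sum condition, because otherwise the limit along an explicit one-parameter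
  subgroup has smaller rank. Irreducibility and density are tested along polynomial curves, where a
  nonzero polynomial has finitely many zeros. The group [P,P] enters as the block triangular
  matrices whose diagonal blocks have determinant one; being generated by transvections, it is open
  to induction. That an orbit in the spectrum is the variety SL(n)/[P,P], and not merely in
  bijection with it, requires local sections with regular entries; they come from Cramer's rule for
  minors, which is also how a character is turned back into a matrix.\<close>

abbreviation SLc :: "nat => complex mat set" where "SLc n == carrier (SL n)"
abbreviation sq_mat :: "nat => 'a mat set" where "sq_mat n == carrier_mat n n"
notation (input) mult_mat_vec (infixl "*v" 70)

section \<open>Polynomial functions\<close>

text \<open>Polynomiality up to restriction, so that ordinary lambda terms can be handled without a
  \<open>restrict\<close> around every subterm.\<close>

definition pf :: "'x set => ('x => complex) set => ('x => complex) => bool" where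
 "pf X C f \<longleftrightarrow> restrict f X : poly_functions X C"

lemma poly_functions_extensional: "f : poly_functions X C ==> f : extensional X"
 by (induction rule: poly_functions.induct) (simp_all only: restrict_extensional)

lemma pf_cong: "(!!x. x : X ==> f x = h x) ==> pf X C f = pf X C h"
 unfolding pf_def by (metis restrict_ext)

lemma pf_const: "pf X C (%x. c)"
 unfolding pf_def by (rule poly_functions.const)

lemma pf_coord: "f : C ==> pf X C f"
 unfolding pf_def by (rule poly_functions.coord)

lemma pf_add: "pf X C f ==> pf X C h ==> pf X C (%x. f x + h x)"
 unfolding pf_def by (drule (1) poly_functions.add) (simp cong: restrict_cong)

lemma pf_mult: "pf X C f ==> pf X C h ==> pf X C (%x. f x * h x)"
 unfolding pf_def by (drule (1) poly_functions.mult) (simp cong: restrict_cong)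

lemma pf_sum: "(!!i. i : I ==> pf X C (f i)) ==> pf X C (%x. SUM i:I. f i x)"
 by (induction I rule: infinite_finite_induct) (auto intro: pf_add pf_const)

lemma pf_prod: "(!!i. i : I ==> pf X C (f i)) ==> pf X C (%x. PROD i:I. f i x)"
 by (induction I rule: infinite_finite_induct) (auto intro: pf_mult pf_const)

lemma pf_diff: "pf X C f ==> pf X C h ==> pf X C (%x. f x - h x)"
 using pf_add[of X C f "%x. (-1) * h x"] pf_mult[of X C "%x. -1" h] pf_const[of X C "-1"] by simp

lemma pf_prod_list: "(!!i. i : set l ==> pf X C (f i)) ==> pf X C (%x. prod_list (map (%i. f i x) l))"
 by (induction l) (auto intro: pf_mult pf_const)

lemma pf_det:
 assumes "!!x. x : X ==> M x : carrier_mat d d"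
  and "!!i j. i < d ==> j < d ==> pf X C (%x. M x $$ (i, j))"
 shows "pf X C (%x. det (M x))"
proof -
 have "pf X C (%x. \<Sum>p | p permutes {0..<d}. signof p * (PROD i = 0..<d. M x $$ (i, p i)))"
  by (intro pf_sum pf_mult pf_const pf_prod assms(2)) (auto simp: permutes_in_image[where S = "{0..<d}", simplified])
 thus ?thesis
  by (subst pf_cong) (auto simp: det_def'[OF assms(1)])
qed

lemma index_mult_sum:
 "A : carrier_mat n m ==> B : carrier_mat m k ==> i < n ==> j < k ==>
  (A * B) $$ (i, j) = (SUM l<m. A $$ (i, l) * B $$ (l, j))"
 by (auto simp: scalar_prod_def lessThan_atLeast0 intro!: sum.cong)

lemma index_mult_vec_sum:
 "A : carrier_mat n m ==> v : carrier_vec m ==> i < n ==>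
  (A *v v) $ i = (SUM l<m. A $$ (i, l) * v $ l)"
 by (auto simp: scalar_prod_def lessThan_atLeast0 intro!: sum.cong)

lemma pf_mat_mult:
 assumes "!!x. x : X ==> A x : carrier_mat n m" and "!!x. x : X ==> B x : carrier_mat m k"
  and "!!i j. i < n ==> j < m ==> pf X C (%x. A x $$ (i, j))"
  and "!!i j. i < m ==> j < k ==> pf X C (%x. B x $$ (i, j))"
  and "i < n" and "j < k"
 shows "pf X C (%x. (A x * B x) $$ (i, j))"
proof -
 have "pf X C (%x. SUM l<m. A x $$ (i, l) * B x $$ (l, j))"
  using assms by (intro pf_sum pf_mult) auto
 thus ?thesis
  using index_mult_sum[OF assms(1,2) assms(5,6)] by (subst pf_cong) auto
qed

lemma pf_adj_mat:
 assumes "!!x. x : X ==> M x : carrier_mat d d"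
  and "!!i j. i < d ==> j < d ==> pf X C (%x. M x $$ (i, j))"
  and "i < d" and "j < d"
 shows "pf X C (%x. adj_mat (M x) $$ (i, j))"
proof -
 have "pf X C (%x. (-1) ^ (j + i) * det (mat (d - 1) (d - 1)
  (%(a, b). M x $$ (if a < j then a else Suc a, if b < i then b else Suc b))))"
  using assms by (intro pf_mult pf_const pf_det[where d = "d - 1"]) (auto intro!: assms(2))
 thus ?thesis
 proof (subst pf_cong)
  fix x assume "x : X"
  from assms(1)[OF this] assms(3,4) show "adj_mat (M x) $$ (i, j) = (-1) ^ (j + i) *
   det (mat (d - 1) (d - 1)
    (%(a, b). M x $$ (if a < j then a else Suc a, if b < i then b else Suc b)))"
   by (simp add: adj_mat_def cofactor_def mat_delete_def)
 qed
qed

text \<open>Polynomiality of a pull-back only has to be tested on the coordinates; most such claims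
  below are reduced to matrix entries by this rule.\<close>

lemma pf_compose:
 assumes "pf Y B F" and m: "!!x. x : X ==> m x : Y"
  and b: "!!b. b : B ==> pf X C (%x. b (m x))"
 shows "pf X C (%x. F (m x))"
proof -
 have "pf X C (%x. f (m x))" if "f : poly_functions Y B" for f
  using that
 proof (induction rule: poly_functions.induct)
  case (const c)
  show ?case using pf_const[of X C c] m by (subst pf_cong) auto
 next
  case (coord f)
  show ?case using b[OF coord] m by (subst pf_cong) auto
 next
  case (add f h)
  show ?case using pf_add[OF add.IH] m by (subst pf_cong) auto
 next
  case (mult f h)
  show ?case using pf_mult[OF mult.IH] m by (subst pf_cong) auto
 qed
 from this[OF assms(1)[unfolded pf_def]] show ?thesis
  using m by (subst pf_cong[of X _ "%x. restrict F Y (m x)"]) auto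
qed

section \<open>Polynomial functions of one complex variable\<close>

definition pline :: "(complex => complex) => bool" where
 "pline = pf UNIV {%z. z}"

lemma pline_id: "pline (%z. z)"
 unfolding pline_def by (rule pf_coord) simp

lemma pline_poly: "pline h ==> EX p. ALL z. h z = poly p z"
proof -
 have "EX p. ALL z. h z = poly p z" if "h : poly_functions UNIV {%z. z :: complex}" for h
  using that
 proof (induction rule: poly_functions.induct)
  case (const c)
  show ?case by (rule exI[of _ "[:c:]"]) simp
 next
  case (coord f)
  thus ?case by (intro exI[of _ "[:0, 1:]"]) simp
 next
  case (add f h)
  then obtain p q where "ALL z. f z = poly p z" "ALL z. h z = poly q z" by blast
  thus ?case by (intro exI[of _ "p + q"]) simp
 next
  case (mult f h)
  then obtain p q where "ALL z. f z = poly p z" "ALL z. h z = poly q z" by blast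
  thus ?case by (intro exI[of _ "p * q"]) simp
 qed
 thus "pline h ==> EX p. ALL z. h z = poly p z"
  unfolding pline_def pf_def by fastforce
qed

lemma pline_finite_zeros: "pline h ==> h a ~= 0 ==> finite {z. h z = 0}"
proof -
 assume "pline h" "h a ~= 0"
 then obtain p where p: "!!z. h z = poly p z" using pline_poly by blast
 with `h a ~= 0` have "p ~= 0" by auto
 thus ?thesis using poly_roots_finite[of p] p by simp
qed

text \<open>Stands in for passing to a limit: \<open>Z\<close> contains the finitely many parameters
  at which the argument that gives zero breaks down.\<close>

lemma pline_zero:
 assumes "pline h" and "finite Z" and "!!z. z ~: Z ==> h z = 0"
 shows "h a = 0"
proof (rule ccontr)
 assume "h a ~= 0"
 from pline_finite_zeros[OF assms(1) this] assms(2) have "finite ({z. h z = 0} \<union> Z)" by simp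
 moreover have "{z. h z = 0} \<union> Z = UNIV" using assms(3) by auto
 ultimately show False using infinite_UNIV_char_0[where 'a = complex] by simp
qed

lemma infinite_avoid: "finite (Z :: complex set) ==> EX z. z ~: Z"
 using infinite_UNIV_char_0[where 'a = complex] by (metis UNIV_I finite_subset subsetI)

section \<open>Orthogonal projections\<close>

definition ip :: "'i set => ('i => complex) => ('i => complex) => complex" where
 "ip I c d = (SUM w:I. c w * cnj (d w))"

text \<open>Linear subspaces of the functions supported in \<open>I\<close>; the value 0 outside
  \<open>I\<close> makes a vector determined by its coordinates in \<open>I\<close>.\<close>

definition fsubspace :: "'i set => ('i => complex) set => bool" where
 "fsubspace I S \<longleftrightarrow> (ALL c:S. ALL w. w ~: I --> c w = 0) & (%w. 0) : S &
  (ALL c:S. ALL d:S. (%w. c w + d w) : S) & (ALL a. ALL c:S. (%w. a * c w) : S)"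

lemma fsubspace_lincomb:
 assumes "fsubspace I S" and "c : S" and "d : S"
 shows "(%w. a * c w + b * d w) : S"
proof -
 have "(%w. a * c w) : S" "(%w. b * d w) : S"
  using assms unfolding fsubspace_def by auto
 with assms(1) show ?thesis
  unfolding fsubspace_def by (elim conjE) (drule (1) bspec, drule (1) bspec, simp)
qed

lemma ip_lincomb_left: "ip I (%w. a * c w + b * d w) e = a * ip I c e + b * ip I d e"
 by (simp add: ip_def sum.distrib sum_distrib_left algebra_simps)

lemma ip_lincomb_right: "ip I e (%w. a * c w + b * d w) = cnj a * ip I e c + cnj b * ip I e d"
 by (simp add: ip_def sum.distrib sum_distrib_left algebra_simps)

lemma ip_cnj: "cnj (ip I c d) = ip I d c"
 by (simp add: ip_def algebra_simps)

lemma ip_self_zero: "finite I ==> ip I c c = 0 ==> w : I ==> c w = 0"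
proof -
 assume "finite I" "ip I c c = 0" "w : I"
 have "ip I c c = of_real (SUM w:I. (cmod (c w))\<^sup>2)"
  by (simp only: ip_def complex_norm_square of_real_sum)
 with `ip I c c = 0` have "(SUM w:I. (cmod (c w))\<^sup>2) = 0"
  by (metis of_real_eq_0_iff)
 thus "c w = 0"
  using `finite I` `w : I` by (simp add: sum_nonneg_eq_0_iff)
qed

text \<open>Induction over the coordinates: the members of \<open>S\<close> with vanishing
  coordinate \<open>x\<close> form a subspace \<open>S0\<close> of codimension at most one, whose
  projection \<open>p0\<close> comes from the induction hypothesis; a Gram-Schmidt vector
  \<open>s\<close> supplies the missing direction. The result serves both as projection to
  \<open>S\<close> and, when the product with \<open>e\<close> is an evaluation, as existence of a
  reproducing vector.\<close>

lemma orth_proj: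
 assumes "finite I" and "fsubspace I S"
 shows "EX p:S. ALL c:S. ip I c e = ip I c p"
 using assms
proof (induction I arbitrary: S e rule: finite_induct)
 case empty
 thus ?case by (auto simp: ip_def fsubspace_def)
next
 case (insert x I)
 define S0 where "S0 = {c : S. c x = 0}"
 have S0: "fsubspace I S0"
  using insert.prems unfolding fsubspace_def S0_def by auto
 have ipS0: "ip (insert x I) c d = ip I c d" if "c : S0" for c d
  using that insert.hyps by (simp add: ip_def S0_def)
 have ipS0': "ip (insert x I) d c = ip I d c" if "c : S0" for c d
  using that insert.hyps by (simp add: ip_def S0_def)
 from insert.IH[OF S0] obtain p0 where p0: "p0 : S0" "!!c. c : S0 ==> ip I c e = ip I c p0"
  by blast
 show ?case
 proof (cases "S = S0")
  case True
  thus ?thesis using p0 ipS0 by auto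
 next
  case False
  then obtain s0 where s0: "s0 : S" "s0 x ~= 0" unfolding S0_def by auto
  from insert.IH[OF S0] obtain r where r: "r : S0" "!!c. c : S0 ==> ip I c s0 = ip I c r"
   by blast
  \<comment> \<open>\<open>r\<close> is the projection of \<open>s0\<close> to \<open>S0\<close>, so
    \<open>s\<close> is orthogonal to \<open>S0\<close> and keeps the nonzero coordinate
    \<open>x\<close>.\<close>
  define s where "s = (%w. 1 * s0 w + (-1) * r w)"
  have sS: "s : S" unfolding s_def
   using fsubspace_lincomb[OF insert.prems s0(1)] r(1) S0_def by blast
  have sx: "s x ~= 0" using s0 r(1) unfolding s_def S0_def by auto
  have orth: "ip (insert x I) c s = 0" if "c : S0" for c
   unfolding s_def ip_lincomb_right using r(2)[OF that] ipS0[OF that] by simp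
  have orth': "ip (insert x I) s c = 0" if "c : S0" for c
   using orth[OF that] by (metis complex_cnj_zero_iff ip_cnj)
  have ss: "ip (insert x I) s s ~= 0"
   using ip_self_zero[of "insert x I" s x] sx insert.hyps by auto
  \<comment> \<open>The conjugate appears because \<open>ip\<close> is conjugate linear in its
    second argument.\<close>
  define k where "k = cnj (ip (insert x I) s e / ip (insert x I) s s)"
  define p where "p = (%w. 1 * p0 w + k * s w)"
  have pS: "p : S" unfolding p_def
   using fsubspace_lincomb[OF insert.prems _ sS] p0(1) S0_def by blast
  have "ip (insert x I) c e = ip (insert x I) c p" if c: "c : S" for c
  proof -
   define c0 where "c0 = (%w. 1 * c w + (- c x / s x) * s w)"
   have c0: "c0 : S0"
    unfolding S0_def c0_def
    using fsubspace_lincomb[OF insert.prems c sS, of 1 "- c x / s x"] sx by simp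
   have cc: "c = (%w. 1 * c0 w + (c x / s x) * s w)"
    unfolding c0_def by auto
   have 1: "ip (insert x I) c0 e = ip (insert x I) c0 p"
    unfolding p_def ip_lincomb_right using orth[OF c0] p0(2)[OF c0] ipS0[OF c0] by simp
   have 2: "ip (insert x I) s e = ip (insert x I) s p"
    unfolding p_def ip_lincomb_right using orth'[OF p0(1)] ss by (simp add: k_def)
   show ?thesis
    by (subst (1 2) cc) (simp only: ip_lincomb_left 1 2)
  qed
  thus ?thesis using pS by blast
 qed
qed

text \<open>The residue of \<open>v\<close> after projection to the image of \<open>M\<close> is
  nonzero and orthogonal to the image; its conjugate, divided by its product with \<open>v\<close>,
  is the covector.\<close>

lemma not_in_image_covector:
 fixes M :: "complex mat"
 assumes M: "M : carrier_mat r c" and v: "v : carrier_vec r"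
  and "!!y. y : carrier_vec c ==> M *v y ~= v"
 shows "EX eta. (ALL y:carrier_vec c. (SUM i<r. eta i * (M *v y) $ i) = 0) & (SUM i<r. eta i * v $ i) = 1"
proof -
 define S where "S = (%y i. if i < r then (M *v y) $ i else 0) ` carrier_vec c"
 have S: "fsubspace {..<r} S"
  unfolding fsubspace_def
 proof (intro conjI ballI allI impI)
  show "(%w. 0) : S" unfolding S_def
   by (rule image_eqI[of _ _ "0\<^sub>v c"]) (use M in \<open>auto simp: fun_eq_iff\<close>)
  fix f assume "f : S"
  then obtain y where y: "y : carrier_vec c" "f = (%i. if i < r then (M *v y) $ i else 0)"
   unfolding S_def by blast
  show "f w = 0" if "w ~: {..<r}" for w using y that by simp
  show "(%w. a * f w) : S" for a unfolding S_def
   by (rule image_eqI[of _ _ "a \<cdot>\<^sub>v y"]) (use M y in \<open>auto simp: fun_eq_iff\<close>)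
  fix g assume "g : S"
  then obtain z where z: "z : carrier_vec c" "g = (%i. if i < r then (M *v z) $ i else 0)"
   unfolding S_def by blast
  show "(%w. f w + g w) : S" unfolding S_def
   by (rule image_eqI[of _ _ "y + z"])
    (use M y z in \<open>auto simp: fun_eq_iff scalar_prod_add_distrib[of _ c]\<close>)
 qed
 from orth_proj[OF _ S, of "%i. v $ i"] obtain p where
  p: "p : S" "!!s. s : S ==> ip {..<r} s (%i. v $ i) = ip {..<r} s p" by auto
 define w where "w = (%i. 1 * v $ i + (-1) * p i)"
 from p(1) obtain y where y: "y : carrier_vec c" "p = (%i. if i < r then (M *v y) $ i else 0)"
  unfolding S_def by blast
 have so: "ip {..<r} s w = 0" if "s : S" for s
  using p(2)[OF that] unfolding w_def ip_lincomb_right by simp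
 have "ip {..<r} w w ~= 0"
 proof
  assume "ip {..<r} w w = 0"
  hence "!!i. i < r ==> w i = 0" using ip_self_zero[of "{..<r}" w] by auto
  hence "M *v y = v" using M v y by (intro eq_vecI) (auto simp: w_def)
  with assms(3)[OF y(1)] show False by simp
 qed
 moreover have "ip {..<r} w w = ip {..<r} (%i. v $ i) w"
 proof -
  have "ip {..<r} w w = 1 * ip {..<r} (%i. v $ i) w + (-1) * ip {..<r} p w"
   unfolding ip_lincomb_left[symmetric] w_def ..
  thus ?thesis using so[OF p(1)] by simp
 qed
 ultimately have n0: "ip {..<r} (%i. v $ i) w ~= 0" by simp
 define eta where "eta = (%i. cnj (w i) / ip {..<r} (%i. v $ i) w)"
 have "(SUM i<r. eta i * (M *v y) $ i) = 0" if "y : carrier_vec c" for y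
 proof -
  have "(%i. if i < r then (M *v y) $ i else 0) : S" using that unfolding S_def by blast
  from so[OF this] have "(SUM i<r. (M *v y) $ i * cnj (w i)) = 0"
   by (simp add: ip_def)
  hence "(SUM i<r. (M *v y) $ i * cnj (w i)) / ip {..<r} (%i. v $ i) w = 0" by simp
  thus ?thesis
   by (simp only: eta_def sum_divide_distrib) (simp add: algebra_simps)
 qed
 moreover have "(SUM i<r. eta i * v $ i) = 1"
 proof -
  have "(SUM i<r. eta i * v $ i) = ip {..<r} (%i. v $ i) w / ip {..<r} (%i. v $ i) w"
   unfolding eta_def by (subst (2) ip_def, simp only: sum_divide_distrib) (simp add: algebra_simps)
  thus ?thesis using n0 by simp
 qed
 ultimately show ?thesis by blast
qed

declare index_mult_mat(1) [simp del] index_mult_mat_vec [simp del]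

section \<open>Transvections and block triangular matrices\<close>

abbreviation slc :: "nat => (complex mat => complex) set" where
 "slc n == {(%g. g $$ (r, c)) | r c. r < n & c < n}"

lemma SL_carrier: "g : SLc n \<longleftrightarrow> g : sq_mat n & det g = 1"
 by (simp add: SL_def)

lemma SL_mult [simp]: "g \<otimes>\<^bsub>SL n\<^esub> h = g * h"
 by (simp add: SL_def)

lemma SL_one [simp]: "\<one>\<^bsub>SL n\<^esub> = 1\<^sub>m n"
 by (simp add: SL_def)

lemma SL_mat: "g : SLc n ==> g : sq_mat n"
 by (simp add: SL_def)

lemma SL_mult_closed: "g : SLc n ==> h : SLc n ==> g * h : SLc n"
 by (auto simp: SL_carrier det_mult)

lemma SL_one_closed: "1\<^sub>m n : SLc n"
 by (simp add: SL_carrier)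

lemma SL_adj:
 assumes "g : SLc n"
 shows "adj_mat g : SLc n" "g * adj_mat g = 1\<^sub>m n" "adj_mat g * g = 1\<^sub>m n"
proof -
 have g: "g : sq_mat n" "det g = 1" using assms by (auto simp: SL_carrier)
 show 1: "g * adj_mat g = 1\<^sub>m n" "adj_mat g * g = 1\<^sub>m n"
  using adj_mat[OF g(1)] g(2) by auto
 have "det g * det (adj_mat g) = 1"
  using det_mult[OF g(1) adj_mat(1)[OF g(1)]] 1 by simp
 thus "adj_mat g : SLc n"
  using adj_mat(1)[OF g(1)] g(2) by (simp add: SL_carrier)
qed

lemma SL_adj_cancel:
 assumes "g : SLc n" "h : carrier_mat n m"
 shows "g * (adj_mat g * h) = h" "adj_mat g * (g * h) = h"
 using assms SL_adj[OF assms(1)] SL_mat[OF assms(1)] SL_mat[OF SL_adj(1)[OF assms(1)]]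
 by (simp_all add: assoc_mult_mat[symmetric])

lemma SL_group: "group (SL n)"
proof (rule groupI)
 show "EX y:SLc n. y \<otimes>\<^bsub>SL n\<^esub> x = \<one>\<^bsub>SL n\<^esub>" if "x : SLc n" for x
  using that by (intro bexI[of _ "adj_mat x"]) (simp_all add: SL_adj)
qed (auto simp: SL_mult_closed SL_one_closed SL_carrier det_mult)

lemma SL_inv: "g : SLc n ==> inv\<^bsub>SL n\<^esub> g = adj_mat g"
 by (intro group.inv_equality[OF SL_group]) (simp_all add: SL_adj)

lemma addrow_mat_index:
 "r < n ==> c < n ==> i ~= j ==>
  addrow_mat n a i j $$ (r, c) = (if r = c then 1 else if r = i & c = j then a else 0)"
 by (auto simp: addrow_mat_def)

lemma addrow_mat_carrier [simp]: "addrow_mat n a i j : sq_mat n"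
 by (simp add: addrow_mat_def)

lemma addrow_mat_SL: "i ~= j ==> addrow_mat n a i j : SLc n"
 by (simp add: SL_carrier det_addrow_mat)

lemma addrow_mult_vec:
 assumes "v : carrier_vec n" "i ~= j" "j < n" "r < n"
 shows "(addrow_mat n a i j *v v) $ r = (if r = i then v $ r + a * v $ j else v $ r)"
proof -
 have "(addrow_mat n a i j *v v) $ r = (SUM l<n. (if r = l then 1 else if r = i & l = j then a else 0) * v $ l)"
  using assms by (subst index_mult_vec_sum[OF addrow_mat_carrier]) (auto intro!: sum.cong simp: addrow_mat_index)
 also have "... = (SUM l<n. (if r = l then v $ l else 0) + (if l = j then (if r = i then a * v $ j else 0) else 0))"
  using assms by (intro sum.cong) auto
 also have "... = (if r = i then v $ r + a * v $ j else v $ r)"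
  using assms by (simp add: sum.distrib)
 finally show ?thesis .
qed

text \<open>Words in the transvections 1 + a E_ij with \<open>R i j\<close>. They form a group,
  since the parameters a and -a give inverse elements, and statements about it are proved by
  induction on the word.\<close>

inductive_set tgen :: "nat => (nat => nat => bool) => complex mat set" for n R where
 one: "1\<^sub>m n : tgen n R"
| step: "g : tgen n R ==> i < n ==> j < n ==> i ~= j ==> R i j ==> addrow_mat n a i j * g : tgen n R"

lemma tgen_SL: "g : tgen n R ==> g : SLc n"
 by (induction rule: tgen.induct) (auto intro: SL_mult_closed SL_one_closed addrow_mat_SL)

lemma tgen_carrier: "g : tgen n R ==> g : sq_mat n"
 using tgen_SL SL_mat by blast

lemma tgen_mono: "g : tgen n R ==> (!!i j. R i j ==> R' i j) ==> g : tgen n R'"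
 by (induction rule: tgen.induct) (auto intro: tgen.intros)

lemma tgen_mult: "g : tgen n R ==> h : tgen n R ==> g * h : tgen n R"
proof (induction rule: tgen.induct)
 case one
 thus ?case using tgen_carrier[OF one] by simp
next
 case (step g i j a)
 have "addrow_mat n a i j * g * h = addrow_mat n a i j * (g * h)"
  using tgen_carrier step.hyps(1) step.prems by (intro assoc_mult_mat[of _ n n _ n _ n]) auto
 thus ?case using tgen.step[OF step.IH[OF step.prems] step.hyps(2-5)] by simp
qed

lemma tgen_elem: "i < n ==> j < n ==> i ~= j ==> R i j ==> addrow_mat n a i j : tgen n R"
 using tgen.step[OF tgen.one, of i n j R a] by simp

lemma addrow_mat_inverse:
 "i < n ==> j < n ==> i ~= j ==> addrow_mat n (- a :: complex) i j * addrow_mat n a i j = 1\<^sub>m n"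
 using addrow_mat_inv[of i n j "-a"] by simp

lemma tgen_inverse: "g : tgen n R ==> EX h:tgen n R. h * g = 1\<^sub>m n & g * h = 1\<^sub>m n"
proof (induction rule: tgen.induct)
 case one
 show ?case by (rule bexI[OF _ tgen.one]) simp
next
 case (step g i j a)
 then obtain h where h: "h : tgen n R" "h * g = 1\<^sub>m n" "g * h = 1\<^sub>m n" by blast
 let ?e = "addrow_mat n a i j" and ?f = "addrow_mat n (-a) i j"
 have c: "g : sq_mat n" "h : sq_mat n" "?e : sq_mat n" "?f : sq_mat n"
  using h step tgen_carrier by auto
 have ef: "?f * ?e = 1\<^sub>m n" "?e * ?f = 1\<^sub>m n"
  using addrow_mat_inverse[of i n j a] addrow_mat_inverse[of i n j "-a"] step by auto
 have "h * ?f * (?e * g) = h * (?f * ?e) * g"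
  using c by (smt (verit) assoc_mult_mat mult_carrier_mat)
 moreover have "?e * g * (h * ?f) = ?e * (g * h) * ?f"
  using c by (smt (verit) assoc_mult_mat mult_carrier_mat)
 ultimately have "h * ?f * (?e * g) = 1\<^sub>m n" "?e * g * (h * ?f) = 1\<^sub>m n"
  using c ef h by auto
 moreover have "h * ?f : tgen n R"
  using h(1) step by (intro tgen_mult tgen_elem) auto
 ultimately show ?case by blast
qed

text \<open>A transvection at (i, j) acts on a vector only through its coordinate j, which is zero
  for e_k with k < a <= j.\<close>

lemma tgen_fix_unit:
 assumes "g : tgen n (%i j. a <= j & Q i j)" and "k < a" and "a <= n"
 shows "g *v unit_vec n k = unit_vec n k"
 using assms(1)
proof (induction rule: tgen.induct)
 case (step g i j b)
 have "addrow_mat n b i j * g *v unit_vec n k = addrow_mat n b i j *v unit_vec n k"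
  using step tgen_carrier[OF step.hyps(1)] assoc_mult_mat_vec[of "addrow_mat n b i j" n n g n "unit_vec n k"] by simp
 also have "... = unit_vec n k"
  using step assms by (intro eq_vecI) (auto simp: addrow_mult_vec)
 finally show ?case .
qed (use assms in auto)

lemma tgen_clear:
 assumes v: "v : carrier_vec n" and va: "v $ a = 1" and b: "b <= n" "a < b"
  and S: "finite S" "S \<subseteq> {..<b} - {a}"
 shows "EX z:tgen n (%i j. a <= j & j < b & i < b). ALL i<n. (z *v v) $ i = (if i : S then 0 else v $ i)"
 using S
proof (induction S rule: finite_induct)
 case empty
 show ?case using v by (intro bexI[OF _ tgen.one]) auto
next
 case (insert k S)
 then obtain z where z: "z : tgen n (%i j. a <= j & j < b & i < b)"
   "ALL i<n. (z *v v) $ i = (if i : S then 0 else v $ i)" by auto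
 let ?z = "addrow_mat n (- v $ k) k a * z"
 have zc: "z : sq_mat n" using z tgen_carrier by blast
 have k: "k < b" "k ~= a" "a ~: S" using insert.prems by auto
 have "?z : tgen n (%i j. a <= j & j < b & i < b)"
  using z k b by (intro tgen.step) auto
 moreover have "?z *v v = addrow_mat n (- v $ k) k a *v (z *v v)"
  using zc v by (intro assoc_mult_mat_vec[of _ n n _ n]) auto
 moreover have "z *v v : carrier_vec n" using zc v by auto
 ultimately show ?case
  using z(2) k b va insert.hyps by (intro bexI[of _ ?z]) (auto simp: addrow_mult_vec)
qed

text \<open>Rows cannot be rescaled in determinant one, so the pivot 1 in row \<open>a\<close> is
  made by adding a multiple of another row with nonzero entry; this is where
  \<open>Suc a < b\<close> enters.\<close>

lemma tgen_unit:
 assumes v: "v : carrier_vec n" and ab: "Suc a < b" "b <= n" and k: "a <= k" "k < b" "v $ k ~= 0"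
  and supp: "!!i. b <= i ==> i < n ==> v $ i = 0"
 shows "EX z:tgen n (%i j. a <= j & j < b & i < b). z *v v = unit_vec n a"
proof -
 let ?T = "tgen n (%i j. a <= j & j < b & i < b)"
 have main: "EX z:?T. z *v w = unit_vec n a"
  if w: "w : carrier_vec n" "!!i. b <= i ==> i < n ==> w $ i = 0" and l: "a < l" "l < b" "w $ l ~= 0" for w l
 proof -
  let ?e = "addrow_mat n ((1 - w $ a) / w $ l) a l"
  let ?w = "?e *v w"
  have wc: "?w : carrier_vec n" using w by (meson addrow_mat_carrier mult_mat_vec_carrier)
  have wa: "?w $ a = 1" using w l ab by (simp add: addrow_mult_vec)
  obtain z where z: "z : ?T" "ALL i<n. (z *v ?w) $ i = (if i : {..<b} - {a} then 0 else ?w $ i)"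
   using tgen_clear[OF wc wa, of b "{..<b} - {a}"] ab by auto
  have zc: "z : sq_mat n" using z tgen_carrier by blast
  have "z * ?e : ?T" using z l ab by (intro tgen_mult tgen_elem) auto
  moreover have "(z * ?e) *v w = z *v ?w"
   using zc w by (intro assoc_mult_mat_vec[of _ n n _ n]) auto
  moreover have "z *v ?w = unit_vec n a"
   using z(2) zc wa w l ab by (intro eq_vecI) (auto simp: addrow_mult_vec)
  ultimately show ?thesis by metis
 qed
 show ?thesis
 proof (cases "EX l. a < l & l < b & v $ l ~= 0")
  case True
  thus ?thesis using main[OF v supp] by blast
 next
  case False
  hence va: "v $ a ~= 0" "v $ Suc a = 0" using k ab by (metis le_neq_implies_less, auto)
  \<comment> \<open>No entry beyond row \<open>a\<close> is nonzero: a copy of row \<open>a\<close>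
    is put into the next row, which can then serve to make the pivot.\<close>
  let ?e = "addrow_mat n 1 (Suc a) a"
  have wc: "?e *v v : carrier_vec n" using v by (meson addrow_mat_carrier mult_mat_vec_carrier)
  have "(?e *v v) $ Suc a ~= 0" using v va ab by (simp add: addrow_mult_vec)
  moreover have "!!i. b <= i ==> i < n ==> (?e *v v) $ i = 0"
   using v supp ab by (simp add: addrow_mult_vec)
  ultimately obtain z where z: "z : ?T" "z *v (?e *v v) = unit_vec n a"
   using main[OF wc, of "Suc a"] ab by auto
  have "z * ?e : ?T" using z ab by (intro tgen_mult tgen_elem) auto
  moreover have "(z * ?e) *v v = z *v (?e *v v)"
   using z tgen_carrier v by (intro assoc_mult_mat_vec[of _ n n _ n]) auto
  ultimately show ?thesis using z by metis
 qed
qed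

text \<open>The rows of a minor are selected by an arbitrary function, which avoids signs.\<close>

definition minor :: "complex mat => nat => (nat => nat) => complex" where
 "minor g d rho = det (mat d d (%(i, j). g $$ (rho i, j)))"

text \<open>Equivalently, \<open>g\<close> preserves the span of the first e basis vectors for each
  e in \<open>D\<close> (\<open>blk_lowv\<close>).\<close>

definition blk :: "nat => nat set => complex mat => bool" where
 "blk n D g \<longleftrightarrow> (ALL e:D. ALL r c. e <= r & r < n & c < e --> g $$ (r, c) = 0)"

text \<open>For block triangular \<open>g\<close> the leading minor of size e is the product of the
  determinants of the diagonal blocks up to e, so all diagonal blocks have determinant one. This is
  [P,P] for the standard P of type \<open>D\<close> (\<open>derived_parabolic\<close>).\<close>

definition Hgrp :: "nat => nat set => complex mat set" where
 "Hgrp n D = {g : SLc n. blk n D g & (ALL e:D. minor g e id = 1)}"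

text \<open>The position (i, j) lies in or above a diagonal block.\<close>

definition allowed :: "nat set => nat => nat => bool" where
 "allowed D i j \<longleftrightarrow> (ALL e:D. ~ (j < e & e <= i))"

text \<open>The first e columns of \<open>h\<close> live in the first e rows, so the selected rows
  of the product are those of \<open>g\<close> times the leading block of \<open>h\<close>.\<close>

lemma minor_mult_block:
 assumes g: "g : carrier_mat m n" and h: "h : carrier_mat n p" and e: "e <= n" "e <= p"
  and z: "!!r c. e <= r ==> r < n ==> c < e ==> h $$ (r, c) = 0"
  and rho: "!!i. i < e ==> rho i < m"
 shows "minor (g * h) e rho = minor g e rho * minor h e id"
proof -
 have "mat e e (%(i, j). (g * h) $$ (rho i, j)) = mat e e (%(i, j). g $$ (rho i, j)) * mat e e (%(i, j). h $$ (id i, j))"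
  (is "?l = ?a * ?b")
 proof (rule eq_matI)
  fix i j assume "i < dim_row (?a * ?b)" "j < dim_col (?a * ?b)"
  hence ij: "i < e" "j < e" by auto
  have "(g * h) $$ (rho i, j) = (SUM l<n. g $$ (rho i, l) * h $$ (l, j))"
   using ij e rho by (intro index_mult_sum[OF g h]) auto
  also have "... = (SUM l<e. g $$ (rho i, l) * h $$ (l, j))"
   using e z ij by (intro sum.mono_neutral_right) auto
  finally show "?l $$ (i, j) = (?a * ?b) $$ (i, j)"
   using ij by (simp add: index_mult_sum[of _ e e _ e])
 qed auto
 thus ?thesis unfolding minor_def by (simp add: det_mult[of _ e])
qed

lemma blk_mult:
 assumes "g : sq_mat n" "h : sq_mat n" "blk n D g" "blk n D h" "D \<subseteq> {..n}"
 shows "blk n D (g * h)"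
 unfolding blk_def
proof (intro ballI allI impI)
 fix e r c assume e: "e : D" "e <= r & r < n & c < e"
 hence "(g * h) $$ (r, c) = (SUM l<n. g $$ (r, l) * h $$ (l, c))"
  using assms by (intro index_mult_sum) auto
 also have "... = 0"
 proof (rule sum.neutral, rule ballI)
  fix l assume "l : {..<n}"
  thus "g $$ (r, l) * h $$ (l, c) = 0"
   using e assms(3,4) unfolding blk_def by (cases "l < e") auto
 qed
 finally show "(g * h) $$ (r, c) = 0" .
qed

lemma Hgrp_mult: "D \<subseteq> {..n} ==> g : Hgrp n D ==> h : Hgrp n D ==> g * h : Hgrp n D"
proof -
 assume a: "D \<subseteq> {..n}" "g : Hgrp n D" "h : Hgrp n D"
 have "minor (g * h) e id = 1" if "e : D" for e
 proof -
  have "minor (g * h) e id = minor g e id * minor h e id"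
   using a that by (intro minor_mult_block[of _ n n _ n]) (auto simp: Hgrp_def SL_carrier blk_def)
  thus ?thesis using a that by (simp add: Hgrp_def)
 qed
 thus ?thesis
  using a blk_mult[of g n h D] by (auto simp: Hgrp_def SL_mult_closed SL_mat)
qed

lemma Hgrp_elem:
 assumes D: "D \<subseteq> {..n}" and ij: "i < n" "j < n" "i ~= j" "allowed D i j"
 shows "addrow_mat n a i j : Hgrp n D"
proof -
 have "minor (addrow_mat n a i j) e id = 1" if "e : D" for e
 proof -
  have "mat e e (%(r, c). addrow_mat n a i j $$ (id r, c)) =
    (if i < e & j < e then addrow_mat e a i j else if i < e then 1\<^sub>m e else 1\<^sub>m e)"
   using that D ij by (intro eq_matI) (auto simp: addrow_mat_index addrow_mat_def allowed_def)
  thus ?thesis using ij by (auto simp: minor_def det_addrow_mat)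
 qed
 moreover have "blk n D (addrow_mat n a i j)"
  unfolding blk_def using ij D by (auto simp: addrow_mat_index allowed_def)
 ultimately show ?thesis using ij by (auto simp: Hgrp_def addrow_mat_SL)
qed

lemma Hgrp_one: "D \<subseteq> {..n} ==> 1\<^sub>m n : Hgrp n D"
proof -
 assume D: "D \<subseteq> {..n}"
 have "minor (1\<^sub>m n) e id = 1" if "e : D" for e
 proof -
  have "mat e e (%(r, c). 1\<^sub>m n $$ (id r, c)) = (1\<^sub>m e :: complex mat)"
   using that D by (intro eq_matI) auto
  thus ?thesis by (simp add: minor_def)
 qed
 thus ?thesis using D by (auto simp: Hgrp_def blk_def SL_one_closed)
qed

lemma tgen_Hgrp: "g : tgen n (allowed D) ==> D \<subseteq> {..n} ==> g : Hgrp n D"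
 by (induction rule: tgen.induct) (auto intro: Hgrp_one Hgrp_mult Hgrp_elem)

section \<open>Generation of block triangular groups by transvections\<close>

lemma det_first_col:
 fixes M :: "complex mat"
 assumes M: "M : carrier_mat (Suc m) (Suc m)" and c: "!!i. i < Suc m ==> M $$ (i, 0) = (if i = 0 then 1 else 0)"
 shows "det M = det (mat m m (%(i, j). M $$ (Suc i, Suc j)))"
proof -
 have "det M = (SUM i<Suc m. M $$ (i, 0) * cofactor M i 0)"
  by (rule laplace_expansion_column[OF M]) simp
 also have "... = cofactor M 0 0"
  using c by (simp add: sum.lessThan_Suc_shift del: sum.lessThan_Suc)
 also have "... = det (mat m m (%(i, j). M $$ (Suc i, Suc j)))"
  using M by (simp add: cofactor_def mat_delete_def)
 finally show ?thesis .
qed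

text \<open>The matrix diag(1, h).\<close>

definition shift1 :: "nat => complex mat => complex mat" where
 "shift1 m h = mat (Suc m) (Suc m) (%(i, j). if i = 0 | j = 0 then (if i = j then 1 else 0) else h $$ (i - 1, j - 1))"

lemma shift1_mult:
 assumes "g : carrier_mat m m" "h : carrier_mat m m"
 shows "shift1 m (g * h) = shift1 m g * shift1 m h"
proof (rule eq_matI)
 fix i j assume "i < dim_row (shift1 m g * shift1 m h)" "j < dim_col (shift1 m g * shift1 m h)"
 hence ij: "i < Suc m" "j < Suc m" by (auto simp: shift1_def)
 have "(shift1 m g * shift1 m h) $$ (i, j) = (SUM l<Suc m. shift1 m g $$ (i, l) * shift1 m h $$ (l, j))"
  using ij by (intro index_mult_sum) (auto simp: shift1_def)
 also have "... = shift1 m g $$ (i, 0) * shift1 m h $$ (0, j) + (SUM l<m. shift1 m g $$ (i, Suc l) * shift1 m h $$ (Suc l, j))"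
  by (rule sum.lessThan_Suc_shift)
 also have "... = shift1 m (g * h) $$ (i, j)"
 proof (cases "i = 0 | j = 0")
  case False
  then obtain i' j' where "i = Suc i'" "j = Suc j'" by (metis not0_implies_Suc)
  thus ?thesis using ij assms by (simp add: shift1_def index_mult_sum[of _ m m _ m])
 qed (use ij in \<open>auto simp: shift1_def\<close>)
 finally show "shift1 m (g * h) $$ (i, j) = (shift1 m g * shift1 m h) $$ (i, j)" by simp
qed (auto simp: shift1_def)

lemma shift1_tgen:
 assumes "g : tgen m R" and "!!i j. R i j ==> R' (Suc i) (Suc j)"
 shows "shift1 m g : tgen (Suc m) R'"
 using assms(1)
proof (induction rule: tgen.induct)
 case one
 have "shift1 m (1\<^sub>m m) = 1\<^sub>m (Suc m)" by (intro eq_matI) (auto simp: shift1_def)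
 thus ?case by (simp add: tgen.one)
next
 case (step g i j a)
 have "shift1 m (addrow_mat m a i j) = addrow_mat (Suc m) a (Suc i) (Suc j)"
  using step by (intro eq_matI) (auto simp: shift1_def addrow_mat_def)
 moreover have "addrow_mat (Suc m) a (Suc i) (Suc j) * shift1 m g : tgen (Suc m) R'"
  using step assms(2) by (intro tgen.step) auto
 ultimately show ?case
  using tgen_carrier[OF step.hyps(1)] by (simp add: shift1_mult)
qed

lemma tgen_first_row:
 assumes w: "w : carrier_mat (Suc m) (Suc m)"
  and w': "!!i j. i < Suc m ==> j < Suc m ==> i ~= 0 ==> w $$ (i, j) = (if i = j then 1 else 0)" "w $$ (0, 0) = 1"
  and R: "!!j. 0 < j ==> R 0 j"
 shows "w : tgen (Suc m) R"
proof -
 have "mat (Suc m) (Suc m) (%(i, j). if i = j then 1 else if i = 0 & j <= k then w $$ (0, j) else 0) : tgen (Suc m) R"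
  if "k <= m" for k
  using that
 proof (induction k)
  case 0
  have "mat (Suc m) (Suc m) (%(i, j). if i = j then 1 else if i = 0 & j <= 0 then w $$ (0, j) else 0) = 1\<^sub>m (Suc m)"
   by (intro eq_matI) auto
  thus ?case by (metis tgen.one)
 next
  case (Suc k)
  let ?M = "%k. mat (Suc m) (Suc m) (%(i, j). if i = j then 1 else if i = 0 & j <= k then w $$ (0, j) else 0)"
  have "?M (Suc k) = addrow_mat (Suc m) (w $$ (0, Suc k)) 0 (Suc k) * ?M k"
  proof -
   have "addrow_mat (Suc m) (w $$ (0, Suc k)) 0 (Suc k) * ?M k = addrow (w $$ (0, Suc k)) 0 (Suc k) (?M k)"
    by (rule addrow_mat[symmetric, of _ "Suc m" "Suc m"]) (use Suc in auto)
   also have "... = ?M (Suc k)"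
    using Suc.prems by (intro eq_matI) (auto simp: le_Suc_eq)
   finally show ?thesis by simp
  qed
  also have "... : tgen (Suc m) R"
   using Suc R by (intro tgen.step) auto
  finally show ?case .
 qed
 from this[of m] have "mat (Suc m) (Suc m) (%(i, j). if i = j then 1 else if i = 0 & j <= m then w $$ (0, j) else 0) : tgen (Suc m) R"
  by simp
 also have "mat (Suc m) (Suc m) (%(i, j). if i = j then 1 else if i = 0 & j <= m then w $$ (0, j) else 0) = w"
  using w w' by (intro eq_matI) auto
 finally show ?thesis .
qed

text \<open>Induction on the size: row operations inside the first block turn the first column into
  e_0; what remains is diag(1, h') times a matrix that differs from the identity in its first row
  only, and h' belongs to the group of the flag type lowered by one.\<close>

theorem Hgrp_tgen:
 assumes "D \<subseteq> {..n}" and "h : Hgrp n D"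
 shows "h : tgen n (allowed D)"
 using assms
proof (induction n arbitrary: D h)
 case 0
 hence "h = 1\<^sub>m 0" by (auto simp: Hgrp_def SL_carrier)
 thus ?case using tgen.one by metis
next
 case (Suc m)
 let ?n = "Suc m"
 have hc: "h : carrier_mat ?n ?n" "det h = 1" using Suc.prems by (auto simp: Hgrp_def SL_carrier)
 \<comment> \<open>\<open>b\<close> is the end of the first block; \<open>?n\<close> is inserted for
   the case that \<open>D\<close> has no positive member.\<close>
 define b where "b = (LEAST e. e : insert ?n D & 1 <= e)"
 have b: "b : insert ?n D" "1 <= b" and bl: "!!e. e : D ==> 1 <= e ==> b <= e" and bn: "b <= ?n"
 proof -
  have "b : insert ?n D & 1 <= b"
   unfolding b_def by (rule LeastI[of _ ?n]) auto
  thus "b : insert ?n D" "1 <= b" by auto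
  show "!!e. e : D ==> 1 <= e ==> b <= e" "b <= ?n"
   unfolding b_def by (auto intro: Least_le)
 qed
 have supp: "h $$ (i, 0) = 0" if "b <= i" "i < ?n" for i
 proof -
  have "b : D" using that b(1) by auto
  thus ?thesis using Suc.prems(2) that b(2) unfolding Hgrp_def blk_def by auto
 qed
 have "EX z:tgen ?n (allowed D). ALL i<?n. (z * h) $$ (i, 0) = (if i = 0 then 1 else 0)"
 proof (cases "b = 1")
  case True
  \<comment> \<open>In a first block of size one there is no second row to work with, but then the
    corner is itself a prescribed minor, or the determinant, and equals one.\<close>
  have "h $$ (0, 0) = 1"
  proof (cases "?n = 1")
   case True
   thus ?thesis using hc by (metis det_single)
  next
   case False
   hence "1 : D" using b True by auto
   hence "minor h 1 id = 1" using Suc.prems by (auto simp: Hgrp_def)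
   thus ?thesis unfolding minor_def by (subst (asm) det_single) auto
  qed
  thus ?thesis using supp True hc by (intro bexI[OF _ tgen.one]) auto
 next
  case False
  have "EX k<b. h $$ (k, 0) ~= 0"
  proof (rule ccontr)
   assume "~ ?thesis"
   hence "!!i. i < ?n ==> h $$ (i, 0) = 0" using supp by (meson linorder_not_less)
   hence "det h = 0"
    using laplace_expansion_column[OF hc(1), of 0] by simp
   thus False using hc by simp
  qed
  then obtain k where k: "k < b" "h $$ (k, 0) ~= 0" by blast
  have "EX z:tgen ?n (%i j. 0 <= j & j < b & i < b). z *v col h 0 = unit_vec ?n 0"
   using k False b(2) bn hc supp by (intro tgen_unit[of _ _ _ _ k]) (auto simp: carrier_vecI)
  then obtain z where z: "z : tgen ?n (%i j. 0 <= j & j < b & i < b)" "z *v col h 0 = unit_vec ?n 0"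
   by blast
  have "z : tgen ?n (allowed D)"
  proof (rule tgen_mono[OF z(1)])
   fix i j assume a: "0 <= j & j < b & i < b"
   show "allowed D i j"
    unfolding allowed_def
   proof (intro ballI notI)
    fix e assume "e : D" "j < e & e <= i"
    with a bl[of e] show False by auto
   qed
  qed
  moreover have "(z * h) $$ (i, 0) = (if i = 0 then 1 else 0)" if "i < ?n" for i
  proof -
   have "(z * h) $$ (i, 0) = (z *v col h 0) $ i"
    using tgen_carrier[OF z(1)] hc that by (simp add: index_mult_mat(1) index_mult_mat_vec)
   thus ?thesis using z(2) that by auto
  qed
  ultimately show ?thesis by blast
 qed
 then obtain z where z: "z : tgen ?n (allowed D)" "!!i. i < ?n ==> (z * h) $$ (i, 0) = (if i = 0 then 1 else 0)"
  by blast
 have zc: "z : carrier_mat ?n ?n" using z tgen_carrier by blast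
 define g where "g = z * h"
 have gH: "g : Hgrp ?n D"
  unfolding g_def by (rule Hgrp_mult[OF Suc.prems(1) tgen_Hgrp[OF z(1) Suc.prems(1)] Suc.prems(2)])
 have gc: "g : carrier_mat ?n ?n" "det g = 1" using gH by (auto simp: Hgrp_def SL_carrier)
 have g0: "!!i. i < ?n ==> g $$ (i, 0) = (if i = 0 then 1 else 0)" using z(2) by (simp add: g_def)
 define h' where "h' = mat m m (%(i, j). g $$ (Suc i, Suc j))"
 \<comment> \<open>Truncated subtraction sends both 0 and 1 to 0, where the conditions are
   void.\<close>
 define D' where "D' = (%e. e - 1) ` D"
 have "h' : Hgrp m D'"
  unfolding Hgrp_def
 proof (intro CollectI conjI ballI)
  show "h' : carrier (SL m)"
   using det_first_col[OF gc(1) g0] gc by (auto simp: SL_carrier h'_def)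
  show "blk m D' h'"
   unfolding blk_def
  proof (intro ballI allI impI)
   fix e r c assume "e : D'" and a: "e <= r & r < m & c < e"
   then obtain f where f: "f : D" "e = f - 1" unfolding D'_def by blast
   have "f <= Suc r & Suc r < ?n & Suc c < f" using a f(2) by auto
   moreover have "ALL r c. f <= r & r < ?n & c < f --> g $$ (r, c) = 0"
    using gH f(1) unfolding Hgrp_def blk_def by blast
   ultimately have "g $$ (Suc r, Suc c) = 0" by blast
   thus "h' $$ (r, c) = 0" using a by (auto simp: h'_def)
  qed
  fix e assume "e : D'"
  then obtain f where f: "f : D" "e = f - 1" unfolding D'_def by blast
  show "minor h' e id = 1"
  proof (cases e)
   case 0
   thus ?thesis by (simp add: minor_def)
  next
   case (Suc e')
   hence fe: "f = Suc e" using f by auto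
   have "minor g f id = 1" using gH f by (auto simp: Hgrp_def)
   also have "minor g f id = det (mat e e (%(i, j). mat f f (%(i, j). g $$ (id i, j)) $$ (Suc i, Suc j)))"
    unfolding minor_def fe using fe f(1) Suc.prems(1) g0 by (intro det_first_col) auto
   also have "mat e e (%(i, j). mat f f (%(i, j). g $$ (id i, j)) $$ (Suc i, Suc j)) = mat e e (%(i, j). h' $$ (id i, j))"
    using fe f(1) Suc.prems(1) by (intro eq_matI) (auto simp: h'_def)
   finally show ?thesis by (simp add: minor_def)
  qed
 qed
 moreover have "D' \<subseteq> {..m}" using Suc.prems(1) unfolding D'_def by auto
 ultimately have "h' : tgen m (allowed D')" using Suc.IH by blast
 hence s: "shift1 m h' : tgen ?n (allowed D)"
 proof (rule shift1_tgen)
  fix i j assume a: "allowed D' i j"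
  show "allowed D (Suc i) (Suc j)"
   unfolding allowed_def
  proof (intro ballI notI)
   fix e assume e: "e : D" "Suc j < e & e <= Suc i"
   hence "e - 1 : D'" "j < e - 1 & e - 1 <= i" by (auto simp: D'_def)
   with a show False unfolding allowed_def by blast
  qed
 qed
 define w where "w = mat ?n ?n (%(i, j). if i = j then 1 else if i = 0 then g $$ (0, j) else 0)"
 have wt: "w : tgen ?n (allowed D)"
  by (rule tgen_first_row) (auto simp: w_def allowed_def)
 have "g = shift1 m h' * w"
 proof (rule eq_matI)
  fix i j assume "i < dim_row (shift1 m h' * w)" "j < dim_col (shift1 m h' * w)"
  hence ij: "i < ?n" "j < ?n" by (auto simp: shift1_def w_def)
  have "(shift1 m h' * w) $$ (i, j) = (SUM l<?n. shift1 m h' $$ (i, l) * w $$ (l, j))"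
   using ij by (intro index_mult_sum) (auto simp: shift1_def w_def)
  also have "... = shift1 m h' $$ (i, 0) * w $$ (0, j) + (SUM l<m. shift1 m h' $$ (i, Suc l) * w $$ (Suc l, j))"
   by (rule sum.lessThan_Suc_shift)
  also have "(SUM l<m. shift1 m h' $$ (i, Suc l) * w $$ (Suc l, j)) = (SUM l<m. if Suc l = j then shift1 m h' $$ (i, j) else 0)"
   using ij by (intro sum.cong) (auto simp: w_def)
  also have "... = (if j = 0 then 0 else shift1 m h' $$ (i, j))"
   using ij by (cases j) auto
  finally show "g $$ (i, j) = (shift1 m h' * w) $$ (i, j)"
   using ij g0[of i] by (auto simp: shift1_def w_def h'_def)
 qed (use gc in \<open>auto simp: shift1_def w_def\<close>)
 hence gt: "g : tgen ?n (allowed D)" using tgen_mult[OF s wt] by simp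
 obtain y where y: "y : tgen ?n (allowed D)" "y * z = 1\<^sub>m ?n" using tgen_inverse[OF z(1)] by blast
 have "y * g = y * z * h" unfolding g_def
  using zc hc tgen_carrier[OF y(1)] by (intro assoc_mult_mat[symmetric, of _ ?n ?n _ ?n _ ?n]) auto
 hence "h = y * g" using y hc by simp
 thus ?case using tgen_mult[OF y(1) gt] by simp
qed

lemma SL_tgen: "g : SLc n ==> g : tgen n (%i j. True)"
 using Hgrp_tgen[of "{}" n g] tgen_mono by (fastforce simp: Hgrp_def blk_def)

section \<open>Polynomial curves in \<open>SL(n,\<complex>)\<close>\<close>

text \<open>Multiplying all parameters in a word of transvections by z gives a polynomial curve from
  the identity to \<open>g\<close> inside SL(n).\<close>

lemma tgen_curve:
 "g : tgen n R ==> EX c. c 0 = 1\<^sub>m n & c 1 = g & (ALL z. c z : SLc n) &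
  (ALL i<n. ALL j<n. pline (%z. c z $$ (i, j)))"
proof (induction rule: tgen.induct)
 case one
 thus ?case
  by (intro exI[of _ "%_. 1\<^sub>m n"]) (auto simp: SL_one_closed pline_def pf_const)
next
 case (step g i j a)
 then obtain c where c: "c 0 = 1\<^sub>m n" "c 1 = g" "!!z. c z : SLc n"
  "!!i j. i < n ==> j < n ==> pline (%z. c z $$ (i, j))" by blast
 let ?c = "%z. addrow_mat n (z * a) i j * c z"
 have "addrow_mat n 0 i j = (1\<^sub>m n :: complex mat)" using step by (intro eq_matI) (auto simp: addrow_mat_def)
 hence "?c 0 = 1\<^sub>m n" using c by simp
 moreover have "?c z : SLc n" for z
  using c(3) step by (intro SL_mult_closed addrow_mat_SL) auto
 moreover have "pline (%z. ?c z $$ (r, s))" if "r < n" "s < n" for r s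
  unfolding pline_def
 proof (rule pf_mat_mult[where n = n and m = n and k = n])
  show "pf UNIV {%z. z} (%x. addrow_mat n (x * a) i j $$ (r, s))" if "r < n" "s < n" for r s
  proof -
   have "pf UNIV {%z. z} (%x. if r = s then 1 else if r = i & s = j then x * a else 0)"
    using pf_mult[OF pline_id[unfolded pline_def] pf_const[of _ _ a]]
    by (cases "r = s"; cases "r = i & s = j") (simp_all only: if_True if_False simp_thms pf_const)
   thus ?thesis by (subst pf_cong) (simp_all only: addrow_mat_index[OF that step.hyps(4)])
  qed
  show "pf UNIV {%z. z} (%x. c x $$ (i, j))" if "i < n" "j < n" for i j
   using c(4)[OF that] by (simp add: pline_def)
 qed (use that c(3) SL_mat in auto)
 ultimately show ?case using c(2) by (intro exI[of _ ?c]) auto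
qed

lemma SL_curve:
 assumes "g : SLc n" "h : SLc n"
 shows "EX c. c 0 = g & c 1 = h & (ALL z. c z : SLc n) & (ALL f. pf (SLc n) (slc n) f --> pline (%z. f (c z)))"
proof -
 have "adj_mat g * h : SLc n" using assms SL_adj SL_mult_closed by blast
 from tgen_curve[OF SL_tgen[OF this]] obtain c where c: "c 0 = 1\<^sub>m n" "c 1 = adj_mat g * h"
  "!!z. c z : SLc n" "!!i j. i < n ==> j < n ==> pline (%z. c z $$ (i, j))" by blast
 let ?c = "%z. g * c z"
 note gh = assms[THEN SL_mat]
 have "?c 1 = h"
  unfolding c(2) by (rule SL_adj_cancel(1)[OF assms(1) gh(2)])
 moreover have "?c z : SLc n" for z
  using c(3) assms SL_mult_closed by blast
 moreover have "pline (%z. f (?c z))" if "pf (SLc n) (slc n) f" for f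
  unfolding pline_def
 proof (rule pf_compose[OF that])
  show "?c x : SLc n" for x by fact
  fix b assume "b : slc n"
  then obtain r s where b: "b = (%g. g $$ (r, s))" "r < n" "s < n" by blast
  show "pf UNIV {%z. z} (%x. b (?c x))"
   unfolding b(1)
  proof (rule pf_mat_mult[where n = n and m = n and k = n])
   show "pf UNIV {%z. z} (%x. c x $$ (i, j))" if "i < n" "j < n" for i j
    using c(4)[OF that] by (simp add: pline_def)
  qed (use b c(3) SL_mat gh in \<open>auto intro: pf_const\<close>)
 qed
 ultimately show ?thesis using c(1) gh by (intro exI[of _ ?c]) auto
qed

text \<open>Along a curve joining the two points each function has finitely many zeros, so some
  parameter avoids both sets. This is the irreducibility of SL(n).\<close>

lemma SL_irreducible2:
 assumes "pf (SLc n) (slc n) f" "pf (SLc n) (slc n) f'"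
  and "g : SLc n" "f g ~= 0" "g' : SLc n" "f' g' ~= 0"
 shows "EX h:SLc n. f h ~= 0 & f' h ~= 0"
proof -
 obtain c where c: "c 0 = g" "c 1 = g'" "!!z. c z : SLc n"
  "!!f. pf (SLc n) (slc n) f ==> pline (%z. f (c z))"
  using SL_curve[OF assms(3,5)] by blast
 have "finite {z. f (c z) = 0}" "finite {z. f' (c z) = 0}"
  using pline_finite_zeros[OF c(4)[OF assms(1)], of 0] pline_finite_zeros[OF c(4)[OF assms(2)], of 1]
   assms c by auto
 hence "finite ({z. f (c z) = 0} \<union> {z. f' (c z) = 0})" by simp
 from infinite_avoid[OF this] c(3) show ?thesis by blast
qed

lemma SL_irreducible:
 assumes "finite D" and "!!d. d : D ==> pf (SLc n) (slc n) (f d)"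
  and "!!d. d : D ==> EX g:SLc n. f d g ~= 0"
 shows "EX g:SLc n. ALL d:D. f d g ~= 0"
 using assms
proof (induction D rule: finite_induct)
 case empty
 thus ?case using SL_one_closed by blast
next
 case (insert d D)
 then obtain g where g: "g : SLc n" "ALL d:D. f d g ~= 0" by auto
 obtain g' where g': "g' : SLc n" "f d g' ~= 0" using insert.prems by auto
 have "EX h:SLc n. (PROD d:D. f d h) ~= 0 & f d h ~= 0"
  using insert g g' by (intro SL_irreducible2[of n _ _ g g'] pf_prod) auto
 thus ?case using insert.hyps by auto
qed

lemma SL_dense:
 assumes "pf (SLc n) (slc n) f" "pf (SLc n) (slc n) p"
  and "g : SLc n" "p g ~= 0"
  and "!!h. h : SLc n ==> p h ~= 0 ==> f h = 0" and "h : SLc n"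
 shows "f h = 0"
 using SL_irreducible2[OF assms(1,2) assms(6) _ assms(3,4)] assms(5) by blast

section \<open>Minors\<close>

lemma pf_eq_points:
 assumes "pf X C f" "x : X" "y : X" and "!!c. c : C ==> c x = c y"
 shows "f x = f y"
proof -
 have "h x = h y" if "h : poly_functions X C" for h
  using that by (induction rule: poly_functions.induct) (use assms in auto)
 from this[OF assms(1)[unfolded pf_def]] show ?thesis using assms by simp
qed

text \<open>All choices of d rows, repetitions included, extended by the identity; this is the index
  set of \<open>det_linear_rows_sum\<close>.\<close>

definition rowsel :: "nat => nat => (nat => nat) set" where
 "rowsel n d = {kappa. (ALL i:{0..<d}. kappa i : {0..<n}) & (ALL i. i ~: {0..<d} --> kappa i = i)}"

lemma minor_cong: "(!!i. i < d ==> rho i = rho' i) ==> minor g d rho = minor g d rho'"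
 unfolding minor_def by (intro arg_cong[of _ _ det] eq_matI) auto

text \<open>Multilinearity in the rows. In contrast to Cauchy-Binet the sum runs over all maps, so
  no ordering of rows and no signs enter.\<close>

lemma minor_mult:
 assumes h: "h : carrier_mat p n" and g: "g : carrier_mat n m" and d: "d <= m"
  and rho: "!!i. i < d ==> rho i < p"
 shows "minor (h * g) d rho = (SUM kappa:rowsel n d. (PROD i:{0..<d}. h $$ (rho i, kappa i)) * minor g d kappa)"
proof -
 define a where "a = (%i l. h $$ (rho i, l) \<cdot>\<^sub>v vec d (%j. g $$ (l, j)))"
 have "mat d d (%(i, j). (h * g) $$ (rho i, j)) = mat\<^sub>r d d (%i. finsum_vec TYPE(complex) d (a i) {0..<n})"
 proof (rule eq_matI)
  fix i j assume "i < dim_row (mat\<^sub>r d d (%i. finsum_vec TYPE(complex) d (a i) {0..<n}))"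
   "j < dim_col (mat\<^sub>r d d (%i. finsum_vec TYPE(complex) d (a i) {0..<n}))"
  hence ij: "i < d" "j < d" by auto
  have "(h * g) $$ (rho i, j) = (SUM l<n. h $$ (rho i, l) * g $$ (l, j))"
   using ij d rho by (intro index_mult_sum[OF h g]) auto
  also have "... = finsum_vec TYPE(complex) d (a i) {0..<n} $ j"
   using ij by (subst index_finsum_vec) (auto simp: a_def atLeast0LessThan)
  finally show "mat d d (%(i, j). (h * g) $$ (rho i, j)) $$ (i, j) =
    mat\<^sub>r d d (%i. finsum_vec TYPE(complex) d (a i) {0..<n}) $$ (i, j)"
   using ij by simp
 qed auto
 hence "minor (h * g) d rho = (SUM f:rowsel n d. det (mat\<^sub>r d d (%i. a i (f i))))"
  unfolding minor_def rowsel_def by (simp only:) (rule det_linear_rows_sum, auto simp: a_def)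
 also have "... = (SUM kappa:rowsel n d. (PROD i:{0..<d}. h $$ (rho i, kappa i)) * minor g d kappa)"
 proof (rule sum.cong[OF refl])
  fix kappa
  have "mat\<^sub>r d d (%i. vec d (%j. g $$ (kappa i, j))) = mat d d (%(i, j). g $$ (kappa i, j))"
   by (intro eq_matI) auto
  thus "det (mat\<^sub>r d d (%i. a i (kappa i))) = (PROD i:{0..<d}. h $$ (rho i, kappa i)) * minor g d kappa"
   unfolding a_def minor_def by (subst det_rows_mul) auto
 qed
 finally show ?thesis .
qed

text \<open>Sizes 0 and n are left out because such minors are constant on SL(n).\<close>

definition mins :: "nat => (complex mat => complex) set" where
 "mins n = {(%g. minor g d rho) | d rho. 1 <= d & d < n & (ALL i<d. rho i < n)}"

lemma minsI: "1 <= d ==> d < n ==> (!!i. i < d ==> rho i < n) ==> (%g. minor g d rho) : mins n"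
 unfolding mins_def by blast

lemma rowsel_less: "kappa : rowsel n d ==> i < d ==> kappa i < n"
 by (auto simp: rowsel_def)

lemma pf_slc: "i < n ==> j < n ==> pf X (slc n) (%g. g $$ (i, j))"
 by (intro pf_coord) auto

lemma pf_minor:
 assumes "!!i. i < d ==> rho i < n" "d <= n"
 shows "pf X (slc n) (%g. minor g d rho)"
 unfolding minor_def using assms by (intro pf_det[where d = d]) (auto intro!: pf_slc)

lemma pf_mins_translate:
 assumes h: "h : SLc n" and f: "pf (SLc n) (mins n) f"
 shows "pf (SLc n) (mins n) (%g. f (h * g))"
proof (rule pf_compose[OF f])
 show "h * g : SLc n" if "g : SLc n" for g
  using SL_mult_closed[OF h that] .
 fix b assume "b : mins n"
 then obtain d rho where b: "b = (%g. minor g d rho)" "1 <= d" "d < n" "ALL i<d. rho i < n"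
  unfolding mins_def by blast
 have "pf (SLc n) (mins n)
  (%g. SUM kappa:rowsel n d. (PROD i:{0..<d}. h $$ (rho i, kappa i)) * minor g d kappa)"
  using b by (intro pf_sum pf_mult pf_const pf_coord) (auto intro!: minsI simp: rowsel_less)
 thus "pf (SLc n) (mins n) (%g. b (h * g))"
  using minor_mult[OF SL_mat[OF h] SL_mat] b by (subst pf_cong) auto
qed

definition unitri :: "nat => complex mat set" where
 "unitri n = {u : sq_mat n. ALL i<n. ALL j<=i. u $$ (i, j) = (if i = j then 1 else 0)}"

lemma minor_unitri:
 assumes "u : unitri n" "d <= n" shows "minor u d id = 1"
proof -
 have "upper_triangular (mat d d (%(i, j). u $$ (id i, j)))"
  using assms by (auto simp: unitri_def)
 hence "minor u d id = prod_list (diag_mat (mat d d (%(i, j). u $$ (id i, j))))"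
  unfolding minor_def by (intro det_upper_triangular) auto
 also have "... = (PROD i<d. u $$ (i, i))"
  by (simp add: prod_list_diag_prod atLeast0LessThan)
 also have "... = 1"
  using assms by (intro prod.neutral) (auto simp: unitri_def)
 finally show ?thesis .
qed

lemma minor_full: "g : sq_mat n ==> minor g n id = det g"
 unfolding minor_def by (intro arg_cong[of _ _ det] eq_matI) auto

lemma unitri_carrier: "u : unitri n ==> u : sq_mat n"
 by (simp add: unitri_def)

lemma unitri_blk: "D \<subseteq> {..n} ==> u : unitri n ==> blk n D u"
 by (auto simp: unitri_def blk_def)

lemma unitri_Hgrp: "D \<subseteq> {..n} ==> u : unitri n ==> u : Hgrp n D"
 using minor_unitri[of u n n] minor_full[of u n]
 by (auto simp: Hgrp_def SL_carrier unitri_carrier unitri_blk minor_unitri)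

lemma unitri_SL: "u : unitri n ==> u : SLc n"
 using unitri_Hgrp[of "{}" n u] by (simp add: Hgrp_def)

lemma minor_mult_Hgrp:
 assumes "g : carrier_mat m n" "h : Hgrp n D" "d : D" "d <= n" "!!i. i < d ==> rho i < m"
 shows "minor (g * h) d rho = minor g d rho"
 using minor_mult_block[OF assms(1), of h n d rho] assms by (auto simp: Hgrp_def SL_carrier blk_def)

lemma minor_mult_unitri:
 assumes "g : carrier_mat m n" "u : unitri n" "d <= n" "!!i. i < d ==> rho i < m"
 shows "minor (g * u) d rho = minor g d rho"
 using minor_mult_Hgrp[OF assms(1) unitri_Hgrp[of "{d}" n u], where d = d and rho = rho] assms by auto

text \<open>The leading minors of a triangular matrix are the partial products of its diagonal; when
  they are all one, so is the diagonal.\<close>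

lemma Hgrp_full: "h : Hgrp n {1..n} ==> h : unitri n"
proof -
 assume h: "h : Hgrp n {1..n}"
 have hc: "h : sq_mat n" using h by (simp add: Hgrp_def SL_carrier)
 have z: "h $$ (r, c) = 0" if "c < r" "r < n" for r c
 proof -
  have "ALL e:{1..n}. ALL r c. e <= r & r < n & c < e --> h $$ (r, c) = 0"
   using h by (simp add: Hgrp_def blk_def)
  from bspec[OF this, of r] that show ?thesis by auto
 qed
 have m: "minor h d id = (PROD i<d. h $$ (i, i))" if "d <= n" for d
 proof -
  have "upper_triangular (mat d d (%(i, j). h $$ (id i, j)))"
   using that z by auto
  hence "minor h d id = prod_list (diag_mat (mat d d (%(i, j). h $$ (id i, j))))"
   unfolding minor_def by (intro det_upper_triangular) auto
  also have "... = (PROD i<d. h $$ (i, i))"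
   by (simp add: prod_list_diag_prod atLeast0LessThan)
  finally show ?thesis .
 qed
 have m1: "minor h d id = 1" if "d <= n" for d
  using h that by (cases "d = 0") (auto simp: Hgrp_def minor_def)
 have "h $$ (i, i) = 1" if "i < n" for i
  using m[of "Suc i"] m[of i] m1[of "Suc i"] m1[of i] that by simp
 thus ?thesis using z hc unfolding unitri_def by auto
qed

text \<open>The end of the block that contains column \<open>c\<close>.\<close>

definition nxt :: "nat set => nat => nat" where
 "nxt D c = (LEAST e. e : D & c < e)"

lemma nxt:
 assumes "n : D" "c < n"
 shows "nxt D c : D" "c < nxt D c" "nxt D c <= n" "!!e. e : D ==> c < e ==> nxt D c <= e"
proof -
 have "nxt D c : D & c < nxt D c" unfolding nxt_def by (rule LeastI[of _ n]) (use assms in auto)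
 thus "nxt D c : D" "c < nxt D c" by auto
 show "!!e. e : D ==> c < e ==> nxt D c <= e" unfolding nxt_def by (auto intro: Least_le)
 thus "nxt D c <= n" using assms by auto
qed

text \<open>
  The columns of \<open>secm n D g\<close> are polynomials in minors of \<open>g\<close>. By Cramer's rule they are
  combinations of columns of \<open>g\<close> from the same or earlier blocks, so that \<open>secm n D g\<close> represents
  the coset of \<open>g\<close> after its columns have been rescaled.
\<close>

definition secm :: "nat => nat set => complex mat => complex mat" where
 "secm n D g = mat n n (%(r, c). minor g (nxt D c) (id(c := r)))"

text \<open>Column c is column c of the adjugate of the leading block of size
  \<open>nxt D c\<close>, padded by zeros; multiplication by \<open>g\<close> turns it into the
  minors of \<open>secm\<close> (\<open>secm_factor\<close>).\<close>

definition secf :: "nat => nat set => complex mat => complex mat" where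
 "secf n D g = mat n n (%(k, c). if k < nxt D c then
  cofactor (mat (nxt D c) (nxt D c) (%(i, j). g $$ (i, j))) c k else 0)"

text \<open>Laplace expansion along the replaced row, whose cofactors do not involve that
  row.\<close>

lemma minor_replace_row:
 assumes "c < d"
 shows "minor g d (id(c := r)) = (SUM k<d. g $$ (r, k) * cofactor (mat d d (%(i, j). g $$ (i, j))) c k)"
proof -
 let ?A = "mat d d (%(i, j). g $$ ((id(c := r)) i, j))"
 have "det ?A = (SUM k<d. ?A $$ (c, k) * cofactor ?A c k)"
  using assms by (intro laplace_expansion_row) auto
 also have "... = (SUM k<d. g $$ (r, k) * cofactor (mat d d (%(i, j). g $$ (i, j))) c k)"
 proof (rule sum.cong[OF refl])
  fix k assume k: "k : {..<d}"
  have "mat_delete ?A c k = mat_delete (mat d d (%(i, j). g $$ (i, j))) c k"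
   by (intro eq_matI) (auto simp: mat_delete_def)
  thus "?A $$ (c, k) * cofactor ?A c k = g $$ (r, k) * cofactor (mat d d (%(i, j). g $$ (i, j))) c k"
   using k assms by (simp add: cofactor_def)
 qed
 finally show ?thesis by (simp add: minor_def)
qed

lemma secm_factor:
 assumes D: "n : D" "D \<subseteq> {..n}" and g: "g : sq_mat n"
 shows "secm n D g = g * secf n D g"
proof (rule eq_matI)
 fix r c assume "r < dim_row (g * secf n D g)" "c < dim_col (g * secf n D g)"
 hence rc: "r < n" "c < n" using g by (auto simp: secf_def)
 have "(g * secf n D g) $$ (r, c) = (SUM k<n. g $$ (r, k) * secf n D g $$ (k, c))"
  using rc g by (intro index_mult_sum) (auto simp: secf_def)
 also have "... = (SUM k<nxt D c. g $$ (r, k) * secf n D g $$ (k, c))"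
  using nxt[OF D(1) rc(2)] rc by (intro sum.mono_neutral_right) (auto simp: secf_def)
 also have "... = minor g (nxt D c) (id(c := r))"
  using nxt[OF D(1) rc(2)] rc by (subst minor_replace_row) (auto simp: secf_def intro!: sum.cong)
 finally show "secm n D g $$ (r, c) = (g * secf n D g) $$ (r, c)"
  using rc by (simp add: secm_def)
qed (use g in \<open>auto simp: secm_def secf_def\<close>)

lemma secm_minor:
 assumes D: "n : D" "D \<subseteq> {..n}" and g: "g : sq_mat n" and e: "e : D"
  and rho: "!!i. i < e ==> rho i < n"
 shows "minor (secm n D g) e rho = minor g e rho * minor (secf n D g) e id"
 unfolding secm_factor[OF D g]
proof (rule minor_mult_block[OF g])
 show "secf n D g : sq_mat n" by (simp add: secf_def)
 show "e <= n" "e <= n" using D e by auto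
 fix r c assume "e <= r" "r < n" "c < e"
 moreover from this e have "nxt D c <= e" using nxt(4)[OF D(1), of c e] by simp
 ultimately show "secf n D g $$ (r, c) = 0" by (simp add: secf_def)
qed (use rho in auto)

text \<open>Off the diagonal the minor has two equal rows. Hence \<open>secm\<close> is lower
  triangular and its diagonal blocks are scalar.\<close>

lemma secm_top:
 assumes D: "n : D" "D \<subseteq> {..n}" and c: "c < n" "r < nxt D c"
 shows "secm n D g $$ (r, c) = (if r = c then minor g (nxt D c) id else 0)"
proof -
 have r: "r < n" using nxt[OF D(1) c(1)] c by auto
 have id: "id(c := c) = (id :: nat => nat)" by auto
 have "minor g (nxt D c) (id(c := r)) = 0" if "r ~= c"
  unfolding minor_def
  by (rule det_identical_rows[of _ "nxt D c" r c]) (use nxt[OF D(1) c(1)] c that in \<open>auto simp: row_def\<close>)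
 thus ?thesis using r c id by (auto simp: secm_def)
qed

lemma secm_minor_id:
 assumes D: "n : D" "D \<subseteq> {..n}" and e: "e : D"
 shows "minor (secm n D g) e id = (PROD c<e. minor g (nxt D c) id)"
proof -
 let ?M = "mat e e (%(i, j). secm n D g $$ (id i, j))"
 have en: "e <= n" using D e by auto
 have d: "?M $$ (i, j) = (if i = j then minor g (nxt D j) id else 0)" if "i <= j" "j < e" for i j
  using secm_top[OF D, of j i g] nxt[OF D(1), of j] that en by auto
 have "det ?M = prod_list (diag_mat ?M)"
  by (rule det_lower_triangular[of e]) (use d in auto)
 also have "... = (PROD c<e. ?M $$ (c, c))"
  by (simp add: prod_list_diag_prod atLeast0LessThan)
 also have "... = (PROD c<e. minor g (nxt D c) id)"
  using d by (intro prod.cong) auto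
 finally show ?thesis by (simp add: minor_def)
qed

text \<open>An identity between polynomials in minors, so it survives the application of a
  character; lemma \<open>sct\<close> uses it for characters not yet known to come from a
  matrix.\<close>

lemma secm_relation:
 assumes D: "n : D" "D \<subseteq> {..n}" and g: "g : sq_mat n" and e: "e : D"
  and rho: "!!i. i < e ==> rho i < n"
 shows "minor g e id * minor (secm n D g) e rho = minor g e rho * (PROD c<e. minor g (nxt D c) id)"
proof -
 have "e <= n" using D e by auto
 thus ?thesis
  using secm_minor[OF D g e rho] secm_minor[OF D g e, of id] secm_minor_id[OF D e, of g]
  by (auto simp: algebra_simps)
qed

text \<open>The case of the full flag: dividing the columns of \<open>secf\<close> and
  \<open>secm\<close> by leading minors makes these matrices unitriangular, upper and lower
  respectively.\<close>

lemma triangular_decomposition: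
 assumes g: "g : SLc n" and nz: "!!d. d <= n ==> minor g d id ~= 0"
 shows "EX u:unitri n. EX l. l\<^sup>T : unitri n &
  g * u = l * mat n n (%(i, j). if i = j then minor g (Suc i) id / minor g i id else 0)"
proof (cases "n = 0")
 case True
 thus ?thesis using g
  by (intro bexI[of _ "1\<^sub>m 0"] exI[of _ "1\<^sub>m 0"]) (auto simp: unitri_def SL_carrier)
next
 case False
 let ?D = "{1..n}"
 have D: "n : ?D" "?D \<subseteq> {..n}" using False by auto
 have gc: "g : sq_mat n" using g by (simp add: SL_carrier)
 have nx: "nxt ?D c = Suc c" if "c < n" for c
  using nxt[OF D(1) that] that by (intro antisym) auto
 define u where "u = mat n n (%(i, j). secf n ?D g $$ (i, j) / minor g j id)"
 define l where "l = mat n n (%(i, j). secm n ?D g $$ (i, j) / minor g (Suc j) id)"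
 let ?t = "mat n n (%(i, j). if i = j then minor g (Suc i) id / minor g i id else 0)"
 have "u : unitri n"
 proof -
  have "u $$ (i, j) = (if i = j then 1 else 0)" if "i < n" "j <= i" for i j
  proof -
   have "cofactor (mat (Suc j) (Suc j) (%(i, j). g $$ (i, j))) j j = minor g j id"
    unfolding cofactor_def minor_def mat_delete_def
    by (simp, intro arg_cong[of _ _ det] eq_matI) auto
   thus ?thesis using that nx[of j] nz[of j] by (auto simp: u_def secf_def)
  qed
  thus ?thesis by (auto simp: unitri_def u_def)
 qed
 moreover have "l\<^sup>T : unitri n"
  using secm_top[OF D, of _ _ g] nx nz by (auto simp: unitri_def l_def)
 moreover have "g * u = l * ?t"
 proof (rule eq_matI)
  fix i j assume "i < dim_row (l * ?t)" "j < dim_col (l * ?t)"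
  hence ij: "i < n" "j < n" by (auto simp: l_def)
  have "(g * u) $$ (i, j) = (SUM k<n. g $$ (i, k) * u $$ (k, j))"
   using ij gc by (intro index_mult_sum) (auto simp: u_def)
  also have "... = (SUM k<n. g $$ (i, k) * secf n ?D g $$ (k, j)) / minor g j id"
   using ij by (simp add: u_def sum_divide_distrib)
  also have "(SUM k<n. g $$ (i, k) * secf n ?D g $$ (k, j)) = secm n ?D g $$ (i, j)"
   unfolding secm_factor[OF D gc] using ij gc by (subst index_mult_sum[of _ n n]) (auto simp: secf_def)
  finally have 1: "(g * u) $$ (i, j) = secm n ?D g $$ (i, j) / minor g j id" .
  have "(l * ?t) $$ (i, j) = (SUM k<n. l $$ (i, k) * ?t $$ (k, j))"
   using ij by (intro index_mult_sum) (auto simp: l_def)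
  also have "... = (SUM k<n. if k = j then l $$ (i, j) * ?t $$ (j, j) else 0)"
   using ij by (intro sum.cong) auto
  also have "... = secm n ?D g $$ (i, j) / minor g j id"
   using ij nz[of "Suc j"] by (simp add: l_def)
  finally show "(g * u) $$ (i, j) = (l * ?t) $$ (i, j)" using 1 by simp
 qed (use gc in \<open>auto simp: l_def u_def\<close>)
 ultimately show ?thesis by blast
qed

text \<open>A matrix whose leading minors are the given numbers: with ones just below the diagonal,
  expansion of a leading block along its last column leaves only the top right entry, and the sign
  in the first row cancels the sign of the cofactor.\<close>

definition prescribed :: "nat => (nat => complex) => complex mat" where
 "prescribed n s = mat n n (%(i, j). if i = 0 then (-1) ^ j * s (Suc j) else if i = Suc j then 1 else 0)"

lemma minor_prescribed:
 assumes "d < n" shows "minor (prescribed n s) (Suc d) id = s (Suc d)"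
proof -
 let ?M = "mat (Suc d) (Suc d) (%(i, j). prescribed n s $$ (id i, j))"
 have "det ?M = (SUM i<Suc d. ?M $$ (i, d) * cofactor ?M i d)"
  by (rule laplace_expansion_column) auto
 also have "... = ?M $$ (0, d) * cofactor ?M 0 d + (SUM i<d. ?M $$ (Suc i, d) * cofactor ?M (Suc i) d)"
  by (rule sum.lessThan_Suc_shift)
 also have "(SUM i<d. ?M $$ (Suc i, d) * cofactor ?M (Suc i) d) = 0"
  using assms by (intro sum.neutral) (auto simp: prescribed_def)
 also have "cofactor ?M 0 d = (-1) ^ d"
 proof -
  have "mat_delete ?M 0 d = 1\<^sub>m d"
   using assms by (intro eq_matI) (auto simp: mat_delete_def prescribed_def)
  thus ?thesis by (simp add: cofactor_def)
 qed
 finally show ?thesis using assms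
  by (simp add: minor_def prescribed_def power_mult_distrib[symmetric] flip: power_add)
qed

section \<open>Invariants of the unitriangular group\<close>

text \<open>Monomials are kept as words in the matrix positions and are not collected: the words of
  a given length are a basis of a tensor power, on which the standard hermitian product has the
  adjunction \<open>ip_tact\<close>. Coefficients are then not unique, so functions are compared by
  their values.\<close>

definition words :: "nat => nat => (nat \<times> nat) list set" where
 "words n m = {w. set w \<subseteq> {..<n} \<times> {..<n} & length w <= m}"

definition mono :: "(nat \<times> nat) list => complex mat => complex" where
 "mono w g = prod_list (map (%p. g $$ p) w)"

definition ten :: "(nat \<times> nat) list set => ((nat \<times> nat) list => complex) => complex mat => complex" where
 "ten W c g = (SUM w:W. c w * mono w g)"

lemma finite_words: "finite (words n m)"
 unfolding words_def by (rule finite_lists_length_le) simp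

lemma words_mono: "m <= m' ==> words n m \<subseteq> words n m'"
 by (auto simp: words_def)

lemma ten_mono:
 assumes "m <= m'"
 shows "ten (words n m') (%w. if w : words n m then c w else 0) g = ten (words n m) c g"
 unfolding ten_def using words_mono[OF assms, of n] finite_words[of n m']
 by (intro sum.mono_neutral_cong_right) auto

lemma ten_mult:
 "EX e. ALL g. ten (words n m) c g * ten (words n m') d g = ten (words n (m + m')) e g"
proof -
 let ?P = "words n m \<times> words n m'" and ?h = "%p. fst p @ snd p"
 define e where "e = (%u. SUM p:{p : ?P. ?h p = u}. c (fst p) * d (snd p))"
 have "ten (words n m) c g * ten (words n m') d g = ten (words n (m + m')) e g" for g
 proof -
  have "ten (words n m) c g * ten (words n m') d g =
    (SUM p:?P. c (fst p) * d (snd p) * mono (?h p) g)"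
   unfolding ten_def sum_product sum.cartesian_product
   by (intro sum.cong) (auto simp: mono_def algebra_simps)
  also have "... = (SUM u:words n (m + m'). SUM p:{p : ?P. ?h p = u}. c (fst p) * d (snd p) * mono (?h p) g)"
   by (rule sum.group[symmetric]) (auto simp: finite_words, auto simp: words_def)
  also have "... = (SUM u:words n (m + m'). SUM p:{p : ?P. ?h p = u}. c (fst p) * d (snd p) * mono u g)"
   by (intro sum.cong) auto
  also have "... = ten (words n (m + m')) e g"
   unfolding ten_def e_def by (simp add: sum_distrib_right)
  finally show ?thesis .
 qed
 thus ?thesis by blast
qed

lemma poly_ten:
 assumes "f : poly_functions X (slc n)"
 shows "EX m c. ALL g:X. f g = ten (words n m) c g"
 using assms
proof (induction rule: poly_functions.induct)
 case (const a)
 have "words n 0 = {[]}" by (auto simp: words_def)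
 thus ?case by (intro exI[of _ 0] exI[of _ "%_. a"]) (simp add: ten_def mono_def)
next
 case (coord f)
 then obtain r s where f: "f = (%g. g $$ (r, s))" "r < n" "s < n" by blast
 have "ten (words n 1) (%w. if w = [(r, s)] then 1 else 0) g = g $$ (r, s)" for g
 proof -
  have "ten (words n 1) (%w. if w = [(r, s)] then 1 else 0) g =
    (SUM w:words n 1. if w = [(r, s)] then g $$ (r, s) else 0)"
   unfolding ten_def by (intro sum.cong) (auto simp: mono_def)
  also have "... = g $$ (r, s)"
   using f finite_words by (subst sum.delta) (auto simp: words_def)
  finally show ?thesis .
 qed
 thus ?case using f by (intro exI[of _ 1] exI[of _ "%w. if w = [(r, s)] then 1 else 0"]) simp
next
 case (add f h)
 then obtain m c m' d where f: "!!g. g : X ==> f g = ten (words n m) c g"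
  and h: "!!g. g : X ==> h g = ten (words n m') d g" by blast
 let ?c = "%w. if w : words n m then c w else 0" and ?d = "%w. if w : words n m' then d w else 0"
 have "f g + h g = ten (words n (max m m')) (%w. ?c w + ?d w) g" if "g : X" for g
 proof -
  have "ten (words n (max m m')) (%w. ?c w + ?d w) g =
    ten (words n (max m m')) ?c g + ten (words n (max m m')) ?d g"
   by (simp add: ten_def algebra_simps sum.distrib)
  thus ?thesis
   using f[OF that] h[OF that] ten_mono[of m "max m m'" n c g] ten_mono[of m' "max m m'" n d g] by simp
 qed
 thus ?case by (intro exI[of _ "max m m'"] exI) auto
next
 case (mult f h)
 then obtain m c m' d where f: "!!g. g : X ==> f g = ten (words n m) c g"
  and h: "!!g. g : X ==> h g = ten (words n m') d g" by blast
 obtain e where "ALL g. ten (words n m) c g * ten (words n m') d g = ten (words n (m + m')) e g"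
  using ten_mult by blast
 thus ?case using f h by (intro exI[of _ "m + m'"] exI[of _ e]) simp
qed

lemma pf_ten: "pf X (slc n) (ten (words n m) c)"
 unfolding ten_def mono_def
proof (intro pf_sum pf_mult pf_const pf_prod_list)
 fix w p assume "w : words n m" "p : set w"
 hence "fst p < n & snd p < n" by (auto simp: words_def)
 thus "pf X (slc n) (%x. x $$ p)" using pf_slc[of "fst p" n "snd p"] by simp
qed

text \<open>The matrix coefficients of \<open>h\<close> acting by left translation on monomials.\<close>

fun kern :: "complex mat => (nat \<times> nat) list => (nat \<times> nat) list => complex" where
 "kern h [] [] = 1"
| "kern h (p # w) (q # v) = (if snd p = snd q then h $$ (fst p, fst q) * kern h w v else 0)"
| "kern h _ _ = 0"

lemma sum_words_Suc:
 fixes f :: "(nat \<times> nat) list => complex"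
 shows "(SUM v:words n (Suc m). f v) = f [] + (SUM q:{..<n} \<times> {..<n}. SUM v:words n m. f (q # v))"
proof -
 have e: "words n (Suc m) = insert [] ((%(q, v). q # v) ` (({..<n} \<times> {..<n}) \<times> words n m))" (is "_ = insert [] ?I")
 proof
  show "words n (Suc m) \<subseteq> insert [] ?I"
  proof
   fix w assume w: "w : words n (Suc m)"
   show "w : insert [] ?I"
   proof (cases w)
    case (Cons q v)
    hence "q : {..<n} \<times> {..<n}" "v : words n m" using w by (auto simp: words_def)
    thus ?thesis unfolding Cons by blast
   qed simp
  qed
 qed (auto simp: words_def)
 have fin: "finite ?I" using finite_words by auto
 have inj: "inj_on (%(q, v). q # v) (({..<n} \<times> {..<n}) \<times> words n m)" by (auto simp: inj_on_def)
 have "(SUM v:words n (Suc m). f v) = f [] + (SUM v:?I. f v)"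
  unfolding e using fin by (subst sum.insert) auto
 also have "(SUM v:?I. f v) = (SUM p:({..<n} \<times> {..<n}) \<times> words n m. f (fst p # snd p))"
  using inj by (subst sum.reindex) (auto simp: o_def case_prod_beta)
 also have "... = (SUM q:{..<n} \<times> {..<n}. SUM v:words n m. f (q # v))"
  by (simp add: sum.cartesian_product case_prod_beta)
 finally show ?thesis .
qed

lemma mono_mult:
 assumes "h : sq_mat n" "g : sq_mat n" "w : words n m"
 shows "mono w (h * g) = (SUM v:words n m. kern h w v * mono v g)"
 using assms(3)
proof (induction w arbitrary: m)
 case Nil
 have "(SUM v:words n m. kern h [] v * mono v g) = (SUM v:words n m. if v = [] then 1 else 0)"
 proof (intro sum.cong refl)
  fix v show "kern h [] v * mono v g = (if v = [] then 1 else 0)"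
   by (cases v) (auto simp: mono_def)
 qed
 also have "... = 1" using finite_words by (subst sum.delta) (auto simp: words_def)
 finally show ?case by (simp add: mono_def)
next
 case (Cons p w)
 obtain k where m: "m = Suc k" "w : words n k" using Cons.prems by (cases m) (auto simp: words_def)
 have p: "fst p < n" "snd p < n" using Cons.prems by (auto simp: words_def)
 have "(SUM v:words n m. kern h (p # w) v * mono v g) =
  (SUM q:{..<n} \<times> {..<n}. SUM v:words n k. kern h (p # w) (q # v) * mono (q # v) g)"
  unfolding m(1) sum_words_Suc by simp
 also have "... = (SUM q:{..<n} \<times> {..<n}. (if snd p = snd q then h $$ (fst p, fst q) * g $$ q else 0) * (SUM v:words n k. kern h w v * mono v g))"
  unfolding sum_distrib_left by (intro sum.cong refl) (auto simp: mono_def)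
 also have "... = (SUM q:{..<n} \<times> {..<n}. if snd p = snd q then h $$ (fst p, fst q) * g $$ q else 0) * mono w (h * g)"
  unfolding sum_distrib_right Cons.IH[OF m(2)] ..
 also have "(SUM q:{..<n} \<times> {..<n}. if snd p = snd q then h $$ (fst p, fst q) * g $$ q else 0) =
   (SUM l<n. SUM j<n. if snd p = j then h $$ (fst p, l) * g $$ (l, j) else 0)"
  unfolding sum.cartesian_product by (intro sum.cong) auto
 also have "... = (SUM l<n. h $$ (fst p, l) * g $$ (l, snd p))"
  using p by (intro sum.cong refl) (subst sum.delta', auto)
 also have "... = (h * g) $$ p"
  using index_mult_sum[OF assms(1,2) p] by simp
 finally show ?case by (simp add: mono_def)
qed

section \<open>The adjoint of left translation\<close>

definition cadj :: "complex mat => complex mat" where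
 "cadj h = mat (dim_col h) (dim_row h) (%(i, j). cnj (h $$ (j, i)))"

lemma cadj_carrier: "h : sq_mat n ==> cadj h : sq_mat n"
 by (auto simp: cadj_def)

lemma cadj_SL: "h : SLc n ==> cadj h : SLc n"
proof -
 assume "h : SLc n"
 hence h: "h : sq_mat n" "det h = 1" by (auto simp: SL_carrier)
 let ?c = "mat n n (%(i, j). cnj (h $$ (i, j)))"
 have "det ?c = cnj (det h)"
  unfolding det_def'[OF h(1)] det_def'[of ?c n, OF mat_carrier] cnj_sum complex_cnj_mult cnj_prod
 proof (intro sum.cong refl arg_cong2[of _ _ _ _ "(*)"] prod.cong)
  fix p assume "p : {p. p permutes {0..<n}}"
  hence p: "p permutes {0..<n}" by simp
  show "signof p = cnj (signof p)" by (simp add: sign_def)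
  fix i assume i: "i : {0..<n}"
  hence "p i : {0..<n}" using permutes_in_image[OF p] by blast
  thus "?c $$ (i, p i) = cnj (h $$ (i, p i))" using i by simp
 qed
 moreover have "cadj h = ?c\<^sup>T" using h by (intro eq_matI) (auto simp: cadj_def)
 ultimately have "det (cadj h) = 1" using h det_transpose[of ?c n] by simp
 thus ?thesis using cadj_carrier[OF h(1)] by (simp add: SL_carrier)
qed

lemma kern_cadj:
 assumes "h : sq_mat n" "set w \<subseteq> {..<n} \<times> {..<n}" "set v \<subseteq> {..<n} \<times> {..<n}"
 shows "kern (cadj h) v w = cnj (kern h w v)"
 using assms(2,3)
proof (induction w v rule: list_induct2')
 case (4 p w q v)
 have IH: "kern (cadj h) v w = cnj (kern h w v)"
  using 4 by simp
 have "fst p < n" "fst q < n" using 4 by auto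
 hence "cadj h $$ (fst q, fst p) = cnj (h $$ (fst p, fst q))"
  using assms(1) by (auto simp: cadj_def)
 thus ?case using IH by auto
qed auto

text \<open>If \<open>c\<close> are coefficients of f, these are coefficients of f(h g) as a
  function of g (\<open>ten_tact\<close>); the value 0 outside \<open>W\<close> keeps them among the
  vectors supported in \<open>W\<close>.\<close>

definition tact :: "(nat \<times> nat) list set => complex mat => ((nat \<times> nat) list => complex) => (nat \<times> nat) list => complex" where
 "tact W h c v = (if v : W then SUM w:W. c w * kern h w v else 0)"

lemma ten_tact:
 assumes "h : sq_mat n" "g : sq_mat n"
 shows "ten (words n m) (tact (words n m) h c) g = ten (words n m) c (h * g)"
proof -
 have "ten (words n m) (tact (words n m) h c) g =
  (SUM v:words n m. SUM w:words n m. c w * kern h w v * mono v g)"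
  unfolding ten_def tact_def by (intro sum.cong refl) (simp add: sum_distrib_right)
 also have "... = (SUM w:words n m. c w * (SUM v:words n m. kern h w v * mono v g))"
  by (subst sum.swap) (simp add: sum_distrib_left mult.assoc)
 also have "... = ten (words n m) c (h * g)"
  unfolding ten_def by (intro sum.cong refl) (simp add: mono_mult[OF assms])
 finally show ?thesis .
qed

text \<open>The matrix coefficients of the conjugate transpose are the conjugate transposed
  coefficients (\<open>kern_cadj\<close>). Hence the orthogonal complement of a subspace stable
  under SL(n) is stable.\<close>

lemma ip_tact:
 assumes "h : sq_mat n"
 shows "ip (words n m) (tact (words n m) h c) d = ip (words n m) c (tact (words n m) (cadj h) d)"
proof -
 let ?W = "words n m"
 have "ip ?W (tact ?W h c) d = (SUM v:?W. SUM w:?W. c w * kern h w v * cnj (d v))"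
  unfolding ip_def tact_def by (intro sum.cong refl) (simp add: sum_distrib_right)
 also have "... = (SUM w:?W. SUM v:?W. c w * kern h w v * cnj (d v))"
  by (rule sum.swap)
 also have "... = ip ?W c (tact ?W (cadj h) d)"
  unfolding ip_def tact_def
 proof (intro sum.cong refl)
  fix w assume w: "w : ?W"
  have "(SUM v:?W. c w * kern h w v * cnj (d v)) = (SUM v:?W. c w * cnj (d v * kern (cadj h) v w))"
   using w by (intro sum.cong refl) (auto simp: words_def kern_cadj[OF assms])
  thus "(SUM v:?W. c w * kern h w v * cnj (d v)) = c w * cnj (if w : ?W then SUM v:?W. d v * kern (cadj h) v w else 0)"
   using w by (simp add: sum_distrib_left)
 qed
 finally show ?thesis .
qed

lemma pf_mins_slc: "pf X (mins n) f ==> pf X (slc n) f"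
 by (rule pf_compose[where m = "%x. x"]) (auto simp: mins_def intro!: pf_minor)

lemma pf_mins_unitri:
 assumes "pf (SLc n) (mins n) f" "g : SLc n" "u : unitri n"
 shows "f (g * u) = f g"
 by (rule pf_eq_points[OF assms(1)])
  (use assms in \<open>auto simp: mins_def unitri_SL SL_mult_closed intro!: minor_mult_unitri SL_mat\<close>)

text \<open>Where all leading minors are nonzero, \<open>g\<close> is a lower unitriangular times a
  diagonal times an upper unitriangular matrix, and the diagonal factor is determined by the leading
  minors. So \<open>F\<close> agrees there, and by density everywhere, with its value at the matrix
  with the same leading minors built by \<open>prescribed\<close>.\<close>

lemma bi_invariant:
 assumes F: "pf (SLc n) (slc n) F"
  and R: "!!g u. g : SLc n ==> u : unitri n ==> F (g * u) = F g"
  and L: "!!g u. g : SLc n ==> u : unitri n ==> F (u\<^sup>T * g) = F g"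
 shows "pf (SLc n) (mins n) F"
proof -
 \<comment> \<open>The leading minor of size n is the determinant; fixing it as 1 keeps
   \<open>X g\<close> in SL(n) and leaves only minors from \<open>mins\<close>.\<close>
 define X where "X = (%g. prescribed n (%d. if d = n then 1 else minor g d id))"
 have mX: "minor (X g) d id = minor g d id" if "g : SLc n" "d <= n" for g d
 proof (cases d)
  case 0
  thus ?thesis by (simp add: minor_def)
 next
  case (Suc d')
  thus ?thesis
   using that minor_prescribed[of d' n] minor_full[OF SL_mat[OF that(1)]]
   by (auto simp: X_def SL_carrier)
 qed
 have X: "X g : SLc n" if "g : SLc n" for g
 proof -
  have c: "X g : sq_mat n" by (simp add: X_def prescribed_def)
  have "det (X g) = 1"
   using mX[OF that, of n] minor_full[OF c] minor_full[OF SL_mat[OF that]] that by (simp add: SL_carrier)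
  thus ?thesis using c by (simp add: SL_carrier)
 qed
 have FX: "pf (SLc n) (mins n) (%g. F (X g))"
 proof (rule pf_compose[OF F X])
  fix b assume "b : slc n"
  then obtain r s where b: "b = (%g. g $$ (r, s))" "r < n" "s < n" by blast
  have "pf (SLc n) (mins n) (%g. minor g (Suc s) id)" if "Suc s ~= n"
   using that b by (intro pf_coord minsI) auto
  thus "pf (SLc n) (mins n) (%g. b (X g))"
   unfolding b(1) X_def prescribed_def using b
   by (cases "r = 0"; cases "Suc s = n") (auto intro!: pf_const pf_mult)
 qed
 define p where "p = (%g. PROD d<=n. minor g d id)"
 have pp: "pf (SLc n) (slc n) p"
  unfolding p_def by (intro pf_prod pf_minor) auto
 have p1: "p (1\<^sub>m n) ~= 0"
  unfolding p_def using minor_unitri[of "1\<^sub>m n" n] by (simp add: unitri_def minor_unitri)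
 have diag: "F g = F (mat n n (%(i, j). if i = j then minor g (Suc i) id / minor g i id else 0))"
  (is "_ = F ?t") if g: "g : SLc n" "p g ~= 0" for g
 proof -
  have "minor g d id ~= 0" if "d <= n" for d using g(2) that by (auto simp: p_def)
  from triangular_decomposition[OF g(1) this] obtain u l where
   ul: "u : unitri n" "l\<^sup>T : unitri n" "g * u = l * ?t" by blast
  have lc: "l : sq_mat n" using unitri_carrier[OF ul(2)] by simp
  have "det l = 1" using unitri_SL[OF ul(2)] det_transpose[OF lc] by (simp add: SL_carrier)
  moreover have "det (l * ?t) = 1"
   using SL_mult_closed[OF g(1) unitri_SL[OF ul(1)]] ul(3) by (simp add: SL_carrier)
  ultimately have "?t : SLc n" using det_mult[OF lc, of ?t] by (simp add: SL_carrier)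
  from L[OF this ul(2)] have "F (l * ?t) = F ?t" by simp
  thus ?thesis using R[OF g(1) ul(1)] ul(3) by simp
 qed
 have "F g = F (X g)" if g: "g : SLc n" for g
 proof -
  have "F g - F (X g) = 0"
  proof (rule SL_dense[where f = "%g. F g - F (X g)", OF _ pp SL_one_closed p1 _ g])
   show "pf (SLc n) (slc n) (%g. F g - F (X g))"
    by (rule pf_diff[OF F pf_mins_slc[OF FX]])
   fix h assume h: "h : SLc n" "p h ~= 0"
   hence "p (X h) ~= 0" using mX[OF h(1)] by (simp add: p_def)
   have "mat n n (%(i, j). if i = j then minor (X h) (Suc i) id / minor (X h) i id else 0) =
     mat n n (%(i, j). if i = j then minor h (Suc i) id / minor h i id else 0)"
    using mX[OF h(1)] by (intro eq_matI) auto
   thus "F h - F (X h) = 0"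
    using diag[OF h] diag[OF X[OF h(1)] `p (X h) ~= 0`] by simp
  qed
  thus ?thesis by simp
 qed
 thus ?thesis using FX by (subst pf_cong) auto
qed

lemma ip_diff_right: "ip I e (%w. c w - d w) = ip I e c - ip I e d"
 by (simp add: ip_def algebra_simps sum_subtractf)

lemma fsubspace_diff: "fsubspace I S ==> c : S ==> d : S ==> (%w. c w - d w) : S"
 using fsubspace_lincomb[of I S c d 1 "-1"] by simp

lemma fsubspace_orth_zero:
 assumes "finite I" "fsubspace I S" "c : S" "!!d. d : S ==> ip I d c = 0"
 shows "c = (%w. 0)"
proof
 fix w
 show "c w = 0"
 proof (cases "w : I")
  case True
  thus ?thesis using ip_self_zero[OF assms(1), of c] assms(4)[OF assms(3)] by blast
 next
  case False
  thus ?thesis using assms(2,3) unfolding fsubspace_def by blast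
 qed
qed

text \<open>
  If the span of the invariant polynomials in minors were smaller than the space of all invariants of
  bounded degree, the difference of the two reproducing vectors of evaluation at the identity would be
  invariant under unitriangular matrices on both sides, hence a polynomial in minors orthogonal to all
  such polynomials.
\<close>

theorem unitri_invariants:
 assumes f: "pf (SLc n) (slc n) f"
  and inv: "!!g u. g : SLc n ==> u : unitri n ==> f (g * u) = f g"
 shows "pf (SLc n) (mins n) f"
proof -
 let ?G = "SLc n"
 obtain m c where mc: "!!g. g : ?G ==> f g = ten (words n m) c g"
  using poly_ten[OF f[unfolded pf_def]] by auto
 let ?W = "words n m"
 note finW = finite_words[of n m]
 define V where "V = {c :: (nat \<times> nat) list => complex. ALL w. w ~: ?W --> c w = 0}"
 \<comment> \<open>\<open>S\<close> holds the invariants of word length at most m, \<open>A\<close>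
   the polynomials in minors among them; the aim is \<open>S \<subseteq> A\<close>.\<close>
 define S where "S = {c : V. ALL g:?G. ALL u:unitri n. ten ?W c (g * u) = ten ?W c g}"
 define A where "A = {c : V. pf ?G (mins n) (ten ?W c)}"
 have ten_add: "ten ?W (%w. c w + d w) g = ten ?W c g + ten ?W d g" for c d g
  by (simp add: ten_def algebra_simps sum.distrib)
 have ten_scale: "ten ?W (%w. a * c w) g = a * ten ?W c g" for a c g
  by (simp add: ten_def algebra_simps sum_distrib_left)
 have ten_zero: "ten ?W (%w. 0) g = 0" for g by (simp add: ten_def)
 have S: "fsubspace ?W S"
  unfolding fsubspace_def S_def V_def by (auto simp: ten_add ten_scale ten_zero)
 have A: "fsubspace ?W A"
  unfolding fsubspace_def A_def V_def
 proof (intro conjI ballI allI impI CollectI; (elim CollectE conjE)?)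
  show "pf ?G (mins n) (ten ?W (%w. 0))" by (subst pf_cong[OF ten_zero]) (rule pf_const)
  fix c assume c: "pf ?G (mins n) (ten ?W c)"
  show "pf ?G (mins n) (ten ?W (%w. a * c w))" for a
   by (subst pf_cong[OF ten_scale]) (intro pf_mult pf_const c)
  fix d assume d: "pf ?G (mins n) (ten ?W d)"
  show "pf ?G (mins n) (ten ?W (%w. c w + d w))"
   by (subst pf_cong[OF ten_add]) (intro pf_add c d)
 qed auto
 have AS: "A \<subseteq> S" unfolding A_def S_def using pf_mins_unitri by blast
 have actV: "tact ?W h c : V" for h c by (simp add: V_def tact_def)
 have actS: "tact ?W h c : S" if "c : S" "h : ?G" for h c
  unfolding S_def
 proof (intro CollectI conjI ballI actV)
  fix g u assume g: "g : ?G" "u : unitri n"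
  have hg: "h * g : ?G" using that g SL_mult_closed by blast
  have "ten ?W (tact ?W h c) (g * u) = ten ?W c (h * (g * u))"
   by (rule ten_tact[OF SL_mat[OF that(2)] SL_mat[OF SL_mult_closed[OF g(1) unitri_SL[OF g(2)]]]])
  also have "h * (g * u) = h * g * u"
   using that g unitri_carrier SL_mat by (intro assoc_mult_mat[symmetric, of _ n n _ n _ n]) auto
  also have "ten ?W c (h * g * u) = ten ?W c (h * g)" using that(1) hg g(2) by (simp add: S_def)
  also have "... = ten ?W (tact ?W h c) g"
   using that g by (intro ten_tact[symmetric]) (auto intro: SL_mat)
  finally show "ten ?W (tact ?W h c) (g * u) = ten ?W (tact ?W h c) g" .
 qed
 have actA: "tact ?W h c : A" if "c : A" "h : ?G" for h c
  unfolding A_def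
 proof (intro CollectI conjI actV)
  have "pf ?G (mins n) (%g. ten ?W c (h * g))"
   using that by (intro pf_mins_translate) (auto simp: A_def)
  thus "pf ?G (mins n) (ten ?W (tact ?W h c))"
   using ten_tact[OF SL_mat[OF that(2)] SL_mat] by (subst pf_cong) auto
 qed
 \<comment> \<open>The product with \<open>e\<close> is evaluation at the identity, whose entries
   are real.\<close>
 define e where "e = (%w. mono w (1\<^sub>m n))"
 have e1: "ip ?W c e = ten ?W c (1\<^sub>m n)" for c
 proof -
  have "cnj (mono w (1\<^sub>m n)) = mono w (1\<^sub>m n)" if "w : ?W" for w
  proof -
   have "set w \<subseteq> {..<n} \<times> {..<n}" using that by (simp add: words_def)
   thus ?thesis by (induction w) (auto simp: mono_def split: if_splits)
  qed
  thus ?thesis by (simp add: ip_def ten_def e_def)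
 qed
 obtain p where p: "p : S" "!!c. c : S ==> ip ?W c e = ip ?W c p"
  using orth_proj[OF finW S] by blast
 obtain q where q: "q : A" "!!c. c : A ==> ip ?W c e = ip ?W c q"
  using orth_proj[OF finW A] by blast
 text \<open>Evaluation at the identity is invariant under right translation by \<open>u\<close>, which at the
    identity is also left translation.\<close>
 have fixed: "tact ?W (cadj u) r = r"
  if T: "fsubspace ?W T" "T \<subseteq> S" "!!h c. c : T ==> h : ?G ==> tact ?W h c : T"
   and r: "r : T" "!!c. c : T ==> ip ?W c e = ip ?W c r" and u: "u : unitri n" for T r u
 proof -
  note uG = unitri_SL[OF u]
  have rT: "tact ?W (cadj u) r : T" using T(3) r(1) cadj_SL[OF uG] by blast
  have "(%w. tact ?W (cadj u) r w - r w) = (%w. 0)"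
  proof (rule fsubspace_orth_zero[OF finW T(1)])
   show "(%w. tact ?W (cadj u) r w - r w) : T" by (rule fsubspace_diff[OF T(1) rT r(1)])
   fix d assume d: "d : T"
   have "ip ?W d (tact ?W (cadj u) r) = ip ?W (tact ?W u d) r"
    by (rule ip_tact[OF SL_mat[OF uG], symmetric])
   also have "... = ten ?W (tact ?W u d) (1\<^sub>m n)"
    using r(2)[OF T(3)[OF d uG]] e1 by simp
   also have "... = ten ?W d (1\<^sub>m n * u)"
    using ten_tact[OF SL_mat[OF uG], of "1\<^sub>m n"] SL_mat[OF uG] by simp
   also have "... = ten ?W d (1\<^sub>m n)"
    using d T(2) u SL_one_closed unfolding S_def by blast
   also have "... = ip ?W d r" using r(2)[OF d] e1 by simp
   finally show "ip ?W d (%w. tact ?W (cadj u) r w - r w) = 0" by (simp add: ip_diff_right)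
  qed
  thus ?thesis by (simp add: fun_eq_iff)
 qed
 define k where "k = (%w. p w - q w)"
 have kS: "k : S" unfolding k_def using fsubspace_diff[OF S p(1)] q(1) AS by blast
 have kfix: "tact ?W (cadj u) k = k" if "u : unitri n" for u
 proof -
  have "tact ?W (cadj u) k = (%w. tact ?W (cadj u) p w - tact ?W (cadj u) q w)"
   by (auto simp: tact_def k_def fun_eq_iff algebra_simps sum_subtractf)
  thus ?thesis
   using fixed[OF S subset_refl actS p that] fixed[OF A AS actA q that] by (simp add: k_def)
 qed
 have "pf ?G (mins n) (ten ?W k)"
 proof (rule bi_invariant[OF pf_ten])
  fix g u assume g: "g : ?G" and u: "u : unitri n"
  show "ten ?W k (g * u) = ten ?W k g" using kS g u by (simp add: S_def)
  \<comment> \<open>Conjugating the entries makes the conjugate transpose of \<open>?v\<close> the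
    plain transpose of \<open>u\<close>.\<close>
  have "mat n n (%(i, j). cnj (u $$ (i, j))) : unitri n" (is "?v : _") using u by (auto simp: unitri_def)
  from kfix[OF this] have "ten ?W k g = ten ?W (tact ?W (cadj ?v) k) g" by simp
  also have "... = ten ?W k (cadj ?v * g)"
   using g by (intro ten_tact cadj_carrier) (auto intro: SL_mat)
  also have "cadj ?v = u\<^sup>T" using unitri_carrier[OF u] by (intro eq_matI) (auto simp: cadj_def)
  finally show "ten ?W k (u\<^sup>T * g) = ten ?W k g" by simp
 qed
 hence kA: "k : A" using kS by (simp add: A_def S_def)
 have "k = (%w. 0)"
 proof (rule fsubspace_orth_zero[OF finW A kA])
  fix d assume "d : A"
  thus "ip ?W d k = 0" using p(2)[of d] q(2)[of d] AS by (auto simp: k_def ip_diff_right)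
 qed
 hence pq: "p = q" by (auto simp: k_def fun_eq_iff)
 \<comment> \<open>Subtract from \<open>c\<close> its projection \<open>r\<close> to
   \<open>A\<close>. Since \<open>p = q\<close>, the value of the remainder at h is its product with
   the translate of \<open>q\<close> by the conjugate transpose of h; that translate lies in
   \<open>A\<close>, so the value is zero.\<close>
 have cA: "pf ?G (mins n) (ten ?W c)" if c: "c : S" for c
 proof -
  obtain r where r: "r : A" "!!d. d : A ==> ip ?W d c = ip ?W d r"
   using orth_proj[OF finW A] by blast
  define c' where "c' = (%w. c w - r w)"
  have c'S: "c' : S" unfolding c'_def using fsubspace_diff[OF S c] r(1) AS by blast
  have orth: "ip ?W d c' = 0" if "d : A" for d
   using r(2)[OF that] by (simp add: c'_def ip_diff_right)
  have "ten ?W c' h = 0" if h: "h : ?G" for h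
  proof -
   have "ten ?W c' h = ten ?W (tact ?W h c') (1\<^sub>m n)"
    using ten_tact[OF SL_mat[OF h], of "1\<^sub>m n"] SL_mat[OF h] by simp
   also have "... = ip ?W (tact ?W h c') q"
    using p(2)[OF actS[OF c'S h]] e1 pq by simp
   also have "... = ip ?W c' (tact ?W (cadj h) q)" by (rule ip_tact[OF SL_mat[OF h]])
   also have "... = cnj (ip ?W (tact ?W (cadj h) q) c')" by (simp add: ip_cnj)
   also have "... = 0" using orth[OF actA[OF q(1) cadj_SL[OF h]]] by simp
   finally show ?thesis .
  qed
  moreover have "ten ?W c g = ten ?W c' g + ten ?W r g" for g
   unfolding c'_def by (simp add: ten_add[symmetric])
  ultimately show ?thesis using r(1) by (subst pf_cong[of _ _ "ten ?W r"]) (auto simp: A_def)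
 qed
 define d where "d = (%w. if w : ?W then c w else 0)"
 have dc: "ten ?W d g = ten ?W c g" for g
  unfolding ten_def d_def by (intro sum.cong) auto
 have "d : S"
  unfolding S_def
 proof (intro CollectI conjI ballI)
  fix g u assume "g : ?G" "u : unitri n"
  thus "ten ?W d (g * u) = ten ?W d g"
   unfolding dc using mc inv SL_mult_closed unitri_SL by (metis (no_types))
 qed (simp add: V_def d_def)
 from cA[OF this] show ?thesis using mc dc by (subst pf_cong) auto
qed

section \<open>Maximal unipotent subgroups\<close>

lemma assoc_sq:
 "A : sq_mat n ==> B : sq_mat n ==> C : sq_mat n ==>
  A * B * C = A * (B * C :: complex mat)"
 by (rule assoc_mult_mat)

lemma mult_sq: "A : sq_mat n ==> B : sq_mat n ==> A * B : sq_mat n"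
 by simp

lemma det_nonzero_inverse:
 fixes h :: "complex mat"
 assumes h: "h : sq_mat n" "det h ~= 0"
 shows "EX h':sq_mat n. h * h' = 1\<^sub>m n & h' * h = 1\<^sub>m n"
proof (intro bexI[of _ "(1 / det h) \<cdot>\<^sub>m adj_mat h"] conjI)
 note a = adj_mat[OF h(1)]
 show "(1 / det h) \<cdot>\<^sub>m adj_mat h : sq_mat n" using a by simp
 show "h * ((1 / det h) \<cdot>\<^sub>m adj_mat h) = 1\<^sub>m n"
  using a h by (intro eq_matI) (auto simp: mult_smult_distrib[OF h(1) a(1)])
 show "(1 / det h) \<cdot>\<^sub>m adj_mat h * h = 1\<^sub>m n"
  using a h by (intro eq_matI) (auto simp: mult_smult_assoc_mat[OF a(1) h(1)])
qed

lemma inverse_det_nonzero: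
 fixes h :: "complex mat"
 assumes "h : sq_mat n" "h' : sq_mat n" "h * h' = 1\<^sub>m n"
 shows "det h ~= 0"
 using det_mult[OF assms(1,2)] assms(3) by auto

definition lowv :: "nat => nat => complex vec set" where
 "lowv n k = {x : carrier_vec n. ALL i. k <= i & i < n --> x $ i = 0}"

definition vsub :: "nat => complex vec set => bool" where
 "vsub n W \<longleftrightarrow> W \<subseteq> carrier_vec n & 0\<^sub>v n : W & (ALL v:W. ALL w:W. v + w : W) &
  (ALL a. ALL v:W. a \<cdot>\<^sub>v v : W)"

lemma lowv_span:
 assumes W: "vsub n W" and h: "h : carrier_mat n m" and e: "!!i. i < k ==> h *v unit_vec m i : W"
  and k: "k <= m" and x: "x : lowv m k"
 shows "h *v x : W"
 using e k x
proof (induction k arbitrary: x)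
 case 0
 hence "x = 0\<^sub>v m" by (intro eq_vecI) (auto simp: lowv_def)
 moreover have "h *v 0\<^sub>v m = 0\<^sub>v n" using h by (intro eq_vecI) (auto simp: index_mult_mat_vec)
 ultimately show ?case using W by (simp add: vsub_def)
next
 case (Suc k)
 have xc: "x : carrier_vec m" using Suc.prems by (simp add: lowv_def)
 define y where "y = vec m (%i. if i = k then 0 else x $ i)"
 have "y : lowv m k" using Suc.prems by (auto simp: lowv_def y_def)
 hence 1: "h *v y : W" using Suc by auto
 have "x = y + x $ k \<cdot>\<^sub>v unit_vec m k" using xc Suc.prems(2) by (intro eq_vecI) (auto simp: y_def)
 hence "h *v x = h *v y + x $ k \<cdot>\<^sub>v (h *v unit_vec m k)"
  using h mult_add_distrib_mat_vec[OF h, of y "x $ k \<cdot>\<^sub>v unit_vec m k"]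
  by (simp add: y_def mult_mat_vec)
 thus ?case using 1 Suc.prems(1)[of k] W by (auto simp: vsub_def)
qed

lemma vsub_lowv: "vsub n (lowv n k)"
 by (auto simp: vsub_def lowv_def)

text \<open>Take the largest coordinate subspace that an invertible matrix maps into \<open>W\<close>.\<close>

lemma vsub_basis:
 assumes W: "vsub n W"
 shows "EX k<=n. EX h:sq_mat n. det h ~= 0 & W = (%x. h *v x) ` lowv n k"
proof -
 let ?P = "%k h. h : sq_mat n & det h ~= 0 & (ALL i<k. h *v unit_vec n i : W)"
 define K where "K = {k. k <= n & (EX h. ?P k h)}"
 have "0 : K" unfolding K_def by (auto intro!: exI[of _ "1\<^sub>m n"])
 moreover have fK: "finite K" unfolding K_def by auto
 ultimately have kK: "Max K : K" using Max_in by blast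
 define k where "k = Max K"
 obtain h where k: "k <= n" and h: "?P k h" using kK unfolding k_def K_def by blast
 obtain h' where h': "h' : sq_mat n" "h * h' = 1\<^sub>m n" "h' * h = 1\<^sub>m n"
  using det_nonzero_inverse h by blast
 have "W \<subseteq> (%x. h *v x) ` lowv n k"
 proof
  fix w assume w: "w : W"
  hence wc: "w : carrier_vec n" using W by (auto simp: vsub_def)
  define x where "x = h' *v w"
  have xc: "x : carrier_vec n" using wc h' by (simp add: x_def)
  have hx: "h *v x = w" unfolding x_def using h h' wc assoc_mult_mat_vec[of h n n h' n w] by simp
  show "w : (%x. h *v x) ` lowv n k"
  proof (rule ccontr)
   assume "~ ?thesis"
   hence "x ~: lowv n k" using hx by blast
   then obtain j where j: "k <= j" "j < n" "x $ j ~= 0" using xc by (auto simp: lowv_def)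
   have "EX y:sq_mat n. det y ~= 0 & (ALL i<k. y *v unit_vec n i = unit_vec n i) & y *v unit_vec n k = x"
   proof (cases "Suc k < n")
    case True
    obtain z where z: "z : tgen n (%i j. k <= j & j < n & i < n)" "z *v x = unit_vec n k"
     using tgen_unit[OF xc True le_refl j] by auto
    obtain y where y: "y : tgen n (%i j. k <= j & j < n & i < n)" "y * z = 1\<^sub>m n"
     using tgen_inverse[OF z(1)] by blast
    have "y *v unit_vec n k = x"
     unfolding z(2)[symmetric] using tgen_carrier[OF y(1)] tgen_carrier[OF z(1)] xc y(2)
      assoc_mult_mat_vec[of y n n z n x] by simp
    moreover have "y *v unit_vec n i = unit_vec n i" if "i < k" for i
     by (rule tgen_fix_unit[OF y(1) that k])
    ultimately show ?thesis using tgen_SL[OF y(1)] by (intro bexI[of _ y]) (auto simp: SL_carrier)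
   next
    case False
    hence kn: "n = Suc k" "j = k" using j by auto
    \<comment> \<open>With k = n - 1 no second row is left for a transvection; the last column is
      replaced by \<open>x\<close> instead, at the price of a determinant that may differ from
      one.\<close>
    define y where "y = mat n n (%(r, c). if c = k then x $ r else if r = c then 1 else 0)"
    have "det y = prod_list (diag_mat y)"
     by (rule det_upper_triangular[of _ n]) (use kn in \<open>auto simp: y_def\<close>)
    also have "... ~= 0"
     using j kn by (auto simp: prod_list_zero_iff diag_mat_def y_def)
    finally have "det y ~= 0" .
    moreover have yc: "y : sq_mat n" by (simp add: y_def)
    moreover have ycol: "y *v unit_vec n i = col y i" if "i < n" for i
     using that yc by (intro eq_vecI) (auto simp: index_mult_mat_vec)
    have "y *v unit_vec n i = unit_vec n i" if "i < k" for i
     using that kn ycol[of i] by (auto simp: y_def intro!: eq_vecI)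
    moreover have "y *v unit_vec n k = x"
     using kn ycol[of k] xc by (auto simp: y_def intro!: eq_vecI)
    ultimately show ?thesis by blast
   qed
   then obtain y where y: "y : sq_mat n" "det y ~= 0"
    "!!i. i < k ==> y *v unit_vec n i = unit_vec n i" "y *v unit_vec n k = x" by blast
   have hy: "(h * y) *v v = h *v (y *v v)" if "v : carrier_vec n" for v
    using h y that by (intro assoc_mult_mat_vec) auto
   have "?P (Suc k) (h * y)"
    using h y hy hx w by (auto simp: det_mult less_Suc_eq)
   hence "Suc k : K" using j unfolding K_def by (auto intro!: exI[of _ "h * y"])
   hence "Suc k <= k" unfolding k_def using fK by (rule Max_ge[rotated])
   thus False by simp
  qed
 qed
 moreover have "(%x. h *v x) ` lowv n k \<subseteq> W"
  using lowv_span[OF W] h k by blast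
 ultimately show ?thesis using h k by blast
qed

section \<open>Traces and Kolchin's theorem\<close>

definition tr :: "nat => complex mat => complex" where
 "tr n a = (SUM i<n. a $$ (i, i))"

lemma tr_add: "a : sq_mat n ==> b : sq_mat n ==> tr n (a + b) = tr n a + tr n b"
 by (simp add: tr_def sum.distrib)

lemma tr_smult: "a : sq_mat n ==> tr n (x \<cdot>\<^sub>m a) = x * tr n a"
 by (simp add: tr_def sum_distrib_left)

lemma tr_mult_commute: "a : sq_mat n ==> b : sq_mat n ==> tr n (a * b) = tr n (b * a)"
proof -
 assume ab: "a : sq_mat n" "b : sq_mat n"
 have "tr n (a * b) = (SUM i<n. SUM l<n. a $$ (i, l) * b $$ (l, i))"
  unfolding tr_def by (intro sum.cong refl index_mult_sum[OF ab]) auto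
 also have "... = (SUM l<n. SUM i<n. b $$ (l, i) * a $$ (i, l))"
  by (subst sum.swap) (simp add: mult.commute)
 also have "... = tr n (b * a)"
  unfolding tr_def by (intro sum.cong refl index_mult_sum[OF ab(2,1), symmetric]) auto
 finally show ?thesis .
qed

lemma upper_triangular_mult:
 fixes a b :: "complex mat"
 assumes "a : sq_mat n" "b : sq_mat n" "upper_triangular a" "upper_triangular b"
 shows "upper_triangular (a * b)" and "i < n ==> (a * b) $$ (i, i) = a $$ (i, i) * b $$ (i, i)"
proof -
 have z: "a $$ (i, l) * b $$ (l, j) = 0" if "j <= i" "i < n" "l < n" "l ~= i | j < i" for i j l
  using assms that unfolding upper_triangular_def
  by (metis carrier_matD(1) linorder_neqE_nat mult_eq_0_iff order_le_less_trans order_less_le_trans)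
 show "upper_triangular (a * b)"
 proof (rule upper_triangularI)
  fix i j assume "j < i" "i < dim_row (a * b)"
  hence "(a * b) $$ (i, j) = (SUM l<n. a $$ (i, l) * b $$ (l, j))"
   using assms by (intro index_mult_sum[of _ n n _ n]) auto
  also have "... = 0"
   using `j < i` `i < dim_row (a * b)` assms z by (intro sum.neutral) auto
  finally show "(a * b) $$ (i, j) = 0" .
 qed
 assume i: "i < n"
 hence "(a * b) $$ (i, i) = (SUM l<n. a $$ (i, l) * b $$ (l, i))"
  using assms by (intro index_mult_sum) auto
 also have "... = (SUM l<n. if l = i then a $$ (i, i) * b $$ (i, i) else 0)"
  using i z[of i i] by (intro sum.cong refl) auto
 finally show "(a * b) $$ (i, i) = a $$ (i, i) * b $$ (i, i)" using i by simp
qed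

lemma upper_triangular_power:
 fixes a :: "complex mat"
 assumes "a : sq_mat n" "upper_triangular a"
 shows "upper_triangular (a ^\<^sub>m k) & (ALL i<n. (a ^\<^sub>m k) $$ (i, i) = (a $$ (i, i)) ^ k)"
proof (induction k)
 case 0
 thus ?case using assms by auto
next
 case (Suc k)
 thus ?case
  using upper_triangular_mult[of "a ^\<^sub>m k" n a] assms by (simp add: mult.commute)
qed

text \<open>Schur triangularisation: \<open>d\<close> lists the eigenvalues as they stand on the
  diagonal.\<close>

lemma trace_powers:
 assumes a: "a : sq_mat n"
 shows "EX d. char_poly a = (\<Prod>i\<leftarrow>[0..<n]. [:- d i, 1:]) & (ALL k. tr n (a ^\<^sub>m k) = (SUM i<n. d i ^ k)) &
  (ALL k. a ^\<^sub>m k = 0\<^sub>m n n --> (ALL i<n. d i ^ k = 0))"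
proof -
 obtain es where "char_poly a = (\<Prod>a\<leftarrow>es. [:- a, 1:])" using char_poly_factorized[OF a] by blast
 from schur_decomposition_exists[OF a this] obtain b where
  b: "b : sq_mat n" "upper_triangular b" "similar_mat a b" by blast
 from b(3) obtain p q where w: "similar_mat_wit a b p q" by (auto simp: similar_mat_def)
 have pq: "p : sq_mat n" "q : sq_mat n" "p * q = 1\<^sub>m n" "q * p = 1\<^sub>m n"
  using similar_mat_witD2[OF a w] by auto
 let ?d = "%i. b $$ (i, i)"
 note bk = upper_triangular_power[OF b(1,2)]
 have bc: "b ^\<^sub>m k : sq_mat n" for k using b(1) by simp
 have ak: "a ^\<^sub>m k = p * b ^\<^sub>m k * q" for k using similar_mat_wit_pow_id[OF w] .
 have "tr n (a ^\<^sub>m k) = (SUM i<n. ?d i ^ k)" for k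
 proof -
  have "tr n (a ^\<^sub>m k) = tr n (q * (p * b ^\<^sub>m k))"
   unfolding ak using pq bc[of k] by (intro tr_mult_commute) auto
  also have "q * (p * b ^\<^sub>m k) = b ^\<^sub>m k"
   using pq b(1) by (simp add: assoc_sq[of q n p, symmetric])
  finally show ?thesis using bk[of k] by (simp add: tr_def)
 qed
 moreover have "?d i ^ k = 0" if "a ^\<^sub>m k = 0\<^sub>m n n" "i < n" for i k
 proof -
  have "b ^\<^sub>m k = q * (p * b ^\<^sub>m k * q) * p"
   using pq b(1) by (simp add: assoc_sq[of _ n] mult_sq) (simp add: assoc_sq[of q n p, symmetric] mult_sq)
  also have "... = 0\<^sub>m n n" unfolding ak[symmetric] that(1) using pq by simp
  finally show ?thesis using bk[of k] that(2) by simp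
 qed
 moreover have "char_poly a = (\<Prod>i\<leftarrow>[0..<n]. [:- ?d i, 1:])"
  using char_poly_similar[OF b(3)] char_poly_upper_triangular[OF b(1,2)] b(1)
  by (simp add: diag_mat_def o_def)
 ultimately show ?thesis by (intro exI[of _ ?d]) blast
qed

lemma nilpotent_trace:
 assumes "a : sq_mat n" "a ^\<^sub>m k = 0\<^sub>m n n" shows "tr n a = 0"
proof -
 obtain d where d: "!!k. tr n (a ^\<^sub>m k) = (SUM i<n. d i ^ k)"
  "!!k. a ^\<^sub>m k = 0\<^sub>m n n ==> (ALL i<n. d i ^ k = 0)"
  using trace_powers[OF assms(1)] by blast
 have "ALL i<n. d i = 0" using d(2)[OF assms(2)] by auto
 thus ?thesis using d(1)[of 1] assms(1) by simp
qed

text \<open>Were 1 an eigenvalue, take a polynomial p that vanishes at the other eigenvalues but not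
  at 1. The sum of d p(d) over the eigenvalues d is a positive multiple of p(1), yet it is a
  combination of traces of positive powers.\<close>

lemma traceless_powers_no_fixed:
 assumes a: "a : sq_mat n" and t: "!!k. tr n (a ^\<^sub>m Suc k) = 0"
  and v: "v : carrier_vec n" "a *v v = v"
 shows "v = 0\<^sub>v n"
proof (rule ccontr)
 assume "v ~= 0\<^sub>v n"
 hence "eigenvalue a 1" unfolding eigenvalue_def eigenvector_def using a v by (auto intro!: exI[of _ v])
 hence r: "poly (char_poly a) 1 = 0" using eigenvalue_root_char_poly[OF a] by simp
 obtain d where d: "char_poly a = (\<Prod>i\<leftarrow>[0..<n]. [:- d i, 1:])" "!!k. tr n (a ^\<^sub>m k) = (SUM i<n. d i ^ k)"
  using trace_powers[OF a] by blast
 obtain i0 where i0: "i0 < n" "d i0 = 1"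
  using r unfolding d(1) by (auto simp: poly_prod_list prod_list_zero_iff)
 define p where "p = (PROD mu:d ` {..<n} - {1}. [:- mu, 1:])"
 have p1: "poly p 1 ~= 0" unfolding p_def by (simp add: poly_prod)
 have "(SUM i<n. d i * poly p (d i)) = (SUM i<n. SUM k<=degree p. coeff p k * d i ^ Suc k)"
  by (simp add: poly_altdef sum_distrib_left algebra_simps)
 also have "... = (SUM k<=degree p. coeff p k * (SUM i<n. d i ^ Suc k))"
  by (subst sum.swap) (simp add: sum_distrib_left)
 also have "... = 0" using t unfolding d(2)[symmetric] by simp
 finally have "(SUM i<n. d i * poly p (d i)) = 0" .
 moreover have "d i * poly p (d i) = (if d i = 1 then poly p 1 else 0)" if "i < n" for i
  using that by (auto simp: p_def poly_prod prod_zero_iff)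
 ultimately have "(SUM i<n. if d i = 1 then poly p 1 else 0) = 0" by simp
 hence "of_nat (card {i : {..<n}. d i = 1}) * poly p 1 = 0"
  by (subst (asm) sum.inter_filter[symmetric]) auto
 hence "card {i : {..<n}. d i = 1} = 0" using p1 by simp
 thus False using i0 by auto
qed

definition unip :: "nat => complex mat => bool" where
 "unip n u \<longleftrightarrow> u : sq_mat n & (EX k. (u - 1\<^sub>m n) ^\<^sub>m k = 0\<^sub>m n n)"

definition unip_monoid :: "nat => complex mat set => bool" where
 "unip_monoid n M \<longleftrightarrow> 1\<^sub>m n : M & (ALL u:M. ALL v:M. u * v : M) & (ALL u:M. unip n u)"

inductive_set matspan :: "complex mat set => complex mat set" for M where
 base: "u : M ==> u : matspan M"
| add: "a : matspan M ==> b : matspan M ==> a + b : matspan M"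
| smult: "a : matspan M ==> x \<cdot>\<^sub>m a : matspan M"

lemma unip_trace: "unip n u ==> tr n u = of_nat n"
proof -
 assume "unip n u"
 then obtain k where u: "u : sq_mat n" "(u - 1\<^sub>m n) ^\<^sub>m k = 0\<^sub>m n n" by (auto simp: unip_def)
 have "tr n (u - 1\<^sub>m n) = 0" by (rule nilpotent_trace[OF _ u(2)]) (rule minus_carrier_mat, simp)
 moreover have "tr n (u - 1\<^sub>m n) = tr n u - of_nat n"
  using u(1) by (simp add: tr_def sum_subtractf)
 ultimately show ?thesis by simp
qed

text \<open>
  Kolchin's theorem for an irreducible monoid: the radical of the trace form of the spanned algebra
  contains all \<open>u - 1\<close>; a nonzero element of the radical would, by irreducibility, give one with
  eigenvalue 1, although all its powers are traceless.
\<close>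

lemma irreducible_unip_monoid:
 assumes M: "unip_monoid n M" and u: "u : M"
  and irr: "!!W. vsub n W ==> (!!u w. u : M ==> w : W ==> u *v w : W) ==> W = {0\<^sub>v n} | W = carrier_vec n"
 shows "u = 1\<^sub>m n"
proof (rule ccontr)
 assume u1: "u ~= 1\<^sub>m n"
 define L where "L = matspan M"
 have Mc: "v : sq_mat n" if "v : M" for v using M that by (auto simp: unip_monoid_def unip_def)
 have Lc: "a : sq_mat n" if "a : L" for a
  using that unfolding L_def by (induction rule: matspan.induct) (auto simp: Mc)
 have LbM: "v : M ==> v : L" for v unfolding L_def by (rule matspan.base)
 have Ladd: "a : L ==> b : L ==> a + b : L" for a b unfolding L_def by (rule matspan.add)
 have Lsm: "a : L ==> x \<cdot>\<^sub>m a : L" for a x unfolding L_def by (rule matspan.smult)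
 have L1: "1\<^sub>m n : L" using M LbM by (auto simp: unip_monoid_def)
 have Lm1: "v * b : L" if "v : M" "b : L" for v b
  using that(2) unfolding L_def
 proof (induction rule: matspan.induct)
  case (base w)
  thus ?case using M that(1) by (auto simp: unip_monoid_def intro: matspan.base)
 next
  case (add a b)
  hence "a : sq_mat n" "b : sq_mat n" using Lc by (auto simp: L_def)
  hence "v * (a + b) = v * a + v * b" using Mc[OF that(1)] by (simp add: mult_add_distrib_mat)
  thus ?case using add by (auto intro: matspan.add)
 next
  case (smult a x)
  hence "a : sq_mat n" using Lc by (auto simp: L_def)
  hence "v * (x \<cdot>\<^sub>m a) = x \<cdot>\<^sub>m (v * a)" using Mc[OF that(1)] by (simp add: mult_smult_distrib)
  thus ?case using smult by (auto intro: matspan.smult)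
 qed
 have Lm: "a * b : L" if "a : L" "b : L" for a b
  using that(1) unfolding L_def
 proof (induction rule: matspan.induct)
  case (base w)
  thus ?case using Lm1 that(2) by (auto simp: L_def)
 next
  case (add a c)
  hence "a : sq_mat n" "c : sq_mat n" using Lc by (auto simp: L_def)
  hence "(a + c) * b = a * b + c * b" using Lc[OF that(2)] by (simp add: add_mult_distrib_mat)
  thus ?case using add by (auto intro: matspan.add)
 next
  case (smult a x)
  hence "a : sq_mat n" using Lc by (auto simp: L_def)
  hence "(x \<cdot>\<^sub>m a) * b = x \<cdot>\<^sub>m (a * b)" using Lc[OF that(2)] by (simp add: mult_smult_assoc_mat)
  thus ?case using smult by (auto intro: matspan.smult)
 qed
 \<comment> \<open>The radical of the trace form, a two-sided ideal by \<open>Jr\<close> and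
   \<open>Jl\<close>.\<close>
 define J where "J = {a : L. ALL b:L. tr n (a * b) = 0}"
 have JL: "a : J ==> a : L" for a by (simp add: J_def)
 have Jr: "a * b : J" if "a : J" "b : L" for a b
  unfolding J_def
 proof (intro CollectI conjI ballI)
  show "a * b : L" using Lm that JL by blast
  fix c assume c: "c : L"
  have "a * b * c = a * (b * c)" using Lc JL that c by (intro assoc_sq) auto
  thus "tr n (a * b * c) = 0" using that Lm[OF that(2) c] by (simp add: J_def)
 qed
 have Jl: "b * a : J" if "a : J" "b : L" for a b
  unfolding J_def
 proof (intro CollectI conjI ballI)
  show "b * a : L" using Lm that JL by blast
  fix c assume c: "c : L"
  have cc: "a : sq_mat n" "b : sq_mat n" "c : sq_mat n" using Lc JL that c by auto
  have "tr n (b * a * c) = tr n (b * (a * c))" using cc by (simp add: assoc_sq)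
  also have "... = tr n (a * c * b)" using cc by (intro tr_mult_commute) auto
  also have "... = tr n (a * (c * b))" using cc by (simp add: assoc_sq)
  also have "... = 0" using that(1) Lm[OF c that(2)] by (simp add: J_def)
  finally show "tr n (b * a * c) = 0" .
 qed
 define x where "x = u + (-1) \<cdot>\<^sub>m 1\<^sub>m n"
 have uc: "u : sq_mat n" using Mc[OF u] .
 have xc: "x : sq_mat n" using uc by (simp add: x_def)
 have xJ: "x : J"
  unfolding J_def
 proof (intro CollectI conjI ballI)
  show "x : L" unfolding x_def using Ladd Lsm L1 LbM[OF u] by blast
  fix b assume "b : L"
  thus "tr n (x * b) = 0"
   unfolding L_def
  proof (induction rule: matspan.induct)
   case (base v)
   have vc: "v : sq_mat n" using Mc[OF base] .
   have "x * v = u * v + (-1) \<cdot>\<^sub>m v"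
    unfolding x_def using uc vc by (simp add: add_mult_distrib_mat[of _ n n] mult_smult_assoc_mat[of _ n n])
   hence "tr n (x * v) = tr n (u * v) - tr n v"
    using uc vc tr_add[of "u * v" n "(-1) \<cdot>\<^sub>m v"] tr_smult[of v n "-1"] by simp
   also have "... = 0"
    using M u base unip_trace[of n "u * v"] unip_trace[of n v] by (auto simp: unip_monoid_def)
   finally show ?case .
  next
   case (add a b)
   have "a : sq_mat n" "b : sq_mat n" using add.hyps Lc by (auto simp: L_def)
   thus ?case using add.IH xc tr_add[of "x * a" n "x * b"]
    by (simp add: mult_add_distrib_mat[of _ n n])
  next
   case (smult a y)
   have "a : sq_mat n" using smult.hyps Lc by (auto simp: L_def)
   thus ?case using smult.IH xc tr_smult[of "x * a" n y]
    by (simp add: mult_smult_distrib[of _ n n])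
  qed
 qed
 have "x ~= 0\<^sub>m n n"
 proof
  assume x0: "x = 0\<^sub>m n n"
  have "u = 1\<^sub>m n"
  proof (rule eq_matI)
   fix i j assume "i < dim_row (1\<^sub>m n)" "j < dim_col (1\<^sub>m n)"
   hence ij: "i < n" "j < n" by auto
   have "x $$ (i, j) = 0" using x0 ij by simp
   thus "u $$ (i, j) = 1\<^sub>m n $$ (i, j)" using ij uc by (simp add: x_def)
  qed (use uc in auto)
  thus False using u1 by simp
 qed
 then obtain i j where ij: "i < n" "j < n" "x $$ (i, j) ~= 0"
  using xc by (metis carrier_matD eq_matI index_zero_mat(1,2,3))
 \<comment> \<open>A nonzero column of \<open>x\<close>. Its images under the algebra form an
   invariant subspace, hence everything, so some \<open>b\<close> takes \<open>v\<close> back to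
   e_j; then \<open>b * x\<close> is in the radical and fixes e_j.\<close>
 define v where "v = x *v unit_vec n j"
 have vc: "v : carrier_vec n" using xc by (simp add: v_def)
 have "v $ i ~= 0" using ij xc by (simp add: v_def index_mult_mat_vec)
 hence v0: "v ~= 0\<^sub>v n" using ij by auto
 define W where "W = (%b. b *v v) ` L"
 have Wsub: "vsub n W"
  unfolding vsub_def
 proof (intro conjI ballI allI)
  show "W \<subseteq> carrier_vec n" using vc by (auto simp: W_def intro!: mult_mat_vec_carrier[OF Lc])
  have "0 \<cdot>\<^sub>m 1\<^sub>m n : L" using Lsm L1 by blast
  moreover have "(0 \<cdot>\<^sub>m 1\<^sub>m n) *v v = 0\<^sub>v n"
   using vc by (intro eq_vecI) (auto simp: index_mult_mat_vec scalar_prod_def)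
  ultimately show "0\<^sub>v n : W" unfolding W_def by (metis image_eqI)
  fix y assume "y : W"
  then obtain b where b: "b : L" "y = b *v v" by (auto simp: W_def)
  show "a \<cdot>\<^sub>v y : W" for a
  proof -
   have "a \<cdot>\<^sub>v y = (a \<cdot>\<^sub>m b) *v v"
    using b Lc[OF b(1)] vc by (intro eq_vecI) (auto simp: index_mult_mat_vec)
   thus ?thesis using Lsm[OF b(1)] by (auto simp: W_def)
  qed
  fix z assume "z : W"
  then obtain c where c: "c : L" "z = c *v v" by (auto simp: W_def)
  have "y + z = (b + c) *v v"
   using b c Lc[OF b(1)] Lc[OF c(1)] vc by (simp add: add_mult_distrib_mat_vec)
  thus "y + z : W" using Ladd[OF b(1) c(1)] by (auto simp: W_def)
 qed
 have "W = {0\<^sub>v n} | W = carrier_vec n"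
 proof (rule irr[OF Wsub])
  fix s w assume s: "s : M" "w : W"
  then obtain b where b: "b : L" "w = b *v v" by (auto simp: W_def)
  have "s *v w = (s * b) *v v"
   using b Lc[OF b(1)] Mc[OF s(1)] vc by (simp add: assoc_mult_mat_vec)
  thus "s *v w : W" using Lm1[OF s(1) b(1)] by (auto simp: W_def)
 qed
 moreover have "v : W" unfolding W_def using L1 vc by (intro image_eqI[of _ _ "1\<^sub>m n"]) auto
 ultimately have "W = carrier_vec n" using v0 by auto
 then obtain b where b: "b : L" "unit_vec n j = b *v v" unfolding W_def by (metis image_iff unit_vec_carrier)
 define c where "c = b * x"
 have cJ: "c : J" unfolding c_def by (rule Jl[OF xJ b(1)])
 have cc: "c : sq_mat n" using Lc JL cJ by blast
 have "c *v unit_vec n j = unit_vec n j"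
 proof -
  have "c *v unit_vec n j = b *v (x *v unit_vec n j)"
   unfolding c_def by (rule assoc_mult_mat_vec[OF Lc[OF b(1)] xc]) simp
  also have "... = unit_vec n j" unfolding v_def[symmetric] b(2)[symmetric] ..
  finally show ?thesis .
 qed
 hence fix1: "c *v unit_vec n j = unit_vec n j" .
 have t0: "tr n (c ^\<^sub>m Suc k) = 0" for k
 proof -
  have "c ^\<^sub>m Suc k : J"
  proof (induction k)
   case 0
   show ?case using cJ cc by simp
  next
   case (Suc k)
   show ?case unfolding pow_mat.simps(2)[of c "Suc k"] by (rule Jr[OF Suc JL[OF cJ]])
  qed
  hence "ALL b:L. tr n (c ^\<^sub>m Suc k * b) = 0" unfolding J_def by blast
  from bspec[OF this L1] have "tr n (c ^\<^sub>m Suc k * 1\<^sub>m n) = 0" .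
  moreover have "c ^\<^sub>m Suc k : sq_mat n" by (rule pow_carrier_mat[OF cc])
  ultimately show ?thesis by (simp only: right_mult_one_mat)
 qed
 have "unit_vec n j = (0\<^sub>v n :: complex vec)"
  by (rule traceless_powers_no_fixed[OF cc t0 unit_vec_carrier fix1])
 hence "unit_vec n j $ j = (0\<^sub>v n :: complex vec) $ j" by (rule arg_cong)
 thus False using ij by simp
qed

lemma unip_conj:
 assumes u: "unip n u" and h: "h : sq_mat n" "h' : sq_mat n" "h * h' = 1\<^sub>m n" "h' * h = 1\<^sub>m n"
 shows "unip n (h' * u * h)"
proof -
 obtain k where uc: "u : sq_mat n" and k: "(u - 1\<^sub>m n) ^\<^sub>m k = 0\<^sub>m n n" using u by (auto simp: unip_def)
 have xc: "u - 1\<^sub>m n : sq_mat n" by (rule minus_carrier_mat) simp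
 have "h' * u * h - 1\<^sub>m n = h' * (u - 1\<^sub>m n) * h"
  using uc h by (simp add: mult_minus_distrib_mat[of h' n n] minus_mult_distrib_mat[of "h' * u" n n])
 moreover have "similar_mat_wit (h' * (u - 1\<^sub>m n) * h) (u - 1\<^sub>m n) h' h"
  using h xc by (intro similar_mat_witI[of _ _ n]) auto
 ultimately have "(h' * u * h - 1\<^sub>m n) ^\<^sub>m k = h' * (u - 1\<^sub>m n) ^\<^sub>m k * h"
  using similar_mat_wit_pow_id by metis
 hence "(h' * u * h - 1\<^sub>m n) ^\<^sub>m k = 0\<^sub>m n n" unfolding k using h by simp
 moreover have "h' * u * h : sq_mat n" using h uc by simp
 ultimately show ?thesis by (auto simp: unip_def)
qed

lemma conj_mult:
 assumes "u : sq_mat n" "v : sq_mat n" "h : sq_mat n" "h' : sq_mat n" "h * h' = 1\<^sub>m n"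
 shows "h' * (u * v) * h = h' * u * h * (h' * v * h :: complex mat)"
proof -
 have "h' * u * h * (h' * v * h) = h' * (u * (h * h' * (v * h)))"
  using assms(1-4) by (simp add: assoc_sq[of _ n] mult_sq)
 also have "... = h' * (u * v) * h"
  unfolding assms(5) using assms(1-4) by (simp add: assoc_sq[of _ n] mult_sq)
 finally show ?thesis by simp
qed

definition tl_blk :: "nat => complex mat => complex mat" where
 "tl_blk k u = mat k k (%(i, j). u $$ (i, j))"

definition br_blk :: "nat => nat => complex mat => complex mat" where
 "br_blk k m u = mat m m (%(i, j). u $$ (i + k, j + k))"

lemma tl_blk_mult:
 assumes "u : carrier_mat (k + m) (k + m)" "v : carrier_mat (k + m) (k + m)" "blk (k + m) {k} v"
 shows "tl_blk k (u * v) = tl_blk k u * tl_blk k v"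
proof (rule eq_matI)
 fix i j assume "i < dim_row (tl_blk k u * tl_blk k v)" "j < dim_col (tl_blk k u * tl_blk k v)"
 hence ij: "i < k" "j < k" by (auto simp: tl_blk_def)
 have "(u * v) $$ (i, j) = (SUM l<k + m. u $$ (i, l) * v $$ (l, j))"
  using ij by (intro index_mult_sum[OF assms(1,2)]) auto
 also have "... = (SUM l<k. u $$ (i, l) * v $$ (l, j))"
  using ij assms(3) by (intro sum.mono_neutral_right) (auto simp: blk_def)
 also have "... = (tl_blk k u * tl_blk k v) $$ (i, j)"
  using ij by (subst index_mult_sum[of _ k k _ k]) (auto simp: tl_blk_def)
 finally show "tl_blk k (u * v) $$ (i, j) = (tl_blk k u * tl_blk k v) $$ (i, j)"
  using ij by (simp add: tl_blk_def)
qed (auto simp: tl_blk_def)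

lemma br_blk_mult:
 assumes "u : carrier_mat (k + m) (k + m)" "v : carrier_mat (k + m) (k + m)" "blk (k + m) {k} u"
 shows "br_blk k m (u * v) = br_blk k m u * br_blk k m v"
proof (rule eq_matI)
 fix i j assume "i < dim_row (br_blk k m u * br_blk k m v)" "j < dim_col (br_blk k m u * br_blk k m v)"
 hence ij: "i < m" "j < m" by (auto simp: br_blk_def)
 have "(u * v) $$ (i + k, j + k) = (SUM l<k + m. u $$ (i + k, l) * v $$ (l, j + k))"
  using ij by (intro index_mult_sum[OF assms(1,2)]) auto
 also have "... = (SUM l:{k..<k + m}. u $$ (i + k, l) * v $$ (l, j + k))"
  using ij assms(3) by (intro sum.mono_neutral_right) (auto simp: blk_def)
 also have "... = (SUM l<m. u $$ (i + k, l + k) * v $$ (l + k, j + k))"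
  using sum.shift_bounds_nat_ivl[of "%l. u $$ (i + k, l) * v $$ (l, j + k)" 0 k m]
  by (simp add: add.commute atLeast0LessThan)
 also have "... = (br_blk k m u * br_blk k m v) $$ (i, j)"
  using ij by (subst index_mult_sum[of _ m m _ m]) (auto simp: br_blk_def)
 finally show "br_blk k m (u * v) $$ (i, j) = (br_blk k m u * br_blk k m v) $$ (i, j)"
  using ij by (simp add: br_blk_def)
qed (auto simp: br_blk_def)

lemma blk_unip:
 assumes u: "unip (k + m) u" "blk (k + m) {k} u"
 shows "unip k (tl_blk k u)" "unip m (br_blk k m u)"
proof -
 let ?n = "k + m"
 obtain e where uc: "u : carrier_mat ?n ?n" and e: "(u - 1\<^sub>m ?n) ^\<^sub>m e = 0\<^sub>m ?n ?n" using u by (auto simp: unip_def)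
 define x where "x = u - 1\<^sub>m ?n"
 have xc: "x : carrier_mat ?n ?n" unfolding x_def by (rule minus_carrier_mat) simp
 have xb: "blk ?n {k} x" using u(2) uc by (auto simp: blk_def x_def)
 have pw: "blk ?n {k} (x ^\<^sub>m j) & tl_blk k (x ^\<^sub>m j) = tl_blk k x ^\<^sub>m j & br_blk k m (x ^\<^sub>m j) = br_blk k m x ^\<^sub>m j" for j
 proof (induction j)
  case 0
  have "tl_blk k (1\<^sub>m ?n) = 1\<^sub>m k" "br_blk k m (1\<^sub>m ?n) = 1\<^sub>m m" "blk ?n {k} (1\<^sub>m ?n)"
   by (auto simp: tl_blk_def br_blk_def blk_def intro!: eq_matI)
  thus ?case using xc by (simp add: tl_blk_def br_blk_def)
 next
  case (Suc j)
  have c: "x ^\<^sub>m j : carrier_mat ?n ?n" using xc by simp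
  show ?case
   using blk_mult[OF c xc _ xb] tl_blk_mult[OF c xc xb] br_blk_mult[OF c xc] Suc by simp
 qed
 have "tl_blk k u - 1\<^sub>m k = tl_blk k x" "br_blk k m u - 1\<^sub>m m = br_blk k m x"
  using uc by (auto simp: tl_blk_def br_blk_def x_def intro!: eq_matI)
 moreover have "tl_blk k (x ^\<^sub>m e) = 0\<^sub>m k k" "br_blk k m (x ^\<^sub>m e) = 0\<^sub>m m m"
  using e unfolding x_def[symmetric] by (auto simp: tl_blk_def br_blk_def intro!: eq_matI)
 ultimately show "unip k (tl_blk k u)" "unip m (br_blk k m u)"
  using pw[of e] by (auto simp: unip_def tl_blk_def br_blk_def)
qed

lemma unitri_blocks:
 assumes "X : carrier_mat (k + m) (k + m)" "blk (k + m) {k} X" "tl_blk k X : unitri k" "br_blk k m X : unitri m"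
 shows "X : unitri (k + m)"
proof -
 have "X $$ (i, j) = (if i = j then 1 else 0)" if ij: "i < k + m" "j <= i" for i j
 proof -
  consider "i < k" | "k <= j" | "j < k" "k <= i" by linarith
  thus ?thesis
  proof cases
   case 1
   hence "tl_blk k X $$ (i, j) = (if i = j then 1 else 0)" using assms(3) ij by (auto simp: unitri_def)
   thus ?thesis using 1 ij by (simp add: tl_blk_def)
  next
   case 2
   hence "br_blk k m X $$ (i - k, j - k) = (if i - k = j - k then 1 else 0)"
    using assms(4) ij unfolding unitri_def by (auto simp: diff_le_mono)
   moreover have "i - k = j - k \<longleftrightarrow> i = j" using 2 ij by auto
   ultimately show ?thesis using 2 ij by (simp add: br_blk_def)
  next
   case 3
   thus ?thesis using assms(2) ij by (auto simp: blk_def)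
  qed
 qed
 thus ?thesis using assms(1) by (auto simp: unitri_def)
qed

definition dsum :: "nat => nat => complex mat => complex mat => complex mat" where
 "dsum k m a b = four_block_mat a (0\<^sub>m k m) (0\<^sub>m m k) b"

lemma dsum:
 assumes "a : carrier_mat k k" "b : carrier_mat m m"
 shows "dsum k m a b : carrier_mat (k + m) (k + m)" "blk (k + m) {k} (dsum k m a b)"
  "tl_blk k (dsum k m a b) = a" "br_blk k m (dsum k m a b) = b"
 using assms by (auto simp: dsum_def blk_def tl_blk_def br_blk_def intro!: eq_matI)

lemma dsum_mult:
 assumes "a : carrier_mat k k" "b : carrier_mat m m" "c : carrier_mat k k" "d : carrier_mat m m"
 shows "dsum k m a b * dsum k m c d = dsum k m (a * c) (b * d)"
proof -
 have "a * 0\<^sub>m k m = 0\<^sub>m k m" "0\<^sub>m m k * c = 0\<^sub>m m k" "b * 0\<^sub>m m k = 0\<^sub>m m k" "0\<^sub>m k m * d = 0\<^sub>m k m"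
  "0\<^sub>m k m * 0\<^sub>m m k = (0\<^sub>m k k :: complex mat)" "0\<^sub>m m k * 0\<^sub>m k m = (0\<^sub>m m m :: complex mat)"
  using assms by auto
 moreover have "a * c : carrier_mat k k" "b * d : carrier_mat m m" using assms by auto
 ultimately show ?thesis
  unfolding dsum_def using assms
  by (subst mult_four_block_mat[of _ k k _ m _ m _ _ k _ m]) auto
qed

text \<open>Induction on n. A proper invariant subspace gives block triangular form, with diagonal
  blocks covered by the induction hypothesis; without one the monoid is trivial by
  \<open>irreducible_unip_monoid\<close>.\<close>

theorem kolchin:
 assumes "unip_monoid n M"
 shows "EX h h'. h : sq_mat n & h' : sq_mat n & h * h' = 1\<^sub>m n & h' * h = 1\<^sub>m n &
  (ALL u:M. h' * u * h : unitri n)"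
 using assms
proof (induction n arbitrary: M rule: less_induct)
 case (less n)
 note M = less.prems
 have Mc: "u : sq_mat n" if "u : M" for u using M that by (auto simp: unip_monoid_def unip_def)
 show ?case
 proof (cases "EX W. vsub n W & (ALL u:M. ALL w:W. u *v w : W) & W ~= {0\<^sub>v n} & W ~= carrier_vec n")
  case False
  have "1\<^sub>m n * u * 1\<^sub>m n : unitri n" if "u : M" for u
  proof -
   have "u = 1\<^sub>m n"
    by (rule irreducible_unip_monoid[OF M that]) (use False in blast)
   thus ?thesis by (simp add: unitri_def)
  qed
  thus ?thesis
   by (intro exI[of _ "1\<^sub>m n"]) simp
 next
  case True
  then obtain W where W: "vsub n W" "!!u w. u : M ==> w : W ==> u *v w : W" "W ~= {0\<^sub>v n}" "W ~= carrier_vec n"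
   by blast
  obtain k g where k: "k <= n" and g: "g : sq_mat n" "det g ~= 0" "W = (%x. g *v x) ` lowv n k"
   using vsub_basis[OF W(1)] by blast
  obtain g' where g': "g' : sq_mat n" "g * g' = 1\<^sub>m n" "g' * g = 1\<^sub>m n"
   using det_nonzero_inverse[OF g(1,2)] by blast
  have gg': "g *v (g' *v x) = x" "g' *v (g *v x) = x" if "x : carrier_vec n" for x
   using assoc_mult_mat_vec[OF g(1) g'(1) that] assoc_mult_mat_vec[OF g'(1) g(1) that] g' that by auto
  have "k ~= 0"
  proof
   assume "k = 0"
   hence "lowv n k = {0\<^sub>v n}" by (auto simp: lowv_def)
   hence "W = {0\<^sub>v n}" using g by (auto intro!: eq_vecI simp: index_mult_mat_vec)
   thus False using W(3) by simp
  qed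
  moreover have "k ~= n"
  proof
   assume "k = n"
   hence l: "lowv n k = carrier_vec n" by (auto simp: lowv_def)
   have "carrier_vec n \<subseteq> W"
   proof
    fix x :: "complex vec" assume x: "x : carrier_vec n"
    have "g' *v x : carrier_vec n" using x g' by simp
    thus "x : W" unfolding g(3) l using gg'(1)[OF x] by (metis image_eqI)
   qed
   thus False using W(1,4) by (auto simp: vsub_def)
  qed
  ultimately have kn: "0 < k" "k < n" using k by auto
  define m where "m = n - k"
  have n: "n = k + m" using kn by (simp add: m_def)
  define C where "C = (%u. g' * u * g)"
  have Cc: "C u : sq_mat n" if "u : M" for u using g g' Mc[OF that] by (simp add: C_def)
  have Cb: "blk n {k} (C u)" if u: "u : M" for u
  proof -
   have "C u $$ (r, c) = 0" if rc: "k <= r" "r < n" "c < k" for r c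
   proof -
    have cn: "c < n" using rc kn by simp
    have "unit_vec n c : lowv n k" using rc cn by (auto simp: lowv_def)
    hence "g *v unit_vec n c : W" using g by blast
    hence "u *v (g *v unit_vec n c) : W" using W(2) u by blast
    then obtain y where y: "y : lowv n k" "u *v (g *v unit_vec n c) = g *v y" using g by blast
    have yc: "y : carrier_vec n" using y by (simp add: lowv_def)
    have ugc: "u *v (g *v unit_vec n c) : carrier_vec n" using Mc[OF u] g by auto
    have "C u *v unit_vec n c = g' * u *v (g *v unit_vec n c)"
     unfolding C_def using g' g Mc[OF u] by (intro assoc_mult_mat_vec[of _ n n _ n]) auto
    also have "... = g' *v (u *v (g *v unit_vec n c))"
     using g' g Mc[OF u] by (intro assoc_mult_mat_vec[of _ n n _ n]) auto
    also have "... = y" unfolding y(2) using gg'(2)[OF yc] .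
    finally have "(C u *v unit_vec n c) $ r = 0" using y rc by (auto simp: lowv_def)
    thus ?thesis using rc cn Cc[OF u] by (simp add: index_mult_mat_vec)
   qed
   thus ?thesis by (auto simp: blk_def)
  qed
  have Cm: "C (u * v) = C u * C v" if "u : M" "v : M" for u v
   unfolding C_def using conj_mult[of u n v g g'] Mc that g g' by auto
  have C1: "C (1\<^sub>m n) = 1\<^sub>m n" unfolding C_def using g' by simp
  have Cu: "unip n (C u)" if "u : M" for u
   unfolding C_def using M that by (intro unip_conj) (use g g' in \<open>auto simp: unip_monoid_def\<close>)
  have M1: "1\<^sub>m n : M" and Mm: "!!u v. u : M ==> v : M ==> u * v : M" using M by (auto simp: unip_monoid_def)
  have "unip_monoid k ((%u. tl_blk k (C u)) ` M)"
   unfolding unip_monoid_def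
  proof (intro conjI ballI)
   have "tl_blk k (C (1\<^sub>m n)) = 1\<^sub>m k" unfolding C1 using kn by (auto simp: tl_blk_def)
   thus "1\<^sub>m k : (%u. tl_blk k (C u)) ` M" using M1 by (metis image_eqI)
   fix x assume "x : (%u. tl_blk k (C u)) ` M"
   then obtain u where u: "u : M" "x = tl_blk k (C u)" by blast
   show "unip k x" unfolding u(2) using Cu[OF u(1)] Cb[OF u(1)] n by (intro blk_unip(1)[of k m]) auto
   fix y assume "y : (%u. tl_blk k (C u)) ` M"
   then obtain v where v: "v : M" "y = tl_blk k (C v)" by blast
   have "x * y = tl_blk k (C (u * v))"
    unfolding u v Cm[OF u(1) v(1)] using Cc[OF u(1)] Cc[OF v(1)] Cb[OF v(1)] n
    by (intro tl_blk_mult[of _ k m, symmetric]) auto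
   thus "x * y : (%u. tl_blk k (C u)) ` M" using Mm u v by blast
  qed
  from less.IH[OF kn(2) this] obtain a a' where a: "a : carrier_mat k k" "a' : carrier_mat k k"
   "a * a' = 1\<^sub>m k" "a' * a = 1\<^sub>m k" "!!u. u : M ==> a' * tl_blk k (C u) * a : unitri k" by blast
  have "unip_monoid m ((%u. br_blk k m (C u)) ` M)"
   unfolding unip_monoid_def
  proof (intro conjI ballI)
   have "br_blk k m (C (1\<^sub>m n)) = 1\<^sub>m m" unfolding C1 using n by (auto simp: br_blk_def)
   thus "1\<^sub>m m : (%u. br_blk k m (C u)) ` M" using M1 by (metis image_eqI)
   fix x assume "x : (%u. br_blk k m (C u)) ` M"
   then obtain u where u: "u : M" "x = br_blk k m (C u)" by blast
   show "unip m x" unfolding u(2) using Cu[OF u(1)] Cb[OF u(1)] n by (intro blk_unip(2)[of k m]) auto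
   fix y assume "y : (%u. br_blk k m (C u)) ` M"
   then obtain v where v: "v : M" "y = br_blk k m (C v)" by blast
   have "x * y = br_blk k m (C (u * v))"
    unfolding u v Cm[OF u(1) v(1)] using Cc[OF u(1)] Cc[OF v(1)] Cb[OF u(1)] n
    by (intro br_blk_mult[of _ k m, symmetric]) auto
   thus "x * y : (%u. br_blk k m (C u)) ` M" using Mm u v by blast
  qed
  moreover have "m < n" using kn by (simp add: m_def)
  ultimately obtain b b' where b: "b : carrier_mat m m" "b' : carrier_mat m m"
   "b * b' = 1\<^sub>m m" "b' * b = 1\<^sub>m m" "!!u. u : M ==> b' * br_blk k m (C u) * b : unitri m"
   using less.IH by blast
  \<comment> \<open>The block diagonal matrix brings both diagonal blocks into unitriangular form at
    once.\<close>
  let ?d = "dsum k m a b" and ?d' = "dsum k m a' b'"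
  have d1: "dsum k m (1\<^sub>m k) (1\<^sub>m m) = 1\<^sub>m n" unfolding dsum_def n by (intro eq_matI) auto
  have dc: "?d : sq_mat n" "?d' : sq_mat n" using dsum(1) a b n by auto
  have dd: "?d * ?d' = 1\<^sub>m n" "?d' * ?d = 1\<^sub>m n" using a b by (simp_all add: dsum_mult d1)
  have "(g * ?d) * (?d' * g') = g * (?d * ?d' * g')"
   using g(1) g'(1) dc by (simp add: assoc_sq[of _ n] mult_sq)
  hence 1: "(g * ?d) * (?d' * g') = 1\<^sub>m n" unfolding dd using g' by simp
  have "(?d' * g') * (g * ?d) = ?d' * (g' * g * ?d)"
   using g(1) g'(1) dc by (simp add: assoc_sq[of _ n] mult_sq)
  hence 2: "(?d' * g') * (g * ?d) = 1\<^sub>m n" using g'(3) dc dd by simp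
  have "?d' * g' * u * (g * ?d) : unitri n" if u: "u : M" for u
  proof -
   have eq: "?d' * g' * u * (g * ?d) = ?d' * (C u * ?d)"
    unfolding C_def using g g' dc Mc[OF u] by (simp add: assoc_sq[of _ n] mult_sq)
   note cc = Cc[OF u, unfolded n] and dc' = dc[unfolded n] and cb = Cb[OF u, unfolded n]
   note ds = dsum[OF a(1) b(1)] and ds' = dsum[OF a(2) b(2)]
   have b1: "blk (k + m) {k} (C u * ?d)" by (rule blk_mult[OF cc dc'(1) cb ds(2)]) simp
   have "?d' * (C u * ?d) : unitri (k + m)"
   proof (rule unitri_blocks)
    show "?d' * (C u * ?d) : carrier_mat (k + m) (k + m)" using cc dc' by (intro mult_sq)
    show "blk (k + m) {k} (?d' * (C u * ?d))"
     by (rule blk_mult[OF dc'(2) mult_sq[OF cc dc'(1)] ds'(2) b1]) simp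
    have "tl_blk k (?d' * (C u * ?d)) = a' * (tl_blk k (C u) * a)"
     unfolding tl_blk_mult[OF dc'(2) mult_sq[OF cc dc'(1)] b1] tl_blk_mult[OF cc dc'(1) ds(2)] ds ds' ..
    also have "... = a' * tl_blk k (C u) * a"
     using a by (intro assoc_sq[symmetric]) (auto simp: tl_blk_def)
    finally show "tl_blk k (?d' * (C u * ?d)) : unitri k" using a(5)[OF u] by simp
    have "br_blk k m (?d' * (C u * ?d)) = b' * (br_blk k m (C u) * b)"
     unfolding br_blk_mult[OF dc'(2) mult_sq[OF cc dc'(1)] ds'(2)] br_blk_mult[OF cc dc'(1) cb] ds ds' ..
    also have "... = b' * br_blk k m (C u) * b"
     using b by (intro assoc_sq[symmetric]) (auto simp: br_blk_def)
    finally show "br_blk k m (?d' * (C u * ?d)) : unitri m" using b(5)[OF u] by simp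
   qed
   thus ?thesis unfolding eq n .
  qed
  thus ?thesis using 1 2 g g' dc
   by (intro exI[of _ "g * ?d"] exI[of _ "?d' * g'"]) (auto intro: mult_sq)
 qed
qed

definition cj :: "complex mat => complex mat => complex mat" where
 "cj k g = k * g * adj_mat k"

lemma adj_adj: "k : SLc n ==> adj_mat (adj_mat k) = k"
 using group.inv_inv[OF SL_group, of k n] SL_inv[of k n] SL_inv[OF SL_adj(1)[of k n]] by simp

lemma cj_SL: "k : SLc n ==> g : SLc n ==> cj k g : SLc n"
 unfolding cj_def by (intro SL_mult_closed SL_adj(1))

lemma cj_mult:
 "k : SLc n ==> g : sq_mat n ==> h : sq_mat n ==> cj k (g * h) = cj k g * cj k h"
 unfolding cj_def using SL_adj[of k n] by (intro conj_mult) (auto simp: SL_mat)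

lemma cj_cj: "k : SLc n ==> g : sq_mat n ==> cj (adj_mat k) (cj k g) = g"
 unfolding cj_def adj_adj using SL_adj[of k n] SL_mat[of k n] SL_mat[OF SL_adj(1)[of k n]]
 by (simp add: assoc_sq[of _ n] mult_sq SL_adj_cancel(2)[of k n])

lemma cj_cj': "k : SLc n ==> g : sq_mat n ==> cj k (cj (adj_mat k) g) = g"
 using cj_cj[OF SL_adj(1)] by (simp add: adj_adj)

lemma cj_one: "k : SLc n ==> cj k (1\<^sub>m n) = 1\<^sub>m n"
 unfolding cj_def using SL_adj[of k n] SL_mat[of k n] by simp

lemma SL_inv_unique: "g : SLc n ==> h : sq_mat n ==> h * g = 1\<^sub>m n ==> h = adj_mat g"
 using SL_adj[of g n] SL_mat[of g n] SL_mat[OF SL_adj(1)[of g n]]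
 by (metis assoc_sq left_mult_one_mat right_mult_one_mat)

lemma Hgrp_adj:
 assumes "D \<subseteq> {..n}" "h : Hgrp n D" shows "adj_mat h : Hgrp n D"
proof -
 obtain y where y: "y : tgen n (allowed D)" "y * h = 1\<^sub>m n"
  using tgen_inverse[OF Hgrp_tgen[OF assms]] by blast
 have "h : SLc n" using assms(2) by (simp add: Hgrp_def)
 hence "y = adj_mat h" using SL_inv_unique[OF _ tgen_carrier[OF y(1)] y(2)] by blast
 thus ?thesis using tgen_Hgrp[OF y(1) assms(1)] by simp
qed

lemma conj_subgroup:
 assumes k: "k : SLc n" and H: "H \<subseteq> SLc n" "1\<^sub>m n : H"
  and m: "!!g h. g : H ==> h : H ==> g * h : H" and i: "!!h. h : H ==> adj_mat h : H"
 shows "subgroup (cj k ` H) (SL n)"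
proof (rule group.subgroupI[OF SL_group])
 show "cj k ` H \<subseteq> SLc n" using cj_SL[OF k] H by blast
 show "cj k ` H ~= {}" using H by auto
 fix x assume "x : cj k ` H"
 then obtain g where g: "g : H" "x = cj k g" by blast
 have gS: "g : SLc n" using g H by blast
 have "inv\<^bsub>SL n\<^esub> x = cj k (adj_mat g)"
 proof (rule group.inv_equality[OF SL_group])
  show "cj k (adj_mat g) \<otimes>\<^bsub>SL n\<^esub> x = \<one>\<^bsub>SL n\<^esub>"
   using cj_mult[OF k SL_mat[OF SL_adj(1)[OF gS]] SL_mat[OF gS]] SL_adj[OF gS] cj_one[OF k] g by simp
 qed (use g gS cj_SL[OF k] SL_adj(1)[OF gS] in auto)
 thus "inv\<^bsub>SL n\<^esub> x : cj k ` H" using i g by blast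
 fix y assume "y : cj k ` H"
 then obtain h where h: "h : H" "y = cj k h" by blast
 have "x * y = cj k (g * h)" using cj_mult[OF k] g h H SL_mat by (metis subsetD)
 thus "x \<otimes>\<^bsub>SL n\<^esub> y : cj k ` H" using m g h by simp
qed

lemma unitri_eq_Hgrp: "unitri n = Hgrp n {1..n}"
 using Hgrp_full unitri_Hgrp[of "{1..n}"] by auto

text \<open>Each further power of u - 1 pushes the first nonzero superdiagonal up by one.\<close>

lemma unitri_nilpotent:
 assumes "u : unitri n" shows "unip n u"
proof -
 define x where "x = u - 1\<^sub>m n"
 have uc: "u : sq_mat n" using assms by (simp add: unitri_def)
 have xc: "x : sq_mat n" unfolding x_def by (rule minus_carrier_mat) simp
 have x0: "x $$ (i, j) = 0" if "i < n" "j <= i" for i j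
  using assms that uc by (auto simp: x_def unitri_def)
 have "(x ^\<^sub>m k) $$ (i, j) = 0" if "i < n" "j < n" "j < i + k" for i j k
  using that
 proof (induction k arbitrary: i j)
  case 0
  thus ?case using xc by simp
 next
  case (Suc k)
  have "(x ^\<^sub>m k * x) $$ (i, j) = (SUM l<n. (x ^\<^sub>m k) $$ (i, l) * x $$ (l, j))"
   using Suc.prems xc by (intro index_mult_sum[of _ n n _ n]) auto
  also have "... = 0"
  proof (rule sum.neutral, rule ballI)
   fix l assume "l : {..<n}"
   thus "(x ^\<^sub>m k) $$ (i, l) * x $$ (l, j) = 0"
    using Suc x0[of l j] by (cases "l < i + k") auto
  qed
  finally show ?case by simp
 qed
 hence "x ^\<^sub>m n = 0\<^sub>m n n" using xc by (intro eq_matI) auto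
 thus ?thesis using uc unfolding unip_def x_def by blast
qed

text \<open>Kolchin's theorem puts \<open>N\<close> into a conjugate of the unitriangular group,
  which is itself unipotent, so maximality gives equality.\<close>

theorem maximal_unipotent_conj:
 assumes n: "1 <= n" and N: "maximal_unipotent n N"
 shows "EX k:SLc n. N = cj k ` unitri n"
proof -
 have sub: "subgroup N (SL n)" and nil: "ALL u:N. EX k. (u - 1\<^sub>m n) ^\<^sub>m k = 0\<^sub>m n n"
  and mx: "!!M. unipotent_subgroup n M ==> N \<subseteq> M ==> M = N"
  using N by (auto simp: maximal_unipotent_def unipotent_subgroup_def)
 have NS: "N \<subseteq> SLc n" using sub by (rule subgroup.subset)
 have "unip_monoid n N"
  unfolding unip_monoid_def
 proof (intro conjI ballI)
  show "1\<^sub>m n : N" using subgroup.one_closed[OF sub] by simp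
  show "u * v : N" if "u : N" "v : N" for u v using subgroup.m_closed[OF sub that] by simp
  show "unip n u" if "u : N" for u using nil NS that SL_mat unfolding unip_def by blast
 qed
 from kolchin[OF this] obtain h h' where h: "h : sq_mat n" "h' : sq_mat n"
  "h * h' = 1\<^sub>m n" "h' * h = 1\<^sub>m n" and hu: "!!u. u : N ==> h' * u * h : unitri n" by blast
 have dh: "det h ~= 0" using inverse_det_nonzero[OF h(1-3)] .
 \<comment> \<open>An n-th root that rescales \<open>h\<close> to determinant one; conjugation is
   the same for both.\<close>
 obtain c where c: "c ^ n = 1 / det h" "c ~= 0"
 proof -
  have "EX c :: complex. c ^ n = 1 / det h"
  proof -
   have "degree (monom 1 n - [:1 / det h:]) = n"
    using n by (intro antisym degree_le le_degree) (auto simp: coeff_eq_0 coeff_pCons split: nat.splits)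
   hence "~ constant (poly (monom 1 n - [:1 / det h:]))"
    using n by (simp add: constant_degree)
   from fundamental_theorem_of_algebra[OF this] show ?thesis by (auto simp: poly_monom)
  qed
  then obtain c :: complex where "c ^ n = 1 / det h" by blast
  moreover from this have "c ~= 0" using dh n by (auto simp: power_0_left)
  ultimately show ?thesis using that by blast
 qed
 define k where "k = c \<cdot>\<^sub>m h"
 have kS: "k : SLc n" using h c dh by (simp add: SL_carrier k_def)
 have ak: "adj_mat k = (1 / c) \<cdot>\<^sub>m h'"
 proof (rule SL_inv_unique[OF kS, symmetric])
  show "(1 / c) \<cdot>\<^sub>m h' * k = 1\<^sub>m n"
   unfolding k_def using h c
   by (simp add: mult_smult_distrib[of _ n n _ n] mult_smult_assoc_mat[of _ n n _ n]) (auto intro!: eq_matI)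
 qed (use h in auto)
 have "N \<subseteq> cj k ` unitri n"
 proof
  fix u assume u: "u : N"
  hence uc: "u : sq_mat n" using NS SL_mat by blast
  have "cj (adj_mat k) u = adj_mat k * u * k" by (simp add: cj_def adj_adj[OF kS])
  also have "... = h' * u * h"
   unfolding ak unfolding k_def using h(1,2) uc c(2)
   by (simp add: mult_smult_distrib[of _ n n _ n] mult_smult_assoc_mat[of _ n n _ n]) (auto intro!: eq_matI)
  finally have "cj (adj_mat k) u : unitri n" using hu[OF u] by simp
  thus "u : cj k ` unitri n" using cj_cj'[OF kS uc] by (metis image_eqI)
 qed
 moreover have "unipotent_subgroup n (cj k ` unitri n)"
  unfolding unipotent_subgroup_def
 proof (intro conjI ballI)
  show "subgroup (cj k ` unitri n) (SL n)"
   unfolding unitri_eq_Hgrp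
   by (rule conj_subgroup[OF kS]) (auto simp: Hgrp_one Hgrp_mult Hgrp_adj, auto simp: Hgrp_def)
  fix x assume "x : cj k ` unitri n"
  then obtain u where u: "u : unitri n" "x = cj k u" by blast
  have "unip n x" unfolding u(2) cj_def
   by (rule unip_conj[OF unitri_nilpotent[OF u(1)]]) (use SL_adj[OF kS] SL_mat kS in auto)
  thus "EX k. (x - 1\<^sub>m n) ^\<^sub>m k = 0\<^sub>m n n" by (simp add: unip_def)
 qed
 ultimately have "cj k ` unitri n = N" using mx by blast
 thus ?thesis using kS by blast
qed

section \<open>Standard parabolic subgroups and their derived groups\<close>

lemma vsub_image:
 assumes W: "vsub n W" and h: "h : sq_mat n"
 shows "vsub n ((%x. h *v x) ` W)"
 unfolding vsub_def
proof (intro conjI ballI allI)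
 have Wc: "W \<subseteq> carrier_vec n" using W by (simp add: vsub_def)
 show "(%x. h *v x) ` W \<subseteq> carrier_vec n" using Wc h by auto
 have "h *v 0\<^sub>v n = 0\<^sub>v n" using h by (intro eq_vecI) (auto simp: index_mult_mat_vec)
 thus "0\<^sub>v n : (%x. h *v x) ` W" using W by (metis image_eqI vsub_def)
 fix v assume "v : (%x. h *v x) ` W"
 then obtain x where x: "x : W" "v = h *v x" by blast
 show "a \<cdot>\<^sub>v v : (%x. h *v x) ` W" for a
 proof -
  have "a \<cdot>\<^sub>v v = h *v (a \<cdot>\<^sub>v x)" using x Wc h by (auto simp: mult_mat_vec)
  thus ?thesis using W x by (auto simp: vsub_def)
 qed
 fix w assume "w : (%x. h *v x) ` W"
 then obtain y where y: "y : W" "w = h *v y" by blast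
 have "v + w = h *v (x + y)"
 proof -
  have "x : carrier_vec n" "y : carrier_vec n" using x y Wc by blast+
  thus ?thesis unfolding x y by (rule mult_add_distrib_mat_vec[OF h, symmetric])
 qed
 thus "v + w : (%x. h *v x) ` W" using W x y by (auto simp: vsub_def)
qed

text \<open>Let m be the last coordinate that occurs in \<open>W\<close>, witnessed by w. The
  transvection at (j, m) changes w by a nonzero multiple of e_j, so every e_j with j < m lies in
  \<open>W\<close>, and then e_m does.\<close>

lemma unitri_stable:
 assumes W: "vsub n W" and st: "!!u w. u : unitri n ==> w : W ==> u *v w : W"
 shows "EX d<=n. W = lowv n d"
proof -
 have Wc: "W \<subseteq> carrier_vec n" and Wadd: "!!v w. v : W ==> w : W ==> v + w : W"
  and Wsm: "!!a v. v : W ==> a \<cdot>\<^sub>v v : W" and W0: "0\<^sub>v n : W" using W by (auto simp: vsub_def)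
 define T where "T = {i. i < n & (EX w:W. w $ i ~= 0)}"
 show ?thesis
 proof (cases "T = {}")
  case True
  have "W = lowv n 0"
  proof
   show "W \<subseteq> lowv n 0" using True Wc by (auto simp: lowv_def T_def)
   show "lowv n 0 \<subseteq> W"
   proof
    fix x :: "complex vec" assume "x : lowv n 0"
    hence "x = 0\<^sub>v n" by (intro eq_vecI) (auto simp: lowv_def)
    thus "x : W" using W0 by simp
   qed
  qed
  thus ?thesis by blast
 next
  case False
  have fT: "finite T" by (simp add: T_def)
  define m where "m = Max T"
  have mT: "m : T" unfolding m_def using False fT by (rule Max_in[rotated])
  then obtain w where m: "m < n" and w: "w : W" "w $ m ~= 0" by (auto simp: T_def)
  have wc: "w : carrier_vec n" using w Wc by blast
  have up: "W \<subseteq> lowv n (Suc m)"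
  proof
   fix x assume x: "x : W"
   have "x $ i = 0" if "Suc m <= i" "i < n" for i
   proof (rule ccontr)
    assume "x $ i ~= 0"
    hence "i : T" using x that by (auto simp: T_def)
    hence "i <= m" unfolding m_def using fT by simp
    thus False using that by simp
   qed
   thus "x : lowv n (Suc m)" using x Wc by (auto simp: lowv_def)
  qed
  have ej: "unit_vec n j : W" if j: "j < m" for j
  proof -
   let ?u = "addrow_mat n 1 j m"
   have "?u : unitri n" unfolding unitri_def using j m by (auto simp: addrow_mat_index)
   hence "?u *v w : W" using st w by blast
   hence "(1 / w $ m) \<cdot>\<^sub>v (?u *v w + (-1) \<cdot>\<^sub>v w) : W" using Wadd Wsm w by blast
   also have "(1 / w $ m) \<cdot>\<^sub>v (?u *v w + (-1) \<cdot>\<^sub>v w) = unit_vec n j"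
    using j m wc w(2) by (intro eq_vecI) (auto simp: addrow_mult_vec)
   finally show ?thesis .
  qed
  define y where "y = vec n (%i. if i = m then 0 else w $ i)"
  have "y : lowv n m"
  proof -
   have "w $ i = 0" if "Suc m <= i" "i < n" for i using up w that by (auto simp: lowv_def)
   thus ?thesis by (auto simp: lowv_def y_def)
  qed
  from lowv_span[OF W one_carrier_mat _ less_imp_le[OF m] this]
  have "1\<^sub>m n *v y : W" using ej by simp
  hence "y : W" by (simp add: y_def)
  hence "(1 / w $ m) \<cdot>\<^sub>v (w + (-1) \<cdot>\<^sub>v y) : W" using Wadd Wsm w by blast
  also have "(1 / w $ m) \<cdot>\<^sub>v (w + (-1) \<cdot>\<^sub>v y) = unit_vec n m"
   using m wc w(2) by (intro eq_vecI) (auto simp: y_def)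
  finally have em: "unit_vec n m : W" .
  have "x : W" if "x : lowv n (Suc m)" for x
  proof -
   have "1\<^sub>m n *v unit_vec n i : W" if "i < Suc m" for i
    using ej em that by (cases "i = m") auto
   from lowv_span[OF W one_carrier_mat this Suc_leI[OF m] that]
   have "1\<^sub>m n *v x : W" .
   thus ?thesis using that by (simp add: lowv_def)
  qed
  hence "W = lowv n (Suc m)" using up by blast
  thus ?thesis using m by (intro exI[of _ "Suc m"]) simp
 qed
qed

lemma blk_lowv:
 assumes g: "g : sq_mat n" and d: "d <= n"
 shows "blk n {d} g \<longleftrightarrow> (ALL y:lowv n d. g *v y : lowv n d)"
proof
 assume b: "blk n {d} g"
 show "ALL y:lowv n d. g *v y : lowv n d"
 proof
  fix y :: "complex vec" assume y: "y : lowv n d"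
  hence yc: "y : carrier_vec n" by (simp add: lowv_def)
  have "(g *v y) $ i = 0" if i: "d <= i" "i < n" for i
  proof -
   have "(g *v y) $ i = (SUM l<n. g $$ (i, l) * y $ l)" using index_mult_vec_sum[OF g yc i(2)] .
   also have "... = 0"
   proof (rule sum.neutral, rule ballI)
    fix l assume "l : {..<n}"
    thus "g $$ (i, l) * y $ l = 0"
     using b y i by (cases "l < d") (auto simp: blk_def lowv_def)
   qed
   finally show ?thesis .
  qed
  thus "g *v y : lowv n d" using g yc by (auto simp: lowv_def)
 qed
next
 assume a: "ALL y:lowv n d. g *v y : lowv n d"
 show "blk n {d} g"
  unfolding blk_def
 proof (intro ballI allI impI)
  fix e r c assume e: "e : {d}" "e <= r & r < n & c < e"
  hence c: "c < n" using d by auto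
  have "unit_vec n c : lowv n d" using e c by (auto simp: lowv_def)
  hence "g *v unit_vec n c : lowv n d" using a by blast
  hence "(g *v unit_vec n c) $ r = 0" using e by (auto simp: lowv_def)
  thus "g $$ (r, c) = 0" using e c g by (simp add: index_mult_mat_vec)
 qed
qed

section \<open>Subspaces, dimensions and ranks\<close>

lemma linear_subspace_vsub: "linear_subspace n W \<longleftrightarrow> vsub n W"
proof -
 interpret V: vec_space "TYPE(complex)" n .
 show ?thesis
 proof
  assume "linear_subspace n W"
  hence "submodule class_ring W (module_vec TYPE(complex) n)"
   unfolding linear_subspace_def VectorSpace.subspace_def by simp
  then interpret S: submodule class_ring W "module_vec TYPE(complex) n" .
  show "vsub n W"
   unfolding vsub_def
   using S.subset S.m_closed S.zero_closed S.smult_closed by (auto simp: module_vec_simps)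
 next
  assume W: "vsub n W"
  have "submodule class_ring W (module_vec TYPE(complex) n)"
   by (rule submodule.intro[OF V.module_axioms]) (use W in \<open>auto simp: vsub_def module_vec_simps\<close>)
  thus "linear_subspace n W"
   unfolding linear_subspace_def VectorSpace.subspace_def using V.vectorspace_axioms by simp
 qed
qed

lemma span_cols:
 assumes A: "A : carrier_mat n nc"
 shows "LinearCombinations.module.span class_ring (module_vec TYPE(complex) n) (set (cols A)) =
  (%x. A *v x) ` carrier_vec nc"
proof -
 interpret V: vec_space "TYPE(complex)" n .
 have cc: "set (cols A) \<subseteq> carrier_vec n" using cols_dim[of A] A by auto
 have "linear_subspace n (V.span (set (cols A)))"
  unfolding linear_subspace_def using V.span_is_subspace[OF cc] .
 hence sv: "vsub n (V.span (set (cols A)))" by (simp add: linear_subspace_vsub)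
 have ucol: "A *v unit_vec nc i = col A i" if "i < nc" for i
  using that A by (intro eq_vecI) (auto simp: index_mult_mat_vec)
 have img: "vsub n ((%x. A *v x) ` carrier_vec nc)"
  unfolding vsub_def
 proof (intro conjI ballI allI)
  show "(%x. A *v x) ` carrier_vec nc \<subseteq> carrier_vec n" using A by auto
  have "A *v 0\<^sub>v nc = 0\<^sub>v n" using A by (intro eq_vecI) (auto simp: index_mult_mat_vec)
  thus "0\<^sub>v n : (%x. A *v x) ` carrier_vec nc" by (metis image_eqI zero_carrier_vec)
  fix v assume "v : (%x. A *v x) ` carrier_vec nc"
  then obtain x where x: "x : carrier_vec nc" "v = A *v x" by blast
  show "a \<cdot>\<^sub>v v : (%x. A *v x) ` carrier_vec nc" for a
   using x A by (intro image_eqI[of _ _ "a \<cdot>\<^sub>v x"]) (auto simp: mult_mat_vec)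
  fix w assume "w : (%x. A *v x) ` carrier_vec nc"
  then obtain y where y: "y : carrier_vec nc" "w = A *v y" by blast
  show "v + w : (%x. A *v x) ` carrier_vec nc"
   using x y by (intro image_eqI[of _ _ "x + y"]) (auto simp: mult_add_distrib_mat_vec[OF A])
 qed
 show ?thesis
 proof
  have "submodule class_ring ((%x. A *v x) ` carrier_vec nc) (module_vec TYPE(complex) n)"
   using img unfolding linear_subspace_vsub[symmetric] linear_subspace_def VectorSpace.subspace_def by simp
  moreover have "set (cols A) \<subseteq> (%x. A *v x) ` carrier_vec nc"
  proof
   fix v assume "v : set (cols A)"
   then obtain i where "i < nc" "v = col A i" using A by (auto simp: cols_def)
   thus "v : (%x. A *v x) ` carrier_vec nc" using ucol[of i] by (metis image_eqI unit_vec_carrier)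
  qed
  ultimately show "V.span (set (cols A)) \<subseteq> (%x. A *v x) ` carrier_vec nc"
   using V.span_is_subset by blast
  show "(%x. A *v x) ` carrier_vec nc \<subseteq> V.span (set (cols A))"
  proof
   fix v assume "v : (%x. A *v x) ` carrier_vec nc"
   then obtain x where x: "x : carrier_vec nc" "v = A *v x" by blast
   have "A *v x : V.span (set (cols A))"
   proof (rule lowv_span[OF sv A, where k = nc])
    fix i assume i: "i < nc"
    hence "col A i : set (cols A)" using A by (auto simp: cols_def)
    thus "A *v unit_vec nc i : V.span (set (cols A))"
     unfolding ucol[OF i] using V.in_own_span[of "set (cols A)"] cc by auto
   qed (use x in \<open>auto simp: lowv_def\<close>)
   thus "v : V.span (set (cols A))" using x by simp
  qed
 qed
qed

lemma rank_linear_dim: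
 "A : carrier_mat n nc ==> vec_space.rank n A = linear_dim n ((%x. A *v x) ` carrier_vec nc)"
 by (simp add: vec_space.rank_def linear_dim_def span_cols)

text \<open>The first d columns of the invertible \<open>h\<close> are independent and span this
  subspace, so its dimension is the rank of a matrix with d columns.\<close>

lemma linear_dim_lowv:
 assumes h: "h : sq_mat n" "det h ~= 0" and d: "d <= n"
 shows "linear_dim n ((%x. h *v x) ` lowv n d) = d"
proof -
 interpret V: vec_space "TYPE(complex)" n .
 obtain h' where h': "h' : sq_mat n" "h' * h = 1\<^sub>m n" using det_nonzero_inverse[OF h] by blast
 define A where "A = mat n d (%(i, j). h $$ (i, j))"
 have A: "A : carrier_mat n d" by (simp add: A_def)
 define pad where "pad = (%x :: complex vec. vec n (%i. if i < d then x $ i else 0))"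
 have Ah: "A *v x = h *v pad x" if x: "x : carrier_vec d" for x
 proof (rule eq_vecI)
  fix i assume "i < dim_vec (h *v pad x)"
  hence i: "i < n" using h by simp
  have "(A *v x) $ i = (SUM l<d. A $$ (i, l) * x $ l)" by (rule index_mult_vec_sum[OF A x i])
  also have "... = (SUM l<d. h $$ (i, l) * pad x $ l)"
   using i d by (intro sum.cong) (auto simp: A_def pad_def)
  also have "... = (SUM l<n. h $$ (i, l) * pad x $ l)"
   using d by (intro sum.mono_neutral_left) (auto simp: pad_def)
  also have "... = (h *v pad x) $ i"
   by (rule index_mult_vec_sum[OF h(1) _ i, symmetric]) (simp add: pad_def)
  finally show "(A *v x) $ i = (h *v pad x) $ i" .
 qed (use h A in auto)
 have padl: "pad ` carrier_vec d = lowv n d"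
 proof
  show "lowv n d \<subseteq> pad ` carrier_vec d"
  proof
   fix y :: "complex vec" assume "y : lowv n d"
   hence "y = pad (vec d (%i. y $ i))" using d by (intro eq_vecI) (auto simp: pad_def lowv_def)
   thus "y : pad ` carrier_vec d" by (metis image_eqI vec_carrier)
  qed
 qed (auto simp: pad_def lowv_def)
 have img: "(%x. A *v x) ` carrier_vec d = (%x. h *v x) ` lowv n d"
  unfolding padl[symmetric] image_image using Ah by (intro image_cong) auto
 have inj: "x = y" if xy: "x : carrier_vec d" "y : carrier_vec d" "A *v x = A *v y" for x y
 proof -
  have "h' *v (h *v pad x) = h' *v (h *v pad y)" using xy Ah by simp
  moreover have "h' *v (h *v pad z) = pad z" for z
   using assoc_mult_mat_vec[OF h'(1) h(1), of "pad z"] h'(2) by (simp add: pad_def)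
  ultimately have p: "pad x = pad y" by simp
  show ?thesis
  proof (rule eq_vecI)
   fix i assume "i < dim_vec y"
   hence "i < d" using xy by simp
   thus "x $ i = y $ i" using arg_cong[OF p, of "%v. v $ i"] d by (simp add: pad_def)
  qed (use xy in simp)
 qed
 have ucol: "A *v unit_vec d i = col A i" if "i < d" for i
  using that A by (intro eq_vecI) (auto simp: index_mult_mat_vec)
 have dist: "distinct (cols A)"
 proof (rule distinct_conv_nth[THEN iffD2], intro allI impI)
  fix i j assume ij: "i < length (cols A)" "j < length (cols A)" "i ~= j"
  hence ij': "i < d" "j < d" using A by auto
  show "cols A ! i ~= cols A ! j"
  proof
   assume "cols A ! i = cols A ! j"
   hence "A *v unit_vec d i = A *v unit_vec d j" using ij' A ucol by simp
   from inj[OF _ _ this] have "unit_vec d i $ i = (unit_vec d j $ i :: complex)" by simp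
   thus False using ij ij' by simp
  qed
 qed
 have "V.lin_indpt (set (cols A))"
 proof
  assume "V.lin_dep (set (cols A))"
  from V.lin_depE[OF A this dist] obtain v where v: "v : carrier_vec d" "v ~= 0\<^sub>v d" "A *v v = 0\<^sub>v n" by blast
  have "A *v 0\<^sub>v d = 0\<^sub>v n" using A by (intro eq_vecI) (auto simp: index_mult_mat_vec)
  thus False using inj[OF v(1), of "0\<^sub>v d"] v by simp
 qed
 hence "V.rank A = d" by (rule V.lin_indpt_full_rank[OF A dist])
 thus ?thesis using rank_linear_dim[OF A] img by simp
qed

definition Pgrp :: "nat => nat set => complex mat set" where
 "Pgrp n D = {g : SLc n. blk n D g}"

lemma SL_vec_cancel:
 assumes "k : SLc n" "x : carrier_vec n"
 shows "k *v (adj_mat k *v x) = x" "adj_mat k *v (k *v x) = x"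
 using assoc_mult_mat_vec[OF SL_mat[OF assms(1)] SL_mat[OF SL_adj(1)[OF assms(1)]] assms(2)]
  assoc_mult_mat_vec[OF SL_mat[OF SL_adj(1)[OF assms(1)]] SL_mat[OF assms(1)] assms(2)]
  SL_adj[OF assms(1)] assms(2) by auto

lemma cj_vec:
 assumes "k : SLc n" "g : sq_mat n" "x : carrier_vec n"
 shows "cj k g *v (k *v x) = k *v (g *v x)"
proof -
 have kc: "k : sq_mat n" "adj_mat k : sq_mat n" using SL_mat SL_adj(1) assms(1) by auto
 have "cj k g *v (k *v x) = k * g *v (adj_mat k *v (k *v x))"
  unfolding cj_def using kc assms by (intro assoc_mult_mat_vec[of _ n n _ n]) auto
 also have "... = k * g *v x" using SL_vec_cancel[OF assms(1,3)] by simp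
 also have "... = k *v (g *v x)" using kc assms by (intro assoc_mult_mat_vec) auto
 finally show ?thesis .
qed

text \<open>By \<open>unitri_stable\<close> the subspaces stable under the conjugated group are the
  images under \<open>k\<close> of the coordinate subspaces, one in each dimension.\<close>

lemma parabolic_conj:
 assumes k: "k : SLc n" and D: "D \<subseteq> {..n}"
 shows "parabolic n (cj k ` unitri n) D = cj k ` Pgrp n D"
proof
 have kc: "k : sq_mat n" "adj_mat k : sq_mat n" using SL_mat SL_adj(1) k by auto
 have dk: "det k ~= 0" using k by (simp add: SL_carrier)
 have lc: "lowv n d \<subseteq> carrier_vec n" for d by (auto simp: lowv_def)
 show "parabolic n (cj k ` unitri n) D \<subseteq> cj k ` Pgrp n D"
 proof
  fix g assume g: "g : parabolic n (cj k ` unitri n) D"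
  hence gS: "g : SLc n" by (simp add: parabolic_def)
  define x where "x = cj (adj_mat k) g"
  have xS: "x : SLc n" unfolding x_def by (rule cj_SL[OF SL_adj(1)[OF k] gS])
  have gx: "g = cj k x" unfolding x_def using cj_cj'[OF k SL_mat[OF gS]] by simp
  have "blk n {d} x" if d: "d : D" for d
  proof -
   have dn: "d <= n" using d D by auto
   let ?W = "(%y. k *v y) ` lowv n d"
   have "linear_subspace n ?W" unfolding linear_subspace_vsub by (rule vsub_image[OF vsub_lowv kc(1)])
   moreover have "ALL u:cj k ` unitri n. ALL w:?W. u *v w : ?W"
   proof (intro ballI)
    fix u w assume "u : cj k ` unitri n" "w : ?W"
    then obtain v y where v: "v : unitri n" "u = cj k v" and y: "y : lowv n d" "w = k *v y" by blast
    have "u *v w = k *v (v *v y)"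
     unfolding v y using cj_vec[OF k unitri_carrier[OF v(1)]] y lc by blast
    moreover have "v *v y : lowv n d"
     using unitri_blk[of "{d}" n v] blk_lowv[OF unitri_carrier[OF v(1)] dn] v y dn by blast
    ultimately show "u *v w : ?W" by blast
   qed
   moreover have "linear_dim n ?W : D" using linear_dim_lowv[OF kc(1) dk dn] d by simp
   ultimately have st: "ALL w:?W. g *v w : ?W" using g unfolding parabolic_def by blast
   have "x *v y : lowv n d" if y: "y : lowv n d" for y
   proof -
    have yc: "y : carrier_vec n" using y lc by blast
    have "g *v (k *v y) : ?W" using st y by blast
    then obtain z where z: "z : lowv n d" "g *v (k *v y) = k *v z" by blast
    have "k *v (x *v y) = k *v z" using z(2) unfolding gx cj_vec[OF k SL_mat[OF xS] yc] .
    hence "adj_mat k *v (k *v (x *v y)) = adj_mat k *v (k *v z)" by simp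
    moreover have "x *v y : carrier_vec n" "z : carrier_vec n" using SL_mat[OF xS] yc z lc by auto
    ultimately have "x *v y = z" using SL_vec_cancel(2)[OF k] by simp
    thus ?thesis using z by simp
   qed
   thus ?thesis using blk_lowv[OF SL_mat[OF xS] dn] by blast
  qed
  hence "blk n D x" unfolding blk_def by blast
  thus "g : cj k ` Pgrp n D" using gx xS by (auto simp: Pgrp_def)
 qed
 show "cj k ` Pgrp n D \<subseteq> parabolic n (cj k ` unitri n) D"
 proof
  fix g assume "g : cj k ` Pgrp n D"
  then obtain x where x: "x : SLc n" "blk n D x" "g = cj k x" by (auto simp: Pgrp_def)
  have "g *v w : W" if W: "linear_subspace n W" "ALL u:cj k ` unitri n. ALL w:W. u *v w : W"
   "linear_dim n W : D" and w: "w : W" for W w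
  proof -
   have Wv: "vsub n W" using W by (simp add: linear_subspace_vsub)
   have Wc: "W \<subseteq> carrier_vec n" using Wv by (simp add: vsub_def)
   let ?W = "(%y. adj_mat k *v y) ` W"
   have "EX d<=n. ?W = lowv n d"
   proof (rule unitri_stable[OF vsub_image[OF Wv kc(2)]])
    fix u y assume u: "u : unitri n" "y : ?W"
    then obtain z where z: "z : W" "y = adj_mat k *v z" by blast
    have zc: "z : carrier_vec n" using z Wc by blast
    have yc: "y : carrier_vec n" unfolding z using kc zc by simp
    have "cj k u *v z : W" using W(2) u z by blast
    moreover have "cj k u *v z = k *v (u *v y)"
     using cj_vec[OF k unitri_carrier[OF u(1)] yc] SL_vec_cancel(1)[OF k zc] z by simp
    moreover have "adj_mat k *v (k *v (u *v y)) = u *v y"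
     using SL_vec_cancel(2)[OF k] unitri_carrier[OF u(1)] yc by simp
    ultimately show "u *v y : ?W" by (metis image_eqI)
   qed
   then obtain d where d: "d <= n" "?W = lowv n d" by blast
   have WW: "W = (%y. k *v y) ` lowv n d"
   proof -
    have "(%y. k *v (adj_mat k *v y)) ` W = (%y. y) ` W"
    proof (rule image_cong[OF refl])
     fix y assume "y : W"
     hence "y : carrier_vec n" using Wc by blast
     thus "k *v (adj_mat k *v y) = y" by (rule SL_vec_cancel(1)[OF k])
    qed
    thus ?thesis unfolding d(2)[symmetric] image_image by simp
   qed
   hence "d : D" using W(3) linear_dim_lowv[OF kc(1) dk d(1)] by simp
   hence b: "blk n {d} x" using x by (simp add: blk_def)
   obtain y where y: "y : lowv n d" "w = k *v y" using w WW by blast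
   have "g *v w = k *v (x *v y)"
    unfolding x y using cj_vec[OF k SL_mat[OF x(1)]] y lc by blast
   moreover have "x *v y : lowv n d" using blk_lowv[OF SL_mat[OF x(1)] d(1)] b y by blast
   ultimately show ?thesis using WW by blast
  qed
  thus "g : parabolic n (cj k ` unitri n) D"
   using cj_SL[OF k x(1)] x(3) unfolding parabolic_def by blast
 qed
qed

lemma Hgrp_subgroup:
 assumes "k : SLc n" "D \<subseteq> {..n}"
 shows "subgroup (cj k ` Hgrp n D) (SL n)"
 by (rule conj_subgroup[OF assms(1)]) (use assms(2) in \<open>auto simp: Hgrp_one Hgrp_mult Hgrp_adj\<close>, auto simp: Hgrp_def)

lemma minor_Pgrp_mult:
 "D \<subseteq> {..n} ==> g : sq_mat n ==> h : sq_mat n ==> blk n D h ==> e : D ==>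
  minor (g * h) e id = minor g e id * minor h e id"
 by (rule minor_mult_block[of _ n n _ n]) (auto simp: blk_def)

text \<open>An element of P maps each subspace of the flag onto itself: preimages are found by
  inverting its top left block.\<close>

lemma blk_adj:
 assumes D: "D \<subseteq> {..n}" and p: "p : Pgrp n D"
 shows "adj_mat p : Pgrp n D"
proof -
 have "blk n {d} (adj_mat p)" if d: "d : D" for d
 proof -
  have pS: "p : SLc n" and pb: "blk n {d} p" using p d by (auto simp: Pgrp_def blk_def)
  have dn: "d <= n" using d D by auto
  let ?L = "%m. (%y. p *v y) ` lowv n m"
  note pc = SL_mat[OF pS]
  have adp: "minor (p * adj_mat p) d id = 1" using SL_adj[OF pS] Hgrp_one[of "{d}" n] dn by (simp add: Hgrp_def)
  text \<open>The inverse is a polynomial in \<open>p\<close>; concretely, the top left block of \<open>p\<close> is invertible.\<close>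
  have "det p = minor p d id * det (br_blk d (n - d) p)"
  proof -
   have "p = four_block_mat (tl_blk d p) (mat d (n - d) (%(i, j). p $$ (i, j + d))) (0\<^sub>m (n - d) d) (br_blk d (n - d) p)"
    using pc pb dn by (intro eq_matI) (auto simp: tl_blk_def br_blk_def blk_def)
   hence "det p = det (tl_blk d p) * det (br_blk d (n - d) p)"
    using det_four_block_mat_lower_left_zero[of "tl_blk d p" d "mat d (n - d) (%(i, j). p $$ (i, j + d))" "n - d" "0\<^sub>m (n - d) d" "br_blk d (n - d) p"]
    by (simp add: tl_blk_def br_blk_def)
   thus ?thesis by (simp add: minor_def tl_blk_def)
  qed
  hence m0: "minor p d id ~= 0" using pS by (auto simp: SL_carrier)
  have "tl_blk d p : carrier_mat d d" "det (tl_blk d p) ~= 0" using m0 by (auto simp: tl_blk_def minor_def)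
  then obtain t where t: "t : carrier_mat d d" "tl_blk d p * t = 1\<^sub>m d" using det_nonzero_inverse by blast
  have "adj_mat p *v y : lowv n d" if y: "y : lowv n d" for y
  proof -
   have yc: "y : carrier_vec n" using y by (simp add: lowv_def)
   define z where "z = t *v vec d (%i. y $ i)"
   have zc: "z : carrier_vec d" using t by (simp add: z_def)
   define w where "w = vec n (%i. if i < d then z $ i else 0)"
   have wl: "w : lowv n d" by (auto simp: w_def lowv_def)
   have wc: "w : carrier_vec n" by (simp add: w_def)
   have "p *v w = y"
   proof (rule eq_vecI)
    fix i assume "i < dim_vec y"
    hence i: "i < n" using yc by simp
    show "(p *v w) $ i = y $ i"
    proof (cases "i < d")
     case True
     have "(p *v w) $ i = (SUM l<n. p $$ (i, l) * w $ l)" by (rule index_mult_vec_sum[OF pc wc i])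
     also have "... = (SUM l<d. p $$ (i, l) * w $ l)"
      using dn by (intro sum.mono_neutral_right) (auto simp: w_def)
     also have "... = (SUM l<d. tl_blk d p $$ (i, l) * z $ l)"
      using True dn by (intro sum.cong) (auto simp: tl_blk_def w_def)
     also have "... = (tl_blk d p *v z) $ i"
      by (rule index_mult_vec_sum[symmetric, OF _ zc True]) (simp add: tl_blk_def)
     also have "tl_blk d p *v z = vec d (%i. y $ i)"
      unfolding z_def using assoc_mult_mat_vec[of "tl_blk d p" d d t d "vec d (%i. y $ i)"] t
      by (simp add: tl_blk_def)
     finally show ?thesis using True by simp
    next
     case False
     have "p *v w : lowv n d" using blk_lowv[OF pc dn] pb wl by blast
     thus ?thesis using False i y by (auto simp: lowv_def)
    qed
   qed (use pc yc in auto)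
   hence "adj_mat p *v y = w" using SL_vec_cancel(2)[OF pS wc] by simp
   thus ?thesis using wl by simp
  qed
  thus ?thesis using blk_lowv[OF SL_mat[OF SL_adj(1)[OF pS]] dn] by blast
 qed
 hence "blk n D (adj_mat p)" unfolding blk_def by blast
 thus ?thesis using p SL_adj(1) by (simp add: Pgrp_def)
qed

text \<open>Leading minors at the members of \<open>D\<close> are multiplicative on P and so cancel
  in a commutator.\<close>

lemma commutator_Hgrp:
 assumes D: "D \<subseteq> {..n}" and p: "p : Pgrp n D" and q: "q : Pgrp n D"
 shows "p * q * adj_mat p * adj_mat q : Hgrp n D"
proof -
 let ?p = "adj_mat p" and ?q = "adj_mat q"
 have p': "?p : Pgrp n D" "?q : Pgrp n D" using blk_adj[OF D] p q by auto
 have c: "p : sq_mat n" "q : sq_mat n" "?p : sq_mat n" "?q : sq_mat n"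
  using p q p' by (auto simp: Pgrp_def SL_mat)
 have b: "blk n D p" "blk n D q" "blk n D ?p" "blk n D ?q" using p q p' by (auto simp: Pgrp_def)
 have S: "p * q * ?p * ?q : SLc n"
  using p q p' by (intro SL_mult_closed) (auto simp: Pgrp_def)
 moreover have "blk n D (p * q * ?p * ?q)"
  using b c D by (intro blk_mult mult_sq) auto
 moreover have "minor (p * q * ?p * ?q) e id = 1" if e: "e : D" for e
 proof -
  have inv: "minor x e id * minor (adj_mat x) e id = 1" if "x : Pgrp n D" for x
  proof -
   have xS: "x : SLc n" "adj_mat x : Pgrp n D" using that blk_adj[OF D that] by (auto simp: Pgrp_def)
   hence "minor (x * adj_mat x) e id = minor x e id * minor (adj_mat x) e id"
    using e D by (intro minor_Pgrp_mult) (auto simp: Pgrp_def SL_mat)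
   thus ?thesis using SL_adj[OF xS(1)] Hgrp_one[OF D] e by (simp add: Hgrp_def)
  qed
  have "minor (p * q * ?p * ?q) e id = minor p e id * minor q e id * minor ?p e id * minor ?q e id"
   unfolding minor_Pgrp_mult[OF D mult_sq[OF mult_sq[OF c(1,2)] c(3)] c(4) b(4) e]
    minor_Pgrp_mult[OF D mult_sq[OF c(1,2)] c(3) b(3) e] minor_Pgrp_mult[OF D c(1,2) b(2) e] ..
  also have "... = (minor p e id * minor ?p e id) * (minor q e id * minor ?q e id)"
   by (simp only: mult_ac)
  finally show ?thesis unfolding inv[OF p] inv[OF q] by simp
 qed
 ultimately show ?thesis by (simp add: Hgrp_def)
qed

text \<open>Conjugating by the diagonal matrix with entries \<open>2\<close> and \<open>1/2\<close> scales the entry \<open>b\<close> by \<open>4\<close>.\<close>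

lemma addrow_commutator:
 assumes ij: "i < n" "j < n" "i ~= j"
 shows "EX t:SLc n. (ALL D. blk n D t) &
  addrow_mat n a i j = t * addrow_mat n (a / 3) i j * adj_mat t * adj_mat (addrow_mat n (a / 3) i j)"
proof -
 define f where "f = (%l. if l = i then 2 else if l = j then 1 / 2 else 1 :: complex)"
 define t where "t = mat_diag n f"
 let ?x = "addrow_mat n (a / 3) i j"
 have tc: "t : sq_mat n" by (simp add: t_def)
 have "det t = prod_list (diag_mat t)"
  by (rule det_upper_triangular[OF _ tc]) (auto simp: t_def mat_diag_def)
 also have "... = (PROD l = 0..<n. f l)"
  unfolding prod_list_diag_prod by (auto simp: t_def mat_diag_def)
 also have "... = f i * (f j * (PROD l:{0..<n} - {i} - {j}. f l))"
  using ij by (subst prod.remove[of _ i], simp, simp, subst prod.remove[of _ j]) auto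
 also have "(PROD l:{0..<n} - {i} - {j}. f l) = 1" by (rule prod.neutral) (auto simp: f_def)
 finally have "det t = 1" using ij by (simp add: f_def)
 hence tS: "t : SLc n" using tc by (simp add: SL_carrier)
 have xS: "?x : SLc n" using ij by (simp add: addrow_mat_SL)
 have e: "t * ?x = addrow_mat n a i j * (?x * t)"
 proof -
  \<comment> \<open>Conjugation multiplies the parameter b by 4 and the inverse factor subtracts b,
    which leaves 3 b.\<close>
  define b where "b = a / 3"
  have ab: "a = 3 * b" by (simp add: b_def)
  have xt: "addrow_mat n b i j * t = mat n n (%(r, c). addrow_mat n b i j $$ (r, c) * f c)"
   unfolding t_def by (rule mat_diag_mult_right) simp
  have tx: "t * addrow_mat n b i j = mat n n (%(r, c). f r * addrow_mat n b i j $$ (r, c))"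
   unfolding t_def by (rule mat_diag_mult_left) simp
  have "addrow_mat n a i j * (addrow_mat n b i j * t) = addrow a i j (addrow_mat n b i j * t)"
   by (rule addrow_mat[symmetric, of _ n n]) (use ij tc in auto)
  also have "... = t * addrow_mat n b i j"
   unfolding xt tx
  proof (rule eq_matI)
   fix r c assume "r < dim_row (mat n n (%(r, c). f r * addrow_mat n b i j $$ (r, c)))"
    "c < dim_col (mat n n (%(r, c). f r * addrow_mat n b i j $$ (r, c)))"
   hence rc: "r < n" "c < n" by auto
   have x: "addrow_mat n b i j $$ (r', c) = (if r' = c then 1 else if r' = i & c = j then b else 0)"
    if "r' < n" for r' using addrow_mat_index[OF that rc(2) ij(3)] .
   show "addrow a i j (mat n n (%(r, c). addrow_mat n b i j $$ (r, c) * f c)) $$ (r, c) =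
     mat n n (%(r, c). f r * addrow_mat n b i j $$ (r, c)) $$ (r, c)"
    using rc ij by (simp add: x f_def ab)
  qed auto
  finally show ?thesis by (simp add: b_def)
 qed
 have xc: "?x : sq_mat n" "adj_mat ?x : sq_mat n" "adj_mat t : sq_mat n"
  using SL_mat SL_adj(1) xS tS by auto
 have "t * ?x * adj_mat t * adj_mat ?x = addrow_mat n a i j * (?x * (t * (adj_mat t * adj_mat ?x)))"
  unfolding e using tc xc by (simp add: assoc_sq[of _ n] mult_sq)
 also have "... = addrow_mat n a i j"
  using SL_adj_cancel(1)[OF tS xc(2)] SL_adj[OF xS] by simp
 finally have "addrow_mat n a i j = t * ?x * adj_mat t * adj_mat ?x" ..
 moreover have "blk n D t" if "D \<subseteq> {..n}" for D using that by (auto simp: blk_def t_def mat_diag_def)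
 moreover have "blk n D t" for D by (auto simp: blk_def t_def mat_diag_def)
 ultimately show ?thesis using tS by blast
qed

text \<open>One inclusion is \<open>commutator_Hgrp\<close>. For the other, each generating
  transvection is a commutator with a diagonal matrix, which lies in every standard P.\<close>

theorem derived_parabolic:
 assumes k: "k : SLc n" and D: "D \<subseteq> {..n}"
 shows "derived (SL n) (parabolic n (cj k ` unitri n) D) = cj k ` Hgrp n D"
proof -
 let ?G = "SL n" and ?P = "cj k ` Pgrp n D"
 have PS: "Pgrp n D \<subseteq> carrier ?G" by (auto simp: Pgrp_def)
 have comm: "cj k p * cj k q * inv\<^bsub>?G\<^esub> (cj k p) * inv\<^bsub>?G\<^esub> (cj k q) = cj k (p * q * adj_mat p * adj_mat q)"
  if pq: "p : carrier ?G" "q : carrier ?G" for p q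
 proof -
  have inv: "inv\<^bsub>?G\<^esub> (cj k x) = cj k (adj_mat x)" if x: "x : carrier ?G" for x
  proof (rule group.inv_equality[OF SL_group])
   show "cj k (adj_mat x) \<otimes>\<^bsub>SL n\<^esub> cj k x = \<one>\<^bsub>SL n\<^esub>"
    using cj_mult[OF k SL_mat[OF SL_adj(1)[OF x]] SL_mat[OF x]] SL_adj[OF x] cj_one[OF k] by simp
  qed (use x cj_SL[OF k] SL_adj(1)[OF x] in auto)
  have c: "p : sq_mat n" "q : sq_mat n" "adj_mat p : sq_mat n" "adj_mat q : sq_mat n"
   using SL_mat SL_adj(1) pq by auto
  show ?thesis unfolding inv[OF pq(1)] inv[OF pq(2)]
    cj_mult[OF k mult_sq[OF mult_sq[OF c(1,2)] c(3)] c(4)] cj_mult[OF k mult_sq[OF c(1,2)] c(3)]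
    cj_mult[OF k c(1,2)] ..
 qed
 show ?thesis
  unfolding derived_def parabolic_conj[OF k D]
 proof
  show "generate ?G (derived_set ?G ?P) \<subseteq> cj k ` Hgrp n D"
  proof (rule group.generate_subgroup_incl[OF SL_group _ Hgrp_subgroup[OF k D]])
   show "derived_set ?G ?P \<subseteq> cj k ` Hgrp n D"
   proof
    fix x assume "x : derived_set ?G ?P"
    then obtain p q where pq: "p : Pgrp n D" "q : Pgrp n D"
     "x = cj k p * cj k q * inv\<^bsub>?G\<^esub> (cj k p) * inv\<^bsub>?G\<^esub> (cj k q)" by auto
    hence "x = cj k (p * q * adj_mat p * adj_mat q)" using comm PS by (metis subsetD)
    thus "x : cj k ` Hgrp n D" using commutator_Hgrp[OF D pq(1,2)] by blast
   qed
  qed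
  show "cj k ` Hgrp n D \<subseteq> generate ?G (derived_set ?G ?P)"
  proof
   fix x assume "x : cj k ` Hgrp n D"
   then obtain h where h: "h : tgen n (allowed D)" "x = cj k h" using Hgrp_tgen[OF D] by blast
   have "cj k h : generate ?G (derived_set ?G ?P)"
    using h(1)
   proof (induction rule: tgen.induct)
    case one
    show ?case unfolding cj_one[OF k] using generate.one[of ?G] by simp
   next
    case (step g i j a)
    obtain t where t: "t : carrier ?G" "!!D. blk n D t"
     "addrow_mat n a i j = t * addrow_mat n (a / 3) i j * adj_mat t * adj_mat (addrow_mat n (a / 3) i j)"
     using addrow_commutator[OF step.hyps(2-4), of a] by blast
    let ?x = "addrow_mat n (a / 3) i j"
    have xP: "?x : Pgrp n D" using Hgrp_elem[OF D step.hyps(2-5)] by (auto simp: Hgrp_def Pgrp_def)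
    have tP: "t : Pgrp n D" using t by (simp add: Pgrp_def)
    have "cj k (addrow_mat n a i j) = cj k t * cj k ?x * inv\<^bsub>?G\<^esub> (cj k t) * inv\<^bsub>?G\<^esub> (cj k ?x)"
     unfolding t(3) by (rule comm[symmetric]) (use xP tP PS in auto)
    also have "... : derived_set ?G ?P" using xP tP by auto
    finally have "cj k (addrow_mat n a i j) : generate ?G (derived_set ?G ?P)" by (rule generate.incl)
    from generate.eng[OF this step.IH] show ?case
     using cj_mult[OF k addrow_mat_carrier tgen_carrier[OF step.hyps(1)]] by simp
   qed
   thus "x : generate ?G (derived_set ?G ?P)" using h by simp
  qed
 qed
qed

text \<open>The image under \<open>x\<close> of the coordinate subspace of dimension e is stable
  under \<open>Hgrp n D\<close>, hence under the unitriangular group, so it is that coordinate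
  subspace itself. If e were not in \<open>D\<close>, the transvection at (e, e - 1) would lie in
  \<open>Hgrp n D\<close> and move it. Used in both directions, this shows that groups of different
  types are not conjugate.\<close>

lemma Hgrp_conj_eq:
 assumes D: "D : flag_types n" and E: "E : flag_types n" and x: "x : SLc n"
  and eq: "Hgrp n D = cj x ` Hgrp n E"
 shows "E \<subseteq> D"
proof
 fix e assume e: "e : E"
 have Dn: "D \<subseteq> {..n}" "E \<subseteq> {..n}" using D E by (auto simp: flag_types_def)
 have en: "e <= n" "0 < e" using e E by (auto simp: flag_types_def)
 note xc = SL_mat[OF x]
 let ?W = "(%y. x *v y) ` lowv n e"
 have st: "h *v w : ?W" if h: "h : Hgrp n D" and w: "w : ?W" for h w
 proof -
  obtain g where g: "g : Hgrp n E" "h = cj x g" using h eq by blast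
  obtain y where y: "y : lowv n e" "w = x *v y" using w by blast
  have gc: "g : sq_mat n" "blk n {e} g" using g e by (auto simp: Hgrp_def SL_mat blk_def)
  have "h *v w = x *v (g *v y)"
   unfolding g y using y by (intro cj_vec[OF x gc(1)]) (simp add: lowv_def)
  thus ?thesis using blk_lowv[OF gc(1) en(1)] gc y by blast
 qed
 have "EX d<=n. ?W = lowv n d"
  by (rule unitri_stable[OF vsub_image[OF vsub_lowv xc]]) (rule st[OF unitri_Hgrp[OF Dn(1)]])
 then obtain d where d: "d <= n" "?W = lowv n d" by blast
 have "linear_dim n ?W = e" using linear_dim_lowv[OF xc _ en(1)] x by (simp add: SL_carrier)
 moreover have "linear_dim n (lowv n d) = d"
 proof -
  have "(%y. 1\<^sub>m n *v y) ` lowv n d = lowv n d" by (force simp: lowv_def)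
  thus ?thesis using linear_dim_lowv[of "1\<^sub>m n" n d] d by simp
 qed
 ultimately have W: "?W = lowv n e" using d by simp
 show "e : D"
 proof (rule ccontr)
  assume eD: "e ~: D"
  hence ne: "e < n" using en D by (cases "e = n") (auto simp: flag_types_def)
  let ?h = "addrow_mat n (1 :: complex) e (e - 1)"
  have "allowed D e (e - 1)" unfolding allowed_def using eD en by (auto simp: le_less)
  hence hH: "?h : Hgrp n D" using ne en by (intro Hgrp_elem[OF Dn(1)]) auto
  hence "ALL y:lowv n e. ?h *v y : lowv n e" using st W by blast
  hence "blk n {e} ?h" using blk_lowv[of ?h n e] en by simp
  hence "ALL r c. e <= r & r < n & c < e --> ?h $$ (r, c) = 0" unfolding blk_def by blast
  from this[rule_format, of e "e - 1"] have "?h $$ (e, e - 1) = 0" using ne en by simp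
  thus False using ne en addrow_mat_index[of e n "e - 1" e "e - 1" "1 :: complex"] by (cases e) simp_all
 qed
qed

section \<open>Quivers\<close>

text \<open>Gauge transformations that may also act at the last vertex.\<close>

definition gauges :: "nat => (nat => complex mat) set" where
 "gauges n = {gamma. ALL i. 1 <= i & i <= n --> gamma i : carrier (SL i)}"

definition qact :: "nat => (nat => complex mat) => (nat => complex mat) => (nat => complex mat)" where
 "qact n gamma alpha = (\<lambda>i\<in>{1..<n}. gamma (Suc i) * alpha i * adj_mat (gamma i))"

definition qcoords :: "nat => ((nat => complex mat) => complex) set" where
 "qcoords n = {(%alpha. alpha i $$ (r, c)) | i r c. 1 <= i & i < n & r < i + 1 & c < i}"

lemma quiverD: "alpha : quivers n ==> 1 <= i ==> i < n ==> alpha i : carrier_mat (Suc i) i"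
 by (auto simp: quivers_def PiE_iff)

lemma quiver_eqI: "alpha : quivers n ==> beta : quivers n ==> (!!i. 1 <= i ==> i < n ==> alpha i = beta i) ==> alpha = beta"
 unfolding quivers_def by (erule (1) PiE_ext) auto

lemma gaugeD: "gamma : gauges n ==> 1 <= i ==> i <= n ==> gamma i : carrier (SL i)"
 by (simp add: gauges_def)

lemma gauge_mat: "gamma : gauges n ==> 1 <= i ==> i <= n ==> gamma i : carrier_mat i i"
 by (intro SL_mat gaugeD)

lemma gauge_adj_mat: "gamma : gauges n ==> 1 <= i ==> i <= n ==> adj_mat (gamma i) : carrier_mat i i"
 by (intro SL_mat SL_adj(1) gaugeD)

text \<open>Lets gauges carry a component at vertex 1, where \<open>component\<close> has the
  identity.\<close>

lemma SL1: "x : carrier (SL 1) ==> x = 1\<^sub>m 1"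
proof (rule eq_matI)
 assume x: "x : carrier (SL 1)"
 fix i j :: nat assume "i < dim_row (1\<^sub>m 1 :: complex mat)" "j < dim_col (1\<^sub>m 1 :: complex mat)"
 hence "i = 0" "j = 0" by auto
 moreover have "x $$ (0, 0) = 1" using x det_single[of x] by (simp add: SL_carrier)
 ultimately show "x $$ (i, j) = 1\<^sub>m 1 $$ (i, j)" by simp
qed (auto simp: SL_carrier)

lemma component_gauge: "g : quiver_group n ==> component n g : gauges n"
 by (auto simp: gauges_def component_def SL_one_closed quiver_group_def PiE_iff)

lemma component_last: "component n g n = 1\<^sub>m n"
 by (simp add: component_def)

lemma quiver_act_qact:
 assumes "g : quiver_group n"
 shows "quiver_act n g alpha = qact n (component n g) alpha"
 unfolding quiver_act_def qact_def
 using gaugeD[OF component_gauge[OF assms]] by (intro restrict_ext) (auto simp: SL_inv)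

lemma gauge_quiver_group:
 assumes gamma: "gamma : gauges n" and last: "gamma n = 1\<^sub>m n"
 shows "EX g:quiver_group n. ALL alpha. quiver_act n g alpha = qact n gamma alpha"
proof
 let ?g = "restrict gamma {2..<n}"
 show g: "?g : quiver_group n" using gaugeD[OF gamma] by (auto simp: quiver_group_def)
 have c: "component n ?g i = gamma i" if "1 <= i" "i <= n" for i
 proof -
  have "i = 1 | i = n | 2 <= i & i < n" using that by linarith
  thus ?thesis
  proof (elim disjE)
   assume "i = 1"
   thus ?thesis using SL1[of "gamma 1"] gaugeD[OF gamma, of 1] that by (simp add: component_def)
  qed (auto simp: component_def last)
 qed
 show "ALL alpha. quiver_act n ?g alpha = qact n gamma alpha"
  unfolding quiver_act_qact[OF g] qact_def using c by (auto intro!: restrict_ext)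
qed

lemma qact_closed: "gamma : gauges n ==> alpha : quivers n ==> qact n gamma alpha : quivers n"
 unfolding quivers_def qact_def
proof (rule PiE_I)
 fix i assume a: "gamma : gauges n" "alpha : (\<Pi>\<^sub>E i\<in>{1..<n}. carrier_mat (i + 1) i)" and i: "i : {1..<n}"
 have "alpha i : carrier_mat (Suc i) i" using a(2) i by (auto simp: PiE_iff)
 hence "gamma (Suc i) * alpha i * adj_mat (gamma i) : carrier_mat (Suc i) i"
  using gauge_mat[OF a(1), of "Suc i"] gauge_adj_mat[OF a(1), of i] i by (intro mult_carrier_mat) auto
 thus "(\<lambda>i\<in>{1..<n}. gamma (Suc i) * alpha i * adj_mat (gamma i)) i : carrier_mat (i + 1) i" using i by simp
qed auto

lemma SL_adj_mult:
 assumes "g : SLc n" "h : SLc n"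
 shows "adj_mat (g * h) = adj_mat h * adj_mat g"
proof (rule SL_inv_unique[symmetric, OF SL_mult_closed[OF assms]])
 have c: "adj_mat h : sq_mat n" "adj_mat g : sq_mat n" "g : sq_mat n" "h : sq_mat n"
  using assms SL_mat SL_adj(1) by auto
 thus "adj_mat h * adj_mat g : sq_mat n" by simp
 have "adj_mat h * adj_mat g * (g * h) = adj_mat h * (adj_mat g * (g * h))"
  using c by (intro assoc_sq) auto
 thus "adj_mat h * adj_mat g * (g * h) = 1\<^sub>m n"
  using SL_adj_cancel(2)[OF assms(1) c(4)] SL_adj[OF assms(2)] by simp
qed

lemma gauge_mult: "gamma : gauges n ==> delta : gauges n ==> (%i. gamma i * delta i) : gauges n"
 by (auto simp: gauges_def SL_mult_closed)

lemma gauge_adj: "gamma : gauges n ==> (%i. adj_mat (gamma i)) : gauges n"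
 by (auto simp: gauges_def SL_adj(1))

lemma qact_mult:
 assumes gamma: "gamma : gauges n" and delta: "delta : gauges n" and alpha: "alpha : quivers n"
 shows "qact n gamma (qact n delta alpha) = qact n (%i. gamma i * delta i) alpha"
proof (rule quiver_eqI)
 show "qact n gamma (qact n delta alpha) : quivers n" "qact n (%i. gamma i * delta i) alpha : quivers n"
  using assms by (auto intro!: qact_closed gauge_mult)
 fix i assume i: "1 <= i" "i < n"
 let ?I = "Suc i"
 have c: "gamma ?I : carrier_mat ?I ?I" "delta ?I : carrier_mat ?I ?I" "alpha i : carrier_mat ?I i"
  "adj_mat (delta i) : carrier_mat i i" "adj_mat (gamma i) : carrier_mat i i"
  using i gauge_mat[OF gamma, of ?I] gauge_mat[OF delta, of ?I] quiverD[OF alpha] gauge_adj_mat[OF gamma] gauge_adj_mat[OF delta] by auto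
 have "gamma ?I * (delta ?I * alpha i * adj_mat (delta i)) * adj_mat (gamma i) =
   gamma ?I * delta ?I * alpha i * (adj_mat (delta i) * adj_mat (gamma i))"
 proof -
  have "gamma ?I * (delta ?I * alpha i * adj_mat (delta i)) = gamma ?I * (delta ?I * alpha i) * adj_mat (delta i)"
   using c by (intro assoc_mult_mat[symmetric, of _ ?I ?I _ i _ i]) auto
  also have "gamma ?I * (delta ?I * alpha i) = gamma ?I * delta ?I * alpha i"
   using c by (intro assoc_mult_mat[symmetric]) auto
  finally show ?thesis
   using c by (simp only:) (intro assoc_mult_mat[of _ ?I i _ i _ i], auto)
 qed
 also have "adj_mat (delta i) * adj_mat (gamma i) = adj_mat (gamma i * delta i)"
  using i by (intro SL_adj_mult[symmetric, of _ i] gaugeD[OF gamma] gaugeD[OF delta]) auto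
 finally show "qact n gamma (qact n delta alpha) i = qact n (%i. gamma i * delta i) alpha i"
  using i by (simp add: qact_def)
qed

lemma qact_cong: "(!!i. 1 <= i ==> i <= n ==> gamma i = delta i) ==> qact n gamma alpha = qact n delta alpha"
 unfolding qact_def by (intro restrict_ext) auto

lemma adj_one: "adj_mat (1\<^sub>m n) = (1\<^sub>m n :: complex mat)"
 using SL_adj(2)[OF SL_one_closed[of n]] SL_mat[OF SL_adj(1)[OF SL_one_closed[of n]]] by simp

lemma qact_one: "alpha : quivers n ==> qact n (%i. 1\<^sub>m i) alpha = alpha"
proof (rule quiver_eqI)
 assume a: "alpha : quivers n"
 show "qact n (%i. 1\<^sub>m i) alpha : quivers n" using a by (intro qact_closed) (auto simp: gauges_def SL_one_closed)
 fix i assume i: "1 <= i" "i < n"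
 thus "qact n (%i. 1\<^sub>m i) alpha i = alpha i" using quiverD[OF a i] by (simp add: qact_def adj_one)
qed

lemma qact_adj:
 assumes gamma: "gamma : gauges n" and alpha: "alpha : quivers n"
 shows "qact n (%i. adj_mat (gamma i)) (qact n gamma alpha) = alpha" "qact n gamma (qact n (%i. adj_mat (gamma i)) alpha) = alpha"
 unfolding qact_mult[OF gauge_adj[OF gamma] gamma alpha] qact_mult[OF gamma gauge_adj[OF gamma] alpha]
 using SL_adj[OF gaugeD[OF gamma]]
 by (auto intro!: trans[OF qact_cong qact_one[OF alpha]])

lemma pf_qcoord: "1 <= i ==> i < n ==> r < Suc i ==> c < i ==> pf X (qcoords n) (%alpha. alpha i $$ (r, c))"
 unfolding qcoords_def by (rule pf_coord, rule CollectI, intro exI[of _ i] exI[of _ r] exI[of _ c]) simp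

lemma pf_qact:
 assumes f: "pf (quivers n) (qcoords n) f" and gamma: "gamma : gauges n"
 shows "pf (quivers n) (qcoords n) (%alpha. f (qact n gamma alpha))"
proof (rule pf_compose[OF f qact_closed[OF gamma]])
 fix b assume "b : qcoords n"
 then obtain i r c where b: "b = (%alpha. alpha i $$ (r, c))" and i: "1 <= i" "i < n" "r < Suc i" "c < i"
  by (auto simp: qcoords_def)
 have "pf (quivers n) (qcoords n) (%alpha. (gamma (Suc i) * alpha i * adj_mat (gamma i)) $$ (r, c))"
 proof (rule pf_mat_mult[where n = "Suc i" and m = i and k = i])
  show "pf (quivers n) (qcoords n) (%alpha. (gamma (Suc i) * alpha i) $$ (r, c))" if "r < Suc i" "c < i" for r c
   by (rule pf_mat_mult[where n = "Suc i" and m = "Suc i" and k = i])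
    (use that i gauge_mat[OF gamma, of "Suc i"] quiverD in \<open>auto intro: pf_const pf_qcoord\<close>)
  show "gamma (Suc i) * alpha i : carrier_mat (Suc i) i" if "alpha : quivers n" for alpha
   using i gauge_mat[OF gamma, of "Suc i"] quiverD[OF that i(1,2)] by (intro mult_carrier_mat) auto
 qed (use i gauge_adj_mat[OF gamma] in \<open>auto intro: pf_const\<close>)
 thus "pf (quivers n) (qcoords n) (%alpha. b (qact n gamma alpha))"
  unfolding b using i by (simp add: qact_def)
qed

text \<open>The composite of the j arrows that start at vertex d, from C^d to C^(d+j).\<close>

fun chain :: "(nat => complex mat) => nat => nat => complex mat" where
 "chain alpha d 0 = 1\<^sub>m d"
| "chain alpha d (Suc j) = alpha (d + j) * chain alpha d j"

lemma chain_carrier: "alpha : quivers n ==> 1 <= d ==> d + j <= n ==> chain alpha d j : carrier_mat (d + j) d"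
proof (induction j)
 case (Suc j)
 hence "alpha (d + j) : carrier_mat (Suc (d + j)) (d + j)" by (intro quiverD) auto
 thus ?case using Suc by (auto intro!: mult_carrier_mat)
qed simp

lemma chain_add:
 assumes "alpha : quivers n" "1 <= d" "d + i + j <= n"
 shows "chain alpha d (i + j) = chain alpha (d + i) j * chain alpha d i"
 using assms(3)
proof (induction j)
 case 0
 thus ?case using chain_carrier[OF assms(1,2), of i] by simp
next
 case (Suc j)
 have c: "alpha (d + i + j) : carrier_mat (Suc (d + i + j)) (d + i + j)"
  "chain alpha (d + i) j : carrier_mat (d + i + j) (d + i)" "chain alpha d i : carrier_mat (d + i) d"
  using Suc.prems assms by (auto intro!: quiverD chain_carrier)
 have "alpha (d + i + j) * (chain alpha (d + i) j * chain alpha d i) = alpha (d + i + j) * chain alpha (d + i) j * chain alpha d i"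
  using c by (intro assoc_mult_mat[symmetric]) auto
 thus ?case using Suc by (simp add: add.assoc)
qed

lemma chain_qact:
 assumes gamma: "gamma : gauges n" and alpha: "alpha : quivers n" and d: "1 <= d" "d + j <= n"
 shows "chain (qact n gamma alpha) d j = gamma (d + j) * chain alpha d j * adj_mat (gamma d)"
 using d(2)
proof (induction j)
 case 0
 thus ?case using SL_adj[OF gaugeD[OF gamma d(1)]] gauge_mat[OF gamma d(1)] by simp
next
 case (Suc j)
 let ?k = "d + j"
 have c: "gamma (Suc ?k) : carrier_mat (Suc ?k) (Suc ?k)" "alpha ?k : carrier_mat (Suc ?k) ?k"
  "adj_mat (gamma ?k) : carrier_mat ?k ?k" "gamma ?k : carrier_mat ?k ?k" "chain alpha d j : carrier_mat ?k d"
  "adj_mat (gamma d) : carrier_mat d d" "gamma ?k : carrier (SL ?k)"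
  using Suc.prems d by (auto intro!: gauge_mat[OF gamma] gauge_adj_mat[OF gamma] quiverD[OF alpha] chain_carrier[OF alpha] gaugeD[OF gamma])
 have q: "qact n gamma alpha ?k = gamma (Suc ?k) * alpha ?k * adj_mat (gamma ?k)"
  using Suc.prems d by (simp add: qact_def)
 have IH: "chain (qact n gamma alpha) d j = gamma ?k * chain alpha d j * adj_mat (gamma d)" using Suc by simp
 have "chain (qact n gamma alpha) d (Suc j) = gamma (Suc ?k) * alpha ?k * adj_mat (gamma ?k) * (gamma ?k * chain alpha d j * adj_mat (gamma d))"
  unfolding chain.simps q IH ..
 also have "... = gamma (Suc ?k) * alpha ?k * (adj_mat (gamma ?k) * (gamma ?k * (chain alpha d j * adj_mat (gamma d))))"
 proof -
  have "gamma ?k * chain alpha d j * adj_mat (gamma d) = gamma ?k * (chain alpha d j * adj_mat (gamma d))"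
   using c by (intro assoc_mult_mat) auto
  thus ?thesis using c by (simp only:) (intro assoc_mult_mat[of _ "Suc ?k" ?k _ ?k _ d], auto)
 qed
 also have "adj_mat (gamma ?k) * (gamma ?k * (chain alpha d j * adj_mat (gamma d))) = chain alpha d j * adj_mat (gamma d)"
  using c by (intro SL_adj_cancel(2)[of _ ?k _ d]) auto
 also have "gamma (Suc ?k) * alpha ?k * (chain alpha d j * adj_mat (gamma d)) = gamma (Suc ?k) * alpha ?k * chain alpha d j * adj_mat (gamma d)"
  using c by (intro assoc_mult_mat[symmetric, of _ "Suc ?k" ?k _ d _ d]) auto
 also have "gamma (Suc ?k) * alpha ?k * chain alpha d j = gamma (Suc ?k) * chain alpha d (Suc j)"
  using c by (simp del: assoc_mult_mat) (intro assoc_mult_mat, auto)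
 finally show ?case by simp
qed

lemma pf_chain:
 assumes d: "1 <= d" "d + j <= n" and rc: "r < d + j" "c < d"
 shows "pf (quivers n) (qcoords n) (%alpha. chain alpha d j $$ (r, c))"
 using d(2) rc
proof (induction j arbitrary: r c)
 case 0
 thus ?case by (simp add: pf_const)
next
 case (Suc j)
 show ?case
  unfolding chain.simps
  by (rule pf_mat_mult[where n = "Suc (d + j)" and m = "d + j" and k = d])
   (use Suc d in \<open>auto intro!: quiverD pf_qcoord chain_carrier\<close>)
qed

text \<open>The basic invariants: in the composite from vertex d to vertex n the intermediate gauges
  cancel, and the gauge at d multiplies the minor by its determinant, one. On the normal forms
  \<open>pt\<close> they are minors of \<open>g\<close> or zero (\<open>qinv_pt\<close>).\<close>

definition qinv :: "nat => nat => (nat => nat) => (nat => complex mat) => complex" where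
 "qinv n d rho alpha = minor (chain alpha d (n - d)) d rho"

lemma pf_qinv:
 assumes "1 <= d" "d <= n" "!!i. i < d ==> rho i < n"
 shows "pf (quivers n) (qcoords n) (qinv n d rho)"
 unfolding qinv_def minor_def
 by (rule pf_det[where d = d]) (use assms in \<open>auto intro!: pf_chain\<close>)

lemma qinv_qact:
 assumes gamma: "gamma : gauges n" and alpha: "alpha : quivers n" and d: "1 <= d" "d <= n" and rho: "!!i. i < d ==> rho i < n"
 shows "qinv n d rho (qact n gamma alpha) = minor (gamma n * chain alpha d (n - d)) d rho"
proof -
 have cc: "chain alpha d (n - d) : carrier_mat n d" using chain_carrier[OF alpha d(1), of "n - d"] d by simp
 have a: "adj_mat (gamma d) : carrier (SL d)" using gaugeD[OF gamma d] by (rule SL_adj(1))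
 have "qinv n d rho (qact n gamma alpha) = minor (gamma n * chain alpha d (n - d) * adj_mat (gamma d)) d rho"
  unfolding qinv_def using chain_qact[OF gamma alpha d(1), of "n - d"] d by simp
 also have "... = minor (gamma n * chain alpha d (n - d)) d rho * minor (adj_mat (gamma d)) d id"
  using cc gauge_mat[OF gamma, of n] SL_mat[OF a] d rho
  by (intro minor_mult_block[of _ n d _ d]) auto
 also have "minor (adj_mat (gamma d)) d id = 1" using minor_full[OF SL_mat[OF a]] a by (simp add: SL_carrier)
 finally show ?thesis by simp
qed

definition pid :: "nat => nat => nat => complex mat" where
 "pid a b m = mat a b (%(i, j). if i = j & j < m then 1 else 0)"

lemma pid_carrier [simp]: "pid a b m : carrier_mat a b"
 by (simp add: pid_def)

lemma dim_pid [simp]: "dim_row (pid a b m) = a" "dim_col (pid a b m) = b"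
 by (simp_all add: pid_def)

lemma mult_pid:
 assumes "A : carrier_mat r a" "c <= a"
 shows "A * pid a c m = mat r c (%(i, j). if j < m then A $$ (i, j) else 0)"
proof (rule eq_matI)
 fix i j assume "i < dim_row (mat r c (%(i, j). if j < m then A $$ (i, j) else 0))"
  "j < dim_col (mat r c (%(i, j). if j < m then A $$ (i, j) else 0))"
 hence ij: "i < r" "j < c" by auto
 have "(A * pid a c m) $$ (i, j) = (SUM l<a. A $$ (i, l) * pid a c m $$ (l, j))"
  by (rule index_mult_sum[OF assms(1) pid_carrier ij])
 also have "... = (SUM l<a. if l = j then (if j < m then A $$ (i, j) else 0) else 0)"
  using ij assms by (intro sum.cong) (auto simp: pid_def)
 also have "... = (if j < m then A $$ (i, j) else 0)" using ij assms by simp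
 finally show "(A * pid a c m) $$ (i, j) = mat r c (%(i, j). if j < m then A $$ (i, j) else 0) $$ (i, j)"
  using ij by simp
qed (use assms in auto)

lemma pid_mult:
 assumes "A : carrier_mat c k" "c <= a"
 shows "pid a c m * A = mat a k (%(i, j). if i < c & i < m then A $$ (i, j) else 0)"
proof (rule eq_matI)
 fix i j assume "i < dim_row (mat a k (%(i, j). if i < c & i < m then A $$ (i, j) else 0))"
  "j < dim_col (mat a k (%(i, j). if i < c & i < m then A $$ (i, j) else 0))"
 hence ij: "i < a" "j < k" by auto
 have "(pid a c m * A) $$ (i, j) = (SUM l<c. pid a c m $$ (i, l) * A $$ (l, j))"
  by (rule index_mult_sum[OF pid_carrier assms(1) ij])
 also have "... = (SUM l<c. if l = i then (if i < m then A $$ (i, j) else 0) else 0)"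
  using ij assms by (intro sum.cong) (auto simp: pid_def)
 also have "... = (if i < c & i < m then A $$ (i, j) else 0)" using ij assms by simp
 finally show "(pid a c m * A) $$ (i, j) = mat a k (%(i, j). if i < c & i < m then A $$ (i, j) else 0) $$ (i, j)"
  using ij by simp
qed (use assms in auto)

text \<open>The rank of arrow i in a quiver of type \<open>D\<close>: the last member of
  \<open>D\<close> up to i, or 0 if there is none.\<close>

definition mm :: "nat set => nat => nat" where
 "mm D i = Max (insert 0 (D \<inter> {..i}))"

lemma mm_le: "mm D i <= i"
 unfolding mm_def by (subst Max_le_iff) auto

lemma mm_in: "mm D i : insert 0 D"
 using Max_in[of "insert 0 (D \<inter> {..i})"] unfolding mm_def by auto

lemma mm_self: "i : D ==> mm D i = i"
 unfolding mm_def by (rule Max_eqI) auto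

lemma mm_skip: "i ~: D ==> 1 <= i ==> mm D i = mm D (i - 1)"
proof -
 assume "i ~: D" "1 <= i"
 hence "D \<inter> {..i} = D \<inter> {..i - 1}" by (auto simp: le_less)
 thus ?thesis by (simp add: mm_def)
qed

lemma mm_mono: "i <= j ==> mm D i <= mm D j"
 unfolding mm_def by (rule Max_mono) auto

lemma mm_cong: "(!!e. e <= i ==> e : D \<longleftrightarrow> e : E) ==> mm D i = mm E i"
proof -
 assume "!!e. e <= i ==> e : D \<longleftrightarrow> e : E"
 hence "D \<inter> {..i} = E \<inter> {..i}" by auto
 thus ?thesis by (simp add: mm_def)
qed

definition qE :: "nat => nat set => (nat => complex mat)" where
 "qE n D = (\<lambda>i\<in>{1..<n}. pid (Suc i) i (mm D i))"

lemma qE_quiver: "qE n D : quivers n"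
 by (auto simp: qE_def quivers_def)

lemma chain_qE:
 assumes "1 <= d" "d + Suc j <= n"
 shows "chain (qE n D) d (Suc j) = pid (d + Suc j) d (mm D d)"
 using assms(2)
proof (induction j)
 case 0
 thus ?case using assms right_mult_one_mat[OF pid_carrier, of "Suc d" d "mm D d"] by (simp add: qE_def)
next
 case (Suc j)
 let ?k = "d + Suc j"
 have IH: "chain (qE n D) d (Suc j) = pid ?k d (mm D d)" using Suc by (simp del: chain.simps)
 have q: "qE n D ?k = pid (Suc ?k) ?k (mm D ?k)" using Suc.prems assms by (simp add: qE_def)
 have "chain (qE n D) d (Suc (Suc j)) = pid (Suc ?k) ?k (mm D ?k) * pid ?k d (mm D d)"
  unfolding chain.simps(2)[of _ d "Suc j"] IH q ..
 also have "... = pid (Suc ?k) d (mm D d)"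
  using mm_mono[of d ?k D] mm_le[of D ?k]
  by (subst mult_pid) (auto simp: pid_def intro!: eq_matI)
 finally show ?case by simp
qed

definition topg :: "nat => complex mat => nat => complex mat" where
 "topg n h = (%i. if i = n then h else 1\<^sub>m i)"

lemma topg_gauge: "h : SLc n ==> topg n h : gauges n"
 by (auto simp: topg_def gauges_def SL_one_closed)

text \<open>\<open>g\<close> acts at vertex n, where the group of the quotient does not act, so it
  can tell orbits apart.\<close>

definition pt :: "nat => nat set => complex mat => (nat => complex mat)" where
 "pt n D g = qact n (topg n g) (qE n D)"

lemma pt_quiver: "g : SLc n ==> pt n D g : quivers n"
 unfolding pt_def by (intro qact_closed topg_gauge qE_quiver)

lemma qinv_pt:
 assumes g: "g : SLc n" and d: "1 <= d" "d < n" and rho: "!!i. i < d ==> rho i < n"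
 shows "qinv n d rho (pt n D g) = (if d : D then minor g d rho else 0)"
proof -
 \<comment> \<open>At least one arrow is composed, so \<open>chain_qE\<close> applies; the empty
   composite would be the full identity.\<close>
 obtain j where j: "n - d = Suc j" using d by (metis Suc_diff_Suc)
 have dj: "d + Suc j = n" using j d by simp
 have cE: "chain (qE n D) d (n - d) = pid n d (mm D d)"
  unfolding j using chain_qE[of d j n D] d unfolding dj by (simp del: chain.simps)
 have "qinv n d rho (pt n D g) = minor (g * pid n d (mm D d)) d rho"
  unfolding pt_def using qinv_qact[OF topg_gauge[OF g] qE_quiver d(1) _ rho] d cE by (simp add: topg_def)
 also have "g * pid n d (mm D d) = mat n d (%(i, j). if j < mm D d then g $$ (i, j) else 0)"
  using SL_mat[OF g] d by (intro mult_pid) auto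
 also have "minor ... d rho = (if d : D then minor g d rho else 0)"
 proof (cases "d : D")
  case True
  thus ?thesis unfolding minor_def using rho mm_self[OF True]
   by (auto intro!: arg_cong[of _ _ det] eq_matI)
 next
  case False
  hence m: "mm D d <= d - 1" using mm_skip[OF False d(1)] mm_le[of D "d - 1"] by simp
  let ?M = "mat d d (%(i, j). mat n d (%(i, j). if j < mm D d then g $$ (i, j) else 0) $$ (rho i, j))"
  have "det ?M = (SUM i<d. ?M $$ (i, d - 1) * cofactor ?M i (d - 1))"
   by (rule laplace_expansion_column) (use d in auto)
  also have "... = 0" using m d rho by (intro sum.neutral) auto
  finally show ?thesis using False by (simp add: minor_def)
 qed
 finally show ?thesis .
qed

lemma det_dsum:
 "a : carrier_mat k k ==> b : carrier_mat m m ==> det (dsum k m a b) = det a * det b"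
 unfolding dsum_def by (rule det_four_block_mat_lower_left_zero) auto

text \<open>An element of \<open>Hgrp n D\<close> extends to a gauge \<open>delta\<close> that fixes
  \<open>qE n D\<close>: at vertex i take its leading block of size \<open>mm D i\<close>, completed
  by the identity. Its action at vertex n can therefore be exchanged for one at the other
  vertices.\<close>

lemma pt_Hgrp:
 assumes D: "D : flag_types n" and g: "g : SLc n" and h: "h : Hgrp n D"
 shows "EX gamma:gauges n. gamma n = 1\<^sub>m n & pt n D (g * h) = qact n gamma (pt n D g)"
proof -
 have Dn: "D \<subseteq> {..n}" "n : D" "0 ~: D" using D by (auto simp: flag_types_def)
 have hS: "h : SLc n" using h by (simp add: Hgrp_def)
 define delta where "delta = (%i. mat i i (%(r, c). if r < mm D i & c < mm D i then h $$ (r, c) else if r = c then 1 else 0))"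
 have deltan: "delta n = h" using mm_self[OF Dn(2)] SL_mat[OF hS] by (intro eq_matI) (auto simp: delta_def)
 have deltaS: "delta i : carrier (SL i)" if "i <= n" for i
 proof -
  let ?m = "mm D i"
  have m: "?m <= i" by (rule mm_le)
  have "delta i = dsum ?m (i - ?m) (tl_blk ?m h) (1\<^sub>m (i - ?m))"
   using m by (intro eq_matI) (auto simp: delta_def dsum_def tl_blk_def)
  hence "det (delta i) = det (tl_blk ?m h)"
   by (simp add: det_dsum tl_blk_def)
  also have "... = minor h ?m id" by (simp add: tl_blk_def minor_def)
  also have "... = 1" using mm_in[of D i] h by (auto simp: Hgrp_def minor_def)
  finally show ?thesis by (simp add: SL_carrier delta_def)
 qed
 have deltaG: "delta : gauges n" using deltaS by (simp add: gauges_def)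
 have comm: "delta (Suc i) * pid (Suc i) i (mm D i) = pid (Suc i) i (mm D i) * delta i" if i: "1 <= i" "i < n" for i
 proof -
  let ?m = "mm D i" and ?M = "mm D (Suc i)"
  have c: "delta i : carrier_mat i i" "delta (Suc i) : carrier_mat (Suc i) (Suc i)" by (auto simp: delta_def)
  have mi: "?m <= i" by (rule mm_le)
  have e: "(if s < ?m then delta (Suc i) $$ (r, s) else 0) = (if r < i & r < ?m then delta i $$ (r, s) else 0)"
   if rs: "r < Suc i" "s < i" for r s
  proof (cases "s < ?m")
   case True
   have "?M = ?m | ?M = Suc i" using mm_skip[of "Suc i" D] mm_self[of "Suc i" D] by (cases "Suc i : D") auto
   moreover have "h $$ (r, s) = 0" if "?m <= r"
   proof -
    have "?m : D" using mm_in[of D i] True by auto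
    thus ?thesis using h that True rs i unfolding Hgrp_def blk_def by auto
   qed
   ultimately show ?thesis using True rs mi by (auto simp: delta_def)
  next
   case False
   thus ?thesis using rs mi by (auto simp: delta_def)
  qed
  show ?thesis
   unfolding mult_pid[OF c(2) le_SucI[OF le_refl]] pid_mult[OF c(1) le_SucI[OF le_refl]]
   using e by (intro eq_matI) auto
 qed
 have fixE: "qact n delta (qE n D) = qE n D"
 proof (rule quiver_eqI[OF qact_closed[OF deltaG qE_quiver] qE_quiver])
  fix i assume i: "1 <= i" "i < n"
  have c: "delta i : carrier_mat i i" "adj_mat (delta i) : carrier_mat i i"
   using gauge_mat[OF deltaG] gauge_adj_mat[OF deltaG] i by auto
  have "qact n delta (qE n D) i = pid (Suc i) i (mm D i) * delta i * adj_mat (delta i)"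
   using i comm[OF i] by (simp add: qact_def qE_def)
  also have "... = pid (Suc i) i (mm D i) * (delta i * adj_mat (delta i))"
   using c by (intro assoc_mult_mat[of _ "Suc i" i _ i]) auto
  also have "... = qE n D i" using SL_adj[OF deltaS[of i]] i right_mult_one_mat[of "pid (Suc i) i (mm D i)" "Suc i" i]
   by (simp add: qE_def)
  finally show "qact n delta (qE n D) i = qE n D i" .
 qed
 define gamma where "gamma = (%i. if i = n then 1\<^sub>m n else adj_mat (delta i))"
 have gammaG: "gamma : gauges n" using gauge_adj[OF deltaG] SL_one_closed by (auto simp: gauges_def gamma_def)
 have gh: "g * h : SLc n" using g hS by (rule SL_mult_closed)
 have "qE n D = qact n (%i. adj_mat (delta i)) (qE n D)" using qact_adj(1)[OF deltaG qE_quiver[of n D]] fixE by simp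
 hence "pt n D (g * h) = qact n (topg n (g * h)) (qact n (%i. adj_mat (delta i)) (qE n D))"
  unfolding pt_def by simp
 also have "... = qact n (%i. topg n (g * h) i * adj_mat (delta i)) (qE n D)"
  by (rule qact_mult[OF topg_gauge[OF gh] gauge_adj[OF deltaG] qE_quiver])
 also have "... = qact n (%i. gamma i * topg n g i) (qE n D)"
 proof (rule qact_cong)
  fix i assume i: "1 <= i" "i <= n"
  show "topg n (g * h) i * adj_mat (delta i) = gamma i * topg n g i"
  proof (cases "i = n")
   case True
   have "g * h * adj_mat h = g * (h * adj_mat h)"
    using SL_mat g hS SL_adj(1)[OF hS] by (intro assoc_sq) auto
   thus ?thesis using True deltan SL_adj[OF hS] SL_mat[OF g] by (simp add: topg_def gamma_def)
  next
   case False
   thus ?thesis using gauge_adj_mat[OF deltaG i] by (simp add: topg_def gamma_def)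
  qed
 qed
 also have "... = qact n gamma (pt n D g)"
  unfolding pt_def by (rule qact_mult[OF gammaG topg_gauge[OF g] qE_quiver, symmetric])
 finally show ?thesis using gammaG by (intro bexI[of _ gamma]) (auto simp: gamma_def)
qed

text \<open>The matrix g^-1 g' has the same minors as the identity at the sizes in \<open>D\<close>.
  Replacing a row of its leading block by a lower row gives minor zero, so the first d entries of
  that lower row are annihilated by the adjugate of the leading block; as this block is invertible,
  they vanish.\<close>

lemma minors_Hgrp:
 assumes D: "D : flag_types n" and g: "g : SLc n" and g': "g' : SLc n"
  and eq: "!!d rho. d : D ==> d < n ==> (!!i. i < d ==> rho i < n) ==> minor g d rho = minor g' d rho"
 shows "adj_mat g * g' : Hgrp n D"
proof -
 have Dn: "D \<subseteq> {..n}" "0 ~: D" using D by (auto simp: flag_types_def)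
 define h where "h = adj_mat g * g'"
 have hS: "h : SLc n" unfolding h_def using SL_mult_closed SL_adj(1) g g' by blast
 note ac = SL_mat[OF SL_adj(1)[OF g]]
 have m: "minor h d rho = minor (1\<^sub>m n) d rho" if d: "d : D" "d < n" and rho: "!!i. i < d ==> rho i < n" for d rho
 proof -
  have "minor h d rho = (SUM kappa:rowsel n d. (PROD i:{0..<d}. adj_mat g $$ (rho i, kappa i)) * minor g' d kappa)"
   unfolding h_def using d rho by (intro minor_mult[OF ac SL_mat[OF g']]) auto
  also have "... = (SUM kappa:rowsel n d. (PROD i:{0..<d}. adj_mat g $$ (rho i, kappa i)) * minor g d kappa)"
   using eq[OF d] rowsel_less by (intro sum.cong refl) metis
  also have "... = minor (adj_mat g * g) d rho"
   using d rho by (intro minor_mult[OF ac SL_mat[OF g], symmetric]) auto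
  finally show ?thesis using SL_adj[OF g] by simp
 qed
 have one: "1\<^sub>m n : Hgrp n D" by (rule Hgrp_one[OF Dn(1)])
 have "minor h d id = 1" if d: "d : D" for d
 proof (cases "d < n")
  case True
  thus ?thesis using m[OF d True, of id] one d by (simp add: Hgrp_def)
 next
  case False
  hence "d = n" using d Dn by auto
  thus ?thesis using minor_full[OF SL_mat[OF hS]] hS by (simp add: SL_carrier)
 qed
 moreover have "blk n {d} h" if d: "d : D" for d
 proof (cases "d < n")
  case True
  let ?A = "mat d d (%(i, j). h $$ (i, j))"
  have "h $$ (r, c) = 0" if r: "d <= r" "r < n" and c: "c < d" for r c
  proof -
   have z: "(SUM k<d. h $$ (r, k) * cofactor ?A c' k) = 0" if c': "c' < d" for c'
   proof -
    have rho: "(id(c' := r)) i < n" if "i < d" for i using that r True by auto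
    have "minor h d (id(c' := r)) = minor (1\<^sub>m n) d (id(c' := r))" by (rule m[OF d True rho])
    also have "... = (SUM k<d. 1\<^sub>m n $$ (r, k) * cofactor (mat d d (%(i, j). 1\<^sub>m n $$ (i, j))) c' k)"
     by (rule minor_replace_row[OF c'])
    also have "... = 0" using r True by (intro sum.neutral) auto
    finally show ?thesis using minor_replace_row[OF c', of h r] by simp
   qed
   have Ac: "?A : carrier_mat d d" by simp
   have dA: "det ?A = 1" using m[OF d True, of id] one d True by (simp add: Hgrp_def minor_def)
   have "h $$ (r, c) = (SUM k<d. h $$ (r, k) * (adj_mat ?A * ?A) $$ (k, c))"
   proof -
    have "(SUM k<d. h $$ (r, k) * (adj_mat ?A * ?A) $$ (k, c)) = (SUM k<d. if k = c then h $$ (r, c) else 0)"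
     unfolding adj_mat(3)[OF Ac] dA using c by (intro sum.cong) auto
    thus ?thesis using c by simp
   qed
   also have "... = (SUM k<d. SUM l<d. h $$ (r, k) * (adj_mat ?A $$ (k, l) * ?A $$ (l, c)))"
    using c by (intro sum.cong refl) (subst index_mult_sum[OF adj_mat(1)[OF Ac] Ac], auto simp: sum_distrib_left)
   also have "... = (SUM l<d. (SUM k<d. h $$ (r, k) * cofactor ?A l k) * ?A $$ (l, c))"
    by (subst sum.swap) (auto simp: sum_distrib_right adj_mat_def mult.assoc intro!: sum.cong)
   also have "... = 0" using z by (intro sum.neutral) auto
   finally show ?thesis .
  qed
  thus ?thesis by (auto simp: blk_def)
 next
  case False
  hence "d = n" using d Dn by auto
  thus ?thesis by (auto simp: blk_def)
 qed
 hence "blk n D h" unfolding blk_def by blast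
 ultimately show ?thesis using hS by (simp add: Hgrp_def h_def)
qed

section \<open>Normal forms of quivers\<close>

text \<open>The first m columns are made unit vectors one after another by transvections that fix
  the previous ones. As m < N there is always a second row to work with, so determinant one can be
  kept.\<close>

lemma reduce_pid:
 assumes B: "B : carrier_mat N c" and m: "m <= c" "m < N"
  and z: "!!i j. i < N ==> m <= j ==> j < c ==> B $$ (i, j) = 0"
  and inj: "!!x. x : lowv c m ==> B *v x = 0\<^sub>v N ==> x = 0\<^sub>v c"
 shows "EX g:carrier (SL N). g * B = pid N c m"
proof -
 have "EX g:carrier (SL N). ALL j<k. ALL i<N. (g * B) $$ (i, j) = (if i = j then 1 else 0)" if "k <= m" for k
  using that
 proof (induction k)
  case 0
  thus ?case using SL_one_closed by auto
 next
  case (Suc k)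
  then obtain g where g: "g : carrier (SL N)" "!!i j. j < k ==> i < N ==> (g * B) $$ (i, j) = (if i = j then 1 else 0)"
   by auto
  have gc: "g : carrier_mat N N" using g(1) by (rule SL_mat)
  have gB: "g * B : carrier_mat N c" using gc B by simp
  have kc: "k < c" using Suc.prems m by simp
  define w where "w = (%j. vec N (%i. (g * B) $$ (i, j)))"
  have wc: "w j : carrier_vec N" for j by (simp add: w_def)
  define v where "v = w k"
  have vc: "v : carrier_vec N" by (simp add: v_def wc)
  have vi: "v $ i = (g * B) $$ (i, k)" if "i < N" for i using that by (simp add: v_def w_def)
  have "EX l. k <= l & l < N & v $ l ~= 0"
  proof (rule ccontr)
   assume "~ ?thesis"
   hence v0: "v $ l = 0" if "k <= l" "l < N" for l using that by auto
   \<comment> \<open>Column k would be a combination of the previous columns, which gives a kernel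
     vector supported in the first m coordinates.\<close>
   define x where "x = vec c (%i. if i = k then 1 else if i < k then - v $ i else 0)"
   have xc: "x : carrier_vec c" by (simp add: x_def)
   have xl: "x : lowv c m" using Suc.prems by (auto simp: x_def lowv_def)
   have "(g * B) *v x = 0\<^sub>v N"
   proof (rule eq_vecI)
    fix i assume "i < dim_vec (0\<^sub>v N :: complex vec)"
    hence i: "i < N" by simp
    have "((g * B) *v x) $ i = (SUM l<c. (g * B) $$ (i, l) * x $ l)"
     by (rule index_mult_vec_sum[OF gB xc i])
    also have "... = (SUM l<c. (if l = k then v $ i else 0) + (if l = i then (if i < k then - v $ i else 0) else 0))"
    proof (rule sum.cong[OF refl])
     fix l assume "l : {..<c}"
     hence l: "l < c" by simp
     consider "l < k" | "l = k" | "k < l" by linarith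
     thus "(g * B) $$ (i, l) * x $ l = (if l = k then v $ i else 0) + (if l = i then (if i < k then - v $ i else 0) else 0)"
     proof cases
      case 1
      thus ?thesis using g(2)[OF 1 i] l by (auto simp: x_def)
     next
      case 2
      thus ?thesis using vi[OF i] kc by (auto simp: x_def)
     next
      case 3
      thus ?thesis using l by (auto simp: x_def)
     qed
    qed
    also have "... = v $ i + (if i < k then - v $ i else 0)"
     using kc by (auto simp: sum.distrib)
    also have "... = 0" using v0[OF _ i] by auto
    finally show "((g * B) *v x) $ i = 0\<^sub>v N $ i" using i by simp
   qed (use gc in simp)
   hence "g *v (B *v x) = 0\<^sub>v N" using assoc_mult_mat_vec[OF gc B xc] by simp
   hence "adj_mat g *v (g *v (B *v x)) = adj_mat g *v 0\<^sub>v N" by simp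
   hence "B *v x = 0\<^sub>v N"
    using SL_vec_cancel(2)[OF g(1), of "B *v x"] B xc SL_mat[OF SL_adj(1)[OF g(1)]]
    by (auto simp: index_mult_mat_vec intro!: eq_vecI)
   hence "x $ k = 0" using inj[OF xl] kc by simp
   thus False using kc by (simp add: x_def)
  qed
  then obtain l where l: "k <= l" "l < N" "v $ l ~= 0" by blast
  have kN: "Suc k < N" using Suc.prems m by simp
  obtain y where y: "y : tgen N (%i j. k <= j & j < N & i < N)" "y *v v = unit_vec N k"
   using tgen_unit[OF vc kN le_refl l] by auto
  have yc: "y : carrier_mat N N" using y(1) by (rule tgen_carrier)
  have fixu: "y *v unit_vec N j = unit_vec N j" if "j < k" for j
   by (rule tgen_fix_unit[OF y(1) that]) (use kN in simp)
  have cm: "y * g * B = y * (g * B)" using yc gc B by (intro assoc_mult_mat) auto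
  have "(y * g * B) $$ (i, j) = (if i = j then 1 else 0)" if ij: "j < Suc k" "i < N" for i j
  proof -
   have jc: "j < c" using ij kc by simp
   have "(y * g * B) $$ (i, j) = (SUM l<N. y $$ (i, l) * w j $ l)"
    unfolding cm index_mult_sum[OF yc gB ij(2) jc] by (intro sum.cong) (auto simp: w_def)
   also have "... = (y *v w j) $ i" by (rule index_mult_vec_sum[OF yc wc ij(2), symmetric])
   also have "w j = (if j = k then v else unit_vec N j)"
   proof (cases "j = k")
    case False
    hence "j < k" using ij by simp
    hence "w j = unit_vec N j" using g(2)[of j] kN by (intro eq_vecI) (auto simp: w_def)
    thus ?thesis using False by simp
   qed (simp add: v_def)
   finally show ?thesis using fixu[of j] y(2) ij kN by (cases "j = k") auto
  qed
  moreover have "y * g : carrier (SL N)" using SL_mult_closed tgen_SL[OF y(1)] g(1) by blast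
  ultimately show ?case by blast
 qed
 from this[OF le_refl] obtain g where g: "g : carrier (SL N)"
  "!!i j. j < m ==> i < N ==> (g * B) $$ (i, j) = (if i = j then 1 else 0)" by blast
 have "g * B = pid N c m"
 proof (rule eq_matI)
  fix i j assume "i < dim_row (pid N c m)" "j < dim_col (pid N c m)"
  hence ij: "i < N" "j < c" by auto
  show "(g * B) $$ (i, j) = pid N c m $$ (i, j)"
  proof (cases "j < m")
   case True
   thus ?thesis using g(2)[OF True ij(1)] ij by (simp add: pid_def)
  next
   case False
   have "(g * B) $$ (i, j) = (SUM l<N. g $$ (i, l) * B $$ (l, j))"
    by (rule index_mult_sum[OF SL_mat[OF g(1)] B ij])
   also have "... = 0" using z False ij by (intro sum.neutral) auto
   finally show ?thesis using False ij by (simp add: pid_def)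
  qed
 qed (use SL_mat[OF g(1)] B in auto)
 thus ?thesis using g(1) by blast
qed

definition minj :: "complex mat => bool" where
 "minj A \<longleftrightarrow> (ALL x:carrier_vec (dim_col A). A *v x = 0\<^sub>v (dim_row A) --> x = 0\<^sub>v (dim_col A))"

text \<open>The image of the arrow into vertex i; at vertex 1, where no arrow ends, it is
  zero.\<close>

definition qim :: "(nat => complex mat) => nat => complex vec set" where
 "qim beta i = (if i <= 1 then {0\<^sub>v i} else (%z. beta (i - 1) *v z) ` carrier_vec (i - 1))"

text \<open>The alternative for polystable quivers: arrow i is injective, or the image of the
  previous arrow and the kernel of arrow i span C^i and meet in zero only, both expressed through
  values of arrow i.\<close>

definition pstab :: "nat => (nat => complex mat) => bool" where
 "pstab n beta \<longleftrightarrow> (ALL i. 1 <= i & i < n --> minj (beta i) |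
  (ALL x:carrier_vec i. EX y:qim beta i. beta i *v x = beta i *v y) &
  (ALL y:qim beta i. beta i *v y = 0\<^sub>v (Suc i) --> y = 0\<^sub>v i))"

lemma pid_vec:
 assumes "u : carrier_vec c" "i < a"
 shows "(pid a c m *v u) $ i = (if i < c & i < m then u $ i else 0)"
proof -
 have "(pid a c m *v u) $ i = (SUM l<c. pid a c m $$ (i, l) * u $ l)"
  by (rule index_mult_vec_sum[OF pid_carrier assms])
 also have "... = (SUM l<c. if l = i then (if i < m then u $ i else 0) else 0)"
  using assms by (intro sum.cong) (auto simp: pid_def)
 finally show ?thesis by simp
qed

lemma mult_vec_zero: "A : carrier_mat r c ==> A *v 0\<^sub>v c = 0\<^sub>v r"
 by (intro eq_vecI) (auto simp: index_mult_mat_vec)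

text \<open>\<open>B\<close> is arrow j in the coordinates reached so far. If it is injective, a
  gauge at the next vertex suffices and j joins \<open>E\<close>. Otherwise the image of the
  previous arrow is the span of the first m coordinates (\<open>to_low\<close>,
  \<open>from_low\<close>), and the gauge at j is corrected so that the kernel becomes the span of
  the remaining coordinates while that image stays fixed pointwise; the earlier arrows keep their
  form.\<close>

lemma normal_form_step:
 assumes beta: "beta : quivers n" and ps: "pstab n beta" and j: "1 <= j" "j < n"
  and gamma: "!!i. 1 <= i ==> i <= j ==> gamma i : carrier (SL i)" and E: "E \<subseteq> {1..<j}"
  and nf: "!!i. 1 <= i ==> i < j ==> gamma (Suc i) * beta i = pid (Suc i) i (mm E i) * gamma i"
 shows "EX gamma E. (ALL i. 1 <= i & i <= Suc j --> gamma i : carrier (SL i)) & E \<subseteq> {1..<Suc j} &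
  (ALL i. 1 <= i & i < Suc j --> gamma (Suc i) * beta i = pid (Suc i) i (mm E i) * gamma i)"
proof -
 have bj: "beta j : carrier_mat (Suc j) j" using quiverD[OF beta j] .
 have gj: "gamma j : carrier (SL j)" using gamma j by simp
 have gc: "gamma j : carrier_mat j j" "adj_mat (gamma j) : carrier_mat j j" using SL_mat SL_adj(1) gj by auto
 define B where "B = beta j * adj_mat (gamma j)"
 have B: "B : carrier_mat (Suc j) j" using bj gc by (simp add: B_def)
 have Bg: "B * gamma j = beta j"
 proof -
  have "B * gamma j = beta j * (adj_mat (gamma j) * gamma j)" unfolding B_def using bj gc by (intro assoc_mult_mat) auto
  thus ?thesis using SL_adj[OF gj] bj by simp
 qed
 have Bv: "B *v x = beta j *v (adj_mat (gamma j) *v x)" if "x : carrier_vec j" for x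
  unfolding B_def by (rule assoc_mult_mat_vec[OF bj gc(2) that])
 have jE: "j ~: E" using E by auto
 show ?thesis
 proof (cases "minj (beta j)")
  case True
  have inj: "x = 0\<^sub>v j" if x: "x : carrier_vec j" "B *v x = 0\<^sub>v (Suc j)" for x
  proof -
   have ax: "adj_mat (gamma j) *v x : carrier_vec j" using gc x by simp
   have "ALL y:carrier_vec j. beta j *v y = 0\<^sub>v (Suc j) --> y = 0\<^sub>v j"
    using True bj unfolding minj_def by auto
   hence "adj_mat (gamma j) *v x = 0\<^sub>v j" using Bv[OF x(1)] x(2) ax by simp
   hence "gamma j *v (adj_mat (gamma j) *v x) = gamma j *v 0\<^sub>v j" by simp
   thus ?thesis using SL_vec_cancel(1)[OF gj x(1)] mult_vec_zero[OF gc(1)] by simp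
  qed
  obtain g where g: "g : carrier (SL (Suc j))" "g * B = pid (Suc j) j j"
   using reduce_pid[OF B le_refl lessI] inj by (auto simp: lowv_def)
  have gB: "g * beta j = pid (Suc j) j j * gamma j"
  proof -
   have "g * beta j = g * (B * gamma j)" by (simp only: Bg)
   also have "... = g * B * gamma j" using SL_mat[OF g(1)] B gc by (intro assoc_mult_mat[symmetric]) auto
   finally show ?thesis using g(2) by simp
  qed
  let ?gamma = "gamma(Suc j := g)" and ?E = "insert j E"
  have mE: "mm ?E i = mm E i" if "i < j" for i using that by (intro mm_cong) auto
  show ?thesis
  proof (intro exI[of _ ?gamma] exI[of _ ?E] conjI allI impI)
   show "?E \<subseteq> {1..<Suc j}" using E j by auto
   fix i
   show "1 <= i & i <= Suc j ==> ?gamma i : carrier (SL i)" using gamma g by (auto simp: le_Suc_eq)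
   assume i: "1 <= i & i < Suc j"
   show "?gamma (Suc i) * beta i = pid (Suc i) i (mm ?E i) * ?gamma i"
    using i gB mm_self[of j ?E] mE[of i] nf[of i] by (cases "i = j") auto
  qed
 next
  case False
  hence onto: "!!x. x : carrier_vec j ==> EX y:qim beta j. beta j *v x = beta j *v y"
   and inj0: "!!y. y : qim beta j ==> beta j *v y = 0\<^sub>v (Suc j) ==> y = 0\<^sub>v j"
   using ps j unfolding pstab_def by blast+
  define m where "m = mm E j"
  have m': "m = mm E (j - 1)" unfolding m_def by (rule mm_skip[OF jE j(1)])
  have mj: "m <= j - 1" unfolding m' by (rule mm_le)
  hence mj': "m < j" using j by simp
  have to_low: "gamma j *v y : lowv j m & y : carrier_vec j" if y: "y : qim beta j" for y
  proof (cases "j = 1")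
   case True
   hence "y = 0\<^sub>v j" using y by (simp add: qim_def)
   thus ?thesis using mult_vec_zero[OF gc(1)] by (auto simp: lowv_def)
  next
   case False
   hence j1: "1 <= j - 1" "j - 1 < j" "Suc (j - 1) = j" using j by auto
   obtain z where z: "z : carrier_vec (j - 1)" "y = beta (j - 1) *v z" using y False j by (auto simp: qim_def)
   have c: "beta (j - 1) : carrier_mat j (j - 1)" "gamma (j - 1) : carrier_mat (j - 1) (j - 1)"
    using quiverD[OF beta j1(1) less_trans[OF j1(2) j(2)], unfolded j1(3)]
     SL_mat[OF gamma[OF j1(1) less_imp_le[OF j1(2)]]] by blast+
   have "gamma j *v y = (gamma j * beta (j - 1)) *v z" unfolding z using gc c z by (intro assoc_mult_mat_vec[symmetric]) auto
   also have "gamma j * beta (j - 1) = pid j (j - 1) m * gamma (j - 1)" using nf[OF j1(1,2)] j1(3) m' by simp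
   also have "... *v z = pid j (j - 1) m *v (gamma (j - 1) *v z)" using c z by (intro assoc_mult_mat_vec) auto
   finally have "gamma j *v y = pid j (j - 1) m *v (gamma (j - 1) *v z)" .
   moreover have "gamma (j - 1) *v z : carrier_vec (j - 1)" using c z by simp
   moreover have "pid j (j - 1) m *v u : lowv j m" if "u : carrier_vec (j - 1)" for u
   proof -
    have "pid j (j - 1) m *v u : carrier_vec j" by (rule mult_mat_vec_carrier[OF pid_carrier that])
    thus ?thesis unfolding lowv_def using pid_vec[OF that] by simp
   qed
   moreover have "y : carrier_vec j" unfolding z(2) using c(1) z(1) by (rule mult_mat_vec_carrier)
   ultimately show ?thesis by simp
  qed
  have from_low: "adj_mat (gamma j) *v w : qim beta j" if w: "w : lowv j m" for w
  proof (cases "j = 1")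
   case True
   hence "w = 0\<^sub>v j" using w mj by (intro eq_vecI) (auto simp: lowv_def)
   thus ?thesis using mult_vec_zero[OF gc(2)] True by (simp add: qim_def)
  next
   case False
   hence j1: "1 <= j - 1" "j - 1 < j" "Suc (j - 1) = j" using j by auto
   have g1: "gamma (j - 1) : carrier (SL (j - 1))" using gamma[OF j1(1)] by simp
   have c: "beta (j - 1) : carrier_mat j (j - 1)" "gamma (j - 1) : carrier_mat (j - 1) (j - 1)"
    "adj_mat (gamma (j - 1)) : carrier_mat (j - 1) (j - 1)"
    using quiverD[OF beta j1(1) less_trans[OF j1(2) j(2)], unfolded j1(3)]
     SL_mat[OF g1] SL_mat[OF SL_adj(1)[OF g1]] by blast+
   define u where "u = vec (j - 1) (%i. w $ i)"
   define z where "z = adj_mat (gamma (j - 1)) *v u"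
   have uc: "u : carrier_vec (j - 1)" by (simp add: u_def)
   have zc: "z : carrier_vec (j - 1)" using c uc by (simp add: z_def)
   have wc: "w : carrier_vec j" using w by (simp add: lowv_def)
   have "gamma j *v (beta (j - 1) *v z) = (gamma j * beta (j - 1)) *v z" using gc c zc by (intro assoc_mult_mat_vec[symmetric]) auto
   also have "gamma j * beta (j - 1) = pid j (j - 1) m * gamma (j - 1)" using nf[OF j1(1,2)] j1(3) m' by simp
   also have "... *v z = pid j (j - 1) m *v (gamma (j - 1) *v z)" using c zc by (intro assoc_mult_mat_vec) auto
   also have "gamma (j - 1) *v z = u" unfolding z_def by (rule SL_vec_cancel(1)[OF g1 uc])
   also have "pid j (j - 1) m *v u = w"
    using w mj wc uc by (intro eq_vecI) (auto simp: pid_vec lowv_def, auto simp: u_def)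
   finally have "gamma j *v (beta (j - 1) *v z) = w" .
   hence "adj_mat (gamma j) *v w = beta (j - 1) *v z"
    using SL_vec_cancel(2)[OF gj, of "beta (j - 1) *v z"] c zc by auto
   thus ?thesis using zc False j by (auto simp: qim_def)
  qed
  have lc: "w : lowv j m ==> w : carrier_vec j" for w by (simp add: lowv_def)
  have ontoB: "EX w:lowv j m. B *v x = B *v w" if x: "x : carrier_vec j" for x
  proof -
   have "adj_mat (gamma j) *v x : carrier_vec j" using gc x by simp
   from onto[OF this] obtain y where y: "y : qim beta j" "beta j *v (adj_mat (gamma j) *v x) = beta j *v y" by blast
   have yl: "gamma j *v y : lowv j m" "y : carrier_vec j" using to_low[OF y(1)] by auto
   have "B *v (gamma j *v y) = beta j *v y" using Bv[OF lc[OF yl(1)]] SL_vec_cancel(2)[OF gj yl(2)] by simp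
   thus ?thesis using y Bv[OF x] yl by (intro bexI[of _ "gamma j *v y"]) auto
  qed
  have injB: "w = 0\<^sub>v j" if w: "w : lowv j m" "B *v w = 0\<^sub>v (Suc j)" for w
  proof -
   have "adj_mat (gamma j) *v w = 0\<^sub>v j" using inj0[OF from_low[OF w(1)]] Bv[OF lc[OF w(1)]] w(2) by simp
   hence "gamma j *v (adj_mat (gamma j) *v w) = 0\<^sub>v j" using mult_vec_zero[OF gc(1)] by simp
   thus ?thesis using SL_vec_cancel(1)[OF gj lc[OF w(1)]] by simp
  qed
  \<comment> \<open>e_c and \<open>Y c\<close> have the same value under \<open>B\<close>, so their
    difference lies in the kernel; these differences become the last columns of
    \<open>v\<close>.\<close>
  have "ALL c. EX w. w : lowv j m & B *v unit_vec j c = B *v w"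
   using ontoB[OF unit_vec_carrier] by blast
  then obtain Y where Y: "!!c. Y c : lowv j m" "!!c. B *v unit_vec j c = B *v Y c"
   by metis
  text \<open>A unipotent change of basis that moves the kernel to a coordinate subspace.\<close>
  define v where "v = mat j j (%(r, c). (if r = c then 1 else 0) - (if c < m then 0 else Y c $ r))"
  have vc: "v : carrier_mat j j" by (simp add: v_def)
  have vl: "v $$ (r, c) = (if r = c then 1 else 0)" if "c < m | m <= r" "r < j" "c < j" for r c
   using that Y(1)[of c] by (auto simp: v_def lowv_def)
  have "upper_triangular v"
  proof (rule upper_triangularI)
   fix r c assume rc: "c < r" "r < dim_row v"
   hence "r < j" "c < j" using vc by auto
   thus "v $$ (r, c) = 0" using vl[of c r] rc by (cases "c < m") auto
  qed
  hence "det v = prod_list (diag_mat v)" by (rule det_upper_triangular[OF _ vc])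
  also have "... = (PROD i = 0..<dim_row v. v $$ (i, i))" by (rule prod_list_diag_prod)
  also have "... = 1"
  proof (rule prod.neutral, rule ballI)
   fix i assume "i : {0..<dim_row v}"
   hence "i < j" using vc by simp
   thus "v $$ (i, i) = 1" using vl[of i i] by (cases "i < m") auto
  qed
  finally have vS: "v : carrier (SL j)" using vc by (simp add: SL_carrier)
  note av = SL_adj[OF vS]
  have avc: "adj_mat v : carrier_mat j j" using av(1) by (rule SL_mat)
  have vcol: "v *v unit_vec j c = col v c" if "c < j" for c
   using that vc by (intro eq_vecI) (auto simp: index_mult_mat_vec)
  have vlow: "v *v w = w" if w: "w : lowv j m" for w
  proof (rule eq_vecI)
   fix i assume "i < dim_vec w"
   hence i: "i < j" using lc[OF w] by simp
   have "(v *v w) $ i = (SUM l<j. v $$ (i, l) * w $ l)" by (rule index_mult_vec_sum[OF vc lc[OF w] i])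
   also have "... = (SUM l<j. if l = i then w $ i else 0)"
   proof (rule sum.cong[OF refl])
    fix l assume "l : {..<j}"
    thus "v $$ (i, l) * w $ l = (if l = i then w $ i else 0)"
     using vl[of l i] i w by (cases "l < m") (auto simp: lowv_def)
   qed
   finally show "(v *v w) $ i = w $ i" using i by simp
  qed (use lc[OF w] vc in auto)
  define B' where "B' = B * v"
  have B': "B' : carrier_mat (Suc j) j" using B vc by (simp add: B'_def)
  have B'v: "B' *v x = B *v (v *v x)" if "x : carrier_vec j" for x
   unfolding B'_def by (rule assoc_mult_mat_vec[OF B vc that])
  have Bz: "B' $$ (i, c) = 0" if ic: "i < Suc j" "m <= c" "c < j" for i c
  proof -
   have "v *v unit_vec j c = unit_vec j c - Y c"
    unfolding vcol[OF ic(3)] using ic lc[OF Y(1)[of c]] by (intro eq_vecI) (auto simp: v_def)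
   hence "B' *v unit_vec j c = B *v (unit_vec j c - Y c)" using B'v[of "unit_vec j c"] by simp
   also have "... = B *v unit_vec j c - B *v Y c"
    by (rule mult_minus_distrib_mat_vec[OF B unit_vec_carrier lc[OF Y(1)]])
   also have "... = 0\<^sub>v (Suc j)" using Y(2)[of c] B lc[OF Y(1)[of c]] by simp
   finally have "(B' *v unit_vec j c) $ i = 0" using ic by simp
   thus ?thesis using ic B' by (simp add: index_mult_mat_vec)
  qed
  obtain g where g: "g : carrier (SL (Suc j))" "g * B' = pid (Suc j) j m"
  proof -
   have "EX g:carrier (SL (Suc j)). g * B' = pid (Suc j) j m"
   proof (rule reduce_pid[OF B'])
    fix x assume "x : lowv j m" "B' *v x = 0\<^sub>v (Suc j)"
    thus "x = 0\<^sub>v j" using injB B'v[OF lc] vlow by simp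
   qed (use mj' Bz in auto)
   thus ?thesis using that by blast
  qed
  define g' where "g' = adj_mat v * gamma j"
  have g'S: "g' : carrier (SL j)" unfolding g'_def by (rule SL_mult_closed[OF av(1) gj])
  have top: "g * beta j = pid (Suc j) j m * g'"
  proof -
   have "B = B' * adj_mat v"
    unfolding B'_def using B vc avc av assoc_mult_mat[OF B vc avc] by simp
   hence "beta j = B' * adj_mat v * gamma j" using Bg by simp
   also have "... = B' * g'" unfolding g'_def using B' avc gc by (intro assoc_mult_mat) auto
   finally have "g * beta j = g * (B' * g')" by simp
   also have "... = g * B' * g'" using SL_mat[OF g(1)] B' SL_mat[OF g'S] by (intro assoc_mult_mat[symmetric]) auto
   finally show ?thesis using g(2) by simp
  qed
  have low: "g' * beta (j - 1) = pid j (j - 1) m * gamma (j - 1)" if j1: "j ~= 1"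
  proof -
   have j1: "1 <= j - 1" "j - 1 < j" "Suc (j - 1) = j" using j j1 by auto
   have c: "beta (j - 1) : carrier_mat j (j - 1)" "gamma (j - 1) : carrier_mat (j - 1) (j - 1)"
    using quiverD[OF beta j1(1) less_trans[OF j1(2) j(2)], unfolded j1(3)]
     SL_mat[OF gamma[OF j1(1) less_imp_le[OF j1(2)]]] by blast+
   have vp: "v * pid j (j - 1) m = pid j (j - 1) m"
    using vl mj by (subst mult_pid[OF vc]) (auto simp: pid_def intro!: eq_matI)
   have "adj_mat v * pid j (j - 1) m = pid j (j - 1) m"
    using SL_adj_cancel(2)[OF vS pid_carrier, of "j - 1" m] vp by simp
   moreover have "g' * beta (j - 1) = adj_mat v * (gamma j * beta (j - 1))"
    unfolding g'_def using avc gc c by (intro assoc_mult_mat) auto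
   moreover have "gamma j * beta (j - 1) = pid j (j - 1) m * gamma (j - 1)" using nf[OF j1(1,2)] j1(3) m' by simp
   moreover have "adj_mat v * (pid j (j - 1) m * gamma (j - 1)) = adj_mat v * pid j (j - 1) m * gamma (j - 1)"
    using avc c by (intro assoc_mult_mat[symmetric]) auto
   ultimately show ?thesis by simp
  qed
  let ?gamma = "gamma(j := g', Suc j := g)"
  show ?thesis
  proof (intro exI[of _ ?gamma] exI[of _ E] conjI allI impI)
   show "E \<subseteq> {1..<Suc j}" using E by auto
   fix i
   show "1 <= i & i <= Suc j ==> ?gamma i : carrier (SL i)" using gamma g g'S by (auto simp: le_Suc_eq)
   assume i: "1 <= i & i < Suc j"
   consider "i = j" | "i = j - 1" "j ~= 1" "i ~= j" | "i < j - 1" using i by linarith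
   thus "?gamma (Suc i) * beta i = pid (Suc i) i (mm E i) * ?gamma i"
   proof cases
    case 1
    thus ?thesis using top m_def by simp
   next
    case 2
    hence "Suc i = j" using i by auto
    thus ?thesis using low[OF 2(2)] 2 m' by auto
   next
    case 3
    thus ?thesis using nf[of i] i by auto
   qed
  qed
 qed
qed

theorem normal_form:
 assumes n: "1 <= n" and beta: "beta : quivers n" and ps: "pstab n beta"
 shows "EX gamma:gauges n. EX D:flag_types n. beta = qact n gamma (qE n D)"
proof -
 have "EX gamma E. (ALL i. 1 <= i & i <= j --> gamma i : carrier (SL i)) & E \<subseteq> {1..<j} &
  (ALL i. 1 <= i & i < j --> gamma (Suc i) * beta i = pid (Suc i) i (mm E i) * gamma i)" if "1 <= j" "j <= n" for j
  using that
 proof (induction j)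
  case (Suc j)
  show ?case
  proof (cases "j = 0")
   case True
   thus ?thesis by (intro exI[of _ "%i. 1\<^sub>m i"] exI[of _ "{}"]) (auto simp: SL_one_closed)
  next
   case False
   hence j: "1 <= j" "j < n" "j <= n" using Suc.prems by auto
   obtain gamma E where gammaE: "ALL i. 1 <= i & i <= j --> gamma i : carrier (SL i)" "E \<subseteq> {1..<j}"
    "ALL i. 1 <= i & i < j --> gamma (Suc i) * beta i = pid (Suc i) i (mm E i) * gamma i"
    using Suc.IH[OF j(1,3)] by blast
   show ?thesis
    by (rule normal_form_step[OF beta ps j(1,2) _ gammaE(2)]) (use gammaE in blast)+
  qed
 qed simp
 from this[OF n le_refl] obtain gamma E where gamma: "gamma : gauges n" and E: "E \<subseteq> {1..<n}"
  and nf: "!!i. 1 <= i ==> i < n ==> gamma (Suc i) * beta i = pid (Suc i) i (mm E i) * gamma i"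
  by (auto simp: gauges_def)
 let ?D = "insert n E"
 have D: "?D : flag_types n" using E n by (auto simp: flag_types_def)
 have "qact n gamma beta = qE n ?D"
 proof (rule quiver_eqI[OF qact_closed[OF gamma beta] qE_quiver])
  fix i assume i: "1 <= i" "i < n"
  have "gamma i : carrier (SL i)" using gaugeD[OF gamma] i by simp
  note g = this SL_adj[OF this] SL_mat[OF this] SL_mat[OF SL_adj(1)[OF this]]
  have "qact n gamma beta i = pid (Suc i) i (mm E i) * gamma i * adj_mat (gamma i)" using i nf by (simp add: qact_def)
  also have "... = pid (Suc i) i (mm E i) * (gamma i * adj_mat (gamma i))" using g by (intro assoc_mult_mat) auto
  also have "... = pid (Suc i) i (mm E i)" using g right_mult_one_mat[OF pid_carrier, of "Suc i" i "mm E i"] by simp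
  also have "mm E i = mm ?D i" using i by (intro mm_cong) auto
  finally show "qact n gamma beta i = qE n ?D i" using i by (simp add: qE_def)
 qed
 hence "beta = qact n (%i. adj_mat (gamma i)) (qE n ?D)" using qact_adj(1)[OF gamma beta] by simp
 thus ?thesis using gauge_adj[OF gamma] D by blast
qed

section \<open>Degeneration of quivers\<close>

definition G1 :: "nat => (nat => complex mat) set" where
 "G1 n = {gamma : gauges n. gamma n = 1\<^sub>m n}"

text \<open>The Zariski closure of the orbit, described by the polynomials that vanish on the orbit;
  \<open>polystable_iff\<close> links it to the topology.\<close>

definition qclos :: "nat => (nat => complex mat) => (nat => complex mat) set" where
 "qclos n alpha = {beta : quivers n. ALL f. pf (quivers n) (qcoords n) f --> (ALL gamma:G1 n. f (qact n gamma alpha) = 0) --> f beta = 0}"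

lemma G1_mult: "gamma : G1 n ==> delta : G1 n ==> (%i. gamma i * delta i) : G1 n"
 by (auto simp: G1_def gauge_mult)

lemma G1_one: "(%i. 1\<^sub>m i) : G1 n"
 by (auto simp: G1_def gauges_def SL_one_closed)

lemma qclos_self: "alpha : quivers n ==> alpha : qclos n alpha"
 using G1_one[of n] qact_one[of alpha n] unfolding qclos_def by force

text \<open>A gauge acts polynomially and permutes the orbit, so it also preserves the
  closure.\<close>

lemma qclos_qact:
 assumes alpha: "alpha : quivers n" and beta: "beta : qclos n alpha" and gamma: "gamma : G1 n"
  and f: "pf (quivers n) (qcoords n) f" "!!gamma. gamma : G1 n ==> f (qact n gamma alpha) = 0"
 shows "f (qact n gamma beta) = 0"
proof -
 have g: "gamma : gauges n" using gamma by (simp add: G1_def)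
 have "pf (quivers n) (qcoords n) (%alpha. f (qact n gamma alpha))" by (rule pf_qact[OF f(1) g])
 moreover have "f (qact n gamma (qact n delta alpha)) = 0" if d: "delta : G1 n" for delta
 proof -
  have "delta : gauges n" using d by (simp add: G1_def)
  thus ?thesis unfolding qact_mult[OF g _ alpha] using f(2)[OF G1_mult[OF gamma d]] by (simp add: qact_mult[OF g _ alpha])
 qed
 ultimately show ?thesis using beta unfolding qclos_def by blast
qed

text \<open>The rank as the least inner dimension of a factorisation. Monotonicity under products is
  then immediate, and \<open>frank_drop\<close> modifies an optimal factorisation.\<close>

definition frank :: "complex mat => nat" where
 "frank A = (LEAST r. EX X:carrier_mat (dim_row A) r. EX Y:carrier_mat r (dim_col A). A = X * Y)"

lemma frank_le:
 assumes "A : carrier_mat a b" "X : carrier_mat a r" "Y : carrier_mat r b" "A = X * Y"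
 shows "frank A <= r"
 unfolding frank_def by (rule Least_le) (use assms in blast)

lemma frank_ex:
 assumes A: "A : carrier_mat a b"
 shows "EX X:carrier_mat a (frank A). EX Y:carrier_mat (frank A) b. A = X * Y"
proof -
 have "EX r. EX X:carrier_mat (dim_row A) r. EX Y:carrier_mat r (dim_col A). A = X * Y"
  using A right_mult_one_mat[OF A] by (intro exI[of _ b] bexI[of _ A] bexI[of _ "1\<^sub>m b"]) auto
 from LeastI_ex[OF this] show ?thesis using A by (simp add: frank_def)
qed

lemma frank_mult_right: "A : carrier_mat a b ==> Q : carrier_mat b c ==> frank (A * Q) <= frank A"
proof -
 assume A: "A : carrier_mat a b" and Q: "Q : carrier_mat b c"
 obtain X Y where XY: "X : carrier_mat a (frank A)" "Y : carrier_mat (frank A) b" "A = X * Y"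
  using frank_ex[OF A] by blast
 have "A * Q = X * (Y * Q)" using assoc_mult_mat[OF XY(1,2) Q] XY(3) by simp
 thus ?thesis using A Q XY by (intro frank_le[of _ a c X _ "Y * Q"]) auto
qed

lemma frank_mult_left: "A : carrier_mat a b ==> Q : carrier_mat c a ==> frank (Q * A) <= frank A"
proof -
 assume A: "A : carrier_mat a b" and Q: "Q : carrier_mat c a"
 obtain X Y where XY: "X : carrier_mat a (frank A)" "Y : carrier_mat (frank A) b" "A = X * Y"
  using frank_ex[OF A] by blast
 have "Q * A = Q * X * Y" using assoc_mult_mat[OF Q XY(1,2)] XY(3) by simp
 thus ?thesis using A Q XY by (intro frank_le[of _ c b "Q * X" _ Y]) auto
qed

text \<open>Wedderburn's rank reduction. For A = X Y put x = Y w and tau = theta X; then U = X - (A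
  w) tau satisfies U x = 0, and U Y is the reduced matrix. Since some x_l is nonzero, column l of U
  is a combination of the others, which saves one inner dimension.\<close>

lemma frank_drop:
 assumes A: "A : carrier_mat a b" and w: "w : carrier_vec b" and th: "(SUM i<a. theta i * (A *v w) $ i) = 1"
 shows "frank (mat a b (%(r, c). A $$ (r, c) - (A *v w) $ r * (SUM i<a. theta i * A $$ (i, c)))) < frank A"
proof -
 define k where "k = frank A"
 obtain X Y where XY: "X : carrier_mat a k" "Y : carrier_mat k b" "A = X * Y"
  using frank_ex[OF A] unfolding k_def by blast
 define x where "x = Y *v w"
 have xc: "x : carrier_vec k" using XY w by (simp add: x_def)
 have Xx: "X *v x = A *v w" unfolding x_def using assoc_mult_mat_vec[OF XY(1,2) w] XY(3) by simp
 define tau where "tau = (%l. SUM i<a. theta i * X $$ (i, l))"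
 have taux: "(SUM l<k. tau l * x $ l) = 1"
 proof -
  have "(SUM i<a. theta i * (X *v x) $ i) = (SUM i<a. SUM l<k. theta i * (X $$ (i, l) * x $ l))"
   by (intro sum.cong refl) (simp add: index_mult_vec_sum[OF XY(1) xc] sum_distrib_left)
  also have "... = (SUM l<k. tau l * x $ l)"
   unfolding tau_def by (subst sum.swap) (simp add: sum_distrib_right mult.assoc)
  finally show ?thesis using th Xx by simp
 qed
 have "EX l<k. x $ l ~= 0"
 proof (rule ccontr)
  assume "~ ?thesis"
  hence "(SUM l<k. tau l * x $ l) = 0" by (intro sum.neutral) auto
  thus False using taux by simp
 qed
 then obtain l where l: "l < k" "x $ l ~= 0" by blast
 \<comment> \<open>Enumerates the indices other than \<open>l\<close>.\<close>
 define ins where "ins = (%j. if j < l then j else Suc j)"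
 have bij: "bij_betw ins {..<k - 1} ({..<k} - {l})"
  by (rule bij_betw_byWitness[where f' = "%j. if j < l then j else j - 1"]) (use l in \<open>auto simp: ins_def\<close>)
 define U where "U = (%r j. X $$ (r, j) - (A *v w) $ r * tau j)"
 define V where "V = (%j c. Y $$ (j, c) - x $ j / x $ l * Y $$ (l, c))"
 let ?A = "mat a b (%(r, c). A $$ (r, c) - (A *v w) $ r * (SUM i<a. theta i * A $$ (i, c)))"
 let ?U = "mat a (k - 1) (%(r, j). U r (ins j))" and ?V = "mat (k - 1) b (%(j, c). V (ins j) c)"
 have "?A = ?U * ?V"
 proof (rule eq_matI)
  fix r c assume "r < dim_row (?U * ?V)" "c < dim_col (?U * ?V)"
  hence rc: "r < a" "c < b" by auto
  have Ux: "(SUM j<k. U r j * x $ j) = 0"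
  proof -
   have "(SUM j<k. U r j * x $ j) = (SUM j<k. X $$ (r, j) * x $ j) - (A *v w) $ r * (SUM j<k. tau j * x $ j)"
    by (simp add: U_def algebra_simps sum_subtractf sum_distrib_left)
   also have "(SUM j<k. X $$ (r, j) * x $ j) = (A *v w) $ r"
    using index_mult_vec_sum[OF XY(1) xc rc(1)] Xx by simp
   finally show ?thesis using taux by simp
  qed
  have UY: "(SUM j<k. U r j * Y $$ (j, c)) = A $$ (r, c) - (A *v w) $ r * (SUM i<a. theta i * A $$ (i, c))"
  proof -
   have Ae: "A $$ (i, c) = (SUM j<k. X $$ (i, j) * Y $$ (j, c))" if "i < a" for i
    using index_mult_sum[OF XY(1,2) that rc(2)] XY(3) by simp
   have "(SUM i<a. theta i * A $$ (i, c)) = (SUM i<a. SUM j<k. theta i * (X $$ (i, j) * Y $$ (j, c)))"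
    by (intro sum.cong refl) (simp add: Ae sum_distrib_left)
   also have "... = (SUM j<k. tau j * Y $$ (j, c))"
    unfolding tau_def by (subst sum.swap) (simp add: sum_distrib_right mult.assoc)
   finally have "(SUM i<a. theta i * A $$ (i, c)) = (SUM j<k. tau j * Y $$ (j, c))" .
   thus ?thesis unfolding Ae[OF rc(1)]
    by (simp add: U_def algebra_simps sum_subtractf sum_distrib_left)
  qed
  have "(?U * ?V) $$ (r, c) = (SUM j<k - 1. U r (ins j) * V (ins j) c)"
   using rc by (subst index_mult_sum[of _ a "k - 1" _ b]) auto
  also have "... = (SUM j:{..<k} - {l}. U r j * V j c)"
   using sum.reindex_bij_betw[OF bij, of "%j. U r j * V j c"] .
  also have "... = (SUM j<k. U r j * V j c)"
   using l by (intro sum.mono_neutral_left) (auto simp: V_def)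
  also have "... = (SUM j<k. U r j * Y $$ (j, c)) - Y $$ (l, c) / x $ l * (SUM j<k. U r j * x $ j)"
   by (simp add: V_def algebra_simps sum_subtractf sum_distrib_left)
  finally show "?A $$ (r, c) = (?U * ?V) $$ (r, c)" using rc Ux UY by simp
 qed auto
 hence "frank ?A <= k - 1" by (intro frank_le[of _ a b ?U _ ?V]) auto
 thus ?thesis using l unfolding k_def by simp
qed

section \<open>Rank-one matrices and one-parameter subgroups\<close>

definition oo :: "nat => complex vec => (nat => complex) => complex mat" where
 "oo N a eta = mat N N (%(r, c). a $ r * eta c)"

lemma oo_carrier [simp]: "oo N a eta : carrier_mat N N"
 by (simp add: oo_def)

lemma dim_oo [simp]: "dim_row (oo N a eta) = N" "dim_col (oo N a eta) = N"
 by (simp_all add: oo_def)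

lemma oo_mult:
 assumes "M : carrier_mat N k" "a : carrier_vec N" "r < N" "c < k"
 shows "(oo N a eta * M) $$ (r, c) = a $ r * (SUM l<N. eta l * M $$ (l, c))"
 using assms by (subst index_mult_sum[OF oo_carrier assms(1)]) (auto simp: oo_def sum_distrib_left mult.assoc)

lemma mult_oo:
 assumes "M : carrier_mat k N" "a : carrier_vec N" "r < k" "c < N"
 shows "(M * oo N a eta) $$ (r, c) = (M *v a) $ r * eta c"
 using assms by (subst index_mult_sum[OF assms(1) oo_carrier])
  (auto simp: oo_def sum_distrib_right mult.assoc index_mult_vec_sum[OF assms(1,2)])

lemma oo_oo:
 assumes "a : carrier_vec N" "b : carrier_vec N"
 shows "oo N a eta * oo N b xi = (SUM l<N. eta l * b $ l) \<cdot>\<^sub>m oo N a xi"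
proof (rule eq_matI)
 fix r c assume "r < dim_row ((SUM l<N. eta l * b $ l) \<cdot>\<^sub>m oo N a xi)" "c < dim_col ((SUM l<N. eta l * b $ l) \<cdot>\<^sub>m oo N a xi)"
 hence rc: "r < N" "c < N" by (auto simp: oo_def)
 thus "(oo N a eta * oo N b xi) $$ (r, c) = ((SUM l<N. eta l * b $ l) \<cdot>\<^sub>m oo N a xi) $$ (r, c)"
  using assms by (subst oo_mult[OF oo_carrier]) (auto simp: oo_def sum_distrib_left sum_distrib_right mult_ac)
qed (auto simp: oo_def)

text \<open>Conjugation by an element of SL(N) that takes \<open>u\<close> to e_0 makes the matrix
  upper triangular; \<open>2 <= N\<close> provides such an element.\<close>

lemma det_one_plus_oo:
 assumes N: "2 <= N" and u: "u : carrier_vec N" "u ~= 0\<^sub>v N"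
 shows "det (1\<^sub>m N + s \<cdot>\<^sub>m oo N u phi) = 1 + s * (SUM l<N. phi l * u $ l)"
proof -
 have "EX l<N. u $ l ~= 0"
 proof (rule ccontr)
  assume "~ ?thesis"
  hence "u = 0\<^sub>v N" using u by (intro eq_vecI) auto
  thus False using u by simp
 qed
 then obtain l where "l < N" "u $ l ~= 0" by blast
 then obtain z where z: "z : tgen N (%i j. 0 <= j & j < N & i < N)" "z *v u = unit_vec N 0"
  using tgen_unit[OF u(1), of 0 N l] N by auto
 have zS: "z : carrier (SL N)" using z(1) by (rule tgen_SL)
 have zc: "z : carrier_mat N N" "adj_mat z : carrier_mat N N" using SL_mat zS SL_adj(1) by auto
 define psi where "psi = (%c. SUM l<N. phi l * adj_mat z $$ (l, c))"
 let ?M = "1\<^sub>m N + s \<cdot>\<^sub>m oo N u phi" and ?e = "unit_vec N 0 :: complex vec"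
 have "z * ?M * adj_mat z = 1\<^sub>m N + s \<cdot>\<^sub>m oo N ?e psi"
 proof -
  have 1: "z * oo N u phi = oo N ?e phi"
  proof (rule eq_matI)
   fix r c assume "r < dim_row (oo N ?e phi)" "c < dim_col (oo N ?e phi)"
   hence "r < N" "c < N" by (auto simp: oo_def)
   thus "(z * oo N u phi) $$ (r, c) = oo N ?e phi $$ (r, c)"
    using mult_oo[OF zc(1) u(1), of r c phi] z(2) by (simp add: oo_def)
  qed (use zc in \<open>auto simp: oo_def\<close>)
  have 2: "oo N ?e phi * adj_mat z = oo N ?e psi"
  proof (rule eq_matI)
   fix r c assume "r < dim_row (oo N ?e psi)" "c < dim_col (oo N ?e psi)"
   hence "r < N" "c < N" by (auto simp: oo_def)
   thus "(oo N ?e phi * adj_mat z) $$ (r, c) = oo N ?e psi $$ (r, c)"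
    using oo_mult[OF zc(2) unit_vec_carrier, of r c 0 phi] by (simp add: oo_def psi_def)
  qed (use zc in \<open>auto simp: oo_def\<close>)
  have "z * ?M = z + s \<cdot>\<^sub>m oo N ?e phi"
   unfolding mult_add_distrib_mat[OF zc(1) one_carrier_mat smult_carrier_mat[OF oo_carrier]]
    mult_smult_distrib[OF zc(1) oo_carrier] 1 right_mult_one_mat[OF zc(1)] ..
  hence "z * ?M * adj_mat z = z * adj_mat z + s \<cdot>\<^sub>m (oo N ?e phi * adj_mat z)"
   using zc by (simp add: add_mult_distrib_mat[of _ N N] mult_smult_assoc_mat[of _ N N])
  thus ?thesis using 2 SL_adj[OF zS] by simp
 qed
 hence "det (z * ?M * adj_mat z) = det (1\<^sub>m N + s \<cdot>\<^sub>m oo N ?e psi)" by simp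
 moreover have "det (z * ?M * adj_mat z) = det ?M"
  using zc zS SL_adj(1)[OF zS] by (simp add: det_mult[of _ N] SL_carrier)
 moreover have "det (1\<^sub>m N + s \<cdot>\<^sub>m oo N ?e psi) = 1 + s * psi 0"
 proof -
  let ?T = "1\<^sub>m N + s \<cdot>\<^sub>m oo N ?e psi"
  have Tc: "?T : carrier_mat N N" by simp
  have T: "?T $$ (r, c) = (if r = c then 1 else 0) + (if r = 0 then s * psi c else 0)" if "r < N" "c < N" for r c
   using that by (simp add: oo_def)
  have "upper_triangular ?T"
  proof (rule upper_triangularI)
   fix i j assume "j < i" "i < dim_row ?T"
   thus "?T $$ (i, j) = 0" using T[of i j] by (simp add: oo_def)
  qed
  hence "det ?T = prod_list (diag_mat ?T)" by (rule det_upper_triangular[OF _ Tc])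
  also have "... = (PROD i = 0..<dim_row ?T. ?T $$ (i, i))" by (rule prod_list_diag_prod)
  also have "... = (PROD i:{0..<N}. if i = 0 then 1 + s * psi 0 else 1)"
   using T by (intro prod.cong) (auto simp: oo_def)
  also have "... = 1 + s * psi 0" using N by (subst prod.delta) auto
  finally show ?thesis .
 qed
 moreover have "psi 0 = (SUM l<N. phi l * u $ l)"
 proof -
  have "u = adj_mat z *v ?e" using SL_vec_cancel(2)[OF zS u(1)] z(2) by simp
  hence "u $ l = adj_mat z $$ (l, 0)" if "l < N" for l
   using that zc N by (simp add: index_mult_mat_vec)
  thus ?thesis unfolding psi_def by (intro sum.cong) auto
 qed
 ultimately show ?thesis by simp
qed

text \<open>
  One step of a degeneration: the one-parameter subgroup of \<open>SL(i,\<complex>)\<close> scaling \<open>a\<close> by \<open>s\<close> and \<open>b\<close> by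
  \<open>1/s\<close>, where \<open>a\<close> lies in the kernel of the outgoing map and \<open>xi\<close> vanishes on the image of the incoming
  map, has a limit for \<open>s \<rightarrow> 0\<close>.
\<close>

lemma degeneration_step:
 assumes alpha: "alpha : quivers n" and beta: "beta : qclos n alpha" and i: "2 <= i" "i < n"
  and a: "a : carrier_vec i" "beta i *v a = 0\<^sub>v (Suc i)" and b: "b : carrier_vec i"
  and xi: "!!z. z : carrier_vec (i - 1) ==> (SUM l<i. xi l * (beta (i - 1) *v z) $ l) = 0"
  and dual: "(SUM l<i. eta l * a $ l) = 1" "(SUM l<i. eta l * b $ l) = 0" "(SUM l<i. xi l * a $ l) = 0" "(SUM l<i. xi l * b $ l) = 1"
 shows "beta(i - 1 := beta (i - 1) + (-1) \<cdot>\<^sub>m (oo i a eta * beta (i - 1)), i := beta i + (-1) \<cdot>\<^sub>m (beta i * oo i b xi)) : qclos n alpha"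
proof -
 have betaQ: "beta : quivers n" using beta by (simp add: qclos_def)
 have i1: "1 <= i - 1" "i - 1 < n" "Suc (i - 1) = i" "i - 1 ~= i" "1 <= i" using i by auto
 let ?A = "beta (i - 1)" and ?B = "beta i" and ?E = "oo i a eta" and ?F = "oo i b xi"
 have A: "?A : carrier_mat i (i - 1)" using quiverD[OF betaQ i1(1,2)] i1(3) by simp
 have B: "?B : carrier_mat (Suc i) i" using quiverD[OF betaQ i1(5) i(2)] .
 have BE: "?B * ?E = 0\<^sub>m (Suc i) i"
  using B a by (intro eq_matI) (auto simp: mult_oo[OF B a(1)])
 have FA: "?F * ?A = 0\<^sub>m i (i - 1)"
 proof (rule eq_matI)
  fix r c assume "r < dim_row (0\<^sub>m i (i - 1) :: complex mat)" "c < dim_col (0\<^sub>m i (i - 1) :: complex mat)"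
  hence rc: "r < i" "c < i - 1" by auto
  have "(?F * ?A) $$ (r, c) = b $ r * (SUM l<i. xi l * ?A $$ (l, c))" by (rule oo_mult[OF A b rc])
  also have "(SUM l<i. xi l * ?A $$ (l, c)) = (SUM l<i. xi l * (?A *v unit_vec (i - 1) c) $ l)"
   using A rc by (intro sum.cong) (auto simp: index_mult_mat_vec)
  also have "... = 0" by (rule xi) simp
  finally show "(?F * ?A) $$ (r, c) = 0\<^sub>m i (i - 1) $$ (r, c)" using rc by simp
 qed (use A in \<open>auto simp: oo_def\<close>)
 have EF: "?E * ?F = 0\<^sub>m i i" "?F * ?E = 0\<^sub>m i i" "?F * ?F = ?F" "?E * ?E = ?E"
  unfolding oo_oo[OF a(1) b] oo_oo[OF b a(1)] oo_oo[OF b b] oo_oo[OF a(1) a(1)] dual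
  by (auto simp: oo_def intro!: eq_matI)
 \<comment> \<open>\<open>?E\<close> and \<open>?F\<close> are orthogonal rank-one idempotents.
   \<open>As\<close> and \<open>Bs\<close> are the arrows into and out of vertex i after scaling
   \<open>a\<close> by s and \<open>b\<close> by 1/s, written as polynomials in s so that s = 0
   makes sense.\<close>
 define As where "As = (%s. ?A + (s - 1) \<cdot>\<^sub>m (?E * ?A))"
 define Bs where "Bs = (%s. ?B + (s - 1) \<cdot>\<^sub>m (?B * ?F))"
 have EA: "?E * ?A : carrier_mat i (i - 1)" and BF: "?B * ?F : carrier_mat (Suc i) i"
  using A B by (auto intro: mult_carrier_mat[OF oo_carrier] mult_carrier_mat[OF _ oo_carrier])
 have Asc: "As s : carrier_mat i (i - 1)" and Bsc: "Bs s : carrier_mat (Suc i) i" for s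
  using A B EA BF by (auto simp: As_def Bs_def)
 define betas where "betas = (%s. beta(i - 1 := As s, i := Bs s))"
 have betasQ: "betas s : quivers n" for s
  using betaQ Asc[of s] Bsc[of s] i i1 by (auto simp: quivers_def betas_def PiE_iff extensional_def)
 have a0: "a ~= 0\<^sub>v i" and b0: "b ~= 0\<^sub>v i" using dual by auto
 \<comment> \<open>For nonzero s the curve stays in the orbit: the scaling matrix \<open>g\<close>
   turns the incoming arrow into \<open>As s\<close> because \<open>?F\<close> kills that arrow, and
   \<open>Bs s * g\<close> is the outgoing arrow because the latter kills \<open>a\<close>.\<close>
 have orbit: "EX gamma:G1 n. betas s = qact n gamma beta" if s: "s ~= 0" for s
 proof -
  define u where "u = 1\<^sub>m i + (s - 1) \<cdot>\<^sub>m ?E"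
  define w where "w = 1\<^sub>m i + (1 / s - 1) \<cdot>\<^sub>m ?F"
  define g where "g = u * w"
  have uc: "u : carrier_mat i i" and wc: "w : carrier_mat i i" by (auto simp: u_def w_def)
  have gc: "g : carrier_mat i i" using uc wc by (simp add: g_def)
  have "det u = s" unfolding u_def det_one_plus_oo[OF i(1) a(1) a0] dual by simp
  moreover have "det w = 1 / s" unfolding w_def det_one_plus_oo[OF i(1) b b0] dual by simp
  ultimately have gS: "g : carrier (SL i)"
   using uc wc s by (simp add: SL_carrier g_def det_mult[of _ i])
  have gA: "g * ?A = As s"
  proof -
   have "w * ?A = ?A + (1 / s - 1) \<cdot>\<^sub>m (?F * ?A)"
    unfolding w_def using A by (simp add: add_mult_distrib_mat[of _ i i] mult_smult_assoc_mat[of _ i i])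
   also have "... = ?A" unfolding FA using A by (intro eq_matI) auto
   finally have "g * ?A = u * ?A" unfolding g_def using assoc_mult_mat[OF uc wc A] by simp
   also have "... = As s"
    unfolding u_def As_def using A by (simp add: add_mult_distrib_mat[of _ i i] mult_smult_assoc_mat[of _ i i])
   finally show ?thesis .
  qed
  have Bg: "Bs s * g = ?B"
  proof -
   have BsE: "Bs s * ?E = 0\<^sub>m (Suc i) i"
   proof -
    have "Bs s * ?E = ?B * ?E + (s - 1) \<cdot>\<^sub>m (?B * ?F * ?E)"
     unfolding Bs_def add_mult_distrib_mat[OF B smult_carrier_mat[OF BF] oo_carrier]
      mult_smult_assoc_mat[OF BF oo_carrier] ..
    also have "?B * ?F * ?E = ?B * (?F * ?E)" by (rule assoc_mult_mat[OF B oo_carrier oo_carrier])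
    finally show ?thesis unfolding BE EF using B by simp
   qed
   have "Bs s * u = Bs s + (s - 1) \<cdot>\<^sub>m (Bs s * ?E)"
    unfolding u_def mult_add_distrib_mat[OF Bsc one_carrier_mat smult_carrier_mat[OF oo_carrier]]
     mult_smult_distrib[OF Bsc oo_carrier] right_mult_one_mat[OF Bsc] ..
   also have "... = Bs s" unfolding BsE using Bsc[of s] by (intro eq_matI) auto
   finally have "Bs s * g = Bs s * w" unfolding g_def using assoc_mult_mat[OF Bsc[of s] uc wc] by simp
   also have "... = Bs s + (1 / s - 1) \<cdot>\<^sub>m (Bs s * ?F)"
    unfolding w_def mult_add_distrib_mat[OF Bsc one_carrier_mat smult_carrier_mat[OF oo_carrier]]
     mult_smult_distrib[OF Bsc oo_carrier] right_mult_one_mat[OF Bsc] ..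
   also have "Bs s * ?F = s \<cdot>\<^sub>m (?B * ?F)"
   proof -
    have "Bs s * ?F = ?B * ?F + (s - 1) \<cdot>\<^sub>m (?B * ?F * ?F)"
     unfolding Bs_def add_mult_distrib_mat[OF B smult_carrier_mat[OF BF] oo_carrier]
      mult_smult_assoc_mat[OF BF oo_carrier] ..
    also have "?B * ?F * ?F = ?B * (?F * ?F)" by (rule assoc_mult_mat[OF B oo_carrier oo_carrier])
    finally show ?thesis unfolding EF using BF by (intro eq_matI) (auto simp: algebra_simps)
   qed
   also have "Bs s + (1 / s - 1) \<cdot>\<^sub>m (s \<cdot>\<^sub>m (?B * ?F)) = ?B"
   proof -
    have "X + (s - 1) \<cdot>\<^sub>m P + (1 / s - 1) \<cdot>\<^sub>m (s \<cdot>\<^sub>m P) = X"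
     if "X : carrier_mat (Suc i) i" "P : carrier_mat (Suc i) i" for X P :: "complex mat"
     using that s by (intro eq_matI) (auto simp: field_simps)
    from this[OF B BF] show ?thesis by (simp only: Bs_def)
   qed
   finally show ?thesis .
  qed
  have Bag: "?B * adj_mat g = Bs s"
   unfolding Bg[symmetric] using assoc_mult_mat[OF Bsc[of s] gc SL_mat[OF SL_adj(1)[OF gS]]] SL_adj[OF gS] Bsc[of s] by simp
  define gamma where "gamma = (%j. if j = i then g else 1\<^sub>m j)"
  have gamma: "gamma : G1 n" using gS i by (auto simp: G1_def gauges_def gamma_def SL_one_closed)
  have "betas s = qact n gamma beta"
  proof (rule quiver_eqI[OF betasQ qact_closed])
   fix j assume j: "1 <= j" "j < n"
   have bj: "beta j : carrier_mat (Suc j) j" by (rule quiverD[OF betaQ j])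
   have q: "qact n gamma beta j = gamma (Suc j) * beta j * adj_mat (gamma j)" using j by (simp add: qact_def)
   consider "j = i" | "Suc j = i" "j = i - 1" "j ~= i" | "j ~= i" "Suc j ~= i" "j ~= i - 1" by linarith
   thus "betas s j = qact n gamma beta j"
   proof cases
    case 1
    thus ?thesis unfolding q using Bag B by (simp add: gamma_def betas_def)
   next
    case 2
    thus ?thesis unfolding q using gA Asc[of s] by (simp add: gamma_def betas_def adj_one)
   next
    case 3
    thus ?thesis unfolding q using bj by (simp add: gamma_def betas_def adj_one)
   qed
  qed (use gamma betaQ in \<open>auto simp: G1_def\<close>)
  thus ?thesis using gamma by blast
 qed
 have "betas 0 : qclos n alpha"
  unfolding qclos_def
 proof (intro CollectI conjI allI impI betasQ)
  fix f assume f: "pf (quivers n) (qcoords n) f" "ALL gamma:G1 n. f (qact n gamma alpha) = 0"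
  have "pline (%s. f (betas s))"
   unfolding pline_def
  proof (rule pf_compose[OF f(1) betasQ])
   fix c assume "c : qcoords n"
   then obtain j r t where c: "c = (%alpha. alpha j $$ (r, t))" and j: "1 <= j" "j < n" "r < Suc j" "t < j"
    by (auto simp: qcoords_def)
   have lin: "pf UNIV {%z. z} (%s. x + (s - 1) * y)" for x y :: complex
    using pline_id unfolding pline_def by (intro pf_add pf_mult pf_diff pf_const)
   consider "j = i" | "Suc j = i" "j = i - 1" "j ~= i" | "j ~= i" "j ~= i - 1" by linarith
   thus "pf UNIV {%z. z} (%s. c (betas s))"
   proof cases
    case 1
    hence "c (betas s) = ?B $$ (r, t) + (s - 1) * (?B * ?F) $$ (r, t)" for s
     using c j B BF by (simp add: betas_def Bs_def)
    thus ?thesis using lin by simp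
   next
    case 2
    hence "c (betas s) = ?A $$ (r, t) + (s - 1) * (?E * ?A) $$ (r, t)" for s
     using c j A EA by (simp add: betas_def As_def)
    thus ?thesis using lin by simp
   next
    case 3
    thus ?thesis using c by (simp add: betas_def pf_const)
   qed
  qed
  hence pl: "pline (%s. f (betas s))" .
  have z: "f (betas s) = 0" if "s ~: {0}" for s
  proof -
   have "s ~= 0" using that by simp
   from orbit[OF this] obtain gamma where gamma: "gamma : G1 n" "betas s = qact n gamma beta" by blast
   show ?thesis unfolding gamma(2) by (rule qclos_qact[OF alpha beta gamma(1) f(1)]) (use f(2) in blast)
  qed
  show "f (betas 0) = 0" using pline_zero[OF pl, of "{0}" 0] z by blast
 qed
 thus ?thesis by (simp add: betas_def As_def Bs_def)
qed

text \<open>Transposing and adding a zero row gives a singular square matrix; its kernel vector is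
  the covector.\<close>

lemma left_kernel:
 assumes A: "A : carrier_mat (Suc c) c"
 shows "EX xi. (EX l<Suc c. xi l ~= 0) & (ALL z:carrier_vec c. (SUM l<Suc c. xi l * (A *v z) $ l) = (0 :: complex))"
proof -
 define T where "T = mat (Suc c) (Suc c) (%(i, j). if i = c then 0 else A $$ (j, i))"
 have Tc: "T : carrier_mat (Suc c) (Suc c)" by (simp add: T_def)
 have "det T = (SUM j<Suc c. T $$ (c, j) * cofactor T c j)" by (rule laplace_expansion_row[OF Tc]) simp
 also have "... = 0" by (rule sum.neutral) (simp add: T_def)
 finally obtain v where v: "v : carrier_vec (Suc c)" "v ~= 0\<^sub>v (Suc c)" "T *v v = 0\<^sub>v (Suc c)"
  using det_0_iff_vec_prod_zero[OF Tc] by blast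
 have k: "(SUM l<Suc c. A $$ (l, i) * v $ l) = 0" if i: "i < c" for i
 proof -
  have "(SUM l<Suc c. A $$ (l, i) * v $ l) = (SUM l<Suc c. T $$ (i, l) * v $ l)"
   using i by (intro sum.cong) (auto simp: T_def)
  also have "... = (T *v v) $ i" by (rule index_mult_vec_sum[OF Tc v(1), symmetric]) (use i in simp)
  finally show ?thesis using v(3) i by simp
 qed
 have "(SUM l<Suc c. v $ l * (A *v z) $ l) = 0" if z: "z : carrier_vec c" for z
 proof -
  have "(SUM l<Suc c. v $ l * (A *v z) $ l) = (SUM l<Suc c. SUM i<c. v $ l * (A $$ (l, i) * z $ i))"
   by (intro sum.cong refl) (simp add: index_mult_vec_sum[OF A z] sum_distrib_left)
  also have "... = (SUM i<c. (SUM l<Suc c. A $$ (l, i) * v $ l) * z $ i)"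
   by (subst sum.swap, intro sum.cong refl) (simp add: sum_distrib_left mult_ac del: sum.lessThan_Suc)
  also have "... = 0" using k by simp
  finally show ?thesis .
 qed
 moreover have "EX l<Suc c. v $ l ~= 0"
 proof (rule ccontr)
  assume "~ ?thesis"
  hence "v = 0\<^sub>v (Suc c)" using v(1) by (intro eq_vecI) auto
  thus False using v by simp
 qed
 ultimately show ?thesis by (intro exI[of _ "%l. v $ l"]) blast
qed

text \<open>In the closure of the orbit take a quiver with least sum of ranks. If the condition
  fails at vertex i, suitable vectors a, b and dual covectors permit a degeneration step that lowers
  the rank of one of the two arrows at i and raises none.\<close>

theorem degeneration:
 assumes alpha: "alpha : quivers n"
 shows "EX beta:qclos n alpha. pstab n beta"
proof -
 define mu where "mu = (%beta :: nat => complex mat. SUM i:{1..<n}. frank (beta i))"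
 obtain beta where beta: "beta : qclos n alpha" and mn: "!!beta'. beta' : qclos n alpha ==> mu beta <= mu beta'"
  using exists_least_lemma qclos_self[OF alpha] arg_min_nat_lemma[of "%beta. beta : qclos n alpha" alpha mu] by blast
 have betaQ: "beta : quivers n" using beta by (simp add: qclos_def)
 have "pstab n beta"
  unfolding pstab_def
 proof (intro allI impI, rule ccontr)
  fix i assume i: "1 <= i & i < n"
  assume "~ (minj (beta i) | (ALL x:carrier_vec i. EX y:qim beta i. beta i *v x = beta i *v y) &
  (ALL y:qim beta i. beta i *v y = 0\<^sub>v (Suc i) --> y = 0\<^sub>v i))"
  hence ninj: "~ minj (beta i)" and bad: "(EX x:carrier_vec i. ALL y:qim beta i. beta i *v x ~= beta i *v y) |
   (EX y:qim beta i. beta i *v y = 0\<^sub>v (Suc i) & y ~= 0\<^sub>v i)" by blast+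
  have B: "beta i : carrier_mat (Suc i) i" using quiverD[OF betaQ] i by blast
  obtain a0 where a0: "a0 : carrier_vec i" "beta i *v a0 = 0\<^sub>v (Suc i)" "a0 ~= 0\<^sub>v i"
   using ninj B unfolding minj_def by auto
  \<comment> \<open>At vertex 1 an arrow with nonzero kernel is zero, and then the condition
    holds.\<close>
  have i2: "2 <= i"
  proof (rule ccontr)
   assume "~ 2 <= i"
   hence i1: "i = 1" using i by simp
   have a00: "a0 $ 0 ~= 0"
   proof
    assume "a0 $ 0 = 0"
    hence "a0 = 0\<^sub>v i" using a0(1) i1 by (intro eq_vecI) auto
    thus False using a0 by simp
   qed
   have "beta i *v x = 0\<^sub>v (Suc i)" if x: "x : carrier_vec i" for x
   proof -
    have "x = (x $ 0 / a0 $ 0) \<cdot>\<^sub>v a0" using x a0(1) i1 a00 by (intro eq_vecI) auto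
    hence "beta i *v x = (x $ 0 / a0 $ 0) \<cdot>\<^sub>v (beta i *v a0)" using mult_mat_vec[OF B a0(1)] by metis
    thus ?thesis using a0(2) by (auto intro!: eq_vecI)
   qed
   thus False using bad i1 mult_vec_zero[OF B] by (auto simp: qim_def)
  qed
  have ii: "1 <= i - 1" "i - 1 < n" "Suc (i - 1) = i" "i - 1 ~= i" using i i2 by auto
  have A: "beta (i - 1) : carrier_mat i (i - 1)" using quiverD[OF betaQ ii(1,2)] ii(3) by simp
  have qi: "qim beta i = (%z. beta (i - 1) *v z) ` carrier_vec (i - 1)" using i2 by (simp add: qim_def)
  \<comment> \<open>A coordinate functional normalised at \<open>a\<close> is corrected by a
    multiple of \<open>xi\<close> so as to vanish on \<open>b\<close>.\<close>
  have dual: "EX eta. (SUM l<i. eta l * a $ l) = 1 & (SUM l<i. eta l * b $ l) = 0"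
   if a: "a : carrier_vec i" "a ~= 0\<^sub>v i" and b: "(SUM l<i. xi l * a $ l) = 0" "(SUM l<i. xi l * b $ l) = 1" for a b :: "complex vec" and xi
  proof -
   have "EX k<i. a $ k ~= 0"
   proof (rule ccontr)
    assume "~ ?thesis"
    hence "a = 0\<^sub>v i" using a(1) by (intro eq_vecI) auto
    thus False using a by simp
   qed
   then obtain k where k: "k < i" "a $ k ~= 0" by blast
   let ?eta = "%l. (if l = k then 1 / a $ k else 0) - b $ k / a $ k * xi l"
   have e: "(SUM l<i. ?eta l * x $ l) = x $ k / a $ k - b $ k / a $ k * (SUM l<i. xi l * x $ l)" for x :: "complex vec"
   proof -
    have "(SUM l<i. ?eta l * x $ l) = (SUM l<i. (if l = k then x $ k / a $ k else 0) - b $ k / a $ k * (xi l * x $ l))"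
     by (intro sum.cong) (auto simp: algebra_simps)
    thus ?thesis using k by (simp add: sum_subtractf sum_distrib_left)
   qed
   show ?thesis by (rule exI[of _ ?eta]) (unfold e b, use k in simp)
  qed
  have contra: False if ab: "a : carrier_vec i" "beta i *v a = 0\<^sub>v (Suc i)" "b : carrier_vec i"
   "!!z. z : carrier_vec (i - 1) ==> (SUM l<i. xi l * (beta (i - 1) *v z) $ l) = 0"
   "(SUM l<i. eta l * a $ l) = 1" "(SUM l<i. eta l * b $ l) = 0" "(SUM l<i. xi l * a $ l) = 0" "(SUM l<i. xi l * b $ l) = 1"
   and drop: "(EX w:carrier_vec (i - 1). a = beta (i - 1) *v w) | (EX theta. ALL l<i. xi l = (SUM r<Suc i. theta r * beta i $$ (r, l)))"
   for a b xi eta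
  proof -
   let ?A = "beta (i - 1)" and ?B = "beta i" and ?E = "oo i a eta" and ?F = "oo i b xi"
   let ?A' = "?A + (-1) \<cdot>\<^sub>m (?E * ?A)" and ?B' = "?B + (-1) \<cdot>\<^sub>m (?B * ?F)"
   let ?beta = "beta(i - 1 := ?A', i := ?B')"
   have "?beta : qclos n alpha" using degeneration_step[OF alpha beta i2 _ ab] i by simp
   hence "mu beta <= mu ?beta" by (rule mn)
   have EA: "?E * ?A : carrier_mat i (i - 1)" and BF: "?B * ?F : carrier_mat (Suc i) i"
    by (rule mult_carrier_mat[OF oo_carrier A], rule mult_carrier_mat[OF B oo_carrier])
   have "?A' = (1\<^sub>m i + (-1) \<cdot>\<^sub>m ?E) * ?A"
    using A by (simp add: add_mult_distrib_mat[of _ i i] mult_smult_assoc_mat[of _ i i])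
   hence fA: "frank ?A' <= frank ?A" using frank_mult_left[OF A, of "1\<^sub>m i + (-1) \<cdot>\<^sub>m ?E" i] by simp
   have "?B' = ?B * (1\<^sub>m i + (-1) \<cdot>\<^sub>m ?F)"
    unfolding mult_add_distrib_mat[OF B one_carrier_mat smult_carrier_mat[OF oo_carrier]]
     mult_smult_distrib[OF B oo_carrier] right_mult_one_mat[OF B] ..
   hence fB: "frank ?B' <= frank ?B" using frank_mult_right[OF B, of "1\<^sub>m i + (-1) \<cdot>\<^sub>m ?F" i] by simp
   have strict: "frank ?A' < frank ?A | frank ?B' < frank ?B"
    using drop
   proof
    assume "EX w:carrier_vec (i - 1). a = ?A *v w"
    then obtain w where w: "w : carrier_vec (i - 1)" "a = ?A *v w" by blast
    have "?A' = mat i (i - 1) (%(r, c). ?A $$ (r, c) - (?A *v w) $ r * (SUM l<i. eta l * ?A $$ (l, c)))"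
     using A EA oo_mult[OF A ab(1), of _ _ eta] w(2) by (intro eq_matI) auto
    thus ?thesis using frank_drop[OF A w(1), of eta] ab(5) w(2) by simp
   next
    assume "EX theta. ALL l<i. xi l = (SUM r<Suc i. theta r * ?B $$ (r, l))"
    then obtain theta where theta: "!!l. l < i ==> xi l = (SUM r<Suc i. theta r * ?B $$ (r, l))" by blast
    have "(SUM r<Suc i. theta r * (?B *v b) $ r) = (SUM r<Suc i. SUM l<i. theta r * (?B $$ (r, l) * b $ l))"
     by (intro sum.cong refl) (simp add: index_mult_vec_sum[OF B ab(3)] sum_distrib_left)
    also have "... = (SUM l<i. xi l * b $ l)"
     by (subst sum.swap) (auto simp: theta sum_distrib_right mult.assoc simp del: sum.lessThan_Suc intro!: sum.cong)
    finally have 1: "(SUM r<Suc i. theta r * (?B *v b) $ r) = 1" using ab(8) by simp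
    have "?B' = mat (Suc i) i (%(r, c). ?B $$ (r, c) - (?B *v b) $ r * (SUM l<Suc i. theta l * ?B $$ (l, c)))"
     using B BF mult_oo[OF B ab(3), of _ _ xi] by (intro eq_matI) (auto simp: theta simp del: sum.lessThan_Suc)
    thus ?thesis using frank_drop[OF B ab(3) 1] by simp
   qed
   have split: "mu delta = frank (delta (i - 1)) + (frank (delta i) + (SUM j:{1..<n} - {i - 1} - {i}. frank (delta j)))" for delta
    unfolding mu_def using ii i i2
    by (subst sum.remove[of _ "i - 1"], simp, simp, subst sum.remove[of _ i]) auto
   have "(SUM j:{1..<n} - {i - 1} - {i}. frank (?beta j)) = (SUM j:{1..<n} - {i - 1} - {i}. frank (beta j))"
    by (intro sum.cong) auto
   hence "mu ?beta < mu beta"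
    unfolding split[of ?beta] split[of beta] using strict fA fB ii(4) by auto
   thus False using `mu beta <= mu ?beta` by simp
  qed
  show False
  proof (cases "EX y:qim beta i. beta i *v y = 0\<^sub>v (Suc i) & y ~= 0\<^sub>v i")
   \<comment> \<open>A nonzero vector in both image and kernel serves as \<open>a\<close>, and the
     incoming arrow drops in rank. A covector \<open>xi\<close> exists because the image of C^(i-1)
     is a proper subspace of C^i.\<close>
   case True
   then obtain w where w: "w : carrier_vec (i - 1)" "beta i *v (beta (i - 1) *v w) = 0\<^sub>v (Suc i)" "beta (i - 1) *v w ~= 0\<^sub>v i"
    unfolding qi by blast
   let ?a = "beta (i - 1) *v w"
   have ac: "?a : carrier_vec i" using A w(1) by (rule mult_mat_vec_carrier)
   obtain xi l where xi: "l < i" "xi l ~= 0" "!!z. z : carrier_vec (i - 1) ==> (SUM l<i. xi l * (beta (i - 1) *v z) $ l) = 0"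
    using left_kernel[of "beta (i - 1)" "i - 1"] A unfolding ii(3) by blast
   define b where "b = (1 / xi l) \<cdot>\<^sub>v unit_vec i l"
   have bc: "b : carrier_vec i" by (simp add: b_def)
   have "(SUM k<i. xi k * b $ k) = (SUM k<i. if k = l then 1 else 0)"
    using xi(1,2) by (intro sum.cong) (auto simp: b_def)
   hence xib: "(SUM k<i. xi k * b $ k) = 1" using xi(1) by simp
   obtain eta where eta: "(SUM l<i. eta l * ?a $ l) = 1" "(SUM l<i. eta l * b $ l) = 0"
    using dual[OF ac w(3) xi(3)[OF w(1)] xib] by blast
   have "EX w:carrier_vec (i - 1). ?a = beta (i - 1) *v w" using w(1) by blast
   from contra[OF ac w(2) bc xi(3) eta xi(3)[OF w(1)] xib disjI1[OF this]] show False .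
  next
   \<comment> \<open>Some value of the outgoing arrow is not attained on the image of the incoming
     one: a separating covector \<open>theta\<close>, composed with the outgoing arrow, gives
     \<open>xi\<close>, and the outgoing arrow drops in rank.\<close>
   case False
   then obtain x where x: "x : carrier_vec i" "!!z. z : carrier_vec (i - 1) ==> beta i *v (beta (i - 1) *v z) ~= beta i *v x"
    using bad unfolding qi by force
   let ?M = "beta i * beta (i - 1)"
   have Mc: "?M : carrier_mat (Suc i) (i - 1)" using B A by (rule mult_carrier_mat)
   have Mv: "?M *v z = beta i *v (beta (i - 1) *v z)" if "z : carrier_vec (i - 1)" for z
    by (rule assoc_mult_mat_vec[OF B A that])
   obtain theta where theta: "!!z. z : carrier_vec (i - 1) ==> (SUM r<Suc i. theta r * (?M *v z) $ r) = 0" "(SUM r<Suc i. theta r * (beta i *v x) $ r) = 1"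
    using not_in_image_covector[OF Mc mult_mat_vec_carrier[OF B x(1)]] x(2) Mv by metis
   define xi where "xi = (%l. SUM r<Suc i. theta r * beta i $$ (r, l))"
   have xiv: "(SUM l<i. xi l * v $ l) = (SUM r<Suc i. theta r * (beta i *v v) $ r)" if v: "v : carrier_vec i" for v
   proof -
    have "(SUM r<Suc i. theta r * (beta i *v v) $ r) = (SUM r<Suc i. SUM l<i. theta r * (beta i $$ (r, l) * v $ l))"
     by (intro sum.cong refl) (simp add: index_mult_vec_sum[OF B v] sum_distrib_left)
    also have "... = (SUM l<i. xi l * v $ l)"
     by (subst sum.swap) (auto simp: xi_def sum_distrib_right mult.assoc simp del: sum.lessThan_Suc intro!: sum.cong)
    finally show ?thesis by simp
   qed
   have xiA: "(SUM l<i. xi l * (beta (i - 1) *v z) $ l) = 0" if z: "z : carrier_vec (i - 1)" for z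
    using xiv[OF mult_mat_vec_carrier[OF A z]] theta(1)[OF z] Mv[OF z] by simp
   have xia: "(SUM l<i. xi l * a0 $ l) = 0" using xiv[OF a0(1)] a0(2) by (simp del: sum.lessThan_Suc)
   have xix: "(SUM l<i. xi l * x $ l) = 1" using xiv[OF x(1)] theta(2) by simp
   obtain eta where eta: "(SUM l<i. eta l * a0 $ l) = 1" "(SUM l<i. eta l * x $ l) = 0"
    using dual[OF a0(1,3) xia xix] by blast
   have "EX theta. ALL l<i. xi l = (SUM r<Suc i. theta r * beta i $$ (r, l))"
    unfolding xi_def by (rule exI[of _ theta]) blast
   from contra[OF a0(1,2) x(1) xiA eta xia xix disjI2[OF this]] show False .
  qed
 qed
 thus ?thesis using beta by blast
qed

section \<open>Affine varieties and their spectra\<close>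

text \<open>What makes the non-vanishing loci a basis of the topology. Products are compared on
  \<open>Y\<close> only, which suits evaluation functions on sets of characters.\<close>

definition mult_closed :: "'p set => ('p => complex) set => bool" where
 "mult_closed Y F \<longleftrightarrow> (EX f:F. ALL y:Y. f y ~= 0) & (ALL f:F. ALL h:F. EX e:F. ALL y:Y. e y = f y * h y)"

lemma mult_closedD: "mult_closed Y F ==> f : F ==> h : F ==> EX e:F. ALL y:Y. e y = f y * h y"
 unfolding mult_closed_def by simp

lemma openin_affine:
 assumes F: "mult_closed Y F"
 shows "openin (zariski (affine_variety Y F)) U \<longleftrightarrow>
  U \<subseteq> Y & (ALL y:U. EX f:F. f y ~= 0 & {z:Y. f z ~= 0} \<subseteq> U)" (is "?o U \<longleftrightarrow> ?b U")
proof
 let ?S = "(%f. {y : Y. f y ~= 0}) ` F"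
 assume "?o U"
 hence "generate_topology_on ?S U"
  by (simp add: affine_variety_def Let_def openin_topology_generated_by)
 thus "?b U"
 proof (induction rule: generate_topology_on.induct)
  case (Int a b)
  have "EX f:F. f y ~= 0 & {z:Y. f z ~= 0} \<subseteq> a \<inter> b" if y: "y : a \<inter> b" for y
  proof -
   obtain f h where f: "f : F" "f y ~= 0" "{z:Y. f z ~= 0} \<subseteq> a" and h: "h : F" "h y ~= 0" "{z:Y. h z ~= 0} \<subseteq> b"
    using Int.IH y by blast
   obtain e where e: "e : F" "!!y. y : Y ==> e y = f y * h y"
    using mult_closedD[OF F f(1) h(1)] by blast
   show ?thesis using e f h y Int.IH by (intro bexI[of _ e]) auto
  qed
  thus ?case using Int.IH by blast
 next
  case (UN K)
  show ?case
  proof (intro conjI ballI)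
   show "\<Union>K \<subseteq> Y" using UN.IH by blast
   fix y assume "y : \<Union>K"
   then obtain k where k: "k : K" "y : k" by blast
   then obtain f where "f : F" "f y ~= 0" "{z:Y. f z ~= 0} \<subseteq> k" using UN.IH by blast
   thus "EX f:F. f y ~= 0 & {z:Y. f z ~= 0} \<subseteq> \<Union>K" using k by blast
  qed
 qed auto
next
 let ?S = "(%f. {y : Y. f y ~= 0}) ` F"
 assume b: "?b U"
 have "U = \<Union>{V : ?S. V \<subseteq> U}"
  using b by blast
 moreover have "generate_topology_on ?S (\<Union>{V : ?S. V \<subseteq> U})"
  by (rule generate_topology_on.UN) (blast intro: generate_topology_on.Basis)
 ultimately show "?o U"
  by (simp add: affine_variety_def Let_def openin_topology_generated_by_iff)
qed

lemma points_affine: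
 assumes F: "mult_closed Y F"
 shows "points (affine_variety Y F) = Y"
proof -
 have "openin (zariski (affine_variety Y F)) Y"
  using F by (auto simp: openin_affine[OF F] mult_closed_def)
 moreover have "U \<subseteq> Y" if "openin (zariski (affine_variety Y F)) U" for U
  using that by (simp add: openin_affine[OF F])
 ultimately show ?thesis
  by (metis openin_subset openin_topspace subset_antisym)
qed

lemma openin_basic:
 "mult_closed Y F ==> f : F ==> openin (zariski (affine_variety Y F)) {y:Y. f y ~= 0}"
 by (auto simp: openin_affine)

lemma regular_affine_def:
 "regular (affine_variety Y F) U h \<longleftrightarrow> (ALL y:U. EX W a b. openin (zariski (affine_variety Y F)) W &
  y : W & W \<subseteq> U & a : F & b : F & (ALL z:W. b z ~= 0 & h z = a z / b z))"
 by (simp only: affine_variety_def Let_def variety.simps)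

lemma regular_affine:
 assumes F: "mult_closed Y F"
 shows "regular (affine_variety Y F) U h \<longleftrightarrow> (ALL y:U. EX f:F. EX a:F. EX b:F. y : Y & f y ~= 0 &
  (ALL z:Y. f z ~= 0 --> z : U & b z ~= 0 & h z = a z / b z))"
proof -
 have "(EX W a b. openin (zariski (affine_variety Y F)) W & y : W & W \<subseteq> U & a : F & b : F &
    (ALL z:W. b z ~= 0 & h z = a z / b z)) \<longleftrightarrow>
  (EX f:F. EX a:F. EX b:F. y : Y & f y ~= 0 & (ALL z:Y. f z ~= 0 --> z : U & b z ~= 0 & h z = a z / b z))"
  (is "?L \<longleftrightarrow> ?R") for y
 proof
  assume ?L
  then obtain W a b where W: "openin (zariski (affine_variety Y F)) W" "y : W" "W \<subseteq> U" "a : F" "b : F"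
   "ALL z:W. b z ~= 0 & h z = a z / b z" by blast
  obtain f where "f : F" "f y ~= 0" "{z:Y. f z ~= 0} \<subseteq> W" "W \<subseteq> Y"
   using W(1,2) unfolding openin_affine[OF F] by blast
  thus ?R using W by (intro bexI[of _ f] bexI[of _ a] bexI[of _ b]) auto
 next
  assume ?R
  then obtain f a b where f: "f : F" "a : F" "b : F" "y : Y" "f y ~= 0"
   "!!z. z:Y ==> f z ~= 0 ==> z : U & b z ~= 0 & h z = a z / b z" by blast
  thus ?L using openin_basic[OF F f(1)]
   by (intro exI[of _ "{z:Y. f z ~= 0}"] exI[of _ a] exI[of _ b]) auto
 qed
 thus ?thesis unfolding regular_affine_def by (intro ball_cong refl)
qed

lemma bex3I: "f : F ==> a : F ==> b : F ==> P f a b ==> EX f:F. EX a:F. EX b:F. P f a b"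
 by blast

lemma openin_sub:
 assumes F: "mult_closed Y F" and Z: "Z \<subseteq> Y"
 shows "openin (zariski (subvariety (affine_variety Y F) Z)) W \<longleftrightarrow>
  W \<subseteq> Z & (ALL z:W. EX f:F. f z ~= 0 & (ALL y:Z. f y ~= 0 --> y : W))" (is "?o = ?b")
proof
 assume ?o
 then obtain T where T: "openin (zariski (affine_variety Y F)) T" "W = T \<inter> Z"
  by (auto simp: subvariety_def openin_subtopology)
 show ?b
 proof (intro conjI ballI)
  show "W \<subseteq> Z" using T(2) by blast
  fix z assume "z : W"
  then obtain f where "f : F" "f z ~= 0" "{y:Y. f y ~= 0} \<subseteq> T" using T unfolding openin_affine[OF F] by blast
  thus "EX f:F. f z ~= 0 & (ALL y:Z. f y ~= 0 --> y : W)" using Z T(2) by blast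
 qed
next
 assume b: ?b
 let ?K = "{f : F. ALL y:Z. f y ~= 0 --> y : W}"
 have "openin (zariski (affine_variety Y F)) (UN f:?K. {y:Y. f y ~= 0})"
  by (intro openin_Union ballI) (auto intro: openin_basic[OF F])
 moreover have "W = (UN f:?K. {y:Y. f y ~= 0}) \<inter> Z" using b Z by blast
 ultimately show ?o by (auto simp: subvariety_def openin_subtopology)
qed

lemma regular_sub:
 assumes F: "mult_closed Y F" and Z: "Z \<subseteq> Y" and U: "U \<subseteq> Z"
 shows "regular (subvariety (affine_variety Y F) Z) U h \<longleftrightarrow>
  (ALL z:U. EX f:F. EX a:F. EX b:F. f z ~= 0 & (ALL y:Z. f y ~= 0 --> y : U & b y ~= 0 & h y = a y / b y))"
proof -
 let ?X = "affine_variety Y F"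
 have "(EX W k. openin (zariski ?X) W & z : W & W \<inter> Z \<subseteq> U & regular ?X W k & (ALL y:W \<inter> Z. h y = k y)) \<longleftrightarrow>
  (EX f:F. EX a:F. EX b:F. f z ~= 0 & (ALL y:Z. f y ~= 0 --> y : U & b y ~= 0 & h y = a y / b y))" (is "?l = ?r") if z: "z : U" for z
 proof
  assume ?l
  then obtain W k where W: "openin (zariski ?X) W" "z : W" "W \<inter> Z \<subseteq> U" "regular ?X W k" "ALL y:W \<inter> Z. h y = k y" by blast
  from bspec[OF W(4)[unfolded regular_affine[OF F]] W(2)] obtain f a b where f: "f : F" "a : F" "b : F" "f z ~= 0"
   "!!y. y : Y ==> f y ~= 0 ==> y : W & b y ~= 0 & k y = a y / b y" by (elim bexE conjE) blast
  have y: "y : U & b y ~= 0 & h y = a y / b y" if "y : Z" "f y ~= 0" for y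
   using f(5)[of y] that Z W(3,5) by auto
  show ?r by (rule bex3I[OF f(1-3)]) (use f(4) y in blast)
 next
  assume ?r
  then obtain f a b where f: "f : F" "a : F" "b : F" "f z ~= 0"
   "!!y. y : Z ==> f y ~= 0 ==> y : U & b y ~= 0 & h y = a y / b y" by blast
  \<comment> \<open>\<open>b\<close> is known to be nonzero only on the part of the basic set inside
    \<open>Z\<close>; multiplying by it shrinks the ambient basic set to where the fraction is
    defined.\<close>
  obtain e where e: "e : F" "!!y. y : Y ==> e y = f y * b y" using mult_closedD[OF F f(1,3)] by blast
  let ?W = "{y:Y. e y ~= 0}"
  have W: "y : ?W \<longleftrightarrow> y : Y & f y ~= 0 & b y ~= 0" for y using e(2)[of y] by auto
  have "regular ?X ?W (%y. a y / b y)"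
   unfolding regular_affine[OF F]
   by (intro ballI, rule bex3I[OF e(1) f(2,3)]) (use W in auto)
  moreover have "openin (zariski ?X) ?W" by (rule openin_basic[OF F e(1)])
  moreover have "z : ?W" "?W \<inter> Z \<subseteq> U" "ALL y:?W \<inter> Z. h y = a y / b y" using f(4,5) z U Z W by blast+
  ultimately show ?l by blast
 qed
 thus ?thesis by (simp only: subvariety_def variety.simps cong: ball_cong)
qed

lemma affine_whole:
 assumes F: "mult_closed Y F"
 shows "zariski (subvariety (affine_variety Y F) Y) = zariski (affine_variety Y F)"
 using subtopology_topspace[of "zariski (affine_variety Y F)"] by (simp add: subvariety_def points_affine[OF F])

text \<open>Pull-back along \<open>ev\<close> gives one direction, and near every point of
  \<open>Z\<close> a section with fractional coordinates transports open sets and regular functions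
  back. Isomorphisms of affine varieties use this with a global section, homogeneous spaces with
  local ones.\<close>

lemma section_map:
 assumes SF: "mult_closed X S" and F: "mult_closed Y F" and Z: "Z \<subseteq> Y" and ev: "ev ` X = Z"
  and pull: "!!f. f : F ==> EX e:S. ALL g:X. e g = f (ev g)"
  and sec: "!!g. g : X ==> EX b:F. EX s. b (ev g) ~= 0 & (ALL z:Z. b z ~= 0 --> s z : X & ev (s z) = z) &
   (ALL e:S. EX a:F. EX c:F. ALL z:Z. b z ~= 0 --> c z ~= 0 & e (s z) = a z / c z)"
 shows "W \<subseteq> Z ==> openin (zariski (affine_variety X S)) {g:X. ev g : W} \<longleftrightarrow>
   openin (zariski (subvariety (affine_variety Y F) Z)) W"
  and "U \<subseteq> Z ==> (!!g. g : X ==> h' g = h (ev g)) ==> regular (affine_variety X S) {g:X. ev g : U} h' \<longleftrightarrow>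
   regular (subvariety (affine_variety Y F) Z) U h"
proof -
 have evZ: "ev g : Z" if "g : X" for g using ev that by blast
 show "openin (zariski (affine_variety X S)) {g:X. ev g : W} \<longleftrightarrow>
   openin (zariski (subvariety (affine_variety Y F) Z)) W" (is "?lo \<longleftrightarrow> ?ro") if W: "W \<subseteq> Z"
 proof
  assume l: ?lo
  show ?ro
   unfolding openin_sub[OF F Z]
  proof (intro conjI ballI W)
   fix z assume z: "z : W"
   then obtain g where g: "g : X" "z = ev g" using W ev by blast
   obtain b s where b: "b : F" "b z ~= 0" and s: "!!z. z : Z ==> b z ~= 0 ==> s z : X & ev (s z) = z"
    and fr: "!!e. e : S ==> EX a:F. EX c:F. ALL z:Z. b z ~= 0 --> c z ~= 0 & e (s z) = a z / c z"
    using sec[OF g(1)] unfolding g(2) by blast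
   have sz: "s z : X" "ev (s z) = z" using s[of z] b z W by auto
   hence "s z : {g:X. ev g : W}" using z by simp
   then obtain e where e: "e : S" "e (s z) ~= 0" "{g:X. e g ~= 0} \<subseteq> {g:X. ev g : W}"
    using l unfolding openin_affine[OF SF] by blast
   obtain a c where a: "a : F" "c : F" "!!z. z : Z ==> b z ~= 0 ==> c z ~= 0 & e (s z) = a z / c z" using fr[OF e(1)] by blast
   \<comment> \<open>Near z the set is cut out by the numerator of \<open>e\<close> along the
     section, times \<open>b\<close> to stay where the section exists.\<close>
   obtain q where q: "q : F" "!!y. y : Y ==> q y = a y * b y" using mult_closedD[OF F a(1) b(1)] by blast
   have zZ: "z : Z" "z : Y" using z W Z by auto
   have "q z ~= 0" using a(3)[OF zZ(1) b(2)] b(2) q(2)[OF zZ(2)] e(2) by auto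
   moreover have "y : W" if y: "y : Z" "q y ~= 0" for y
   proof -
    have nz: "a y ~= 0" "b y ~= 0" using y q(2)[of y] Z by auto
    have "e (s y) ~= 0" "s y : X" "ev (s y) = y" using a(3)[OF y(1) nz(2)] s[OF y(1) nz(2)] nz(1) by auto
    hence "s y : {g:X. ev g : W}" using e(3) by blast
    thus ?thesis using `ev (s y) = y` by simp
   qed
   ultimately show "EX f:F. f z ~= 0 & (ALL y:Z. f y ~= 0 --> y : W)" using q(1) by blast
  qed
 next
  assume r: ?ro
  show ?lo
   unfolding openin_affine[OF SF]
  proof (intro conjI ballI)
   fix g assume g: "g : {g:X. ev g : W}"
   then obtain f where f: "f : F" "f (ev g) ~= 0" "!!y. y : Z ==> f y ~= 0 ==> y : W"
    using r unfolding openin_sub[OF F Z] by blast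
   obtain e where "e : S" "!!g. g : X ==> e g = f (ev g)" using pull[OF f(1)] by blast
   thus "EX e:S. e g ~= 0 & {z : X. e z ~= 0} \<subseteq> {g:X. ev g : W}"
    using f g evZ by (intro bexI[of _ e]) auto
  qed simp
 qed
 show "regular (affine_variety X S) {g:X. ev g : U} h' \<longleftrightarrow>
   regular (subvariety (affine_variety Y F) Z) U h" (is "?lr \<longleftrightarrow> ?rr") if U: "U \<subseteq> Z" and h': "!!g. g : X ==> h' g = h (ev g)"
 proof
  assume l: ?lr
  show ?rr
   unfolding regular_sub[OF F Z U]
  proof
   fix z assume z: "z : U"
   then obtain g where g: "g : X" "z = ev g" using U ev by blast
   obtain b s where b: "b : F" "b z ~= 0" and s: "!!z. z : Z ==> b z ~= 0 ==> s z : X & ev (s z) = z"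
    and fr: "!!e. e : S ==> EX a:F. EX c:F. ALL z:Z. b z ~= 0 --> c z ~= 0 & e (s z) = a z / c z"
    using sec[OF g(1)] unfolding g(2) by blast
   have "s z : X" "ev (s z) = z" using s[of z] b z U by auto
   hence "s z : {g:X. ev g : U}" using z by simp
   from bspec[OF l[unfolded regular_affine[OF SF]] this] obtain e p q where e: "e : S" "p : S" "q : S" "e (s z) ~= 0"
    "!!y. y : X ==> e y ~= 0 ==> y : {g:X. ev g : U} & q y ~= 0 & h' y = p y / q y" by (elim bexE conjE) blast
   obtain a1 c1 where 1: "a1 : F" "c1 : F" "!!z. z : Z ==> b z ~= 0 ==> c1 z ~= 0 & e (s z) = a1 z / c1 z" using fr[OF e(1)] by blast
   obtain a2 c2 where 2: "a2 : F" "c2 : F" "!!z. z : Z ==> b z ~= 0 ==> c2 z ~= 0 & p (s z) = a2 z / c2 z" using fr[OF e(2)] by blast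
   obtain a3 c3 where 3: "a3 : F" "c3 : F" "!!z. z : Z ==> b z ~= 0 ==> c3 z ~= 0 & q (s z) = a3 z / c3 z" using fr[OF e(3)] by blast
   obtain f where f: "f : F" "!!y. y : Y ==> f y = a1 y * b y" using mult_closedD[OF F 1(1) b(1)] by blast
   obtain u where u: "u : F" "!!y. y : Y ==> u y = a2 y * c3 y" using mult_closedD[OF F 2(1) 3(2)] by blast
   obtain v where v: "v : F" "!!y. y : Y ==> v y = c2 y * a3 y" using mult_closedD[OF F 2(2) 3(1)] by blast
   have zZ: "z : Z" "z : Y" using z U Z by auto
   have fz: "f z ~= 0" using 1(3)[OF zZ(1) b(2)] b(2) f(2)[OF zZ(2)] e(4) by auto
   have y: "y : U & v y ~= 0 & h y = u y / v y" if y: "y : Z" "f y ~= 0" for y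
   proof -
    have nz: "a1 y ~= 0" "b y ~= 0" using y f(2)[of y] Z by auto
    have sy: "e (s y) ~= 0" "s y : X" "ev (s y) = y" using 1(3)[OF y(1) nz(2)] s[OF y(1) nz(2)] nz(1) by auto
    from e(5)[OF sy(2,1)] have "y : U" "q (s y) ~= 0" "h y = p (s y) / q (s y)" using h'[OF sy(2)] sy(3) by auto
    thus ?thesis using 2(3)[OF y(1) nz(2)] 3(3)[OF y(1) nz(2)] u(2)[of y] v(2)[of y] y(1) Z by auto
   qed
   show "EX f:F. EX a:F. EX b:F. f z ~= 0 & (ALL y:Z. f y ~= 0 --> y : U & b y ~= 0 & h y = a y / b y)"
    by (rule bex3I[OF f(1) u(1) v(1)]) (use fz y in blast)
  qed
 next
  assume r: ?rr
  show ?lr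
   unfolding regular_affine[OF SF]
  proof
   fix g assume g: "g : {g:X. ev g : U}"
   hence "ev g : U" by simp
   from bspec[OF r[unfolded regular_sub[OF F Z U]] this] obtain f a b where f: "f : F" "a : F" "b : F" "f (ev g) ~= 0"
    "!!y. y : Z ==> f y ~= 0 ==> y : U & b y ~= 0 & h y = a y / b y" by blast
   obtain f' where f': "f' : S" "!!g. g : X ==> f' g = f (ev g)" using pull[OF f(1)] by blast
   obtain a' where a': "a' : S" "!!g. g : X ==> a' g = a (ev g)" using pull[OF f(2)] by blast
   obtain b' where b': "b' : S" "!!g. g : X ==> b' g = b (ev g)" using pull[OF f(3)] by blast
   have y: "z : {g:X. ev g : U} & b' z ~= 0 & h' z = a' z / b' z" if z: "z : X" "f' z ~= 0" for z
    using f(5)[OF evZ[OF z(1)]] z f'(2) a'(2) b'(2) h' by simp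
   show "EX f:S. EX a:S. EX b:S. g : X & f g ~= 0 &
     (ALL z:X. f z ~= 0 --> z : {g:X. ev g : U} & b z ~= 0 & h' z = a z / b z)"
    by (rule bex3I[OF f'(1) a'(1) b'(1)]) (use g f(4) f'(2) y in simp)
  qed
 qed
qed

lemma affine_variety_iso:
 assumes F1: "mult_closed Y1 F1" and F2: "mult_closed Y2 F2" and Phi: "bij_betw Phi Y1 Y2"
  and A: "!!f. f : F2 ==> EX e:F1. ALL y:Y1. e y = f (Phi y)"
  and B: "!!e. e : F1 ==> EX f:F2. ALL y:Y1. e y = f (Phi y)"
 shows "variety_iso (affine_variety Y1 F1) (affine_variety Y2 F2) Phi"
proof -
 have im: "Phi ` Y1 = Y2" and inj: "inj_on Phi Y1" using Phi by (auto simp: bij_betw_def)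
 obtain b where b: "b : F2" "!!y. y : Y2 ==> b y ~= 0" using F2 unfolding mult_closed_def by blast
 let ?s = "inv_into Y1 Phi"
 have s: "?s z : Y1" "Phi (?s z) = z" if "z : Y2" for z
  using that unfolding im[symmetric] by (rule inv_into_into, rule f_inv_into_f)
 have "EX b:F2. EX s. b (Phi g) ~= 0 & (ALL z:Y2. b z ~= 0 --> s z : Y1 & Phi (s z) = z) &
   (ALL e:F1. EX a:F2. EX c:F2. ALL z:Y2. b z ~= 0 --> c z ~= 0 & e (s z) = a z / c z)" if g: "g : Y1" for g
 proof (rule bexI[OF _ b(1)], rule exI[of _ ?s], intro conjI ballI impI)
  show "b (Phi g) ~= 0" using b(2) im g by blast
  fix e assume "e : F1"
  from B[OF this] obtain f where f: "f : F2" "!!y. y : Y1 ==> e y = f (Phi y)" by blast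
  obtain q where q: "q : F2" "!!y. y : Y2 ==> q y = f y * b y" using mult_closedD[OF F2 f(1) b(1)] by blast
  show "EX a:F2. EX c:F2. ALL z:Y2. b z ~= 0 --> c z ~= 0 & e (?s z) = a z / c z"
   by (rule bexI[OF _ q(1)], rule bexI[OF _ b(1)]) (simp add: f(2) s q(2))
 qed (use s in simp_all)
 note sm = section_map[OF F1 F2 subset_refl im A this]
 have "homeomorphic_map (zariski (affine_variety Y1 F1)) (zariski (affine_variety Y2 F2)) Phi"
  unfolding homeomorphic_map_def quotient_map_def points_affine[OF F1] points_affine[OF F2]
  using sm(1) im inj unfolding affine_whole[OF F2] by blast
 moreover have "regular (affine_variety Y2 F2) V h \<longleftrightarrow> regular (affine_variety Y1 F1) {x : Y1. Phi x : V} (h \<circ> Phi)"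
  if "openin (zariski (affine_variety Y2 F2)) V" for V h
 proof -
  have V: "V \<subseteq> Y2" using that unfolding openin_affine[OF F2] by blast
  have "regular (affine_variety Y2 F2) V h \<longleftrightarrow> regular (subvariety (affine_variety Y2 F2) Y2) V h"
   unfolding regular_affine[OF F2] regular_sub[OF F2 subset_refl V] by (intro ball_cong bex_cong refl) (use V in auto)
  thus ?thesis using sm(2)[of V "h \<circ> Phi" h] V by simp
 qed
 ultimately show ?thesis unfolding variety_iso_def points_affine[OF F1] by blast
qed

section \<open>Function algebras and their characters\<close>

definition subalg :: "'x set => ('x => complex) set => bool" where
 "subalg X A \<longleftrightarrow> A \<subseteq> extensional X & (ALL c. (\<lambda>x\<in>X. c) : A) &
  (ALL f:A. ALL h:A. (\<lambda>x\<in>X. f x + h x) : A & (\<lambda>x\<in>X. f x * h x) : A)"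

lemma characters_iff:
 assumes A: "subalg X A"
 shows "chi : characters X A \<longleftrightarrow> chi : extensional A & (ALL c. chi (\<lambda>x\<in>X. c) = c) &
  (ALL f:A. ALL h:A. chi (\<lambda>x\<in>X. f x + h x) = chi f + chi h & chi (\<lambda>x\<in>X. f x * h x) = chi f * chi h)"
 using A unfolding characters_def Ring.ring_hom_def subalg_def by (auto simp: fun_ring_def class_ring_simps)

lemma mult_closed_Spec:
 assumes A: "subalg X A"
 shows "mult_closed (characters X A) ((%f (chi :: ('x => complex) => complex). chi f) ` A)" (is "mult_closed _ ?F")
 unfolding mult_closed_def
proof (intro conjI ballI)
 show "EX f:?F. ALL y:characters X A. f y ~= 0"
  using A by (intro bexI[of _ "%chi. chi (\<lambda>x\<in>X. 1)"]) (auto simp: characters_iff[OF A] subalg_def)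
 fix f h assume "f : ?F" "h : ?F"
 then obtain f' h' where "f = (%chi. chi f')" "f' : A" "h = (%chi. chi h')" "h' : A" by blast
 thus "EX e:?F. ALL y:characters X A. e y = f y * h y"
  using A by (intro bexI[of _ "%chi. chi (\<lambda>x\<in>X. f' x * h' x)"]) (auto simp: characters_iff[OF A] subalg_def)
qed

lemma Spec_map_character:
 assumes A: "subalg X A" and B: "subalg Y B"
  and phi: "!!f. f : A ==> phi f : B" "!!c. phi (\<lambda>x\<in>X. c) = (\<lambda>y\<in>Y. c)"
   "!!f h. f : A ==> h : A ==> phi (\<lambda>x\<in>X. f x + h x) = (\<lambda>y\<in>Y. phi f y + phi h y)"
   "!!f h. f : A ==> h : A ==> phi (\<lambda>x\<in>X. f x * h x) = (\<lambda>y\<in>Y. phi f y * phi h y)"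
  and chi: "chi : characters Y B"
 shows "Spec_map A phi chi : characters X A"
 using chi A phi(1) unfolding characters_iff[OF A] characters_iff[OF B] subalg_def
 by (simp add: Spec_map_def phi(2-4))

lemma Spec_iso:
 fixes X :: "'x set" and Y :: "'y set"
 assumes A: "subalg X A" and B: "subalg Y B" and phi: "calg_iso X A Y B phi"
 shows "variety_iso (Spec Y B) (Spec X A) (Spec_map A phi)"
 unfolding Spec_def
proof (rule affine_variety_iso[OF mult_closed_Spec[OF B] mult_closed_Spec[OF A]])
 have phib: "bij_betw phi A B" and phic: "!!c. phi (\<lambda>x\<in>X. c) = (\<lambda>y\<in>Y. c)"
  and phih: "!!f h. f : A ==> h : A ==> phi (\<lambda>x\<in>X. f x + h x) = (\<lambda>y\<in>Y. phi f y + phi h y)"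
   "!!f h. f : A ==> h : A ==> phi (\<lambda>x\<in>X. f x * h x) = (\<lambda>y\<in>Y. phi f y * phi h y)"
  using phi by (auto simp: calg_iso_def ring_iso_def Ring.ring_hom_def fun_ring_def)
 let ?psi = "inv_into A phi"
 have phiB: "phi f : B" "?psi (phi f) = f" if "f : A" for f using phib that by (auto simp: bij_betw_def)
 have psi: "?psi h : A" "phi (?psi h) = h" if "h : B" for h
  using phib that by (auto simp: bij_betw_def inv_into_into f_inv_into_f)
 note A' = A[unfolded subalg_def]
 have psic: "?psi (\<lambda>y\<in>Y. c) = (\<lambda>x\<in>X. c)" for c
  using phiB(2)[of "\<lambda>x\<in>X. c"] A' unfolding phic by simp
 have psih: "?psi (\<lambda>y\<in>Y. f y + h y) = (\<lambda>x\<in>X. ?psi f x + ?psi h x)"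
  "?psi (\<lambda>y\<in>Y. f y * h y) = (\<lambda>x\<in>X. ?psi f x * ?psi h x)" if f: "f : B" and h: "h : B" for f h
  using phiB(2)[of "\<lambda>x\<in>X. ?psi f x + ?psi h x"] phiB(2)[of "\<lambda>x\<in>X. ?psi f x * ?psi h x"] A' psi(1)[OF f] psi(1)[OF h]
  unfolding phih[OF psi(1)[OF f] psi(1)[OF h]] psi(2)[OF f] psi(2)[OF h] by simp_all
 have ext: "chi : extensional B" if "chi : characters Y B" for chi using that unfolding characters_iff[OF B] by blast
 have ext': "chi : extensional A" if "chi : characters X A" for chi using that unfolding characters_iff[OF A] by blast
 show "bij_betw (Spec_map A phi) (characters Y B) (characters X A)"
 proof (rule bij_betw_byWitness[of _ "Spec_map B ?psi"])
  show "Spec_map A phi ` characters Y B \<subseteq> characters X A"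
   by (rule image_subsetI) (rule Spec_map_character[OF A B phiB(1) phic phih])
  show "Spec_map B ?psi ` characters X A \<subseteq> characters Y B"
   by (rule image_subsetI) (rule Spec_map_character[OF B A psi(1) psic psih])
  show "ALL chi:characters Y B. Spec_map B ?psi (Spec_map A phi chi) = chi"
   using ext by (intro ballI extensionalityI[of _ B]) (simp_all add: Spec_map_def psi)
  show "ALL chi:characters X A. Spec_map A phi (Spec_map B ?psi chi) = chi"
   using ext' by (intro ballI extensionalityI[of _ A]) (simp_all add: Spec_map_def phiB)
 qed
 have ev: "Spec_map A phi chi f = chi (phi f)" if "f : A" for chi :: "('y => complex) => complex" and f using that by (simp add: Spec_map_def)
 fix f :: "(('x => complex) => complex) => complex" assume "f : (%f chi. chi f) ` A"
 then obtain a where a: "f = (%chi. chi a)" "a : A" by blast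
 thus "EX e:(%f chi. chi f) ` B. ALL y:characters Y B. e y = f (Spec_map A phi y)"
  using ev[OF a(2)] phiB[OF a(2)] by (intro bexI[of _ "%chi. chi (phi a)"]) auto
next
 fix e :: "(('y => complex) => complex) => complex" assume "e : (%f chi. chi f) ` B"
 then obtain b where b: "e = (%chi. chi b)" "b : B" by blast
 have "bij_betw phi A B" using phi by (simp add: calg_iso_def ring_iso_def fun_ring_def)
 then obtain a where "a : A" "b = phi a" using b(2) by (auto simp: bij_betw_def)
 thus "EX f:(%f chi. chi f) ` A. ALL y:characters Y B. e y = f (Spec_map A phi y)"
  using b by (intro bexI[of _ "%chi. chi a"]) (auto simp: Spec_map_def)
qed

lemma openin_SL_quotient:
 "openin (zariski (SL_quotient n H)) U \<longleftrightarrow> U \<subseteq> (%g. g <#\<^bsub>SL n\<^esub> H) ` SLc n &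
  openin (zariski (SL_variety n)) {g : SLc n. g <#\<^bsub>SL n\<^esub> H : U}"
 unfolding SL_quotient_def variety.simps by (subst topology_inverse'[OF istopology_quotient]) simp

section \<open>Closed orbits\<close>

lemma zero_mat_vec:
 assumes x: "(x :: complex vec) : carrier_vec b"
 shows "0\<^sub>m a b *v x = 0\<^sub>v a"
proof (rule eq_vecI)
 fix i assume "i < dim_vec (0\<^sub>v a :: complex vec)"
 hence i: "i < a" by simp
 have "(0\<^sub>m a b *v x) $ i = (SUM l<b. 0\<^sub>m a b $$ (i, l) * x $ l)"
  by (rule index_mult_vec_sum[OF zero_carrier_mat x i])
 also have "... = 0" using i by (intro sum.neutral) simp
 finally show "(0\<^sub>m a b *v x) $ i = 0\<^sub>v a $ i" using i by simp
qed simp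

lemma chain_normal:
 assumes Gam: "Gam : gauges n" and d: "1 <= d" "d + Suc j <= n"
 shows "chain (qact n Gam (qE n D)) d (Suc j) = Gam (d + Suc j) * pid (d + Suc j) d (mm D d) * adj_mat (Gam d)"
 by (simp only: chain_qact[OF Gam qE_quiver d] chain_qE[OF d])

text \<open>
  The coordinates of the image of vertex \<open>i\<close> in \<open>\<complex>\<^sup>n\<close> with respect to the first \<open>d\<close> columns of \<open>g\<close>.
\<close>

definition topc :: "nat => nat => complex mat => (nat => complex mat) => nat => complex mat" where
 "topc n d g beta i = pid d n d * adj_mat g * chain beta i (n - i)"

lemma topc_carrier:
 assumes "g : SLc n" "beta : quivers n" "1 <= i" "i <= n"
 shows "topc n d g beta i : carrier_mat d i"
proof -
 have "adj_mat g : sq_mat n" using SL_mat[OF SL_adj(1)[OF assms(1)]] .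
 moreover have "chain beta i (n - i) : carrier_mat n i" using chain_carrier[OF assms(2,3), of "n - i"] assms(4) by simp
 ultimately show ?thesis unfolding topc_def by (intro mult_carrier_mat[of _ d n] mult_carrier_mat[of "pid d n d" d n]) auto
qed

lemma pf_topc:
 assumes g: "g : SLc n" and i: "1 <= i" "i <= n" and rc: "r < d" "c < i"
 shows "pf (quivers n) (qcoords n) (%beta. topc n d g beta i $$ (r, c))"
proof -
 have a: "adj_mat g : sq_mat n" using SL_mat[OF SL_adj(1)[OF g]] .
 have c: "chain beta i (n - i) : carrier_mat n i" if "beta : quivers n" for beta
  using chain_carrier[OF that i(1), of "n - i"] i(2) by simp
 show ?thesis unfolding topc_def
  by (rule pf_mat_mult[where n = d and m = n and k = i])
   (use a c i rc in \<open>auto intro!: pf_const pf_chain mult_carrier_mat[of "pid d n d" d n]\<close>)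
qed

lemma pid_pid: "d <= a ==> a <= b ==> pid d b d * pid b a d = pid d a d"
 by (subst mult_pid[of _ d b]) (auto simp: pid_def intro!: eq_matI)

lemma pid_pid': "d <= a ==> d <= b ==> pid b d d * pid d a d = pid b a d"
 by (subst mult_pid[of _ b d] pid_mult[of _ d a]) (auto simp: pid_def intro!: eq_matI)

lemma topc_normal:
 assumes Gam: "Gam : gauges n" and g: "Gam n = g" and i: "1 <= i" "i < n" and d: "d = mm D i"
 shows "topc n d g (qact n Gam (qE n D)) i = pid d i d * adj_mat (Gam i)"
proof -
 obtain j where j: "n - i = Suc j" using i by (metis Suc_diff_Suc)
 have dj: "i + Suc j = n" using j i by simp
 have dn: "d <= i" using d mm_le by simp
 have gS: "g : SLc n" using gaugeD[OF Gam, of n] g i by simp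
 have c: "adj_mat g : sq_mat n" "g : sq_mat n" "adj_mat (Gam i) : carrier_mat i i"
  using SL_mat[OF SL_adj(1)[OF gS]] SL_mat[OF gS] gauge_adj_mat[OF Gam i(1)] i by auto
 have "chain (qact n Gam (qE n D)) i (n - i) = g * pid n i d * adj_mat (Gam i)"
  unfolding j using chain_normal[OF Gam i(1), of j D] unfolding dj g d by simp
 also have "... = g * (pid n i d * adj_mat (Gam i))" by (rule assoc_mult_mat[OF c(2) pid_carrier c(3)])
 finally have 1: "chain (qact n Gam (qE n D)) i (n - i) = g * (pid n i d * adj_mat (Gam i))" .
 have pc: "pid n i d * adj_mat (Gam i) : carrier_mat n i" using c by (intro mult_carrier_mat[of _ n i]) auto
 have "topc n d g (qact n Gam (qE n D)) i = pid d n d * (adj_mat g * (g * (pid n i d * adj_mat (Gam i))))"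
  unfolding topc_def 1
  by (rule assoc_mult_mat[OF pid_carrier c(1)]) (rule mult_carrier_mat[OF c(2) pc])
 also have "... = pid d n d * (pid n i d * adj_mat (Gam i))" unfolding SL_adj_cancel(2)[OF gS pc] ..
 also have "... = pid d n d * pid n i d * adj_mat (Gam i)" by (rule assoc_mult_mat[symmetric, OF pid_carrier pid_carrier c(3)])
 also have "pid d n d * pid n i d = pid d i d" using dn i by (intro pid_pid) auto
 finally show ?thesis .
qed

lemma topc_normal_self:
 assumes Gam: "Gam : gauges n" and g: "Gam n = g" and i: "1 <= d" "d < n" and d: "d : D"
 shows "topc n d g (qact n Gam (qE n D)) d = adj_mat (Gam d)"
proof -
 have "pid d d d = 1\<^sub>m d" by (auto simp: pid_def intro!: eq_matI)
 thus ?thesis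
  using topc_normal[OF Gam g i, of d D] mm_self[OF d] gauge_adj_mat[OF Gam i(1)] i by simp
qed

text \<open>On the orbit, arrow i factors through C^d, where d is the last member of
  \<open>D\<close> up to i. The factorisation is written with \<open>chain\<close>,
  \<open>topc\<close> and an adjugate, all polynomial in the quiver, so that it persists in the
  closure (\<open>clos_arrow\<close>).\<close>

lemma arrow_normal:
 assumes Gam: "Gam : gauges n" and g: "Gam n = g" and i: "1 <= i" "i < n" and d: "d = mm D i" "1 <= d"
 defines "beta == qact n Gam (qE n D)"
 shows "beta i = chain beta d (Suc i - d) * adj_mat (topc n d g beta d) * topc n d g beta i"
proof -
 have di: "d <= i" using d mm_le by simp
 have dD: "d : D" using d mm_in[of D i] by auto
 obtain j where j: "Suc i - d = Suc j" using di by (metis Suc_diff_le)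
 have dj: "d + Suc j = Suc i" using j di by simp
 have dn: "d < n" using di i by simp
 have Gd: "Gam d : carrier (SL d)" using gaugeD[OF Gam d(2)] dn by simp
 have c: "Gam (Suc i) : carrier_mat (Suc i) (Suc i)" "adj_mat (Gam i) : carrier_mat i i"
  "adj_mat (Gam d) : carrier_mat d d" "Gam d : carrier_mat d d"
  using i d dn by (auto intro!: gauge_mat[OF Gam] gauge_adj_mat[OF Gam])
 have 1: "chain beta d (Suc i - d) = Gam (Suc i) * pid (Suc i) d d * adj_mat (Gam d)"
  unfolding j beta_def using chain_normal[OF Gam d(2), of j D] i unfolding dj mm_self[OF dD] by simp
 have 2: "adj_mat (topc n d g beta d) = Gam d"
  unfolding beta_def topc_normal_self[OF Gam g d(2) dn dD] by (rule adj_adj[OF Gd])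
 have 3: "topc n d g beta i = pid d i d * adj_mat (Gam i)"
  unfolding beta_def by (rule topc_normal[OF Gam g i d(1)])
 let ?K = "Gam (Suc i) * pid (Suc i) d d"
 have K: "?K : carrier_mat (Suc i) d" by (rule mult_carrier_mat[OF c(1) pid_carrier])
 have "?K * adj_mat (Gam d) * Gam d = ?K * (adj_mat (Gam d) * Gam d)" by (rule assoc_mult_mat[OF K c(3,4)])
 also have "... = ?K" unfolding SL_adj(3)[OF Gd] by (rule right_mult_one_mat[OF K])
 finally have "chain beta d (Suc i - d) * adj_mat (topc n d g beta d) * topc n d g beta i = ?K * (pid d i d * adj_mat (Gam i))"
  unfolding 1 2 3 by simp
 also have "... = ?K * pid d i d * adj_mat (Gam i)" by (rule assoc_mult_mat[symmetric, OF K pid_carrier c(2)])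
 also have "?K * pid d i d = Gam (Suc i) * (pid (Suc i) d d * pid d i d)" by (rule assoc_mult_mat[OF c(1) pid_carrier pid_carrier])
 also have "pid (Suc i) d d * pid d i d = pid (Suc i) i d" by (rule pid_pid') (use di in auto)
 also have "Gam (Suc i) * pid (Suc i) i d * adj_mat (Gam i) = beta i"
  using i d(1) by (simp add: beta_def qact_def qE_def)
 finally show ?thesis ..
qed

lemma orbit_pt:
 assumes g: "g : SLc n" and gamma: "gamma : G1 n"
 shows "EX Gam:gauges n. Gam n = g & qact n gamma (pt n D g) = qact n Gam (qE n D)"
proof -
 have gammaG: "gamma : gauges n" "gamma n = 1\<^sub>m n" using gamma by (auto simp: G1_def)
 show ?thesis
  unfolding pt_def qact_mult[OF gammaG(1) topg_gauge[OF g] qE_quiver]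
  by (rule bexI[OF _ gauge_mult[OF gammaG(1) topg_gauge[OF g]]])
   (use gammaG SL_mat[OF g] in \<open>auto simp: topg_def\<close>)
qed

text \<open>How formulas for normal forms become properties of limits: the difference of the two
  sides is a polynomial that vanishes on the orbit.\<close>

lemma qclos_eq:
 assumes beta: "beta : qclos n alpha" and f: "pf (quivers n) (qcoords n) f" and h: "pf (quivers n) (qcoords n) h"
  and eq: "!!gamma. gamma : G1 n ==> f (qact n gamma alpha) = h (qact n gamma alpha)"
 shows "f beta = h beta"
proof -
 have "ALL gamma:G1 n. (%b. f b - h b) (qact n gamma alpha) = 0" using eq by simp
 with pf_diff[OF f h] have "(%b. f b - h b) beta = 0"
  using beta unfolding qclos_def mem_Collect_eq by blast
 thus ?thesis by simp
qed

section \<open>Points in the orbit closure of a normal form\<close>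

context
 fixes n :: nat and D :: "nat set" and g :: "complex mat" and beta :: "nat => complex mat"
 assumes g: "g : SLc n" and beta: "beta : qclos n (pt n D g)"
begin

lemma clos_quiver: "beta : quivers n"
 using beta by (simp add: qclos_def)

lemma clos_det:
 assumes d: "d : D" "1 <= d" "d < n"
 shows "det (topc n d g beta d) = 1"
proof (rule qclos_eq[OF beta _ pf_const])
 show "pf (quivers n) (qcoords n) (%beta. det (topc n d g beta d))"
  using d by (intro pf_det[where d = d] pf_topc topc_carrier g) auto
 fix gamma assume "gamma : G1 n"
 from orbit_pt[OF g this] obtain Gam where Gam: "Gam : gauges n" "Gam n = g" "qact n gamma (pt n D g) = qact n Gam (qE n D)"
  by blast
 have "adj_mat (Gam d) : carrier (SL d)" using SL_adj(1)[OF gaugeD[OF Gam(1) d(2)]] d by simp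
 thus "det (topc n d g (qact n gamma (pt n D g)) d) = 1"
  unfolding Gam(3) topc_normal_self[OF Gam(1,2) d(2,3,1)] by (simp add: SL_carrier)
qed

lemma clos_arrow:
 assumes i: "1 <= i" "i < n" and d: "d = mm D i" "1 <= d"
 shows "beta i = chain beta d (Suc i - d) * adj_mat (topc n d g beta d) * topc n d g beta i" (is "_ = ?R beta")
proof (rule eq_matI)
 have di: "d <= i" using d mm_le by simp
 have cc: "chain b d (Suc i - d) : carrier_mat (Suc i) d" "topc n d g b d : carrier_mat d d"
  "topc n d g b i : carrier_mat d i" "adj_mat (topc n d g b d) : carrier_mat d d" if "b : quivers n" for b
  using chain_carrier[OF that d(2), of "Suc i - d"] topc_carrier[OF g that, of _ d] i d(2) di adj_mat(1)[OF topc_carrier[OF g that d(2), of d]]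
  by simp_all
 have R: "?R b : carrier_mat (Suc i) i" if "b : quivers n" for b
  using cc[OF that] by (intro mult_carrier_mat[of _ _ d]) auto
 have B: "beta i : carrier_mat (Suc i) i" using quiverD[OF clos_quiver i] .
 show "dim_row (beta i) = dim_row (?R beta)" "dim_col (beta i) = dim_col (?R beta)"
  using carrier_matD[OF B] carrier_matD[OF R[OF clos_quiver]] by auto
 fix r c assume "r < dim_row (?R beta)" "c < dim_col (?R beta)"
 hence rc: "r < Suc i" "c < i" using carrier_matD[OF R[OF clos_quiver]] by auto
 show "beta i $$ (r, c) = ?R beta $$ (r, c)"
 proof (rule qclos_eq[OF beta pf_qcoord])
  show "pf (quivers n) (qcoords n) (%b. ?R b $$ (r, c))"
  proof (rule pf_mat_mult[where n = "Suc i" and m = d and k = i])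
   show "pf (quivers n) (qcoords n) (%b. (chain b d (Suc i - d) * adj_mat (topc n d g b d)) $$ (r, c))" if "r < Suc i" "c < d" for r c
    by (rule pf_mat_mult[where n = "Suc i" and m = d and k = d])
     (use cc i d di that in \<open>auto intro!: pf_chain pf_adj_mat[where d = d] pf_topc g\<close>)
   show "chain b d (Suc i - d) * adj_mat (topc n d g b d) : carrier_mat (Suc i) d" if "b : quivers n" for b
    using cc[OF that] by (intro mult_carrier_mat[of _ _ d]) auto
  qed (use cc rc i in \<open>auto intro!: pf_topc g\<close>)
  fix gamma assume "gamma : G1 n"
  from orbit_pt[OF g this] obtain Gam where Gam: "Gam : gauges n" "Gam n = g" "qact n gamma (pt n D g) = qact n Gam (qE n D)"
   by blast
  show "qact n gamma (pt n D g) i $$ (r, c) = ?R (qact n gamma (pt n D g)) $$ (r, c)"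
   unfolding Gam(3) using arrow_normal[OF Gam(1,2) i d] by simp
 qed (use i rc in auto)
qed

lemma clos_zero:
 assumes i: "1 <= i" "i < n" and d: "mm D i = 0"
 shows "beta i = 0\<^sub>m (Suc i) i"
proof (rule eq_matI)
 have B: "beta i : carrier_mat (Suc i) i" using quiverD[OF clos_quiver i] .
 thus "dim_row (beta i) = dim_row (0\<^sub>m (Suc i) i :: complex mat)" "dim_col (beta i) = dim_col (0\<^sub>m (Suc i) i :: complex mat)" by auto
 fix r c assume "r < dim_row (0\<^sub>m (Suc i) i :: complex mat)" "c < dim_col (0\<^sub>m (Suc i) i :: complex mat)"
 hence rc: "r < Suc i" "c < i" by auto
 have "beta i $$ (r, c) = 0"
 proof (rule qclos_eq[OF beta pf_qcoord pf_const])
  fix gamma assume "gamma : G1 n"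
  from orbit_pt[OF g this] obtain Gam where Gam: "Gam : gauges n" "Gam n = g" "qact n gamma (pt n D g) = qact n Gam (qE n D)"
   by blast
  have z: "pid (Suc i) i 0 = 0\<^sub>m (Suc i) i" by (auto simp: pid_def intro!: eq_matI)
  have c: "Gam (Suc i) : carrier_mat (Suc i) (Suc i)" "adj_mat (Gam i) : carrier_mat i i"
   using i by (auto intro!: gauge_mat[OF Gam(1)] gauge_adj_mat[OF Gam(1)])
  have "qact n Gam (qE n D) i = 0\<^sub>m (Suc i) i"
   using i d c by (simp add: qact_def qE_def z)
  thus "qact n gamma (pt n D g) i $$ (r, c) = 0" unfolding Gam(3) using rc by simp
 qed (use i rc in auto)
 thus "beta i $$ (r, c) = 0\<^sub>m (Suc i) i $$ (r, c)" using rc by simp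
qed

text \<open>The matrix \<open>topc\<close> at vertex d has determinant one also in the closure, and
  it factors through \<open>chain beta d j\<close>.\<close>

lemma clos_inj:
 assumes d: "d : D" "1 <= d" "d < n" and j: "d + j <= n" and w: "w : carrier_vec d" "chain beta d j *v w = 0\<^sub>v (d + j)"
 shows "w = 0\<^sub>v d"
proof -
 have Q: "beta : quivers n" by (rule clos_quiver)
 have C: "topc n d g beta d : carrier_mat d d" using d by (intro topc_carrier g Q) auto
 have c1: "chain beta d j : carrier_mat (d + j) d" by (rule chain_carrier[OF Q d(2) j])
 have c2: "chain beta (d + j) (n - d - j) : carrier_mat n (d + j)"
  using chain_carrier[OF Q, of "d + j" "n - d - j"] d j by simp
 have c3: "chain beta d (n - d) = chain beta (d + j) (n - d - j) * chain beta d j"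
  using chain_add[OF Q d(2), of j "n - d - j"] j d by simp
 have a: "adj_mat g : sq_mat n" using SL_mat[OF SL_adj(1)[OF g]] .
 have p: "pid d n d * adj_mat g : carrier_mat d n" by (rule mult_carrier_mat[OF pid_carrier a])
 have "chain beta d (n - d) *v w = chain beta (d + j) (n - d - j) *v (chain beta d j *v w)"
  unfolding c3 by (rule assoc_mult_mat_vec[OF c2 c1 w(1)])
 also have "... = 0\<^sub>v n" unfolding w(2) by (rule mult_vec_zero[OF c2])
 finally have z: "chain beta d (n - d) *v w = 0\<^sub>v n" .
 have c4: "chain beta d (n - d) : carrier_mat n d" unfolding c3 by (rule mult_carrier_mat[OF c2 c1])
 have "topc n d g beta d *v w = (pid d n d * adj_mat g) *v (chain beta d (n - d) *v w)"
  unfolding topc_def by (rule assoc_mult_mat_vec[OF p c4 w(1)])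
 also have "... = 0\<^sub>v d" unfolding z by (rule mult_vec_zero[OF p])
 finally have t: "topc n d g beta d *v w = 0\<^sub>v d" .
 have S: "topc n d g beta d : carrier (SL d)" using C clos_det[OF d] by (simp add: SL_carrier)
 have "w = adj_mat (topc n d g beta d) *v (topc n d g beta d *v w)"
  using SL_vec_cancel(2)[OF S w(1)] by simp
 also have "... = 0\<^sub>v d" unfolding t by (rule mult_vec_zero[OF SL_mat[OF SL_adj(1)[OF S]]])
 finally show ?thesis .
qed

lemma clos_im:
 assumes i: "1 <= i" "i < n" and d: "d = mm D i" "1 <= d" and x: "x : carrier_vec i"
 shows "EX w:carrier_vec d. beta i *v x = chain beta d (Suc i - d) *v w"
proof -
 have Q: "beta : quivers n" by (rule clos_quiver)
 have di: "d <= i" using d mm_le by simp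
 have cc: "chain beta d (Suc i - d) : carrier_mat (Suc i) d" "topc n d g beta d : carrier_mat d d"
  "topc n d g beta i : carrier_mat d i" "adj_mat (topc n d g beta d) : carrier_mat d d"
  using chain_carrier[OF Q d(2), of "Suc i - d"] topc_carrier[OF g Q, of _ d] i d(2) di adj_mat(1)[OF topc_carrier[OF g Q d(2), of d]]
  by simp_all
 have cd: "chain beta d (Suc i - d) * adj_mat (topc n d g beta d) : carrier_mat (Suc i) d" by (rule mult_carrier_mat[OF cc(1,4)])
 have tx: "topc n d g beta i *v x : carrier_vec d" by (rule mult_mat_vec_carrier[OF cc(3) x])
 have "beta i *v x = chain beta d (Suc i - d) * adj_mat (topc n d g beta d) *v (topc n d g beta i *v x)"
  by (subst clos_arrow[OF i d]) (rule assoc_mult_mat_vec[OF cd cc(3) x])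
 also have "... = chain beta d (Suc i - d) *v (adj_mat (topc n d g beta d) *v (topc n d g beta i *v x))"
  by (rule assoc_mult_mat_vec[OF cc(1,4) tx])
 finally show ?thesis using mult_mat_vec_carrier[OF cc(4) tx] by blast
qed

text \<open>Ranks cannot drop in the limit. At members of \<open>D\<close> the arrows stay injective
  by \<open>clos_inj\<close>; at other vertices with d >= 1 every value of the arrow comes from C^d
  through the image of the previous arrow, on which the arrow is injective.\<close>

lemma clos_pstab: "pstab n beta"
 unfolding pstab_def
proof (intro allI impI)
 fix i assume i: "1 <= i & i < n"
 have Q: "beta : quivers n" by (rule clos_quiver)
 have B: "beta i : carrier_mat (Suc i) i" using quiverD[OF Q] i by blast
 let ?P = "(ALL x:carrier_vec i. EX y:qim beta i. beta i *v x = beta i *v y) &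
  (ALL y:qim beta i. beta i *v y = 0\<^sub>v (Suc i) --> y = 0\<^sub>v i)"
 consider (inj) "i : D" | (zero) "i ~: D" "mm D i = 0" | (skip) "i ~: D" "1 <= mm D i" by linarith
 thus "minj (beta i) | ?P"
 proof cases
  case inj
  have "minj (beta i)"
   unfolding minj_def
  proof (intro ballI impI)
   fix x assume x: "x : carrier_vec (dim_col (beta i))" "beta i *v x = 0\<^sub>v (dim_row (beta i))"
   have "chain beta i 1 = beta i" using B by simp
   hence "x = 0\<^sub>v i" using clos_inj[OF inj, of 1 x] i x B by simp
   thus "x = 0\<^sub>v (dim_col (beta i))" using B by simp
  qed
  thus ?thesis ..
 next
  case zero
  have z: "beta i = 0\<^sub>m (Suc i) i" using clos_zero[OF _ _ zero(2)] i by blast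
  have q: "qim beta i = {0\<^sub>v i}"
  proof (cases "i <= 1")
   case False
   have "mm D (i - 1) = 0" using mm_mono[of "i - 1" i D] zero(2) by simp
   hence "beta (i - 1) = 0\<^sub>m i (i - 1)" using clos_zero[of "i - 1"] False i by simp
   thus ?thesis using False zero_mat_vec[of _ "i - 1" i]
    by (auto simp: qim_def intro!: image_eqI[of _ _ "0\<^sub>v (i - 1)"])
  qed (simp add: qim_def)
  have ?P unfolding q z by (simp add: zero_mat_vec)
  thus ?thesis ..
 next
  case skip
  define d where "d = mm D i"
  have d: "d = mm D i" "1 <= d" using skip d_def by auto
  have dD: "d : D" using mm_in[of D i] d by auto
  have di: "d < i" using mm_le[of D i] dD skip(1) d by (metis le_neq_implies_less)
  have dn: "d < n" using di i by simp
  have i2: "2 <= i" "1 <= i - 1" "i - 1 < n" "Suc (i - 1) = i" using di d i by auto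
  have m: "d = mm D (i - 1)" using mm_skip[OF skip(1)] i d by simp
  have A: "beta (i - 1) : carrier_mat i (i - 1)" using quiverD[OF Q i2(2,3)] i2(4) by simp
  have qi: "qim beta i = (%z. beta (i - 1) *v z) ` carrier_vec (i - 1)" using di d(2) by (simp add: qim_def)
  have cc: "chain beta d (i - d) : carrier_mat i d" "chain beta d (i - 1 - d) : carrier_mat (i - 1) d"
   using chain_carrier[OF Q d(2), of "i - d"] chain_carrier[OF Q d(2), of "i - 1 - d"] di i by auto
  have s1: "chain beta d (Suc i - d) = beta i * chain beta d (i - d)"
   using chain.simps(2)[of beta d "i - d"] di by (simp add: Suc_diff_le)
  have s2: "chain beta d (i - d) = beta (i - 1) * chain beta d (i - 1 - d)"
   using chain.simps(2)[of beta d "i - 1 - d"] di by (simp add: Suc_diff_Suc)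
  have e1: "chain beta d (Suc i - d) *v w = beta i *v (chain beta d (i - d) *v w)" if "w : carrier_vec d" for w
   unfolding s1 by (rule assoc_mult_mat_vec[OF B cc(1) that])
  have e2: "chain beta d (i - d) *v w = beta (i - 1) *v (chain beta d (i - 1 - d) *v w)" if "w : carrier_vec d" for w
   unfolding s2 by (rule assoc_mult_mat_vec[OF A cc(2) that])
  have ?P
  proof (intro conjI ballI impI)
   fix x :: "complex vec" assume x: "x : carrier_vec i"
   obtain w where w: "w : carrier_vec d" "beta i *v x = chain beta d (Suc i - d) *v w"
    using clos_im[OF _ _ d x] i by blast
   have "chain beta d (i - d) *v w : qim beta i"
    unfolding qi e2[OF w(1)] using mult_mat_vec_carrier[OF cc(2) w(1)] by blast
   thus "EX y:qim beta i. beta i *v x = beta i *v y"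
    unfolding w(2) e1[OF w(1)] by blast
  next
   fix y assume y: "y : qim beta i" "beta i *v y = 0\<^sub>v (Suc i)"
   then obtain z where z: "z : carrier_vec (i - 1)" "y = beta (i - 1) *v z" unfolding qi by blast
   obtain w where w: "w : carrier_vec d" "y = chain beta d (i - d) *v w"
    using clos_im[OF i2(2,3) m d(2) z(1)] unfolding z(2) i2(4) by blast
   have "chain beta d (Suc i - d) *v w = 0\<^sub>v (Suc i)" using y(2) unfolding w(2) e1[OF w(1)] .
   hence "w = 0\<^sub>v d" using clos_inj[OF dD d(2) dn, of "Suc i - d" w] w(1) di i by simp
   thus "y = 0\<^sub>v i" using w(2) mult_vec_zero[OF cc(1)] by simp
  qed
  thus ?thesis ..
 qed
qed

end

section \<open>Separation of the normal forms by invariants\<close>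

lemma minor_nonzero:
 assumes g: "g : SLc n" and d: "d <= n"
 shows "EX rho. (ALL i<d. rho i < n) & minor g d rho ~= 0"
proof (rule ccontr)
 assume "~ ?thesis"
 hence z: "minor g d kappa = 0" if "kappa : rowsel n d" for kappa using rowsel_less[OF that] by blast
 have "minor (adj_mat g * g) d id = 0"
  using minor_mult[OF SL_mat[OF SL_adj(1)[OF g]] SL_mat[OF g] d, of id] z d by simp
 moreover have "minor (1\<^sub>m n :: complex mat) d id = 1"
  by (rule minor_unitri[OF _ d]) (auto simp: unitri_def)
 ultimately show False unfolding SL_adj(3)[OF g] by simp
qed

text \<open>The last component of the gauge is moved into the matrix argument of \<open>pt\<close>,
  which leaves a gauge that is trivial at vertex n.\<close>

lemma qact_pt_normal:
 assumes gamma: "gamma : gauges n" and n: "1 <= n"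
 shows "EX delta:G1 n. qact n gamma (qE n D) = qact n delta (pt n D (gamma n))"
proof -
 let ?delta = "%i. if i = n then 1\<^sub>m n else gamma i"
 have g: "gamma n : SLc n" using gaugeD[OF gamma n] by simp
 have delta: "?delta : G1 n" using gamma SL_one_closed by (auto simp: G1_def gauges_def)
 hence "?delta : gauges n" by (simp add: G1_def)
 hence "qact n ?delta (pt n D (gamma n)) = qact n (%i. ?delta i * topg n (gamma n) i) (qE n D)"
  unfolding pt_def by (rule qact_mult[OF _ topg_gauge[OF g] qE_quiver])
 also have "... = qact n gamma (qE n D)"
 proof (rule qact_cong)
  fix i assume "1 <= i" "i <= n"
  thus "?delta i * topg n (gamma n) i = gamma i"
   using gauge_mat[OF gamma, of i] by (cases "i = n") (simp_all add: topg_def)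
 qed
 finally show ?thesis using delta by metis
qed

lemma qinv_G1:
 assumes gamma: "gamma : G1 n" and alpha: "alpha : quivers n" and d: "1 <= d" "d <= n" and rho: "!!i. i < d ==> rho i < n"
 shows "qinv n d rho (qact n gamma alpha) = qinv n d rho alpha"
proof -
 have "chain alpha d (n - d) : carrier_mat n d" using chain_carrier[OF alpha d(1), of "n - d"] d by simp
 thus ?thesis using qinv_qact[OF _ alpha d rho, of gamma] gamma by (simp add: G1_def qinv_def)
qed

text \<open>An invertible matrix has a nonzero minor of each size on its first columns, so the
  vanishing pattern gives back \<open>D\<close>, and \<open>minors_Hgrp\<close> gives the
  coset.\<close>

lemma pt_minors_eq:
 assumes E: "E : flag_types n" and D: "D : flag_types n" and g': "g' : SLc n" and g: "g : SLc n"
  and inv: "!!d rho. 1 <= d ==> d < n ==> (!!i. i < d ==> rho i < n) ==>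
   (if d : E then minor g' d rho else 0) = (if d : D then minor g d rho else 0)"
 shows "E = D & adj_mat g * g' : Hgrp n D"
proof -
 have "d : E \<longleftrightarrow> d : D" if d: "1 <= d" "d < n" for d
 proof -
  obtain rho rho' where rho: "!!i. i < d ==> rho i < n" "minor g d rho ~= 0"
   and rho': "!!i. i < d ==> rho' i < n" "minor g' d rho' ~= 0"
   using minor_nonzero[OF g, of d] minor_nonzero[OF g', of d] d by auto
  show ?thesis using inv[of d rho, OF d rho(1)] inv[of d rho', OF d rho'(1)] rho(2) rho'(2) by (auto split: if_splits)
 qed
 hence DE: "d : E \<longleftrightarrow> d : D" if "1 <= d" "d < n" for d using that by blast
 have "n : D" "n : E" "D \<subseteq> {1..n}" "E \<subseteq> {1..n}" using D E by (simp_all add: flag_types_def)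
 hence "e : E \<longleftrightarrow> e : D" for e using DE[of e] by (cases "e = n"; cases "1 <= e & e < n") auto
 hence ED: "E = D" by blast
 have m: "minor g d rho = minor g' d rho" if "d : D" "d < n" "!!i. i < d ==> rho i < n" for d rho
 proof -
  have "1 <= d" using that(1) D by (auto simp: flag_types_def)
  from inv[OF this that(2,3)] show ?thesis using that(1) ED by simp
 qed
 have h: "adj_mat g * g' : Hgrp n D" by (rule minors_Hgrp[OF D g g' m])
 thus ?thesis using ED by blast
qed

text \<open>A point of the closure has a normal form by \<open>clos_pstab\<close>, and it has the
  same invariants as \<open>pt n D g\<close>; these determine type and coset, so the point lies in
  the orbit. In other words the orbit is closed.\<close>

lemma clos_pt:
 assumes n: "1 <= n" and D: "D : flag_types n" and g: "g : SLc n" and beta: "beta : qclos n (pt n D g)"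
 shows "EX gamma:G1 n. beta = qact n gamma (pt n D g)"
proof -
 have Q: "beta : quivers n" using beta by (simp add: qclos_def)
 obtain gamma E where gamma: "gamma : gauges n" and E: "E : flag_types n" and b: "beta = qact n gamma (qE n E)"
  using normal_form[OF n Q clos_pstab[OF g beta]] by blast
 define g' where "g' = gamma n"
 have g': "g' : SLc n" using gaugeD[OF gamma n] g'_def by simp
 obtain delta where delta: "delta : G1 n" "beta = qact n delta (pt n E g')"
  using qact_pt_normal[OF gamma n, of E] unfolding b g'_def by blast
 have inv: "(if d : E then minor g' d rho else 0) = (if d : D then minor g d rho else 0)"
  if d: "1 <= d" "d < n" and rho: "!!i. i < d ==> rho i < n" for d rho
 proof -
  have dn: "d <= n" using d by simp
  have "qinv n d rho beta = qinv n d rho (pt n D g)"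
  proof (rule qclos_eq[OF beta _ pf_const])
   show "pf (quivers n) (qcoords n) (qinv n d rho)" by (rule pf_qinv[OF d(1) dn rho])
   show "qinv n d rho (qact n gamma (pt n D g)) = qinv n d rho (pt n D g)" if "gamma : G1 n" for gamma
    by (rule qinv_G1[OF that pt_quiver[OF g] d(1) dn rho])
  qed
  moreover have "qinv n d rho beta = qinv n d rho (pt n E g')"
   unfolding delta(2) by (rule qinv_G1[OF delta(1) pt_quiver[OF g'] d(1) dn rho])
  ultimately have "qinv n d rho (pt n E g') = qinv n d rho (pt n D g)" by simp
  thus ?thesis
   by (simp only: qinv_pt[OF g d rho, where D = D] qinv_pt[OF g' d rho, where D = E])
 qed
 note pt_minors_eq[OF E D g' g inv]
 hence ED: "E = D" and h: "adj_mat g * g' : Hgrp n D" by blast+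
 obtain eps where eps: "eps : gauges n" "eps n = 1\<^sub>m n" "pt n D (g * (adj_mat g * g')) = qact n eps (pt n D g)"
  using pt_Hgrp[OF D g h] by blast
 have eps1: "eps : G1 n" using eps by (simp add: G1_def)
 have g'e: "g * (adj_mat g * g') = g'" by (rule SL_adj_cancel(1)[OF g SL_mat[OF g']])
 have "beta = qact n delta (qact n eps (pt n D g))" using delta(2) unfolding ED eps(3)[unfolded g'e] .
 also have "... = qact n (%i. delta i * eps i) (pt n D g)"
  using delta(1) eps(1) by (intro qact_mult pt_quiver g) (auto simp: G1_def)
 finally show ?thesis using G1_mult[OF delta(1) eps1] by blast
qed

lemma orbit_G1:
 assumes "1 <= n" "alpha : quivers n"
 shows "(%g. quiver_act n g alpha) ` quiver_group n = (%gamma. qact n gamma alpha) ` G1 n"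
proof (intro Set.set_eqI iffI)
 fix beta assume "beta : (%g. quiver_act n g alpha) ` quiver_group n"
 then obtain g where g: "g : quiver_group n" "beta = quiver_act n g alpha" by blast
 thus "beta : (%gamma. qact n gamma alpha) ` G1 n"
  using quiver_act_qact[OF g(1)] component_gauge[OF g(1)] component_last by (auto simp: G1_def)
next
 fix beta assume "beta : (%gamma. qact n gamma alpha) ` G1 n"
 then obtain gamma where gamma: "gamma : G1 n" "beta = qact n gamma alpha" by blast
 then obtain g where "g : quiver_group n" "quiver_act n g alpha = beta"
  using gauge_quiver_group[of gamma n] by (auto simp: G1_def)
 thus "beta : (%g. quiver_act n g alpha) ` quiver_group n" by blast
qed

lemma mult_closed_pf: "mult_closed X (poly_functions X C)"
 unfolding mult_closed_def
proof (intro conjI ballI)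
 show "EX f:poly_functions X C. ALL y:X. f y ~= 0"
  by (rule bexI[OF _ poly_functions.const[where c = 1]]) simp
 fix f h assume "f : poly_functions X C" "h : poly_functions X C"
 thus "EX e:poly_functions X C. ALL y:X. e y = f y * h y"
  by (intro bexI[of _ "\<lambda>x\<in>X. f x * h x"] poly_functions.mult) simp_all
qed

lemma quiver_functions_pf: "f : quiver_functions n \<longleftrightarrow> f : extensional (quivers n) & pf (quivers n) (qcoords n) f"
proof -
 have e: "quiver_functions n = poly_functions (quivers n) (qcoords n)"
  unfolding quiver_functions_def qcoords_def ..
 show ?thesis
  unfolding e pf_def using poly_functions_extensional[of f "quivers n" "qcoords n"] extensional_restrict[of f "quivers n"]
  by auto
qed

text \<open>Both sides say that each quiver off the orbit admits a polynomial that vanishes on the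
  orbit but not there.\<close>

lemma polystable_iff:
 assumes n: "1 <= n" and alpha: "alpha : quivers n"
 shows "polystable n alpha \<longleftrightarrow> qclos n alpha \<subseteq> (%gamma. qact n gamma alpha) ` G1 n"
proof -
 let ?O = "(%gamma. qact n gamma alpha) ` G1 n" and ?Q = "quivers n" and ?F = "quiver_functions n"
 have F: "mult_closed ?Q ?F" unfolding quiver_functions_def by (rule mult_closed_pf)
 have OQ: "?O \<subseteq> ?Q" using qact_closed[OF _ alpha] by (auto simp: G1_def)
 have "polystable n alpha \<longleftrightarrow> openin (zariski (affine_variety ?Q ?F)) (?Q - ?O)"
  using OQ alpha unfolding polystable_def orbit_G1[OF n alpha] closedin_def points_affine[OF F] by (simp only: simp_thms)
 also have "... \<longleftrightarrow> (ALL y:?Q - ?O. EX f:?F. f y ~= 0 & {z:?Q. f z ~= 0} \<subseteq> ?Q - ?O)"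
  by (simp only: openin_affine[OF F] Diff_subset simp_thms)
 also have "... \<longleftrightarrow> qclos n alpha \<subseteq> ?O" (is "?l = ?r")
 proof
  assume l: ?l
  show ?r
  proof
   fix beta assume beta: "beta : qclos n alpha"
   show "beta : ?O"
   proof (rule ccontr)
    assume "beta ~: ?O"
    then obtain f where f: "f : ?F" "f beta ~= 0" "{z:?Q. f z ~= 0} \<subseteq> ?Q - ?O"
     using bspec[OF l, of beta] beta unfolding qclos_def by blast
    have "f (qact n gamma alpha) = 0" if "gamma : G1 n" for gamma using f(3) that OQ by blast
    moreover have "pf ?Q (qcoords n) f" using f(1) by (simp add: quiver_functions_pf)
    ultimately show False using beta f(2) unfolding qclos_def by blast
   qed
  qed
 next
  assume r: ?r
  show ?l
  proof
   fix beta assume beta: "beta : ?Q - ?O"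
   hence "beta ~: qclos n alpha" using r by blast
   then obtain f where f: "pf ?Q (qcoords n) f" "ALL gamma:G1 n. f (qact n gamma alpha) = 0" "f beta ~= 0"
    using beta unfolding qclos_def by blast
   have "restrict f ?Q : ?F" using f(1) by (simp add: pf_def quiver_functions_def qcoords_def)
   moreover have "{z : ?Q. restrict f ?Q z ~= 0} \<subseteq> ?Q - ?O" using f(2) by auto
   ultimately show "EX f:?F. f beta ~= 0 & {z:?Q. f z ~= 0} \<subseteq> ?Q - ?O"
    using beta f(3) by (intro bexI[of _ "restrict f ?Q"]) auto
  qed
 qed
 finally show ?thesis .
qed

text \<open>A closed orbit contains the quiver found by \<open>degeneration\<close>, and this one
  has a normal form; conversely orbits of normal forms are closed by \<open>clos_pt\<close>.\<close>

theorem polystable_normal_form: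
 assumes n: "1 <= n"
 shows "polystable n alpha \<longleftrightarrow> (EX D:flag_types n. EX g:SLc n. EX gamma:G1 n. alpha = qact n gamma (pt n D g))"
proof
 assume ps: "polystable n alpha"
 hence alpha: "alpha : quivers n" by (simp add: polystable_def)
 obtain beta where beta: "beta : qclos n alpha" "pstab n beta" using degeneration[OF alpha] by blast
 have betaQ: "beta : quivers n" using beta by (simp add: qclos_def)
 obtain delta where delta: "delta : G1 n" "beta = qact n delta alpha" using beta(1) ps unfolding polystable_iff[OF n alpha] by blast
 obtain gamma D where gamma: "gamma : gauges n" and D: "D : flag_types n" and b: "beta = qact n gamma (qE n D)"
  using normal_form[OF n betaQ beta(2)] by blast
 obtain eps where eps: "eps : G1 n" "beta = qact n eps (pt n D (gamma n))" using qact_pt_normal[OF gamma n, of D] unfolding b by blast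
 have g: "gamma n : SLc n" using gaugeD[OF gamma n] by simp
 have deltag: "delta : gauges n" "eps : gauges n" using delta eps by (auto simp: G1_def)
 have delta': "(%i. adj_mat (delta i)) : G1 n" using delta gauge_adj by (auto simp: G1_def adj_one)
 have "alpha = qact n (%i. adj_mat (delta i)) beta" unfolding delta(2) using qact_adj(1)[OF deltag(1) alpha] by simp
 also have "... = qact n (%i. adj_mat (delta i) * eps i) (pt n D (gamma n))"
  unfolding eps(2) by (rule qact_mult[OF gauge_adj[OF deltag(1)] deltag(2) pt_quiver[OF g]])
 finally show "EX D:flag_types n. EX g:SLc n. EX gamma:G1 n. alpha = qact n gamma (pt n D g)"
  using D g G1_mult[OF delta' eps(1)] by blast
next
 assume "EX D:flag_types n. EX g:SLc n. EX gamma:G1 n. alpha = qact n gamma (pt n D g)"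
 then obtain D g gamma where D: "D : flag_types n" and g: "g : SLc n" and gamma: "gamma : G1 n" and a: "alpha = qact n gamma (pt n D g)" by blast
 have gammag: "gamma : gauges n" using gamma by (simp add: G1_def)
 have P: "pt n D g : quivers n" by (rule pt_quiver[OF g])
 have alpha: "alpha : quivers n" unfolding a by (rule qact_closed[OF gammag P])
 have gamma': "(%i. adj_mat (gamma i)) : G1 n" using gamma gauge_adj by (auto simp: G1_def adj_one)
 have ai: "pt n D g = qact n (%i. adj_mat (gamma i)) alpha" unfolding a using qact_adj(1)[OF gammag P] by simp
 show "polystable n alpha"
  unfolding polystable_iff[OF n alpha]
 proof
  fix beta assume beta: "beta : qclos n alpha"
  have "beta : qclos n (pt n D g)"
   unfolding qclos_def
  proof (intro CollectI conjI allI impI)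
   show "beta : quivers n" using beta by (simp add: qclos_def)
   fix f assume f: "pf (quivers n) (qcoords n) f" "ALL gamma:G1 n. f (qact n gamma (pt n D g)) = 0"
   have "f (qact n delta alpha) = 0" if delta: "delta : G1 n" for delta
   proof -
    have "delta : gauges n" using delta by (simp add: G1_def)
    from qact_mult[OF this gammag P] show ?thesis unfolding a using f(2) G1_mult[OF delta gamma] by simp
   qed
   thus "f beta = 0" using beta f(1) unfolding qclos_def by blast
  qed
  from clos_pt[OF n D g this] obtain eps where eps: "eps : G1 n" "beta = qact n eps (pt n D g)" by blast
  have "eps : gauges n" using eps by (simp add: G1_def)
  from qact_mult[OF this gauge_adj[OF gammag] alpha] have "beta = qact n (%i. eps i * adj_mat (gamma i)) alpha"
   unfolding eps(2) ai by simp
  thus "beta : (%gamma. qact n gamma alpha) ` G1 n" using G1_mult[OF eps(1) gamma'] by blast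
 qed
qed

text \<open>The image is \<open>A\<close> applied to the coordinate subspace of dimension m.\<close>

lemma rank_pid:
 assumes a: "A : carrier (SL (Suc i))" and b: "B : carrier (SL i)" and m: "m <= i"
 shows "vec_space.rank (i + 1) (A * pid (Suc i) i m * adj_mat B) = m"
proof -
 have c: "A : carrier_mat (Suc i) (Suc i)" "B : carrier_mat i i" "adj_mat B : carrier_mat i i"
  using SL_mat[OF a] SL_mat[OF b] SL_mat[OF SL_adj(1)[OF b]] .
 have Ap: "A * pid (Suc i) i m : carrier_mat (Suc i) i" by (rule mult_carrier_mat[OF c(1) pid_carrier])
 let ?M = "A * pid (Suc i) i m * adj_mat B"
 have M: "?M : carrier_mat (Suc i) i" by (rule mult_carrier_mat[OF Ap c(3)])
 have Mv: "?M *v x = A *v (pid (Suc i) i m *v (adj_mat B *v x))" if x: "x : carrier_vec i" for x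
  using assoc_mult_mat_vec[OF Ap c(3) x] assoc_mult_mat_vec[OF c(1) pid_carrier mult_mat_vec_carrier[OF c(3) x]] by simp
 have "(%x. ?M *v x) ` carrier_vec i = (%x. A *v x) ` lowv (Suc i) m"
 proof (intro Set.set_eqI iffI)
  fix y assume "y : (%x. ?M *v x) ` carrier_vec i"
  then obtain x where x: "x : carrier_vec i" "y = ?M *v x" by blast
  let ?u = "adj_mat B *v x"
  have u: "?u : carrier_vec i" by (rule mult_mat_vec_carrier[OF c(3) x(1)])
  have "pid (Suc i) i m *v ?u : carrier_vec (Suc i)" by (rule mult_mat_vec_carrier[OF pid_carrier u])
  hence "pid (Suc i) i m *v ?u : lowv (Suc i) m"
   using pid_vec[OF u, of _ "Suc i" m] unfolding lowv_def by (simp del: index_mult_mat_vec)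
  thus "y : (%x. A *v x) ` lowv (Suc i) m"
   unfolding x(2) Mv[OF x(1)] by (rule imageI)
 next
  fix y assume "y : (%x. A *v x) ` lowv (Suc i) m"
  then obtain v where v: "v : lowv (Suc i) m" "y = A *v v" by blast
  let ?u = "vec i (%j. v $ j)"
  have u: "?u : carrier_vec i" by simp
  have "pid (Suc i) i m *v ?u = v"
  proof (rule eq_vecI)
   have dv: "dim_vec v = Suc i" using v(1) by (auto simp: lowv_def)
   thus "dim_vec (pid (Suc i) i m *v ?u) = dim_vec v" by simp
   fix j assume "j < dim_vec v"
   hence j: "j < Suc i" using dv by simp
   show "(pid (Suc i) i m *v ?u) $ j = v $ j"
    unfolding pid_vec[OF u j] using j v(1) m by (cases "j < m") (simp_all add: lowv_def)
  qed
  hence "?M *v (B *v ?u) = y"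
   using Mv[OF mult_mat_vec_carrier[OF c(2) u]] SL_vec_cancel(2)[OF b u] v(2) by simp
  thus "y : (%x. ?M *v x) ` carrier_vec i"
   using imageI[OF mult_mat_vec_carrier[OF c(2) u], of "%x. ?M *v x"] by simp
 qed
 thus ?thesis
  using rank_linear_dim[OF M] linear_dim_lowv[OF c(1), of m] a m by (simp add: SL_carrier)
qed

lemma quiver_type_pt:
 assumes n: "1 <= n" and D: "D : flag_types n" and g: "g : SLc n" and gamma: "gamma : G1 n"
 shows "quiver_type n (qact n gamma (pt n D g)) = D"
proof -
 obtain Gam where Gam: "Gam : gauges n" "qact n gamma (pt n D g) = qact n Gam (qE n D)" using orbit_pt[OF g gamma] by blast
 have nD: "n : D" "D \<subseteq> {1..n}" using D by (auto simp: flag_types_def)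
 have "quiver_rank n (qact n Gam (qE n D)) i = mm D i" if i: "i : {1..n}" for i
 proof (cases "i < n")
  case True
  have "qact n Gam (qE n D) i = Gam (Suc i) * pid (Suc i) i (mm D i) * adj_mat (Gam i)"
   using i True by (simp add: qact_def qE_def)
  thus ?thesis using rank_pid[OF gaugeD[OF Gam(1), of "Suc i"] gaugeD[OF Gam(1), of i] mm_le[of D i]] i True
   by (simp add: quiver_rank_def)
 next
  case False
  thus ?thesis using i mm_self[OF nD(1)] by (simp add: quiver_rank_def)
 qed
 hence "quiver_type n (qact n gamma (pt n D g)) = mm D ` {1..n} - {0}"
  unfolding Gam(2) quiver_type_def by (subst image_cong[OF refl]) simp_all
 also have "... = D"
 proof (intro Set.set_eqI iffI)
  fix e assume "e : mm D ` {1..n} - {0}"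
  thus "e : D" using mm_in by blast
 next
  fix e assume e: "e : D"
  hence "e : {1..n}" using nD by blast
  thus "e : mm D ` {1..n} - {0}" using mm_self[OF e] by (auto intro!: image_eqI[of _ _ e])
 qed
 finally show ?thesis .
qed

section \<open>The comparison of invariants\<close>

lemma pf_translate_right:
 assumes k: "k : SLc n" and f: "pf (SLc n) (slc n) f"
 shows "pf (SLc n) (slc n) (%g. f (g * k))"
proof (rule pf_compose[OF f SL_mult_closed[OF _ k]])
 fix b assume "b : slc n"
 then obtain r c where b: "b = (%g. g $$ (r, c))" "r < n" "c < n" by blast
 show "pf (SLc n) (slc n) (%g. b (g * k))"
  unfolding b(1) by (rule pf_mat_mult[where n = n and m = n and k = n])
   (use b SL_mat SL_mat[OF k] in \<open>auto intro: pf_const pf_slc\<close>)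
qed

lemma pf_translate_left:
 assumes k: "k : SLc n" and f: "pf (SLc n) (slc n) f"
 shows "pf (SLc n) (slc n) (%g. f (k * g))"
proof (rule pf_compose[OF f SL_mult_closed[OF k]])
 fix b assume "b : slc n"
 then obtain r c where b: "b = (%g. g $$ (r, c))" "r < n" "c < n" by blast
 show "pf (SLc n) (slc n) (%g. b (k * g))"
  unfolding b(1) by (rule pf_mat_mult[where n = n and m = n and k = n])
   (use b SL_mat SL_mat[OF k] in \<open>auto intro: pf_const pf_slc\<close>)
qed

lemma pf_pt:
 assumes f: "pf (quivers n) (qcoords n) f"
 shows "pf (SLc n) (slc n) (%g. f (pt n D g))"
proof (rule pf_compose[OF f pt_quiver])
 fix b assume "b : qcoords n"
 then obtain i r c where b: "b = (%alpha. alpha i $$ (r, c))" and i: "1 <= i" "i < n" "r < Suc i" "c < i"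
  by (auto simp: qcoords_def)
 have top: "pf (SLc n) (slc n) (%g. topg n g (Suc i) $$ (r, c))" if "r < Suc i" "c < Suc i" for r c
  using that i(2) by (cases "Suc i = n") (simp_all add: topg_def pf_const pf_slc)
 have tc: "topg n g (Suc i) : carrier_mat (Suc i) (Suc i)" if "g : SLc n" for g
  using SL_mat[OF that] by (simp add: topg_def)
 have "pf (SLc n) (slc n) (%g. (topg n g (Suc i) * pid (Suc i) i (mm D i)) $$ (r, c))"
  by (rule pf_mat_mult[where n = "Suc i" and m = "Suc i" and k = i]) (use tc i top in \<open>auto intro: pf_const\<close>)
 moreover have "b (pt n D g) = (topg n g (Suc i) * pid (Suc i) i (mm D i)) $$ (r, c)" if g: "g : SLc n" for g
 proof -
  have "pt n D g i = topg n g (Suc i) * pid (Suc i) i (mm D i) * adj_mat (1\<^sub>m i)"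
   using i by (simp add: pt_def qact_def qE_def topg_def)
  also have "... = topg n g (Suc i) * pid (Suc i) i (mm D i)"
   unfolding adj_one by (rule right_mult_one_mat[OF mult_carrier_mat[OF tc[OF g] pid_carrier]])
  finally show ?thesis by (simp only: b)
 qed
 ultimately show "pf (SLc n) (slc n) (%g. b (pt n D g))"
  by (subst pf_cong)
qed

lemma quiver_invariants_iff:
 "f : quiver_invariants n \<longleftrightarrow> f : extensional (quivers n) & pf (quivers n) (qcoords n) f &
  (ALL gamma:G1 n. ALL alpha:quivers n. f (qact n gamma alpha) = f alpha)"
proof -
 have "(ALL g:quiver_group n. ALL alpha:quivers n. f (quiver_act n g alpha) = f alpha) \<longleftrightarrow>
  (ALL gamma:G1 n. ALL alpha:quivers n. f (qact n gamma alpha) = f alpha)" (is "?l = ?r")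
 proof
  assume l: ?l
  show ?r
  proof (intro ballI)
   fix gamma alpha assume gamma: "gamma : G1 n" and alpha: "alpha : quivers n"
   then obtain g where "g : quiver_group n" "quiver_act n g alpha = qact n gamma alpha"
    using gauge_quiver_group[of gamma n] by (auto simp: G1_def)
   thus "f (qact n gamma alpha) = f alpha" using l alpha by metis
  qed
 next
  assume r: ?r
  show ?l
  proof (intro ballI)
   fix g alpha assume g: "g : quiver_group n" and alpha: "alpha : quivers n"
   have "component n g : G1 n" using component_gauge[OF g] component_last by (simp add: G1_def)
   thus "f (quiver_act n g alpha) = f alpha" unfolding quiver_act_qact[OF g] using r alpha by blast
  qed
 qed
 thus ?thesis unfolding quiver_invariants_def by (simp add: quiver_functions_pf)
qed

lemma quiver_invariantsI:
 assumes f: "pf (quivers n) (qcoords n) f" and inv: "!!gamma alpha. gamma : G1 n ==> alpha : quivers n ==> f (qact n gamma alpha) = f alpha"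
 shows "restrict f (quivers n) : quiver_invariants n"
 unfolding quiver_invariants_iff
proof (intro conjI ballI)
 show "pf (quivers n) (qcoords n) (restrict f (quivers n))"
  using f by (subst pf_cong[of _ _ f]) simp_all
 fix gamma alpha assume gamma: "gamma : G1 n" and alpha: "alpha : quivers n"
 have "qact n gamma alpha : quivers n" using qact_closed[OF _ alpha] gamma by (simp add: G1_def)
 thus "restrict f (quivers n) (qact n gamma alpha) = restrict f (quivers n) alpha" using alpha inv[OF gamma alpha] by simp
qed simp

lemma subalg_quiver_invariants: "subalg (quivers n) (quiver_invariants n)"
 unfolding subalg_def
proof (intro conjI allI ballI subsetI)
 show "f : extensional (quivers n)" if "f : quiver_invariants n" for f using that by (simp add: quiver_invariants_iff)
 show "(\<lambda>x\<in>quivers n. c) : quiver_invariants n" for c by (rule quiver_invariantsI[OF pf_const]) simp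
 fix f h assume "f : quiver_invariants n" "h : quiver_invariants n"
 thus "(\<lambda>x\<in>quivers n. f x + h x) : quiver_invariants n" "(\<lambda>x\<in>quivers n. f x * h x) : quiver_invariants n"
  unfolding quiver_invariants_iff[of f] quiver_invariants_iff[of h] by (intro quiver_invariantsI pf_add pf_mult; simp)+
qed

definition full :: "nat => nat set" where
 "full n = {1..n}"

lemma full_flag: "1 <= n ==> full n : flag_types n"
 by (simp add: flag_types_def full_def)

lemma in_full: "1 <= d ==> d < n ==> d : full n"
 by (simp add: full_def)

lemma implosion_functions_iff:
 assumes k: "k : SLc n"
 shows "f : implosion_functions n (cj k ` unitri n) \<longleftrightarrow> f : extensional (SLc n) &
  pf (SLc n) (slc n) f & (ALL g:SLc n. ALL u:unitri n. f (g * cj k u) = f g)"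
proof -
 have "f : SL_functions n \<longleftrightarrow> f : extensional (SLc n) & pf (SLc n) (slc n) f"
  unfolding SL_functions_def pf_def
  using poly_functions_extensional[of f] extensional_restrict[of f "SLc n"] by auto
 thus ?thesis unfolding implosion_functions_def by auto
qed

lemma implosionI:
 assumes k: "k : SLc n" and f: "pf (SLc n) (slc n) f"
  "!!g u. g : SLc n ==> u : unitri n ==> f (g * cj k u) = f g"
 shows "restrict f (SLc n) : implosion_functions n (cj k ` unitri n)"
 unfolding implosion_functions_iff[OF k]
proof (intro conjI ballI)
 show "pf (SLc n) (slc n) (restrict f (SLc n))" using f(1) by (subst pf_cong[of _ _ f]) simp_all
 fix g u assume g: "g : SLc n" and u: "u : unitri n"
 have "g * cj k u : SLc n" by (rule SL_mult_closed[OF g cj_SL[OF k unitri_SL[OF u]]])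
 thus "restrict f (SLc n) (g * cj k u) = restrict f (SLc n) g" using f(2)[OF g u] g by simp
qed simp

lemma subalg_implosion:
 assumes k: "k : SLc n"
 shows "subalg (SLc n) (implosion_functions n (cj k ` unitri n))" (is "subalg _ ?A")
 unfolding subalg_def
proof (intro conjI allI ballI subsetI)
 show "f : extensional (SLc n)" if "f : ?A" for f using that by (simp add: implosion_functions_iff[OF k])
 show "(\<lambda>x\<in>SLc n. c) : ?A" for c by (rule implosionI[OF k pf_const]) simp
 fix f h assume "f : ?A" "h : ?A"
 thus "(\<lambda>x\<in>SLc n. f x + h x) : ?A" "(\<lambda>x\<in>SLc n. f x * h x) : ?A"
  unfolding implosion_functions_iff[OF k, of f] implosion_functions_iff[OF k, of h]
  by (intro implosionI[OF k] pf_add pf_mult; simp)+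
qed

lemma SL_cancel_right:
 assumes "k : SLc n" "g : sq_mat n"
 shows "g * k * adj_mat k = g" "g * adj_mat k * k = g"
 using assoc_sq[OF assms(2) SL_mat[OF assms(1)] SL_mat[OF SL_adj(1)[OF assms(1)]]]
  assoc_sq[OF assms(2) SL_mat[OF SL_adj(1)[OF assms(1)]] SL_mat[OF assms(1)]] SL_adj[OF assms(1)] assms(2)
 by simp_all

lemma cj_right:
 assumes k: "k : SLc n" and g: "g : sq_mat n" and u: "u : sq_mat n"
 shows "g * cj k u * k = g * k * u"
proof -
 note K = SL_mat[OF k] SL_mat[OF SL_adj(1)[OF k]]
 have ku: "k * u : sq_mat n" by (rule mult_sq[OF K(1) u])
 have "g * cj k u * k = g * (cj k u * k)"
  unfolding cj_def by (rule assoc_sq[OF g mult_sq[OF ku K(2)] K(1)])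
 also have "cj k u * k = k * u" unfolding cj_def by (rule SL_cancel_right(2)[OF k ku])
 also have "g * (k * u) = g * k * u" by (rule assoc_sq[symmetric, OF g K(1) u])
 finally show ?thesis .
qed

lemma invariant_pt_Hgrp:
 assumes D: "D : flag_types n" and g: "g : SLc n" and h: "h : Hgrp n D"
  and f: "f : quiver_invariants n"
 shows "f (pt n D (g * h)) = f (pt n D g)"
proof -
 obtain gamma where "gamma : gauges n" "gamma n = 1\<^sub>m n" "pt n D (g * h) = qact n gamma (pt n D g)"
  using pt_Hgrp[OF D g h] by blast
 thus ?thesis using f pt_quiver[OF g] by (simp add: quiver_invariants_iff G1_def)
qed

text \<open>Restriction to the normal forms with injective arrows, parametrised by SL(n). The factor
  \<open>k\<close> turns invariance under the unitriangular group into invariance under its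
  conjugate.\<close>

definition resq :: "nat => complex mat => ((nat => complex mat) => complex) => complex mat => complex" where
 "resq n k f = (\<lambda>g\<in>SLc n. f (pt n (full n) (g * k)))"

lemma resq_closed:
 assumes n: "1 <= n" and k: "k : SLc n" and f: "f : quiver_invariants n"
 shows "resq n k f : implosion_functions n (cj k ` unitri n)"
 unfolding resq_def
proof (rule implosionI[OF k pf_translate_right[OF k pf_pt]])
 show "pf (quivers n) (qcoords n) f" using f by (simp add: quiver_invariants_iff)
 fix g u assume g: "g : SLc n" and u: "u : unitri n"
 have "u : Hgrp n (full n)" using u by (simp add: unitri_eq_Hgrp full_def)
 from invariant_pt_Hgrp[OF full_flag[OF n] SL_mult_closed[OF g k] this f]
 show "f (pt n (full n) (g * cj k u * k)) = f (pt n (full n) (g * k))"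
  unfolding cj_right[OF k SL_mat[OF g] unitri_carrier[OF u]] .
qed

lemma minor_top_inj:
 assumes C: "(C :: complex mat) : carrier_mat m d" and d: "d <= m" and nz: "minor C d id ~= 0"
  and x: "x : carrier_vec d" "C *v x = 0\<^sub>v m"
 shows "x = 0\<^sub>v d"
proof -
 let ?M = "mat d d (%(i, j). C $$ (id i, j))"
 have M: "?M : carrier_mat d d" by simp
 obtain M' where M': "M' : carrier_mat d d" "M' * ?M = 1\<^sub>m d"
  using det_nonzero_inverse[OF M] nz unfolding minor_def by blast
 have "?M *v x = 0\<^sub>v d"
 proof (rule eq_vecI)
  fix i assume "i < dim_vec (0\<^sub>v d :: complex vec)"
  hence i: "i < d" by simp
  have "(?M *v x) $ i = (SUM l<d. C $$ (i, l) * x $ l)"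
   unfolding index_mult_vec_sum[OF M x(1) i] using i by (intro sum.cong) auto
  also have "... = (C *v x) $ i" using index_mult_vec_sum[OF C x(1), of i] i d by simp
  finally show "(?M *v x) $ i = 0\<^sub>v d $ i" unfolding x(2) using i d by simp
 qed simp
 with assoc_mult_mat_vec[OF M'(1) M x(1)] have "(M' * ?M) *v x = M' *v 0\<^sub>v d" by (simp only:)
 thus ?thesis unfolding M'(2) mult_vec_zero[OF M'(1)] using x(1) by simp
qed

text \<open>A nonzero minor of the composite from vertex i makes that composite, hence arrow i,
  injective. So there is a normal form, and its invariants force the full type.\<close>

lemma generic_quiver:
 assumes n: "1 <= n" and beta: "beta : quivers n" and nz: "!!d. 1 <= d ==> d < n ==> qinv n d id beta ~= 0"
 shows "EX g:SLc n. EX gamma:G1 n. beta = qact n gamma (pt n (full n) g)"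
proof -
 have "minj (beta i)" if i: "1 <= i" "i < n" for i
  unfolding minj_def
 proof (intro ballI impI)
  have B: "beta i : carrier_mat (Suc i) i" by (rule quiverD[OF beta i])
  fix x assume "x : carrier_vec (dim_col (beta i))" "beta i *v x = 0\<^sub>v (dim_row (beta i))"
  hence x: "x : carrier_vec i" "beta i *v x = 0\<^sub>v (Suc i)" using B by auto
  have C: "chain beta (Suc i) (n - Suc i) : carrier_mat n (Suc i)"
   using chain_carrier[OF beta, of "Suc i" "n - Suc i"] i by simp
  have C': "chain beta i (n - i) : carrier_mat n i" using chain_carrier[OF beta i(1), of "n - i"] i by simp
  have "n - i = 1 + (n - Suc i)" using i by simp
  hence "chain beta i (n - i) = chain beta (i + 1) (n - Suc i) * chain beta i 1"
   using chain_add[OF beta i(1), of 1 "n - Suc i"] i by simp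
  also have "chain beta i 1 = beta i" using B by simp
  finally have c: "chain beta i (n - i) = chain beta (Suc i) (n - Suc i) * beta i" by simp
  have "chain beta i (n - i) *v x = 0\<^sub>v n"
   unfolding c assoc_mult_mat_vec[OF C B x(1)] x(2) by (rule mult_vec_zero[OF C])
  hence "x = 0\<^sub>v i"
   using minor_top_inj[OF C' _ nz[OF i, unfolded qinv_def] x(1)] i by simp
  thus "x = 0\<^sub>v (dim_col (beta i))" using B by simp
 qed
 hence "pstab n beta" by (simp add: pstab_def)
 from normal_form[OF n beta this] obtain gamma D where gamma: "gamma : gauges n" and D: "D : flag_types n" and b: "beta = qact n gamma (qE n D)"
  by blast
 have g: "gamma n : SLc n" using gaugeD[OF gamma n] by simp
 obtain delta where delta: "delta : G1 n" "beta = qact n delta (pt n D (gamma n))"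
  using qact_pt_normal[OF gamma n, of D] unfolding b by blast
 have "d : D" if d: "1 <= d" "d < n" for d
 proof -
  have "qinv n d id beta = qinv n d id (pt n D (gamma n))"
   unfolding delta(2) by (rule qinv_G1[OF delta(1) pt_quiver[OF g] d(1)]) (use d in simp_all)
  also have "... = (if d : D then minor (gamma n) d id else 0)"
   by (rule qinv_pt[OF g d]) (use d in simp)
  finally show ?thesis using nz[OF d] by presburger
 qed
 moreover have "n : D" "D \<subseteq> {1..n}" using D by (simp_all add: flag_types_def)
 ultimately have "e : D \<longleftrightarrow> e : full n" for e
  by (cases "e = n"; cases "1 <= e & e < n") (auto simp: full_def)
 hence "D = full n" by blast
 thus ?thesis using delta g by blast
qed

text \<open>On the line from \<open>alpha\<close> to a quiver of full type, all but finitely many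
  points have composites with nonzero leading minors and so lie in orbits covered by
  \<open>eq\<close>.\<close>

lemma invariants_eqI:
 assumes n: "1 <= n" and f: "f : quiver_invariants n" and f': "f' : quiver_invariants n"
  and eq: "!!g. g : SLc n ==> f (pt n (full n) g) = f' (pt n (full n) g)"
 shows "f = f'"
proof (rule extensionalityI)
 show "f : extensional (quivers n)" "f' : extensional (quivers n)" using f f' by (simp_all add: quiver_invariants_iff)
 fix alpha assume alpha: "alpha : quivers n"
 define beta where "beta = pt n (full n) (1\<^sub>m n)"
 have beta: "beta : quivers n" unfolding beta_def by (rule pt_quiver[OF SL_one_closed])
 define c where "c = (%z. \<lambda>i\<in>{1..<n}. mat (Suc i) i (%(r, s). alpha i $$ (r, s) + z * (beta i $$ (r, s) - alpha i $$ (r, s))))"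
 have cQ: "c z : quivers n" for z by (auto simp: c_def quivers_def)
 have c0: "c 0 = alpha" and c1: "c 1 = beta"
 proof -
  show "c 0 = alpha"
  proof (rule quiver_eqI[OF cQ alpha])
   fix i assume i: "1 <= i" "i < n"
   show "c 0 i = alpha i" using i quiverD[OF alpha i] by (intro eq_matI) (auto simp: c_def)
  qed
  show "c 1 = beta"
  proof (rule quiver_eqI[OF cQ beta])
   fix i assume i: "1 <= i" "i < n"
   show "c 1 i = beta i" using i quiverD[OF beta i] by (intro eq_matI) (auto simp: c_def)
  qed
 qed
 have line: "pline (%z. f (c z))" if "pf (quivers n) (qcoords n) f" for f
  unfolding pline_def
 proof (rule pf_compose[OF that cQ])
  fix b assume "b : qcoords n"
  then obtain i r s where b: "b = (%alpha. alpha i $$ (r, s))" and i: "1 <= i" "i < n" "r < Suc i" "s < i"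
   by (auto simp: qcoords_def)
  have "pf UNIV {%z. z} (%z. alpha i $$ (r, s) + z * (beta i $$ (r, s) - alpha i $$ (r, s)))"
   by (intro pf_add pf_mult pf_const pline_id[unfolded pline_def])
  thus "pf UNIV {%z. z} (%z. b (c z))" using i by (simp add: b c_def)
 qed
 define p where "p = (%z. PROD d:{1..<n}. qinv n d id (c z))"
 have p: "pline p" unfolding p_def by (rule line, rule pf_prod, rule pf_qinv) auto
 have "qinv n d id beta = 1" if d: "1 <= d" "d < n" for d
 proof -
  have "qinv n d id beta = (if d : full n then minor (1\<^sub>m n) d id else 0)"
   unfolding beta_def by (rule qinv_pt[OF SL_one_closed d]) (use d in simp)
  also have "... = minor (1\<^sub>m n) d id" using in_full[OF d] by simp
  also have "... = 1" using d by (intro minor_unitri[of _ n]) (auto simp: unitri_def)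
  finally show ?thesis .
 qed
 hence "p 1 ~= 0" unfolding p_def c1 by simp
 from pline_finite_zeros[OF p this] have Z: "finite {z. p z = 0}" .
 have ff: "pf (quivers n) (qcoords n) (%a. f a - f' a)" using f f' by (intro pf_diff) (simp_all add: quiver_invariants_iff)
 have "(%z. f (c z) - f' (c z)) 0 = 0"
 proof (rule pline_zero[OF line[OF ff] Z])
  fix z assume "z ~: {z. p z = 0}"
  hence "qinv n d id (c z) ~= 0" if "1 <= d" "d < n" for d using that by (auto simp: p_def)
  from generic_quiver[OF n cQ this] obtain g gamma where g: "g : SLc n" "gamma : G1 n" "c z = qact n gamma (pt n (full n) g)" by blast
  show "f (c z) - f' (c z) = 0"
   unfolding g(3) using f f' g(2) pt_quiver[OF g(1)] eq[OF g(1)] by (simp add: quiver_invariants_iff)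
 qed
 thus "f alpha = f' alpha" by (simp add: c0)
qed

lemma resq_inj:
 assumes n: "1 <= n" and k: "k : SLc n"
 shows "inj_on (resq n k) (quiver_invariants n)"
proof (rule inj_onI)
 fix f f' assume f: "f : quiver_invariants n" "f' : quiver_invariants n" and eq: "resq n k f = resq n k f'"
 show "f = f'"
 proof (rule invariants_eqI[OF n f])
  fix g assume g: "g : SLc n"
  let ?h = "g * adj_mat k"
  have h: "?h : SLc n" by (rule SL_mult_closed[OF g SL_adj(1)[OF k]])
  have "?h * k = g * (adj_mat k * k)"
   by (rule assoc_sq[OF SL_mat[OF g] SL_mat[OF SL_adj(1)[OF k]] SL_mat[OF k]])
  hence "?h * k = g" unfolding SL_adj(3)[OF k] using SL_mat[OF g] by simp
  thus "f (pt n (full n) g) = f' (pt n (full n) g)"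
   using fun_cong[OF eq, of ?h] h by (simp add: resq_def)
 qed
qed

lemma qinv_invariant:
 assumes "1 <= d" "d <= n" "!!i. i < d ==> rho i < n"
 shows "restrict (qinv n d rho) (quivers n) : quiver_invariants n"
proof (rule quiver_invariantsI)
 show "pf (quivers n) (qcoords n) (qinv n d rho)" by (rule pf_qinv[OF assms])
 show "qinv n d rho (qact n gamma alpha) = qinv n d rho alpha" if "gamma : G1 n" "alpha : quivers n" for gamma alpha
  by (rule qinv_G1[OF that assms])
qed

text \<open>Each minor lifts to the corresponding \<open>qinv\<close>; together with
  \<open>implosion_mins\<close> this makes the restriction of invariants surjective.\<close>

lemma lift_mins:
 assumes "F : poly_functions (SLc n) (mins n)" and n: "1 <= n"
 shows "EX f:quiver_invariants n. ALL g:SLc n. f (pt n (full n) g) = F g"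
 using assms(1)
proof (induction rule: poly_functions.induct)
 case (const c)
 show ?case
  by (rule bexI[of _ "\<lambda>alpha\<in>quivers n. c"])
   (use subalg_quiver_invariants pt_quiver in \<open>auto simp: subalg_def\<close>)
next
 case (coord f)
 then obtain d rho where f: "f = (%g. minor g d rho)" and d: "1 <= d" "d < n" and rho: "!!i. i < d ==> rho i < n"
  unfolding mins_def by blast
 have dn: "d <= n" using d by simp
 show ?case
 proof (rule bexI[OF _ qinv_invariant[OF d(1) dn rho]])
  show "ALL g:SLc n. restrict (qinv n d rho) (quivers n) (pt n (full n) g) = restrict f (SLc n) g"
  proof
   fix g assume g: "g : SLc n"
   show "restrict (qinv n d rho) (quivers n) (pt n (full n) g) = restrict f (SLc n) g"
    using qinv_pt[OF g d rho, where D = "full n"] pt_quiver[OF g, of "full n"] g in_full[OF d] by (simp add: f)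
  qed
 qed
next
 case (add f h)
 then obtain f' h' where fh: "f' : quiver_invariants n" "ALL g:SLc n. f' (pt n (full n) g) = f g"
  "h' : quiver_invariants n" "ALL g:SLc n. h' (pt n (full n) g) = h g" by blast
 thus ?case
  by (intro bexI[of _ "\<lambda>alpha\<in>quivers n. f' alpha + h' alpha"])
   (use subalg_quiver_invariants pt_quiver in \<open>auto simp: subalg_def\<close>)
next
 case (mult f h)
 then obtain f' h' where fh: "f' : quiver_invariants n" "ALL g:SLc n. f' (pt n (full n) g) = f g"
  "h' : quiver_invariants n" "ALL g:SLc n. h' (pt n (full n) g) = h g" by blast
 thus ?case
  by (intro bexI[of _ "\<lambda>alpha\<in>quivers n. f' alpha * h' alpha"])
   (use subalg_quiver_invariants pt_quiver in \<open>auto simp: subalg_def\<close>)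
qed

text \<open>Right translation by the inverse of \<open>k\<close> carries these functions to
  invariants of the unitriangular group, where \<open>unitri_invariants\<close> applies.\<close>

lemma implosion_mins:
 assumes k: "k : SLc n" and f: "f : implosion_functions n (cj k ` unitri n)"
 shows "pf (SLc n) (mins n) (%g. f (g * adj_mat k))"
proof (rule unitri_invariants)
 have f': "pf (SLc n) (slc n) f" "!!g u. g : SLc n ==> u : unitri n ==> f (g * cj k u) = f g"
  using f by (auto simp: implosion_functions_iff[OF k])
 note k' = SL_adj(1)[OF k]
 show "pf (SLc n) (slc n) (%g. f (g * adj_mat k))" by (rule pf_translate_right[OF k' f'(1)])
 fix g u assume g: "g : SLc n" and u: "u : unitri n"
 have c: "g : sq_mat n" "u : sq_mat n" "k : sq_mat n" "adj_mat k : sq_mat n"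
  using SL_mat g u k k' unitri_carrier by blast+
 have "g * adj_mat k * cj k u = g * (adj_mat k * cj k u)"
  by (rule assoc_sq[OF c(1,4) SL_mat[OF cj_SL[OF k unitri_SL[OF u]]]])
 also have "adj_mat k * cj k u = u * adj_mat k"
 proof -
  have "cj k u = k * (u * adj_mat k)" unfolding cj_def by (rule assoc_sq[OF c(3,2,4)])
  thus ?thesis using SL_adj_cancel(2)[OF k mult_sq[OF c(2,4)]] by simp
 qed
 also have "g * (u * adj_mat k) = g * u * adj_mat k" by (rule assoc_sq[symmetric, OF c(1,2,4)])
 finally show "f (g * u * adj_mat k) = f (g * adj_mat k)"
  using f'(2)[OF SL_mult_closed[OF g k'] u] by simp
qed

lemma resq_surj:
 assumes n: "1 <= n" and k: "k : SLc n" and h: "h : implosion_functions n (cj k ` unitri n)"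
 shows "EX f:quiver_invariants n. resq n k f = h"
proof -
 from lift_mins[OF implosion_mins[OF k h, unfolded pf_def] n] obtain f where
  f: "f : quiver_invariants n" "!!g. g : SLc n ==> f (pt n (full n) g) = h (g * adj_mat k)" by auto
 have "resq n k f = h"
 proof (rule extensionalityI)
  show "resq n k f : extensional (SLc n)" by (simp add: resq_def)
  show "h : extensional (SLc n)" using h by (simp add: implosion_functions_iff[OF k])
  fix g assume g: "g : SLc n"
  show "resq n k f g = h g"
   using f(2)[OF SL_mult_closed[OF g k]] g SL_cancel_right(1)[OF k SL_mat[OF g]] by (simp add: resq_def)
 qed
 thus ?thesis using f(1) by blast
qed

theorem resq_bij:
 assumes n: "1 <= n" and k: "k : SLc n"
 shows "bij_betw (resq n k) (quiver_invariants n) (implosion_functions n (cj k ` unitri n))"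
proof (rule bij_betw_imageI[OF resq_inj[OF n k]])
 show "resq n k ` quiver_invariants n = implosion_functions n (cj k ` unitri n)"
  using resq_closed[OF n k] resq_surj[OF n k] by blast
qed

text \<open>The inverse of restriction, because this direction makes \<open>Spec_map\<close> go from
  the quotient of quivers to the implosion.\<close>

definition liftq :: "nat => complex mat => (complex mat => complex) => (nat => complex mat) => complex" where
 "liftq n k = inv_into (quiver_invariants n) (resq n k)"

lemma liftq:
 assumes n: "1 <= n" and k: "k : SLc n"
 shows liftq_resq: "f : quiver_invariants n ==> liftq n k (resq n k f) = f"
  and liftq_closed: "h : implosion_functions n (cj k ` unitri n) ==> liftq n k h : quiver_invariants n"
  and resq_liftq: "h : implosion_functions n (cj k ` unitri n) ==> resq n k (liftq n k h) = h"
 using resq_bij[OF n k] unfolding liftq_def bij_betw_def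
 by (auto simp: inv_into_into f_inv_into_f)

lemma liftq_ring:
 assumes n: "1 <= n" and k: "k : SLc n"
 shows "liftq n k (\<lambda>g\<in>SLc n. c) = (\<lambda>alpha\<in>quivers n. c)"
  and "f : implosion_functions n (cj k ` unitri n) ==> h : implosion_functions n (cj k ` unitri n) ==>
   liftq n k (\<lambda>g\<in>SLc n. f g + h g) = (\<lambda>alpha\<in>quivers n. liftq n k f alpha + liftq n k h alpha)"
  and "f : implosion_functions n (cj k ` unitri n) ==> h : implosion_functions n (cj k ` unitri n) ==>
   liftq n k (\<lambda>g\<in>SLc n. f g * h g) = (\<lambda>alpha\<in>quivers n. liftq n k f alpha * liftq n k h alpha)"
proof -
 note B = subalg_quiver_invariants[of n, unfolded subalg_def]
 have p: "pt n (full n) (g * k) : quivers n" if "g : SLc n" for g by (rule pt_quiver[OF SL_mult_closed[OF that k]])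
 have "resq n k (\<lambda>alpha\<in>quivers n. c) = (\<lambda>g\<in>SLc n. c)"
  unfolding resq_def by (rule restrict_ext) (simp add: p)
 thus "liftq n k (\<lambda>g\<in>SLc n. c) = (\<lambda>alpha\<in>quivers n. c)"
  using liftq_resq[OF n k, of "\<lambda>alpha\<in>quivers n. c"] B by simp
 assume f: "f : implosion_functions n (cj k ` unitri n)" and h: "h : implosion_functions n (cj k ` unitri n)"
 note L = liftq_closed[OF n k f] liftq_closed[OF n k h]
 have e: "liftq n k f (pt n (full n) (g * k)) = f g" "liftq n k h (pt n (full n) (g * k)) = h g" if "g : SLc n" for g
  using fun_cong[OF resq_liftq[OF n k f], of g] fun_cong[OF resq_liftq[OF n k h], of g] that by (simp_all add: resq_def)
 have "resq n k (\<lambda>alpha\<in>quivers n. liftq n k f alpha + liftq n k h alpha) = (\<lambda>g\<in>SLc n. f g + h g)"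
  unfolding resq_def by (rule restrict_ext) (simp add: p e)
 thus "liftq n k (\<lambda>g\<in>SLc n. f g + h g) = (\<lambda>alpha\<in>quivers n. liftq n k f alpha + liftq n k h alpha)"
  using liftq_resq[OF n k, of "\<lambda>alpha\<in>quivers n. liftq n k f alpha + liftq n k h alpha"] B L by simp
 have "resq n k (\<lambda>alpha\<in>quivers n. liftq n k f alpha * liftq n k h alpha) = (\<lambda>g\<in>SLc n. f g * h g)"
  unfolding resq_def by (rule restrict_ext) (simp add: p e)
 thus "liftq n k (\<lambda>g\<in>SLc n. f g * h g) = (\<lambda>alpha\<in>quivers n. liftq n k f alpha * liftq n k h alpha)"
  using liftq_resq[OF n k, of "\<lambda>alpha\<in>quivers n. liftq n k f alpha * liftq n k h alpha"] B L by simp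
qed

theorem liftq_iso:
 assumes n: "1 <= n" and k: "k : SLc n"
 shows "calg_iso (SLc n) (implosion_functions n (cj k ` unitri n)) (quivers n) (quiver_invariants n) (liftq n k)"
proof -
 let ?A = "implosion_functions n (cj k ` unitri n)"
 have "bij_betw (liftq n k) ?A (quiver_invariants n)"
  unfolding liftq_def by (rule bij_betw_inv_into[OF resq_bij[OF n k]])
 moreover have "liftq n k : Ring.ring_hom (fun_ring (SLc n) ?A) (fun_ring (quivers n) (quiver_invariants n))"
  unfolding Ring.ring_hom_def fun_ring_def using liftq_closed[OF n k] liftq_ring[OF n k] by simp
 ultimately show ?thesis unfolding calg_iso_def ring_iso_def using liftq_ring(1)[OF n k] by (simp add: fun_ring_def)
qed

section \<open>Points of the implosion\<close>

text \<open>Fixes a matrix \<open>k\<close> that conjugates the unitriangular group to the given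
  maximal unipotent group.\<close>

locale implosion_setup =
 fixes n :: nat and k :: "complex mat"
 assumes n: "1 <= n" and k: "k : SLc n"
begin

abbreviation "G == SLc n"
abbreviation "A == implosion_functions n (cj k ` unitri n)"
abbreviation "Ch == characters G A"

lemma subalgA: "(\<lambda>g\<in>G. c) : A" "f : A ==> h : A ==> (\<lambda>g\<in>G. f g + h g) : A" "f : A ==> h : A ==> (\<lambda>g\<in>G. f g * h g) : A"
 using subalg_implosion[OF k] by (auto simp: subalg_def)

lemma Ch:
 assumes "chi : Ch"
 shows "chi (\<lambda>g\<in>G. c) = c" "f : A ==> h : A ==> chi (\<lambda>g\<in>G. f g + h g) = chi f + chi h"
  "f : A ==> h : A ==> chi (\<lambda>g\<in>G. f g * h g) = chi f * chi h"
 using assms unfolding characters_iff[OF subalg_implosion[OF k]] by blast+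

lemma Ch_ext: "chi : Ch ==> chi : extensional A"
 by (simp add: characters_iff[OF subalg_implosion[OF k]])

lemma Ch_add_restrict:
 assumes "chi : Ch" "restrict F G : A" "restrict H G : A"
 shows "(\<lambda>g\<in>G. F g + H g) : A" "chi (\<lambda>g\<in>G. F g + H g) = chi (restrict F G) + chi (restrict H G)"
  "(\<lambda>g\<in>G. F g * H g) : A" "chi (\<lambda>g\<in>G. F g * H g) = chi (restrict F G) * chi (restrict H G)"
 using subalgA(2,3)[OF assms(2,3)] Ch(2,3)[OF assms] by (simp_all cong: restrict_cong)

lemma Ch_sum:
 assumes chi: "chi : Ch" and F: "!!i. i : I ==> restrict (F i) G : A"
 shows "(\<lambda>g\<in>G. SUM i:I. F i g) : A & chi (\<lambda>g\<in>G. SUM i:I. F i g) = (SUM i:I. chi (restrict (F i) G))"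
 using F by (induction I rule: infinite_finite_induct) (simp_all add: subalgA(1) Ch(1)[OF chi] Ch_add_restrict[OF chi])

lemma Ch_prod:
 assumes chi: "chi : Ch" and F: "!!i. i : I ==> restrict (F i) G : A"
 shows "(\<lambda>g\<in>G. PROD i:I. F i g) : A & chi (\<lambda>g\<in>G. PROD i:I. F i g) = (PROD i:I. chi (restrict (F i) G))"
 using F by (induction I rule: infinite_finite_induct) (simp_all add: subalgA(1) Ch(1)[OF chi] Ch_add_restrict[OF chi])

lemma Ch_det:
 assumes chi: "chi : Ch" and F: "!!i j. i < d ==> j < d ==> (\<lambda>g\<in>G. F g i j) : A"
 shows "(\<lambda>g\<in>G. det (mat d d (%(i, j). F g i j))) : A &
  chi (\<lambda>g\<in>G. det (mat d d (%(i, j). F g i j))) = det (mat d d (%(i, j). chi (\<lambda>g\<in>G. F g i j)))"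
proof -
 let ?P = "{p. p permutes {0..<d}}"
 have dt: "det (mat d d (%(i, j). f i j)) = (SUM p:?P. signof p * (PROD i:{0..<d}. f i (p i)))" for f :: "nat => nat => complex"
  by (subst det_def'[of _ d]) (auto intro!: sum.cong prod.cong simp: permutes_in_image[where S = "{0..<d}", simplified])
 have p: "(\<lambda>g\<in>G. PROD i:{0..<d}. F g i (p i)) : A &
  chi (\<lambda>g\<in>G. PROD i:{0..<d}. F g i (p i)) = (PROD i:{0..<d}. chi (\<lambda>g\<in>G. F g i (p i)))" if "p : ?P" for p
  by (rule Ch_prod[OF chi]) (use F that in \<open>auto simp: permutes_in_image[where S = "{0..<d}", simplified]\<close>)
 have s: "(\<lambda>g\<in>G. signof p * (PROD i:{0..<d}. F g i (p i))) : A &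
  chi (\<lambda>g\<in>G. signof p * (PROD i:{0..<d}. F g i (p i))) = signof p * (PROD i:{0..<d}. chi (\<lambda>g\<in>G. F g i (p i)))" if "p : ?P" for p
  using Ch_add_restrict(3,4)[OF chi subalgA(1)[of "signof p"] conjunct1[OF p[OF that]]] p[OF that] Ch(1)[OF chi] by simp
 show ?thesis unfolding dt using Ch_sum[OF chi, of ?P "%p g. signof p * (PROD i:{0..<d}. F g i (p i))"] s by simp
qed

text \<open>Minors translated by \<open>x\<close>; the factor \<open>k\<close> makes them invariant
  under the conjugated group.\<close>

definition mn :: "complex mat => nat => (nat => nat) => complex mat => complex" where
 "mn x d rho = (\<lambda>g\<in>G. minor (x * (g * k)) d rho)"

lemma mn_A:
 assumes x: "x : G" and d: "d <= n" and rho: "!!i. i < d ==> rho i < n"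
 shows "mn x d rho : A"
 unfolding mn_def
proof (rule implosionI[OF k])
 show "pf G (slc n) (%g. minor (x * (g * k)) d rho)"
  by (rule pf_translate_right[OF k], rule pf_translate_left[OF x], rule pf_minor[OF rho d])
 fix g u assume g: "g : G" and u: "u : unitri n"
 have xg: "x * (g * k) : G" by (rule SL_mult_closed[OF x SL_mult_closed[OF g k]])
 have "x * (g * cj k u * k) = x * (g * k) * u"
  unfolding cj_right[OF k SL_mat[OF g] unitri_carrier[OF u]]
  by (rule assoc_sq[symmetric, OF SL_mat[OF x] SL_mat[OF SL_mult_closed[OF g k]] unitri_carrier[OF u]])
 thus "minor (x * (g * cj k u * k)) d rho = minor (x * (g * k)) d rho"
  using minor_mult_unitri[OF SL_mat[OF xg] u d rho] by simp
qed

lemma mn_one: "mn (1\<^sub>m n) d rho = (\<lambda>g\<in>G. minor (g * k) d rho)"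
 unfolding mn_def by (rule restrict_ext) (simp only: left_mult_one_mat[OF SL_mat[OF SL_mult_closed[OF _ k]]])

lemma restrict_right: "(\<lambda>g\<in>G. restrict F G (g * k)) = (\<lambda>g\<in>G. F (g * k))"
 by (rule restrict_ext) (simp add: SL_mult_closed[OF _ k])

lemma restrict_left: "x : G ==> (\<lambda>g\<in>G. restrict F G (x * g)) = (\<lambda>g\<in>G. F (x * g))"
 by (rule restrict_ext) (simp add: SL_mult_closed)

text \<open>For an arbitrary character these values play the role of the minors of a matrix.\<close>

abbreviation "av chi d rho == chi (mn (1\<^sub>m n) d rho)"

lemma mn_translate:
 assumes chi: "chi : Ch" and x: "x : G" and d: "d <= n" and rho: "!!i. i < d ==> rho i < n"
 shows "chi (mn x d rho) = (SUM kappa:rowsel n d. (PROD i:{0..<d}. x $$ (rho i, kappa i)) * av chi d kappa)"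
proof -
 have m: "(\<lambda>g\<in>G. minor (g * k) d kappa) : A" if "kappa : rowsel n d" for kappa
  using mn_A[OF SL_one_closed d rowsel_less[OF that]] unfolding mn_one .
 have "mn x d rho = (\<lambda>g\<in>G. SUM kappa:rowsel n d. (PROD i:{0..<d}. x $$ (rho i, kappa i)) * minor (g * k) d kappa)"
  unfolding mn_def by (rule restrict_ext) (rule minor_mult[OF SL_mat[OF x] SL_mat[OF SL_mult_closed[OF _ k]] d rho])
 hence "chi (mn x d rho) = chi (\<lambda>g\<in>G. SUM kappa:rowsel n d. (PROD i:{0..<d}. x $$ (rho i, kappa i)) * minor (g * k) d kappa)" by simp
 also have "... = (SUM kappa:rowsel n d. chi (\<lambda>g\<in>G. (PROD i:{0..<d}. x $$ (rho i, kappa i)) * minor (g * k) d kappa))"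
  by (rule conjunct2[OF Ch_sum[OF chi]]) (rule Ch_add_restrict(3)[OF chi subalgA(1) m])
 also have "... = (SUM kappa:rowsel n d. (PROD i:{0..<d}. x $$ (rho i, kappa i)) * av chi d kappa)"
  by (intro sum.cong refl) (simp add: Ch_add_restrict(4)[OF chi subalgA(1) m] Ch(1)[OF chi] mn_one)
 finally show ?thesis .
qed

text \<open>Because the minors generate the algebra, by \<open>implosion_mins\<close>.\<close>

lemma Ch_eqI:
 assumes chi: "chi : Ch" and psi: "psi : Ch"
  and eq: "!!d rho. 1 <= d ==> d < n ==> (!!i. i < d ==> rho i < n) ==> av chi d rho = av psi d rho"
 shows "chi = psi"
proof (rule extensionalityI[OF Ch_ext[OF chi] Ch_ext[OF psi]])
 fix h assume h: "h : A"
 have P: "(\<lambda>g\<in>G. F (g * k)) : A & chi (\<lambda>g\<in>G. F (g * k)) = psi (\<lambda>g\<in>G. F (g * k))"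
  if "F : poly_functions G (mins n)" for F
  using that
 proof (induction rule: poly_functions.induct)
  case (const c)
  show ?case unfolding restrict_right Ch(1)[OF chi] Ch(1)[OF psi] using subalgA(1) by blast
 next
  case (coord f)
  then obtain d rho where f: "f = (%g. minor g d rho)" "1 <= d" "d < n" "!!i. i < d ==> rho i < n"
   unfolding mins_def by blast
  have "(\<lambda>g\<in>G. restrict f G (g * k)) = mn (1\<^sub>m n) d rho" unfolding restrict_right mn_one f ..
  moreover have "mn (1\<^sub>m n) d rho : A" using mn_A[OF SL_one_closed _ f(4)] f(3) by simp
  ultimately show ?case using eq[OF f(2-4)] by simp
 next
  case (add f h)
  thus ?case unfolding restrict_right by (simp only: Ch_add_restrict[OF chi] Ch_add_restrict[OF psi] simp_thms)
 next
  case (mult f h)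
  thus ?case unfolding restrict_right by (simp only: Ch_add_restrict[OF chi] Ch_add_restrict[OF psi] simp_thms)
 qed
 have "(\<lambda>g\<in>G. restrict (%g. h (g * adj_mat k)) G (g * k)) = h"
 proof (rule extensionalityI[of _ G])
  show "h : extensional G" using h by (simp add: implosion_functions_iff[OF k])
  fix g assume g: "g : G"
  thus "(\<lambda>g\<in>G. restrict (%g. h (g * adj_mat k)) G (g * k)) g = h g"
   using SL_mult_closed[OF g k] SL_cancel_right(1)[OF k SL_mat[OF g]] by simp
 qed simp
 thus "chi h = psi h" using P[OF implosion_mins[OF k h, unfolded pf_def]] by simp
qed

text \<open>The image of the point of \<open>pt n D g\<close> under the identification of the
  spectra.\<close>

definition pnt :: "nat set => complex mat => (complex mat => complex) => complex" where
 "pnt D g = (\<lambda>f\<in>A. liftq n k f (pt n D g))"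

lemma pnt_Ch:
 assumes "g : G" shows "pnt D g : Ch"
 unfolding characters_iff[OF subalg_implosion[OF k]] pnt_def
 using subalgA liftq_ring[OF n k] pt_quiver[OF assms] by simp

lemma pnt_mn:
 assumes g: "g : G" and d: "1 <= d" "d < n" and rho: "!!i. i < d ==> rho i < n"
 shows "av (pnt D g) d rho = (if d : D then minor g d rho else 0)"
proof -
 have dn: "d <= n" using d by simp
 have "resq n k (restrict (qinv n d rho) (quivers n)) = mn (1\<^sub>m n) d rho"
  unfolding resq_def mn_one
 proof (rule restrict_ext)
  fix g assume g: "g : G"
  show "restrict (qinv n d rho) (quivers n) (pt n (full n) (g * k)) = minor (g * k) d rho"
   using qinv_pt[OF SL_mult_closed[OF g k] d rho, where D = "full n"] pt_quiver[OF SL_mult_closed[OF g k]] in_full[OF d] by simp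
 qed
 hence "liftq n k (mn (1\<^sub>m n) d rho) = restrict (qinv n d rho) (quivers n)"
  using liftq_resq[OF n k qinv_invariant[where rho = rho, OF d(1) dn rho]] by simp
 thus ?thesis
  unfolding pnt_def using mn_A[OF SL_one_closed dn rho] pt_quiver[OF g, of D] qinv_pt[OF g d rho, where D = D] by simp
qed

lemma pnt_eq_iff:
 assumes D: "D : flag_types n" and E: "E : flag_types n" and g: "g : G" and g': "g' : G"
 shows "pnt E g' = pnt D g \<longleftrightarrow> E = D & adj_mat g * g' : Hgrp n D"
proof
 assume "pnt E g' = pnt D g"
 thus "E = D & adj_mat g * g' : Hgrp n D"
  using pnt_mn[OF g] pnt_mn[OF g'] by (intro pt_minors_eq[OF E D g' g]) metis
next
 assume h: "E = D & adj_mat g * g' : Hgrp n D"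
 have "pt n D g' = pt n D (g * (adj_mat g * g'))" using SL_adj_cancel(1)[OF g SL_mat[OF g']] by simp
 hence "f (pt n D g') = f (pt n D g)" if "f : quiver_invariants n" for f
  using invariant_pt_Hgrp[OF D g conjunct2[OF h] that] by simp
 thus "pnt E g' = pnt D g"
  using h liftq_closed[OF n k] unfolding pnt_def by (intro restrict_ext) simp
qed

section \<open>Translation of characters\<close>

abbreviation "act == implosion_act n (cj k ` unitri n)"

lemma translate_A:
 assumes x: "x : G" and f: "f : A"
 shows "(\<lambda>g\<in>G. f (x * g)) : A"
proof (rule implosionI[OF k])
 have f': "pf G (slc n) f" "!!g u. g : G ==> u : unitri n ==> f (g * cj k u) = f g"
  using f by (simp_all add: implosion_functions_iff[OF k])
 show "pf G (slc n) (%g. f (x * g))" by (rule pf_translate_left[OF x f'(1)])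
 fix g u assume g: "g : G" and u: "u : unitri n"
 have "x * (g * cj k u) = x * g * cj k u"
  by (rule assoc_sq[symmetric, OF SL_mat[OF x] SL_mat[OF g] SL_mat[OF cj_SL[OF k unitri_SL[OF u]]]])
 thus "f (x * (g * cj k u)) = f (x * g)" using f'(2)[OF SL_mult_closed[OF x g] u] by simp
qed

lemma act_Ch:
 assumes x: "x : G" and chi: "chi : Ch"
 shows "act x chi : Ch"
 unfolding characters_iff[OF subalg_implosion[OF k]]
proof (intro conjI allI ballI)
 show "act x chi : extensional A" by (simp add: implosion_act_def)
 show "act x chi (\<lambda>g\<in>G. c) = c" for c
  by (simp only: implosion_act_def restrict_apply'[OF subalgA(1)] restrict_left[OF x] Ch(1)[OF chi])
 fix f h assume f: "f : A" and h: "h : A"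
 show "act x chi (\<lambda>g\<in>G. f g + h g) = act x chi f + act x chi h" "act x chi (\<lambda>g\<in>G. f g * h g) = act x chi f * act x chi h"
  using f h subalgA(2,3)[OF f h] Ch_add_restrict(2,4)[OF chi translate_A[OF x f] translate_A[OF x h]]
  by (simp_all only: implosion_act_def restrict_apply' restrict_left[OF x])
qed

lemma act_mn:
 assumes x: "x : G" and d: "d <= n" and rho: "!!i. i < d ==> rho i < n"
 shows "av (act x chi) d rho = chi (mn x d rho)"
proof -
 have "(\<lambda>g\<in>G. (\<lambda>g\<in>G. minor (g * k) d rho) (x * g)) = mn x d rho"
  unfolding mn_def by (rule restrict_ext)
   (simp add: SL_mult_closed[OF x] assoc_sq[OF SL_mat[OF x] SL_mat SL_mat[OF k]])
 thus ?thesis using mn_A[OF SL_one_closed d rho] by (simp add: implosion_act_def mn_one)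
qed

text \<open>Tested on minors: \<open>mn_translate\<close> expands the translated value exactly as
  \<open>minor_mult\<close> expands the minors of \<open>x * g\<close>.\<close>

lemma act_pnt:
 assumes x: "x : G" and g: "g : G"
 shows "act x (pnt D g) = pnt D (x * g)"
proof (rule Ch_eqI[OF act_Ch[OF x pnt_Ch[OF g]] pnt_Ch[OF SL_mult_closed[OF x g]]])
 fix d rho assume d: "1 <= d" "d < n" and rho: "!!i. i < d ==> rho i < (n :: nat)"
 have dn: "d <= n" using d by simp
 have "av (act x (pnt D g)) d rho = pnt D g (mn x d rho)" by (rule act_mn[OF x dn rho])
 also have "... = (SUM kappa:rowsel n d. (PROD i:{0..<d}. x $$ (rho i, kappa i)) * av (pnt D g) d kappa)"
  by (rule mn_translate[OF pnt_Ch[OF g] x dn rho])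
 also have "... = (SUM kappa:rowsel n d. (PROD i:{0..<d}. x $$ (rho i, kappa i)) * (if d : D then minor g d kappa else 0))"
  by (intro sum.cong refl arg_cong2[of _ _ _ _ "(*)"] pnt_mn[OF g d]) (rule rowsel_less)
 also have "... = (if d : D then minor (x * g) d rho else 0)"
  by (simp add: minor_mult[OF SL_mat[OF x] SL_mat[OF g] dn rho])
 also have "... = av (pnt D (x * g)) d rho" by (rule pnt_mn[symmetric, OF SL_mult_closed[OF x g] d rho])
 finally show "av (act x (pnt D g)) d rho = av (pnt D (x * g)) d rho" .
qed

lemma act_adj:
 assumes x: "x : G" and chi: "chi : Ch"
 shows "act (adj_mat x) (act x chi) = chi"
proof (rule extensionalityI[OF Ch_ext[OF act_Ch[OF SL_adj(1)[OF x] act_Ch[OF x chi]]] Ch_ext[OF chi]])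
 fix f assume f: "f : A"
 have "(\<lambda>g\<in>G. (\<lambda>g\<in>G. f (adj_mat x * g)) (x * g)) = f"
 proof (rule extensionalityI[of _ G])
  show "f : extensional G" using f by (simp add: implosion_functions_iff[OF k])
  fix g assume g: "g : G"
  thus "(\<lambda>g\<in>G. (\<lambda>g\<in>G. f (adj_mat x * g)) (x * g)) g = f g"
   using SL_mult_closed[OF x g] SL_adj_cancel(2)[OF x SL_mat[OF g]] by simp
 qed simp
 thus "act (adj_mat x) (act x chi) f = chi f"
  using f translate_A[OF SL_adj(1)[OF x] f] by (simp add: implosion_act_def)
qed

text \<open>
  The value at \<open>mn x d id\<close> is a polynomial in the first \<open>d < n\<close> rows of \<open>x\<close>; if it vanishes on
  \<open>SL(n,\<complex>)\<close> then it vanishes identically.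
\<close>

lemma translate_nonzero:
 assumes chi: "chi : Ch" and d: "d < n" and rho: "!!i. i < d ==> rho i < n" and nz: "av chi d rho ~= 0"
 shows "EX x:G. chi (mn x d id) ~= 0"
proof (rule ccontr)
 define P where "P x = (SUM kappa:rowsel n d. (PROD i:{0..<d}. x $$ (i, kappa i)) * av chi d kappa)" for x
 assume "~ ?thesis"
 hence SLz: "P x = 0" if "x : G" for x
  using mn_translate[OF chi that, of d id] d that unfolding P_def by simp
 have GLz: "P x = 0" if x: "x : sq_mat n" "det x ~= 0" for x
 proof -
  \<comment> \<open>Scaling the last row corrects the determinant; as d < n, that row does not enter
    \<open>P\<close>.\<close>
  let ?M = "multrow_mat n (n - 1) (1 / det x)"
  have "det (?M * x) = 1"
   using x d det_mult[OF multrow_mat_carrier x(1), of "n - 1" "1 / det x"] det_multrow_mat[of "n - 1" n "1 / det x"] by simp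
  hence "?M * x : G" using mult_carrier_mat[OF multrow_mat_carrier x(1)] by (simp add: SL_carrier)
  moreover have "(?M * x) $$ (i, j) = x $$ (i, j)" if "i < d" "j < n" for i j
   using that d x by (subst multrow_mat[symmetric]) auto
  hence "P (?M * x) = P x"
   unfolding P_def by (intro sum.cong prod.cong refl arg_cong2[of _ _ _ _ "(*)"]) (auto dest: rowsel_less)
  ultimately show ?thesis using SLz by simp
 qed
 \<comment> \<open>For i < d, row i is the unit vector at \<open>rho i\<close>, so
   \<open>P x\<close> is the given nonzero value. The matrix may be singular and is reached along a
   line from the identity.\<close>
 define x where "x = mat n n (%(i, j). if j = rho i then 1 else 0 :: complex)"
 define c where "c z = mat n n (%(i, j). (if i = j then 1 else 0) + z * (x $$ (i, j) - (if i = j then 1 else 0)))" for z :: complex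
 have line: "pline (%z. c z $$ (i, j))" if "i < n" "j < n" for i j
  unfolding pline_def c_def using that pline_id[unfolded pline_def] by (simp add: pf_add pf_mult pf_const)
 have "pline (%z. det (c z))" unfolding pline_def by (rule pf_det[where d = n]) (use line in \<open>auto simp: c_def pline_def\<close>)
 moreover have "c 0 = 1\<^sub>m n" "c 1 = x" by (auto simp: c_def x_def intro!: eq_matI)
 ultimately have Z: "finite {z. det (c z) = 0}" using pline_finite_zeros[of "%z. det (c z)" 0] by simp
 have "pline (%z. P (c z))" unfolding pline_def P_def
  by (intro pf_sum pf_mult pf_prod pf_const) (use line d rowsel_less in \<open>auto simp: pline_def\<close>)
 hence "P (c 1) = 0" by (rule pline_zero[OF _ Z]) (auto intro!: GLz simp: c_def)
 moreover have "P x = av chi d rho"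
 proof -
  define rho' where "rho' i = (if i < d then rho i else i)" for i
  have rho': "rho' : rowsel n d" using rho by (auto simp: rowsel_def rho'_def)
  have "(PROD i:{0..<d}. x $$ (i, kappa i)) = (if kappa = rho' then 1 else 0)" if kappa: "kappa : rowsel n d" for kappa
  proof -
   have e: "x $$ (i, kappa i) = (if kappa i = rho i then 1 else 0)" if "i < d" for i
    using that d rowsel_less[OF kappa that] by (simp add: x_def)
   show ?thesis
   proof (cases "kappa = rho'")
    case True
    thus ?thesis using e by (auto simp: rho'_def intro!: prod.neutral)
   next
    case False
    then obtain i where "kappa i ~= rho' i" by blast
    hence "i < d" "kappa i ~= rho i" using kappa by (auto simp: rowsel_def rho'_def split: if_splits)
    thus ?thesis using False e[of i] by (auto intro!: prod_zero bexI[of _ i])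
   qed
  qed
  hence "P x = (SUM kappa:rowsel n d. if kappa = rho' then av chi d kappa else 0)"
   unfolding P_def by (intro sum.cong refl) simp
  also have "... = av chi d rho'" using rho' finite_bounded_functions[of "{0..<n}" "{0..<d}"] by (simp add: rowsel_def)
  also have "mn (1\<^sub>m n) d rho' = mn (1\<^sub>m n) d rho" unfolding mn_def by (intro restrict_ext minor_cong) (simp add: rho'_def)
  finally show ?thesis .
 qed
 ultimately show False using nz `c 1 = x` by simp
qed

lemma mn_full: "mn (1\<^sub>m n) n id = (\<lambda>g\<in>G. 1)"
 unfolding mn_one using SL_mult_closed[OF _ k] by (intro restrict_ext) (simp add: minor_full[OF SL_mat] SL_carrier)

text \<open>For each d the value is polynomial in \<open>x\<close> and nonzero somewhere, so
  irreducibility of SL(n) gives a common \<open>x\<close>.\<close>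

lemma generic_translate:
 assumes chi: "chi : Ch" and D: "D : flag_types n"
  and nz: "!!d. d : D ==> d < n ==> EX rho. (ALL i<d. rho i < n) & av chi d rho ~= 0"
 shows "EX x:G. ALL d:D. chi (mn x d id) ~= 0"
proof (rule SL_irreducible)
 have Dn: "D \<subseteq> {1..n}" using D by (simp add: flag_types_def)
 thus "finite D" by (rule finite_subset) simp
 fix d assume d: "d : D"
 hence dn: "d <= n" using Dn by auto
 have "pf G (slc n) (%x. SUM kappa:rowsel n d. (PROD i:{0..<d}. x $$ (id i, kappa i)) * av chi d kappa)"
  by (intro pf_sum pf_mult pf_prod pf_const pf_slc) (use dn rowsel_less in auto)
 thus "pf G (slc n) (%x. chi (mn x d id))"
  by (subst pf_cong) (rule mn_translate[OF chi _ dn], use dn in auto)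
 show "EX x:G. chi (mn x d id) ~= 0"
 proof (cases "d = n")
  case True
  thus ?thesis using mn_full Ch(1)[OF chi, of 1] by (intro bexI[OF _ SL_one_closed]) simp
 next
  case False
  thus ?thesis using nz[OF d] translate_nonzero[OF chi] dn by (metis le_neq_implies_less)
 qed
qed

text \<open>
  The character with values \<open>av chi d rho\<close> on minors comes from the matrix whose columns are those of
  \<open>secm\<close>, evaluated at \<open>chi\<close> and rescaled so that the leading minors are \<open>av chi d id\<close>.
\<close>

definition colf :: "nat set => ((complex mat => complex) => complex) => nat => complex" where
 "colf D chi e = (if e : D then av chi e id else 1)"

definition sct :: "nat set => ((complex mat => complex) => complex) => complex mat" where
 "sct D chi = mat n n (%(r, c). av chi (nxt D c) (id(c := r)) * (colf D chi (Suc c) / (colf D chi c * av chi (nxt D c) id)))"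

text \<open>The matrix is S T, where S is \<open>secm\<close> evaluated at \<open>chi\<close> and T
  is diagonal. Applying \<open>chi\<close> to \<open>secm_relation\<close> gives the minors of S up
  to a product of leading values, and T is chosen so that its partial products compensate for
  this.\<close>

lemma sct:
 assumes chi: "chi : Ch" and D: "D : flag_types n" and nz: "!!d. d : D ==> av chi d id ~= 0"
  and e: "e : D" and rho: "!!i. i < e ==> rho i < n"
 shows "minor (sct D chi) e rho = av chi e rho"
proof -
 have D': "n : D" "D \<subseteq> {..n}" "0 ~: D" using D by (auto simp: flag_types_def)
 have en: "e <= n" using D' e by auto
 define S where "S = mat n n (%(r, c). av chi (nxt D c) (id(c := r)))"
 define t where "t c = colf D chi (Suc c) / (colf D chi c * av chi (nxt D c) id)" for c
 define T where "T = mat n n (%(i, j). if i = j then t j else 0)"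
 have Sc: "S : sq_mat n" "T : sq_mat n" by (simp_all add: S_def T_def)
 have ST: "sct D chi = S * T"
 proof (rule eq_matI)
  fix r c assume "r < dim_row (S * T)" "c < dim_col (S * T)"
  hence rc: "r < n" "c < n" by (simp_all add: S_def T_def)
  have "(S * T) $$ (r, c) = (SUM l<n. if l = c then S $$ (r, c) * t c else 0)"
   unfolding index_mult_sum[OF Sc rc] using rc by (intro sum.cong) (auto simp: T_def)
  thus "sct D chi $$ (r, c) = (S * T) $$ (r, c)" using rc by (simp add: sct_def S_def t_def)
 qed (simp_all add: sct_def S_def T_def)
 have "minor T e id = prod_list (diag_mat (mat e e (%(i, j). T $$ (id i, j))))"
  unfolding minor_def by (rule det_upper_triangular) (use en in \<open>auto simp: T_def\<close>)
 also have "... = (PROD c<e. t c)" using en by (simp add: prod_list_diag_prod atLeast0LessThan T_def)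
 \<comment> \<open>The quotients telescope. \<open>colf\<close> is 1 off \<open>D\<close>, in
   particular at 0, so all of them are defined.\<close>
 also have "... * (PROD c<e. av chi (nxt D c) id) = (PROD c<e. colf D chi (Suc c) / colf D chi c)"
  unfolding prod.distrib[symmetric]
  by (intro prod.cong) (use en nz nxt(1)[OF D'(1)] in \<open>auto simp: t_def\<close>)
 also have "... = colf D chi e / colf D chi 0"
  by (rule prod_lessThan_telescope) (use nz in \<open>auto simp: colf_def\<close>)
 also have "... = av chi e id" using e D'(3) by (simp add: colf_def)
 finally have T: "minor T e id * (PROD c<e. av chi (nxt D c) id) = av chi e id" .
 have A1: "(\<lambda>g\<in>G. minor (g * k) d kappa) : A" if "d <= n" "!!i. i < d ==> kappa i < n" for d kappa
  using mn_A[OF SL_one_closed that] unfolding mn_one .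
 have nx: "nxt D c <= n" "c < nxt D c" if "c < e" for c using nxt[OF D'(1), of c] that en by auto
 have Am: "(\<lambda>g\<in>G. minor (g * k) (nxt D j) (id(j := rho i))) : A" if "i < e" "j < e" for i j
  by (rule A1) (use nx[OF that(2)] rho[OF that(1)] in auto)
 have mS: "minor (secm n D (g * k)) e rho = det (mat e e (%(i, j). minor (g * k) (nxt D j) (id(j := rho i))))" for g
  unfolding minor_def[of "secm n D (g * k)"] by (intro arg_cong[of _ _ det] eq_matI) (use rho en in \<open>auto simp: secm_def\<close>)
 have S: "(\<lambda>g\<in>G. minor (secm n D (g * k)) e rho) : A & chi (\<lambda>g\<in>G. minor (secm n D (g * k)) e rho) = minor S e rho"
 proof -
  have "minor S e rho = det (mat e e (%(i, j). chi (\<lambda>g\<in>G. minor (g * k) (nxt D j) (id(j := rho i)))))"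
   unfolding minor_def[of S] by (intro arg_cong[of _ _ det] eq_matI) (use rho en in \<open>auto simp: S_def mn_one\<close>)
  thus ?thesis unfolding mS
   using Ch_det[OF chi, of e "%g i j. minor (g * k) (nxt D j) (id(j := rho i))"] Am by simp
 qed
 have P: "(\<lambda>g\<in>G. PROD c<e. minor (g * k) (nxt D c) id) : A &
   chi (\<lambda>g\<in>G. PROD c<e. minor (g * k) (nxt D c) id) = (PROD c<e. av chi (nxt D c) id)"
  unfolding mn_one by (rule Ch_prod[OF chi], rule A1) (use nx in \<open>auto intro: less_le_trans\<close>)
 have E: "(\<lambda>g\<in>G. minor (g * k) e id) : A" "(\<lambda>g\<in>G. minor (g * k) e rho) : A"
  by (rule A1[OF en]; use en rho in auto)+
 have "(\<lambda>g\<in>G. minor (g * k) e id * minor (secm n D (g * k)) e rho) =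
   (\<lambda>g\<in>G. minor (g * k) e rho * (PROD c<e. minor (g * k) (nxt D c) id))"
  by (rule restrict_ext) (rule secm_relation[OF D'(1,2) SL_mat[OF SL_mult_closed[OF _ k]] e rho])
 hence "av chi e id * minor S e rho = av chi e rho * (PROD c<e. av chi (nxt D c) id)"
  using Ch_add_restrict(4)[OF chi E(1) conjunct1[OF S]] Ch_add_restrict(4)[OF chi E(2) conjunct1[OF P]] S P
  by (simp add: mn_one)
 hence "av chi e id * minor S e rho * minor T e id = av chi e rho * av chi e id"
  unfolding T[symmetric] by (simp add: algebra_simps)
 moreover have "minor (sct D chi) e rho = minor S e rho * minor T e id"
  unfolding ST by (rule minor_mult_block[OF Sc en en _ rho]) (use en in \<open>auto simp: T_def\<close>)
 ultimately show ?thesis using nz[OF e] by simp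
qed

lemma sct_SL:
 assumes chi: "chi : Ch" and D: "D : flag_types n" and nz: "!!d. d : D ==> av chi d id ~= 0"
 shows "sct D chi : G"
proof -
 have c: "sct D chi : sq_mat n" by (simp add: sct_def)
 have "n : D" using D by (simp add: flag_types_def)
 from sct[OF assms this, of id] have "det (sct D chi) = 1"
  unfolding minor_full[OF c] mn_full Ch(1)[OF chi] by simp
 thus ?thesis using c by (simp add: SL_carrier)
qed

lemma sct_pnt:
 assumes chi: "chi : Ch" and D: "D : flag_types n" and nz: "!!d. d : D ==> av chi d id ~= 0"
  and z: "!!d rho. 1 <= d ==> d < n ==> d ~: D ==> (!!i. i < d ==> rho i < n) ==> av chi d rho = 0"
 shows "pnt D (sct D chi) = chi"
proof (rule Ch_eqI[OF pnt_Ch[OF sct_SL[OF chi D nz]] chi])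
 fix d rho assume d: "1 <= d" "d < n" and rho: "!!i. i < d ==> rho i < (n :: nat)"
 have "av (pnt D (sct D chi)) d rho = (if d : D then minor (sct D chi) d rho else 0)"
  by (rule pnt_mn[OF sct_SL[OF chi D nz] d rho])
 also have "... = av chi d rho"
 proof (cases "d : D")
  case True
  have "minor (sct D chi) d rho = av chi d rho" by (rule sct[OF chi D nz True rho])
  thus ?thesis using True by simp
 next
  case False
  have "av chi d rho = 0" by (rule z[OF d False rho])
  thus ?thesis using False by simp
 qed
 finally show "av (pnt D (sct D chi)) d rho = av chi d rho" .
qed

text \<open>\<open>D\<close> collects the sizes below n at which some minor of \<open>chi\<close> is
  nonzero, together with n. After a translation the leading ones are nonzero, \<open>sct\<close>
  yields a matrix, and the translation is undone.\<close>

theorem points_pnt: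
 assumes chi: "chi : Ch"
 shows "EX D:flag_types n. EX g:G. chi = pnt D g"
proof -
 define D where "D = insert n {d. 1 <= d & d < n & (EX rho. (ALL i<d. rho i < n) & av chi d rho ~= 0)}"
 have D: "D : flag_types n" using n by (auto simp: flag_types_def D_def)
 have "EX x:G. ALL d:D. chi (mn x d id) ~= 0"
  by (rule generic_translate[OF chi D]) (auto simp: D_def)
 then obtain x where x: "x : G" "!!d. d : D ==> chi (mn x d id) ~= 0" by blast
 let ?psi = "act x chi"
 have psi: "?psi : Ch" by (rule act_Ch[OF x(1) chi])
 have nz: "av ?psi d id ~= 0" if d: "d : D" for d
 proof -
  have "d <= n" using d D by (auto simp: flag_types_def)
  thus ?thesis using act_mn[OF x(1), of d id] x(2)[OF d] by simp
 qed
 have z: "av ?psi d rho = 0" if d: "1 <= d" "d < n" "d ~: D" and rho: "!!i. i < d ==> rho i < n" for d rho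
 proof -
  have "av chi d kappa = 0" if "kappa : rowsel n d" for kappa
   using d rowsel_less[OF that] unfolding D_def by blast
  moreover have "av ?psi d rho = chi (mn x d rho)" by (rule act_mn[OF x(1) _ rho]) (use d in simp)
  moreover have "chi (mn x d rho) = (SUM kappa:rowsel n d. (PROD i:{0..<d}. x $$ (rho i, kappa i)) * av chi d kappa)"
   by (rule mn_translate[OF chi x(1) _ rho]) (use d in simp)
  ultimately show ?thesis by (simp only: mult_zero_right sum.neutral_const cong: sum.cong)
 qed
 have "pnt D (sct D ?psi) = ?psi" by (rule sct_pnt[OF psi D nz z])
 hence "chi = act (adj_mat x) (pnt D (sct D ?psi))" using act_adj[OF x(1) chi] by simp
 also have "... = pnt D (adj_mat x * sct D ?psi)" by (rule act_pnt[OF SL_adj(1)[OF x(1)] sct_SL[OF psi D nz]])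
 finally show ?thesis using D SL_mult_closed[OF SL_adj(1)[OF x(1)] sct_SL[OF psi D nz]] by blast
qed

end

section \<open>Orbits as homogeneous spaces\<close>

lemma points_SL_quotient: "points (SL_quotient n H) = (%g. g <#\<^bsub>SL n\<^esub> H) ` SLc n" (is "_ = ?\<pi> ` ?G")
proof -
 have "points (SL_variety n) = ?G"
  unfolding SL_variety_def SL_functions_def by (rule points_affine[OF mult_closed_pf])
 hence "{g : ?G. ?\<pi> g : ?\<pi> ` ?G} = points (SL_variety n)" by auto
 hence "openin (zariski (SL_quotient n H)) (?\<pi> ` ?G)"
  unfolding openin_SL_quotient by (simp only: openin_topspace simp_thms subset_refl)
 moreover have "points (SL_quotient n H) \<subseteq> ?\<pi> ` ?G"
  using openin_topspace[of "zariski (SL_quotient n H)"] unfolding openin_SL_quotient by blast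
 ultimately show ?thesis using openin_subset by blast
qed

text \<open>\<open>section_map\<close> for the orbit map \<open>ev\<close>, passed to cosets: by
  \<open>coset\<close> its fibres are exactly the cosets.\<close>

lemma SL_quotient_iso:
 fixes ev :: "complex mat => 'p" and n :: nat
 defines "Gn == SLc n" and "S == SL_functions n"
 assumes F: "mult_closed Y F" and Z: "Z \<subseteq> Y" and ev: "ev ` Gn = Z"
  and pull: "!!f. f : F ==> EX e:S. ALL g:Gn. e g = f (ev g)"
  and sec: "!!g. g : Gn ==> EX b:F. EX s. b (ev g) ~= 0 & (ALL z:Z. b z ~= 0 --> s z : Gn & ev (s z) = z) &
   (ALL e:S. EX a:F. EX c:F. ALL z:Z. b z ~= 0 --> c z ~= 0 & e (s z) = a z / c z)"
  and coset: "!!g g'. g : Gn ==> g' : Gn ==> ev g = ev g' \<longleftrightarrow> g <#\<^bsub>SL n\<^esub> H = g' <#\<^bsub>SL n\<^esub> H"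
  and iota: "!!g. g : Gn ==> iota (g <#\<^bsub>SL n\<^esub> H) = ev g"
 shows "variety_iso (SL_quotient n H) (subvariety (affine_variety Y F) Z) iota"
proof -
 let ?X = "affine_variety Y F" and ?\<pi> = "%g. g <#\<^bsub>SL n\<^esub> H"
 have SF: "mult_closed Gn S" unfolding S_def SL_functions_def Gn_def by (rule mult_closed_pf)
 have V: "SL_variety n = affine_variety Gn S" by (simp add: SL_variety_def Gn_def S_def)
 have op: "openin (zariski (SL_variety n)) {g:Gn. ev g : W} \<longleftrightarrow> openin (zariski (subvariety ?X Z)) W" if "W \<subseteq> Z" for W
  unfolding V by (rule section_map(1)[OF SF F Z ev pull sec that])
 have reg: "regular (SL_variety n) {g:Gn. ev g : U} h' \<longleftrightarrow> regular (subvariety ?X Z) U h"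
  if "U \<subseteq> Z" "!!g. g : Gn ==> h' g = h (ev g)" for U h h'
  unfolding V by (rule section_map(2)[OF SF F Z ev pull sec]) (simp_all add: that)
 have Q: "points (SL_quotient n H) = ?\<pi> ` Gn" unfolding Gn_def by (rule points_SL_quotient)
 have pre: "{g:Gn. ?\<pi> g : {C : ?\<pi> ` Gn. iota C : W}} = {g:Gn. ev g : W}" for W using iota by auto
 have ZT: "points (subvariety ?X Z) = Z"
  using Z by (simp add: subvariety_def points_affine[OF F] Int_absorb1)
 have "homeomorphic_map (zariski (SL_quotient n H)) (zariski (subvariety ?X Z)) iota"
  unfolding homeomorphic_map_def quotient_map_def Q ZT
 proof (intro conjI allI impI)
  show "iota ` ?\<pi> ` Gn = Z" using iota ev by force
  show "inj_on iota (?\<pi> ` Gn)"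
   by (rule inj_onI) (use iota coset in auto)
  fix W assume W: "W \<subseteq> Z"
  show "openin (zariski (SL_quotient n H)) {C : ?\<pi> ` Gn. iota C : W} = openin (zariski (subvariety ?X Z)) W"
   using op[OF W] unfolding openin_SL_quotient Gn_def[symmetric] pre by blast
 qed
 moreover have "regular (subvariety ?X Z) W h \<longleftrightarrow> regular (SL_quotient n H) {C : ?\<pi> ` Gn. iota C : W} (h \<circ> iota)"
  if "openin (zariski (subvariety ?X Z)) W" for W h
 proof -
  have W: "W \<subseteq> Z" using that unfolding openin_sub[OF F Z] by blast
  show ?thesis
   unfolding SL_quotient_def variety.simps Gn_def[symmetric] pre by (rule reg[OF W, symmetric]) (simp add: iota)
 qed
 ultimately show ?thesis unfolding variety_iso_def Q by blast
qed

section \<open>The strata\<close>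

lemma (in group) l_coset_eq_iff:
 assumes H: "subgroup H G" and x: "x : carrier G" and y: "y : carrier G"
 shows "x <# H = y <# H \<longleftrightarrow> inv x \<otimes> y : H"
proof
 assume "x <# H = y <# H"
 moreover have "y : y <# H" using subgroup.one_closed[OF H] y unfolding l_coset_def by force
 ultimately obtain h where h: "h : H" "y = x \<otimes> h" unfolding l_coset_def by blast
 hence "inv x \<otimes> y = h" using x subgroup.mem_carrier[OF H] by (simp flip: m_assoc)
 thus "inv x \<otimes> y : H" using h by simp
next
 assume "inv x \<otimes> y : H"
 hence "y : x <# H" by (rule subgroup.lcos_module_rev[OF H is_group x y])
 thus "x <# H = y <# H" by (rule l_repr_independence[OF _ x H])
qed

lemma mem_cj:
 assumes k: "k : SLc n" and m: "m : SLc n" and H: "H \<subseteq> SLc n"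
 shows "m : cj k ` H \<longleftrightarrow> cj (adj_mat k) m : H"
proof
 assume "m : cj k ` H"
 then obtain h where "h : H" "m = cj k h" by blast
 thus "cj (adj_mat k) m : H" using cj_cj[OF k SL_mat] H by auto
next
 assume "cj (adj_mat k) m : H"
 thus "m : cj k ` H" using cj_cj'[OF k SL_mat[OF m]] by (metis imageI)
qed

lemma Hgrp_SL: "Hgrp n D \<subseteq> SLc n"
 by (auto simp: Hgrp_def)

lemma cj_adj_mult:
 assumes k: "k : SLc n" and g: "g : SLc n" and h: "h : SLc n"
 shows "cj (adj_mat k) (adj_mat g * h) = adj_mat (g * k) * (h * k)"
proof -
 note c = SL_mat[OF SL_adj(1)[OF k]] SL_mat[OF SL_adj(1)[OF g]] SL_mat[OF h] SL_mat[OF k]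
 show ?thesis
  unfolding cj_def adj_adj[OF k] SL_adj_mult[OF g k]
  by (simp only: assoc_sq[OF c(1) mult_sq[OF c(2,3)] c(4)] assoc_sq[OF c(2,3,4)] assoc_sq[OF c(1,2) mult_sq[OF c(3,4)]])
qed

context implosion_setup
begin

abbreviation "N == cj k ` unitri n"
abbreviation "Fs == (%f (chi :: (complex mat => complex) => complex). chi f) ` A"
abbreviation "Or D == pnt D ` G"
abbreviation "HD D == cj k ` Hgrp n D"

lemma Fs: "mult_closed Ch Fs"
 by (rule mult_closed_Spec[OF subalg_implosion[OF k]])

lemma implosion_affine: "implosion n N = affine_variety Ch Fs"
 by (simp add: implosion_def Spec_def)

lemma Or_Ch: "Or D \<subseteq> Ch"
 using pnt_Ch by blast

text \<open>A single fraction valid on all of \<open>V\<close>; such functions are closed under the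
  operations that build the local section below.\<close>

definition frac :: "((complex mat => complex) => complex) set => (((complex mat => complex) => complex) => complex) => bool" where
 "frac V u \<longleftrightarrow> (EX a:A. EX c:A. ALL chi:V. chi c ~= 0 & u chi = chi a / chi c)"

lemma frac_cong:
 assumes "!!chi. chi : V ==> u chi = v chi" "frac V u"
 shows "frac V v"
proof -
 obtain a c where a: "a : A" "c : A" "!!chi. chi : V ==> chi c ~= 0 & u chi = chi a / chi c" using assms(2) unfolding frac_def by blast
 hence "ALL chi:V. chi c ~= 0 & v chi = chi a / chi c" using assms(1) by simp
 thus ?thesis unfolding frac_def using a by blast
qed

lemma frac_ev:
 assumes "V \<subseteq> Ch" "f : A"
 shows "frac V (%chi. chi f)"
proof -
 have "ALL chi:V. chi (\<lambda>g\<in>G. 1) ~= 0 & chi f = chi f / chi (\<lambda>g\<in>G. 1)"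
 proof
  fix chi assume "chi : V"
  hence "chi : Ch" using assms(1) by blast
  hence "chi (\<lambda>g\<in>G. 1) = 1" by (rule Ch(1))
  thus "chi (\<lambda>g\<in>G. 1) ~= 0 & chi f = chi f / chi (\<lambda>g\<in>G. 1)" by simp
 qed
 thus ?thesis unfolding frac_def using assms(2) subalgA(1)[of 1] by blast
qed

lemma frac_const: "V \<subseteq> Ch ==> frac V (%chi. c)"
 by (rule frac_cong[OF _ frac_ev[OF _ subalgA(1)[of c]]]) (auto simp: Ch(1))

lemma frac_add:
 assumes V: "V \<subseteq> Ch" and u: "frac V u" and v: "frac V v"
 shows "frac V (%chi. u chi + v chi)"
proof -
 obtain a c where a: "a : A" "c : A" "!!chi. chi : V ==> chi c ~= 0 & u chi = chi a / chi c" using u unfolding frac_def by blast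
 obtain b d where b: "b : A" "d : A" "!!chi. chi : V ==> chi d ~= 0 & v chi = chi b / chi d" using v unfolding frac_def by blast
 let ?p = "\<lambda>g\<in>G. a g * d g" and ?q = "\<lambda>g\<in>G. b g * c g" and ?r = "\<lambda>g\<in>G. c g * d g"
 have m: "?p : A" "?q : A" "?r : A" using a b subalgA(3) by blast+
 show ?thesis
  unfolding frac_def
 proof (rule bexI[OF _ subalgA(2)[OF m(1,2)]], rule bexI[OF _ m(3)], rule ballI)
  fix chi assume chi: "chi : V"
  hence C: "chi : Ch" using V by blast
  show "chi ?r ~= 0 & u chi + v chi = chi (\<lambda>g\<in>G. ?p g + ?q g) / chi ?r"
   using a(3)[OF chi] b(3)[OF chi]
   by (simp only: Ch(2)[OF C m(1,2)] Ch(3)[OF C a(1) b(2)] Ch(3)[OF C b(1) a(2)] Ch(3)[OF C a(2) b(2)])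
    (simp add: field_simps)
 qed
qed

lemma frac_divide:
 assumes V: "V \<subseteq> Ch" and u: "frac V u" and v: "frac V v" and nz: "!!chi. chi : V ==> v chi ~= 0"
 shows "frac V (%chi. u chi / v chi)"
proof -
 obtain a c where a: "a : A" "c : A" "!!chi. chi : V ==> chi c ~= 0 & u chi = chi a / chi c" using u unfolding frac_def by blast
 obtain b d where b: "b : A" "d : A" "!!chi. chi : V ==> chi d ~= 0 & v chi = chi b / chi d" using v unfolding frac_def by blast
 show ?thesis
  unfolding frac_def
 proof (rule bexI[OF _ subalgA(3)[OF a(1) b(2)]], rule bexI[OF _ subalgA(3)[OF a(2) b(1)]], rule ballI)
  fix chi assume chi: "chi : V"
  hence C: "chi : Ch" using V by blast
  show "chi (\<lambda>g\<in>G. c g * b g) ~= 0 & u chi / v chi = chi (\<lambda>g\<in>G. a g * d g) / chi (\<lambda>g\<in>G. c g * b g)"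
   unfolding Ch(3)[OF C a(1) b(2)] Ch(3)[OF C a(2) b(1)] using a(3)[OF chi] b(3)[OF chi] nz[OF chi] by auto
 qed
qed

lemma frac_mult:
 assumes V: "V \<subseteq> Ch" and u: "frac V u" and v: "frac V v"
 shows "frac V (%chi. u chi * v chi)"
proof -
 obtain a c where a: "a : A" "c : A" "!!chi. chi : V ==> chi c ~= 0 & u chi = chi a / chi c" using u unfolding frac_def by blast
 obtain b d where b: "b : A" "d : A" "!!chi. chi : V ==> chi d ~= 0 & v chi = chi b / chi d" using v unfolding frac_def by blast
 show ?thesis
  unfolding frac_def
 proof (rule bexI[OF _ subalgA(3)[OF a(1) b(1)]], rule bexI[OF _ subalgA(3)[OF a(2) b(2)]], rule ballI)
  fix chi assume chi: "chi : V"
  hence C: "chi : Ch" using V by blast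
  show "chi (\<lambda>g\<in>G. c g * d g) ~= 0 & u chi * v chi = chi (\<lambda>g\<in>G. a g * b g) / chi (\<lambda>g\<in>G. c g * d g)"
   unfolding Ch(3)[OF C a(1) b(1)] Ch(3)[OF C a(2) b(2)] using a(3)[OF chi] b(3)[OF chi] by auto
 qed
qed

lemma frac_sum: "V \<subseteq> Ch ==> (!!i. i : I ==> frac V (u i)) ==> frac V (%chi. SUM i:I. u i chi)"
 by (induction I rule: infinite_finite_induct) (auto intro: frac_add frac_const)

lemma frac_mat_mult:
 assumes V: "V \<subseteq> Ch" and M: "!!chi. chi : V ==> M chi : sq_mat n" "!!chi. chi : V ==> M' chi : sq_mat n"
  and f: "!!i j. i < n ==> j < n ==> frac V (%chi. M chi $$ (i, j))" "!!i j. i < n ==> j < n ==> frac V (%chi. M' chi $$ (i, j))"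
  and rc: "r < n" "c < n"
 shows "frac V (%chi. (M chi * M' chi) $$ (r, c))"
proof (rule frac_cong)
 show "frac V (%chi. SUM l<n. M chi $$ (r, l) * M' chi $$ (l, c))"
  by (intro frac_sum[OF V] frac_mult[OF V] f) (use rc in auto)
qed (rule index_mult_sum[symmetric, OF M rc])

lemma orbit_mn_zero:
 assumes chi: "chi : Or D" and x: "x : G" and d: "1 <= d" "d < n" "d ~: D" and rho: "!!i. i < d ==> rho i < n"
 shows "chi (mn x d rho) = 0"
proof -
 obtain g where g: "g : G" "chi = pnt D g" using chi by blast
 have dn: "d <= n" using d by simp
 have "chi (mn x d rho) = act x chi (mn (1\<^sub>m n) d rho)" by (rule act_mn[symmetric, OF x dn rho])
 also have "... = pnt D (x * g) (mn (1\<^sub>m n) d rho)" unfolding g(2) act_pnt[OF x g(1)] ..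
 also have "... = (if d : D then minor (x * g) d rho else 0)" by (rule pnt_mn[OF SL_mult_closed[OF x g(1)] d(1,2) rho])
 finally show ?thesis using d(3) by simp
qed

text \<open>Some translate of the given point has nonzero leading minors at all members of
  \<open>D\<close>. On the open set where these stay nonzero, \<open>sct\<close> of the translate,
  moved back, is a section whose entries are fractions of invariants.\<close>

lemma local_section:
 assumes D: "D : flag_types n" and g: "g : G"
 shows "EX b:Fs. EX s. b (pnt D (g * k)) ~= 0 & (ALL z:Or D. b z ~= 0 --> s z : G & pnt D (s z * k) = z) &
   (ALL e:SL_functions n. EX a:Fs. EX c:Fs. ALL z:Or D. b z ~= 0 --> c z ~= 0 & e (s z) = a z / c z)"
proof -
 have Dn: "D \<subseteq> {1..n}" "n : D" using D by (simp_all add: flag_types_def)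
 have gk: "g * k : G" by (rule SL_mult_closed[OF g k])
 let ?chi0 = "pnt D (g * k)"
 have "EX x:G. ALL d:D. ?chi0 (mn x d id) ~= 0"
 proof (rule generic_translate[OF pnt_Ch[OF gk] D])
  fix d assume d: "d : D" "d < n"
  then obtain rho where rho: "!!i. i < d ==> rho i < n" "minor (g * k) d rho ~= 0" using minor_nonzero[OF gk, of d] by auto
  have "1 <= d" using d Dn by auto
  have "?chi0 (mn (1\<^sub>m n) d rho) = (if d : D then minor (g * k) d rho else 0)" by (rule pnt_mn[OF gk `1 <= d` d(2) rho(1)])
  thus "EX rho. (ALL i<d. rho i < n) & ?chi0 (mn (1\<^sub>m n) d rho) ~= 0" using rho d by (intro exI[of _ rho]) simp
 qed
 then obtain x where x: "x : G" "!!d. d : D ==> ?chi0 (mn x d id) ~= 0" by blast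
 have dn: "d <= n" if "d : D" for d using that Dn by auto
 have mA: "mn x d rho : A" if "d <= n" "!!i. i < d ==> rho i < n" for d rho by (rule mn_A[OF x(1) that])
 have mI: "mn x d id : A" if "d : D" for d by (rule mA[OF dn[OF that]]) (use dn[OF that] in simp)
 have rm: "restrict (mn x d id) G = mn x d id" for d by (simp add: mn_def)
 define f where "f = (\<lambda>g\<in>G. PROD d:D. mn x d id g)"
 have f: "f : A & chi f = (PROD d:D. chi (mn x d id))" if "chi : Ch" for chi
  using Ch_prod[OF that, of D "%d. mn x d id"] mI unfolding f_def rm by simp
 have fin: "finite D" using Dn(1) by (rule finite_subset) simp
 let ?act = "act"
 \<comment> \<open>The outer factors undo the translation by \<open>x\<close> and the factor
   \<open>k\<close> in the orbit map.\<close>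
 define s where "s chi = adj_mat x * sct D (?act x chi) * adj_mat k" for chi
 define V where "V = {chi : Or D. chi f ~= 0}"
 have VC: "V \<subseteq> Ch" using Or_Ch by (auto simp: V_def)
 have mv: "?act x chi (mn (1\<^sub>m n) d rho) = chi (mn x d rho)" if "d <= n" "!!i. i < d ==> rho i < n" for d rho chi
  by (rule act_mn[OF x(1) that])
 have nz: "?act x chi (mn (1\<^sub>m n) d id) ~= 0" if "chi : V" "d : D" for chi d
  using f[of chi] that VC mv[of d id chi] dn[OF that(2)] fin by (auto simp: V_def)
 have sec: "s chi : G & pnt D (s chi * k) = chi" if chi: "chi : V" for chi
 proof -
  have C: "chi : Ch" using chi VC by blast
  note psi = act_Ch[OF x(1) C]
  have S: "sct D (?act x chi) : G" by (rule sct_SL[OF psi D nz[OF chi]])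
  have "pnt D (sct D (?act x chi)) = ?act x chi"
  proof (rule sct_pnt[OF psi D nz[OF chi]])
   fix d rho assume d: "1 <= d" "d < n" "d ~: D" and rho: "!!i. i < d ==> rho i < n"
   have "?act x chi (mn (1\<^sub>m n) d rho) = chi (mn x d rho)" by (rule mv[OF _ rho]) (use d in simp)
   also have "... = 0" by (rule orbit_mn_zero[OF _ x(1) d rho]) (use chi in \<open>simp add: V_def\<close>)
   finally show "?act x chi (mn (1\<^sub>m n) d rho) = 0" .
  qed simp
  hence "pnt D (adj_mat x * sct D (?act x chi)) = chi"
   using act_pnt[OF SL_adj(1)[OF x(1)] S, of D] act_adj[OF x(1) C] by simp
  moreover have xS: "adj_mat x * sct D (?act x chi) : G" by (rule SL_mult_closed[OF SL_adj(1)[OF x(1)] S])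
  ultimately show ?thesis
   unfolding s_def using SL_cancel_right(2)[OF k SL_mat[OF xS]] SL_mult_closed[OF xS SL_adj(1)[OF k]] by simp
 qed
 have fm: "frac V (%chi. ?act x chi (mn (1\<^sub>m n) d rho))" if "d <= n" "!!i. i < d ==> rho i < n" for d rho
  by (rule frac_cong[OF _ frac_ev[OF VC mA[OF that]]]) (rule mv[symmetric, OF that])
 have fc: "frac V (%chi. colf D (?act x chi) e)" for e
 proof (cases "e : D")
  case True
  have "frac V (%chi. act x chi (mn (1\<^sub>m n) e id))" by (rule fm[OF dn[OF True]]) (use dn[OF True] in simp)
  thus ?thesis using True by (simp add: colf_def)
 qed (simp add: colf_def frac_const[OF VC])
 have fS: "frac V (%chi. sct D (?act x chi) $$ (i, j))" if ij: "i < n" "j < n" for i j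
 proof -
  note nx = nxt[OF Dn(2) ij(2)]
  have "frac V (%chi. ?act x chi (mn (1\<^sub>m n) (nxt D j) (id(j := i))) *
    (colf D (?act x chi) (Suc j) / (colf D (?act x chi) j * ?act x chi (mn (1\<^sub>m n) (nxt D j) id))))"
   by (intro frac_mult[OF VC] frac_divide[OF VC] fm fc) (use nx ij nz in \<open>auto simp: colf_def\<close>)
  thus ?thesis using ij by (simp add: sct_def)
 qed
 have fs: "frac V (%chi. s chi $$ (i, j))" if "i < n" "j < n" for i j
  unfolding s_def
  by (intro frac_mat_mult[OF VC] fS frac_const[OF VC] that)
   (use SL_mat[OF SL_adj(1)[OF x(1)]] SL_mat[OF SL_adj(1)[OF k]] in \<open>auto simp: sct_def intro: mult_sq\<close>)
 have fe: "frac V (%chi. e (s chi))" if "e : SL_functions n" for e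
  using that unfolding SL_functions_def
 proof (induction rule: poly_functions.induct)
  case (const c)
  show ?case by (rule frac_cong[OF _ frac_const[OF VC, of c]]) (use sec in auto)
 next
  case (coord f)
  then obtain i j where f: "f = (%g. g $$ (i, j))" "i < n" "j < n" by blast
  show ?case by (rule frac_cong[OF _ fs[OF f(2,3)]]) (use sec f in auto)
 next
  case (add f h)
  show ?case by (rule frac_cong[OF _ frac_add[OF VC add.IH]]) (use sec in auto)
 next
  case (mult f h)
  show ?case by (rule frac_cong[OF _ frac_mult[OF VC mult.IH]]) (use sec in auto)
 qed
 show ?thesis
 proof (rule bexI[of _ "%chi. chi f"], rule exI[of _ s], intro conjI ballI impI)
  show "?chi0 f ~= 0" using f[OF pnt_Ch[OF gk]] x(2) fin by simp
  show "(%chi. chi f) : Fs" using f[OF pnt_Ch[OF gk]] by blast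
  show "s z : G" "pnt D (s z * k) = z" if "z : Or D" "z f ~= 0" for z using sec[of z] that by (auto simp: V_def)
  fix e assume "e : SL_functions n"
  from fe[OF this] obtain a c where ac: "a : A" "c : A" "!!chi. chi : V ==> chi c ~= 0 & e (s chi) = chi a / chi c"
   unfolding frac_def by blast
  show "EX a:Fs. EX c:Fs. ALL z:Or D. z f ~= 0 --> c z ~= 0 & e (s z) = a z / c z"
   by (rule bexI[OF _ imageI[OF ac(1)]], rule bexI[OF _ imageI[OF ac(2)]]) (use ac(3) V_def in simp)
 qed
qed

lemma coset_iff:
 assumes D: "D : flag_types n" and g: "g : G" and h: "h : G"
 shows "pnt D (g * k) = pnt D (h * k) \<longleftrightarrow> g <#\<^bsub>SL n\<^esub> HD D = h <#\<^bsub>SL n\<^esub> HD D"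
proof -
 have Dn: "D \<subseteq> {..n}" using D by (auto simp: flag_types_def)
 have "pnt D (g * k) = pnt D (h * k) \<longleftrightarrow> pnt D (h * k) = pnt D (g * k)" by (rule eq_commute)
 also have "... \<longleftrightarrow> adj_mat (g * k) * (h * k) : Hgrp n D"
  using pnt_eq_iff[OF D D SL_mult_closed[OF g k] SL_mult_closed[OF h k]] by simp
 also have "... \<longleftrightarrow> adj_mat g * h : HD D"
  unfolding mem_cj[OF k SL_mult_closed[OF SL_adj(1)[OF g] h] Hgrp_SL] cj_adj_mult[OF k g h] ..
 also have "... \<longleftrightarrow> g <#\<^bsub>SL n\<^esub> HD D = h <#\<^bsub>SL n\<^esub> HD D"
  using group.l_coset_eq_iff[OF SL_group Hgrp_subgroup[OF k Dn] g h] by (simp add: SL_inv[OF g])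
 finally show ?thesis .
qed

lemma Or_right: "(%g. pnt D (g * k)) ` G = Or D"
proof (intro Set.set_eqI iffI)
 fix z assume "z : Or D"
 then obtain g where g: "g : G" "z = pnt D g" by blast
 thus "z : (%g. pnt D (g * k)) ` G"
  using SL_cancel_right(2)[OF k SL_mat[OF g(1)]] SL_mult_closed[OF g(1) SL_adj(1)[OF k]]
  by (intro image_eqI[of _ _ "g * adj_mat k"]) auto
qed (use SL_mult_closed[OF _ k] in blast)

lemma l_coset_mult:
 assumes "h : G" "g : G" "D : flag_types n"
 shows "h <#\<^bsub>SL n\<^esub> (g <#\<^bsub>SL n\<^esub> HD D) = (h * g) <#\<^bsub>SL n\<^esub> HD D"
proof -
 have "D \<subseteq> {..n}" using assms(3) by (auto simp: flag_types_def)
 from group.lcos_m_assoc[OF SL_group subgroup.subset[OF Hgrp_subgroup[OF k this]] assms(1,2)] show ?thesis by simp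
qed

lemma orbit_iso:
 assumes D: "D : flag_types n"
 shows "EX iota. SL_equivariant_iso n N (HD D) (Or D) iota"
proof -
 let ?\<pi> = "%g. g <#\<^bsub>SL n\<^esub> HD D"
 define iota where "iota C = pnt D ((SOME g. g : G & ?\<pi> g = C) * k)" for C
 have iota: "iota (?\<pi> g) = pnt D (g * k)" if g: "g : G" for g
 proof -
  have "(SOME h. h : G & ?\<pi> h = ?\<pi> g) : G & ?\<pi> (SOME h. h : G & ?\<pi> h = ?\<pi> g) = ?\<pi> g"
   by (rule someI[of _ g]) (use g in simp)
  thus ?thesis unfolding iota_def using coset_iff[OF D _ g] by blast
 qed
 have "variety_iso (SL_quotient n (HD D)) (subvariety (implosion n N) (Or D)) iota"
  unfolding implosion_affine
 proof (rule SL_quotient_iso[OF Fs Or_Ch Or_right])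
  fix f assume "f : Fs"
  then obtain h where h: "h : A" "f = (%chi. chi h)" by blast
  have "pf (quivers n) (qcoords n) (liftq n k h)" using liftq_closed[OF n k h(1)] by (simp add: quiver_invariants_iff)
  from pf_translate_right[OF k pf_pt[OF this, of D]]
  have "(\<lambda>g\<in>G. liftq n k h (pt n D (g * k))) : SL_functions n" by (simp add: pf_def SL_functions_def)
  thus "EX e:SL_functions n. ALL g:G. e g = f (pnt D (g * k))"
   by (rule bexI[rotated]) (simp add: h pnt_def)
 qed (use local_section[OF D] coset_iff[OF D] iota in auto)
 moreover have "iota (h <#\<^bsub>SL n\<^esub> C) = act h (iota C)" if h: "h : G" and C: "C : points (SL_quotient n (HD D))" for h C
 proof -
  obtain g where g: "g : G" "C = ?\<pi> g" using C unfolding points_SL_quotient by blast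
  have "iota (h <#\<^bsub>SL n\<^esub> C) = pnt D (h * g * k)"
   unfolding g(2) l_coset_mult[OF h g(1) D] by (rule iota[OF SL_mult_closed[OF h g(1)]])
  also have "... = pnt D (h * (g * k))" using assoc_sq[OF SL_mat[OF h] SL_mat[OF g(1)] SL_mat[OF k]] by simp
  also have "... = act h (iota C)"
   unfolding g(2) iota[OF g(1)] by (rule act_pnt[symmetric, OF h SL_mult_closed[OF g(1) k]])
  finally show ?thesis .
 qed
 ultimately show ?thesis unfolding SL_equivariant_iso_def by blast
qed

text \<open>An equivariant bijection matches stabilisers, so the two groups are conjugate, and
  \<open>Hgrp_conj_eq\<close> in both directions gives equal types.\<close>

lemma stabilizer_subset:
 assumes D: "D : flag_types n" and E: "E : flag_types n"
  and iso: "SL_equivariant_iso n N (HD D) (Or E) iota"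
 shows "D = E"
proof -
 have Dn: "D \<subseteq> {..n}" "E \<subseteq> {..n}" using D E by (auto simp: flag_types_def)
 let ?\<pi> = "%g. g <#\<^bsub>SL n\<^esub> HD D"
 have hm: "homeomorphic_map (zariski (SL_quotient n (HD D))) (zariski (subvariety (implosion n N) (Or E))) iota"
  and eq: "!!h g. h : G ==> g : G ==> iota (h <#\<^bsub>SL n\<^esub> ?\<pi> g) = act h (iota (?\<pi> g))"
  using iso unfolding SL_equivariant_iso_def variety_iso_def points_SL_quotient by blast+
 have Z: "points (subvariety (implosion n N) (Or E)) = Or E"
  using Or_Ch by (simp add: subvariety_def implosion_affine points_affine[OF Fs] Int_absorb1)
 have im: "iota ` ?\<pi> ` G = Or E" and inj: "inj_on iota (?\<pi> ` G)"
  using hm unfolding homeomorphic_map_def quotient_map_def Z points_SL_quotient by blast+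
 have "pnt E (1\<^sub>m n) : iota ` ?\<pi> ` G" unfolding im using SL_one_closed by blast
 then obtain x where x: "x : G" "iota (?\<pi> x) = pnt E (1\<^sub>m n)" by force
 define y where "y = x * k"
 have y: "y : G" unfolding y_def by (rule SL_mult_closed[OF x(1) k])
 have st: "h : Hgrp n E \<longleftrightarrow> cj (adj_mat y) h : Hgrp n D" if h: "h : G" for h
 proof -
  have hx: "h * x : G" by (rule SL_mult_closed[OF h x(1)])
  have "h : Hgrp n E \<longleftrightarrow> pnt E h = pnt E (1\<^sub>m n)"
   unfolding pnt_eq_iff[OF E E SL_one_closed h] adj_one using left_mult_one_mat[OF SL_mat[OF h]] by simp
  also have "pnt E h = iota (?\<pi> (h * x))"
   using eq[OF h x(1)] act_pnt[OF h SL_one_closed, of E] right_mult_one_mat[OF SL_mat[OF h]]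
   unfolding x(2) l_coset_mult[OF h x(1) D] by simp
  also have "iota (?\<pi> (h * x)) = pnt E (1\<^sub>m n) \<longleftrightarrow> ?\<pi> (h * x) = ?\<pi> x"
   unfolding x(2)[symmetric] using hx x(1) by (intro inj_on_eq_iff[OF inj]) blast+
  also have "... \<longleftrightarrow> adj_mat y * (h * x * k) : Hgrp n D"
   unfolding coset_iff[OF D hx x(1), symmetric] y_def
   using pnt_eq_iff[OF D D SL_mult_closed[OF x(1) k] SL_mult_closed[OF hx k]] by simp
  also have "adj_mat y * (h * x * k) = cj (adj_mat y) h"
   using assoc_sq[OF SL_mat[OF SL_adj(1)[OF y]] SL_mat[OF h] SL_mat[OF y]]
    assoc_sq[OF SL_mat[OF h] SL_mat[OF x(1)] SL_mat[OF k]]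
   unfolding cj_def adj_adj[OF y] by (simp only: y_def)
  finally show ?thesis .
 qed
 have "Hgrp n E = cj y ` Hgrp n D"
 proof (intro Set.set_eqI iffI)
  fix h assume "h : Hgrp n E"
  thus "h : cj y ` Hgrp n D" using st[of h] mem_cj[OF y _ Hgrp_SL] Hgrp_SL by blast
 next
  fix h assume h: "h : cj y ` Hgrp n D"
  hence "h : G" using cj_SL[OF y] Hgrp_SL by blast
  thus "h : Hgrp n E" using st[of h] mem_cj[OF y _ Hgrp_SL] h by blast
 qed
 hence "D \<subseteq> E" by (rule Hgrp_conj_eq[OF E D y])
 have "Hgrp n D = cj (adj_mat y) ` Hgrp n E"
  unfolding \<open>Hgrp n E = cj y ` Hgrp n D\<close> image_image
  by (subst image_cong[OF refl, of _ _ "%h. h"]) (use cj_cj[OF y SL_mat] Hgrp_SL in auto)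
 hence "E \<subseteq> D" by (rule Hgrp_conj_eq[OF D E SL_adj(1)[OF y]])
 with `D \<subseteq> E` show ?thesis by blast
qed

lemma act_orbit:
 assumes g: "g : G"
 shows "(%h. act h (pnt E g)) ` G = Or E"
proof (intro Set.set_eqI iffI)
 fix z assume "z : Or E"
 then obtain h where h: "h : G" "z = pnt E h" by blast
 have hg: "h * adj_mat g : G" by (rule SL_mult_closed[OF h(1) SL_adj(1)[OF g]])
 have "act (h * adj_mat g) (pnt E g) = z"
  unfolding act_pnt[OF hg g] h(2) SL_cancel_right(2)[OF g SL_mat[OF h(1)]] ..
 thus "z : (%h. act h (pnt E g)) ` G" using hg by blast
next
 fix z assume "z : (%h. act h (pnt E g)) ` G"
 thus "z : Or E" using act_pnt[OF _ g] SL_mult_closed[OF _ g] by auto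
qed

lemma derived_HD: "D : flag_types n ==> derived (SL n) (parabolic n N D) = HD D"
 by (rule derived_parabolic[OF k]) (auto simp: flag_types_def)

lemma points_implosion: "points (implosion n N) = Ch"
 by (simp add: implosion_affine points_affine[OF Fs])

text \<open>Every point lies on the orbit of some \<open>pnt E g\<close>
  (\<open>points_pnt\<close>), and the type of this orbit as a homogeneous space is \<open>E\<close>
  alone by \<open>stabilizer_subset\<close>.\<close>

lemma stratum_eq:
 assumes D: "D : flag_types n"
 shows "implosion_stratum n N D = Or D"
proof (intro Set.set_eqI iffI)
 fix chi assume "chi : implosion_stratum n N D"
 then obtain iota where chi: "chi : Ch" and iota: "SL_equivariant_iso n N (HD D) ((%h. act h chi) ` G) iota"
  unfolding implosion_stratum_def derived_HD[OF D] points_implosion by blast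
 obtain E g where E: "E : flag_types n" and g: "g : G" and e: "chi = pnt E g" using points_pnt[OF chi] by blast
 have "D = E" by (rule stabilizer_subset[OF D E]) (use iota in \<open>simp only: e act_orbit[OF g]\<close>)
 thus "chi : Or D" using g e by blast
next
 fix chi assume "chi : Or D"
 then obtain g where g: "g : G" "chi = pnt D g" by blast
 thus "chi : implosion_stratum n N D"
  using orbit_iso[OF D] pnt_Ch[OF g(1)]
  unfolding implosion_stratum_def derived_HD[OF D] points_implosion by (simp add: act_orbit)
qed

text \<open>A label of the stratum that can only grow under small changes
  (\<open>openin_supp\<close>); on \<open>Or D\<close> it is \<open>D\<close> without n.\<close>

definition supp :: "((complex mat => complex) => complex) => nat set" where
 "supp chi = {d. 1 <= d & d < n & (EX rho. (ALL i<d. rho i < n) & av chi d rho ~= 0)}"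

lemma supp_pnt:
 assumes E: "E : flag_types n" and g: "g : G"
 shows "supp (pnt E g) = E - {n}"
proof -
 have *: "(EX rho. (ALL i<d. rho i < n) & av (pnt E g) d rho ~= 0) \<longleftrightarrow> d : E" if d: "1 <= d" "d < n" for d
 proof
  assume "d : E"
  obtain rho where rho: "!!i. i < d ==> rho i < n" "minor g d rho ~= 0" using minor_nonzero[OF g, of d] d by auto
  have "av (pnt E g) d rho = (if d : E then minor g d rho else 0)" by (rule pnt_mn[OF g d rho(1)])
  thus "EX rho. (ALL i<d. rho i < n) & av (pnt E g) d rho ~= 0" using rho `d : E` by (intro exI[of _ rho]) simp
 next
  assume "EX rho. (ALL i<d. rho i < n) & av (pnt E g) d rho ~= 0"
  then obtain rho where "ALL i<d. rho i < n" "av (pnt E g) d rho ~= 0" by blast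
  thus "d : E" using orbit_mn_zero[OF imageI[OF g] SL_one_closed d, of E rho] by blast
 qed
 have "E \<subseteq> {1..n}" using E by (simp add: flag_types_def)
 hence "d : E - {n} \<longleftrightarrow> 1 <= d & d < n & d : E" for d by (metis DiffD1 DiffD2 DiffI atLeastAtMost_iff insertI1 le_neq_implies_less nat_less_le singletonD subsetD)
 thus ?thesis using * by (intro Set.set_eqI) (simp add: supp_def cong: conj_cong)
qed

lemma openin_supp: "openin (zariski (implosion n N)) {chi : Ch. d : supp chi}"
 unfolding implosion_affine openin_affine[OF Fs]
proof (intro conjI ballI)
 fix chi assume "chi : {chi : Ch. d : supp chi}"
 then obtain rho where d: "1 <= d" "d < n" "ALL i<d. rho i < n" "av chi d rho ~= 0" by (auto simp: supp_def)
 have "mn (1\<^sub>m n) d rho : A" by (rule mn_A[OF SL_one_closed]) (use d in auto)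
 thus "EX f:Fs. f chi ~= 0 & {z : Ch. f z ~= 0} \<subseteq> {chi : Ch. d : supp chi}"
  using d by (intro bexI[of _ "%chi. av chi d rho"]) (auto simp: supp_def)
qed blast

lemma stratum_locally_closed:
 assumes D: "D : flag_types n"
 shows "locally_closed_in (zariski (implosion n N)) (Or D)"
proof -
 let ?T = "zariski (implosion n N)" and ?S = "%d. {chi : Ch. d : supp chi}"
 \<comment> \<open>On the open set \<open>?U\<close> the support contains \<open>D\<close> apart
   from n; on the closed complement of \<open>?C\<close> it is contained in
   \<open>D\<close>.\<close>
 let ?U = "topspace ?T \<inter> \<Inter>(?S ` (D - {n}))" and ?C = "\<Union>(?S ` (- D))"
 have fin: "finite (D - {n})" using D by (auto simp: flag_types_def intro: finite_subset)
 have "openin ?T (\<Inter>(insert (topspace ?T) (?S ` (D - {n}))))"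
  by (rule openin_Inter) (use fin openin_supp in auto)
 hence "openin ?T ?U" by simp
 moreover have "closedin ?T (topspace ?T - ?C)"
  by (rule closedin_diff[OF closedin_topspace]) (use openin_supp in blast)
 moreover have "Or D = ?U \<inter> (topspace ?T - ?C)"
 proof (intro Set.set_eqI iffI)
  fix chi assume "chi : Or D"
  then obtain g where g: "g : G" "chi = pnt D g" by blast
  thus "chi : ?U \<inter> (topspace ?T - ?C)"
   using supp_pnt[OF D g(1)] pnt_Ch[OF g(1)] points_implosion by auto
 next
  fix chi assume chi: "chi : ?U \<inter> (topspace ?T - ?C)"
  hence "chi : Ch" using points_implosion by blast
  then obtain E g where E: "E : flag_types n" and g: "g : G" and e: "chi = pnt E g" using points_pnt by blast
  have "supp chi = D - {n}" using chi `chi : Ch` by (auto simp: supp_def)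
  hence "E = D" using supp_pnt[OF E g] D E unfolding e flag_types_def by auto
  thus "chi : Or D" using g e by blast
 qed
 ultimately show ?thesis unfolding locally_closed_in_def by blast
qed

text \<open>The identification of the spectra takes the point of \<open>pt n E g\<close> to
  \<open>pnt E g\<close>, and the quiver type of this normal form is \<open>E\<close>; by
  \<open>polystable_normal_form\<close> nothing else occurs.\<close>

lemma quiver_stratum_eq:
 assumes D: "D : flag_types n"
 shows "Spec_map A (liftq n k) ` quiver_stratum n D = Or D"
proof -
 have ev: "Spec_map A (liftq n k) (eval_point (quiver_invariants n) (qact n gamma (pt n E g))) = pnt E g"
  if "gamma : G1 n" "g : G" for gamma E g
  unfolding Spec_map_def pnt_def
 proof (rule restrict_ext)
  fix f assume "f : A"
  from liftq_closed[OF n k this] show "eval_point (quiver_invariants n) (qact n gamma (pt n E g)) (liftq n k f) = liftq n k f (pt n E g)"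
   using that pt_quiver[OF that(2)] by (simp add: eval_point_def quiver_invariants_iff)
 qed
 show ?thesis
 proof (intro Set.set_eqI iffI)
  fix z assume "z : Spec_map A (liftq n k) ` quiver_stratum n D"
  then obtain alpha where a: "polystable n alpha" "quiver_type n alpha = D" "z = Spec_map A (liftq n k) (eval_point (quiver_invariants n) alpha)"
   unfolding quiver_stratum_def by blast
  obtain E g gamma where E: "E : flag_types n" "g : G" "gamma : G1 n" "alpha = qact n gamma (pt n E g)"
   using a(1) unfolding polystable_normal_form[OF n] by blast
  have "E = D" using a(2) unfolding E(4) quiver_type_pt[OF n E(1-3)] .
  thus "z : Or D" using E(2) unfolding a(3) E(4) ev[OF E(3,2)] by blast
 next
  fix z assume "z : Or D"
  then obtain g where g: "g : G" "z = pnt D g" by blast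
  let ?alpha = "qact n (%i. 1\<^sub>m i) (pt n D g)"
  have "polystable n ?alpha" unfolding polystable_normal_form[OF n] using D g(1) G1_one by blast
  moreover have "quiver_type n ?alpha = D" by (rule quiver_type_pt[OF n D g(1) G1_one])
  ultimately have "eval_point (quiver_invariants n) ?alpha : quiver_stratum n D" unfolding quiver_stratum_def by blast
  thus "z : Spec_map A (liftq n k) ` quiver_stratum n D" unfolding g(2) ev[OF G1_one g(1), symmetric] by (rule imageI)
 qed
qed

lemma implosion_strata:
 shows "disjoint_family_on (implosion_stratum n N) (flag_types n)"
  and "(UN D:flag_types n. implosion_stratum n N D) = points (implosion n N)"
proof -
 show "disjoint_family_on (implosion_stratum n N) (flag_types n)"
  unfolding disjoint_family_on_def
 proof (intro ballI impI)
  fix D E assume D: "D : flag_types n" and E: "E : flag_types n" and ne: "D ~= E"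
  show "implosion_stratum n N D \<inter> implosion_stratum n N E = {}"
   unfolding stratum_eq[OF D] stratum_eq[OF E]
  proof (rule equals0I)
   fix chi assume "chi : Or D \<inter> Or E"
   hence "chi : Or D" "chi : Or E" by simp_all
   then obtain g h where g: "g : G" "chi = pnt D g" and h: "h : G" "chi = pnt E h" by (elim imageE)
   thus False using pnt_eq_iff[OF D E g(1) h(1)] ne by simp
  qed
 qed
 have "(UN D:flag_types n. implosion_stratum n N D) = (UN D:flag_types n. Or D)" using stratum_eq by simp
 also have "... = Ch" using points_pnt Or_Ch by blast
 finally show "(UN D:flag_types n. implosion_stratum n N D) = points (implosion n N)" unfolding points_implosion .
qed

end

theorem theorem4p11:
  fixes n :: nat and N :: "complex mat set"
  assumes "1 \<le> n"
    and "maximal_unipotent n N"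
  shows "disjoint_family_on (implosion_stratum n N) (flag_types n) \<and>
    (\<Union>D\<in>flag_types n. implosion_stratum n N D) = points (implosion n N) \<and>
    (\<forall>D\<in>flag_types n.
       locally_closed_in (zariski (implosion n N)) (implosion_stratum n N D) \<and>
       (\<exists>\<iota>. SL_equivariant_iso n N (derived (SL n) (parabolic n N D)) (implosion_stratum n N D) \<iota>)) \<and>
    (\<exists>\<phi>. calg_iso (carrier (SL n)) (implosion_functions n N) (quivers n) (quiver_invariants n) \<phi> \<and>
       variety_iso (quiver_GIT n) (implosion n N) (Spec_map (implosion_functions n N) \<phi>) \<and>
       (\<forall>D\<in>flag_types n.
          Spec_map (implosion_functions n N) \<phi> ` quiver_stratum n D = implosion_stratum n N D))"
proof -
 obtain k where k: "k : SLc n" and N: "N = cj k ` unitri n"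
  using maximal_unipotent_conj[OF assms] by blast
 interpret implosion_setup n k by standard (rule assms(1), rule k)
 have strata: "locally_closed_in (zariski (implosion n N)) (implosion_stratum n N D) &
   (EX iota. SL_equivariant_iso n N (derived (SL n) (parabolic n N D)) (implosion_stratum n N D) iota)"
  if D: "D : flag_types n" for D
  unfolding N stratum_eq[OF D] derived_HD[OF D] using stratum_locally_closed[OF D] orbit_iso[OF D] by blast
 have iso: "calg_iso (SLc n) (implosion_functions n N) (quivers n) (quiver_invariants n) (liftq n k)"
  unfolding N by (rule liftq_iso[OF assms(1) k])
 have "variety_iso (quiver_GIT n) (implosion n N) (Spec_map (implosion_functions n N) (liftq n k))"
  unfolding quiver_GIT_def implosion_def
  by (rule Spec_iso[OF _ subalg_quiver_invariants iso]) (simp only: N subalg_implosion[OF k])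
 moreover have "ALL D:flag_types n. Spec_map (implosion_functions n N) (liftq n k) ` quiver_stratum n D = implosion_stratum n N D"
  unfolding N using stratum_eq quiver_stratum_eq by simp
 ultimately show ?thesis using implosion_strata strata iso unfolding N by blast
qed

end
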